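(* Let $\mathcal{M}\subset\mathbb{C}^N\times\mathbb{C}^N$ be a formal generic manifold of codimension $d$, with $\rho_1,\dots,\rho_d$ generators of its ideal $\mathcal{I}(\mathcal{M})$, and let $\gamma(\zeta,t)$ be a Segre variety mapping of $\mathcal{M}$. Let $v^j$, $j\ge1$, be the iterated Segre mappings of $\mathcal{M}$ relative to $\gamma$, and put $n=N-d$. Then the rank $\mathrm{Rk}\,v^j$ is an increasing function of $j$ (i.e. $\mathrm{Rk}\,v^{j}\le\mathrm{Rk}\,v^{j+1}$ for all $j\ge1$) and is independent of the choice of the formal holomorphic coordinates $Z$, the formal power series $\rho_j$, and the Segre variety mapping $\gamma$. In addition, there exists an integer $k_0$, $1\le k_0\le d+1$, such that $\mathrm{Rk}\,v^j=\mathrm{Rk}\,v^{j+1}$ for $j\ge k_0$, and, if $k_0>1$, then $\mathrm{Rk}\,v^j<\mathrm{Rk}\,v^{j+1}$ for $1\le j\le k_0-1$. Moreover, the following holds. (i) There exists a unique formal CR manifold $\mathcal{O}\subset\mathcal{M}$, with $\dim\mathcal{O}=\dim_{\mathbb{C}}\mathfrak{g}_{\mathcal{M}}(0)$, such that all the formal CR vector fields on $\mathcal{M}$ are tangent to $\mathcal{O}$. Moreover, if $e=2N-d-\dim\mathfrak{g}_{\mathcal{M}}(0)$, then there exist $f_1,\dots,f_e\in\mathbb{C}[[Z]]$ such that $f_1,\dots,f_e,\rho_1,\dots,\rho_d$ generate the manifold ideal $\mathcal{I}(\mathcal{O})$. (ii) Let $\mathcal{W}\subset\mathbb{C}^N$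 be the formal complex manifold defined by the ideal of $\mathbb{C}[[Z]]$ generated by $f_1,\dots,f_e$. Then $v^j(\mathbb{C}^{jn})\subset\mathcal{W}$ for all $j\ge1$. (iii) $\mathrm{Rk}\,v^{k_0}=\dim\mathfrak{g}_{\mathcal{M}}(0)+d-N=\dim\mathcal{W}$.
   Context: Formal mappings. A formal mapping $F\colon(\mathbb{C}^k,0)\to(\mathbb{C}^p,0)$ is a $p$-tuple of formal power series in $\mathbb{C}[[x]]$, $x=(x_1,\dots,x_k)$, without constant terms. $\mathrm{Rk}\,F$ is the rank of the Jacobian matrix $\partial F/\partial x$ over the field of fractions of $\mathbb{C}[[x]]$. $\bar F(x):=\overline{F(\bar x)}$ (conjugate the coefficients). Formal manifolds. An ideal $I\subset\mathbb{C}[[x]]$, $x=(x_1,\dots,x_k)$, contained in the maximal ideal, is a manifold ideal of codimension $d$ and dimension $k-d$ if it has generators $f_1,\dots,f_d$ with $\frac{\partial f_1}{\partial x}(0),\dots,\frac{\partial f_d}{\partial x}(0)$ linearly independent in $\mathbb{C}^k$; it is said to define a formal manifold $\Sigma\subset\mathbb{C}^k$ of the same (co)dimension, and $I=\mathcal{I}(\Sigma)$. "Generators" of a manifold ideal of codimension $d$ means a generating set of $d$ elements. $\Sigma_1\subset\Sigma_2$ means $\mathcal{I}(\Sigma_2)\subset\mathcal{I}(\Sigma_1)$. For a formal mapping $F\colon(\mathbb{C}^k,0)\to(\mathbb{C}^p,0)$ and a formal manifold $\Sigma\subset\mathbb{C}^p$, $F(\mathbb{C}^k)\subset\Sigma$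 means $f\circ F=0$ for all $f\in\mathcal{I}(\Sigma)$. A formal vector field in $\mathbb{C}^k$ is a $\mathbb{C}$-linear derivation $X=\sum_j a_j(x)\frac{\partial}{\partial x_j}$ of $\mathbb{C}[[x]]$, $a_j\in\mathbb{C}[[x]]$; it is tangent to $\Sigma$ if $Xf\in\mathcal{I}(\Sigma)$ for all $f\in\mathcal{I}(\Sigma)$. Real, CR, generic. Let $Z=(Z_1,\dots,Z_N)$, $\zeta=(\zeta_1,\dots,\zeta_N)$, and $\sigma(f)(Z,\zeta):=\bar f(\zeta,Z)$ for $f\in\mathbb{C}[[Z,\zeta]]$. A formal manifold $\mathcal{M}\subset\mathbb{C}^N\times\mathbb{C}^N$ is real if $\sigma(\mathcal{I}(\mathcal{M}))\subset\mathcal{I}(\mathcal{M})$. A formal real manifold $\mathcal{M}$ of codimension $d$ is CR if for some vector $\rho=(\rho_1,\dots,\rho_d)$ of generators of $\mathcal{I}(\mathcal{M})$ the rank of the matrix $\frac{\partial\rho}{\partial Z}(Z,\zeta)$ over the field of fractions of $\mathbb{C}[[Z,\zeta]]$ equals the rank of $\frac{\partial\rho}{\partial Z}(0,0)$. It is generic if $\frac{\partial\rho}{\partial Z}(0,0)$ has rank $d$ (any formal generic manifold is CR). Allowed changes of formal holomorphic coordinates $Z$ are those of the form $(Z,\zeta)\mapsto(H(Z),\bar H(\zeta))$ with $H\colon(\mathbb{C}^N,0)\to(\mathbb{C}^N,0)$ a formal mapping with invertible Jacobian matrix at $0$. Vector fields. A formal $(1,0)$-vector field is one of the form $\sum_{j=1}^N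 a_j(Z,\zeta)\frac{\partial}{\partial Z_j}$, and a formal $(0,1)$-vector field is one of the form $\sum_{j=1}^N a_j(Z,\zeta)\frac{\partial}{\partial\zeta_j}$, $a_j\in\mathbb{C}[[Z,\zeta]]$. If $\mathcal{M}$ is a formal CR manifold, a formal CR vector field on $\mathcal{M}$ is a formal $(0,1)$-vector field tangent to $\mathcal{M}$. $\mathfrak{g}_{\mathcal{M}}$ is the Lie algebra generated by all formal $(0,1)$- and $(1,0)$-vector fields tangent to $\mathcal{M}$, and $\mathfrak{g}_{\mathcal{M}}(0)$ is the complex vector space of values at $0$ of its elements. Segre mappings. Let $\mathcal{M}$ be formal generic of codimension $d$, $\rho$ a vector of generators of $\mathcal{I}(\mathcal{M})$, $n=N-d$. A Segre variety mapping of $\mathcal{M}$ is a formal mapping $\gamma(\zeta,t)\colon(\mathbb{C}^N\times\mathbb{C}^n,0)\to(\mathbb{C}^N,0)$ with $\rho(\gamma(\zeta,t),\zeta)=0$ and $\frac{\partial\gamma}{\partial t}(0,0)$ of rank $n$. The iterated Segre mappings $v^j\colon(\mathbb{C}^{nj},0)\to(\mathbb{C}^N,0)$ relative to $\gamma$ are given, with $t^i=(t^i_1,\dots,t^i_n)$, by $v^1(t^1):=\gamma(0,t^1)$ and $v^{j+1}(t^1,\dots,t^{j+1}):=\gamma(\bar v^j(t^1,\dots,t^j),t^{j+1})$. *)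

theory Defs
  imports
    "Jordan_Normal_Form.DL_Rank"
    "HOL-Library.Multiset_Order"
    "HOL-Library.Groups_Big_Fun"
    "HOL-Computational_Algebra.Fraction_Field"
    "HOL-Algebra.Ideal"
begin

section \<open>Formal power series in several variables\<close>

text \<open>
  Variables are indexed by natural numbers. A monomial is the finite multiset of its variables,
  so that \<open>count m i\<close> is the exponent of \<open>x\<^sub>i\<close> in \<open>m\<close>, and a series is its family of coefficients.
\<close>


typedef 'a mfps = "UNIV :: (nat multiset \<Rightarrow> 'a) set"
  morphisms mcoeff Abs_mfps ..

setup_lifting type_definition_mfps

lemma mfps_eq_iff: "f = g \<longleftrightarrow> (\<forall>m. mcoeff f m = mcoeff g m)"
  by transfer (simp add: fun_eq_iff)

lemma mfps_eqI: "(\<And>m. mcoeff f m = mcoeff g m) \<Longrightarrow> f = g"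
  by (simp add: mfps_eq_iff)

lemma finite_subsets_mset: "finite {b. b \<subseteq># m}"
proof (induction m)
  case (add x m)
  have "b \<in> {b. b \<subseteq># m} \<union> add_mset x ` {b. b \<subseteq># m}" if b: "b \<subseteq># add_mset x m" for b
  proof (cases "x \<in># b")
    case True
    then obtain c where "b = add_mset x c" by (rule mset_add)
    with b show ?thesis by simp
  next
    case False
    then have "count b y \<le> count m y" for y
      using b[unfolded subseteq_mset_def, rule_format, of y] by (cases "y = x") (auto simp: not_in_iff)
    then show ?thesis by (simp add: subseteq_mset_def)
  qed
  then have "{b. b \<subseteq># add_mset x m} \<subseteq> {b. b \<subseteq># m} \<union> add_mset x ` {b. b \<subseteq># m}" by blast
  then show ?case using add by (meson finite_UnI finite_imageI finite_subset)
qed simp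

lemma finite_mset_splits: "finite {(a, b). a + b = (m :: 'b multiset)}"
proof -
  have "{(a, b). a + b = m} \<subseteq> {b. b \<subseteq># m} \<times> {b. b \<subseteq># m}" by auto
  then show ?thesis by (rule finite_subset) (intro finite_cartesian_product finite_subsets_mset)
qed

instantiation mfps :: (zero) zero begin
lift_definition zero_mfps :: "'a mfps" is "\<lambda>_. 0" .
instance ..
end

instantiation mfps :: (zero_neq_one) zero_neq_one begin
lift_definition one_mfps :: "'a mfps" is "\<lambda>m. if m = {#} then 1 else 0" .
instance by standard (transfer, auto simp: fun_eq_iff)
end

instantiation mfps :: (comm_ring_1) comm_ring_1 begin
lift_definition plus_mfps :: "'a mfps \<Rightarrow> 'a mfps \<Rightarrow> 'a mfps" is "\<lambda>f g m. f m + g m" .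
lift_definition minus_mfps :: "'a mfps \<Rightarrow> 'a mfps \<Rightarrow> 'a mfps" is "\<lambda>f g m. f m - g m" .
lift_definition uminus_mfps :: "'a mfps \<Rightarrow> 'a mfps" is "\<lambda>f m. - f m" .
lift_definition times_mfps :: "'a mfps \<Rightarrow> 'a mfps \<Rightarrow> 'a mfps"
  is "\<lambda>f g m. \<Sum>(a, b) | a + b = m. f a * g b" .
instance
proof
  fix f g h :: "'a mfps"
  show "f * g * h = f * (g * h)"
  proof (rule mfps_eqI)
    fix m :: "nat multiset"
    let ?T = "{(a, b, c). a + b + c = m}"
    have L: "mcoeff (f * g * h) m = (\<Sum>(a, b, c) \<in> ?T. mcoeff f a * mcoeff g b * mcoeff h c)"
      apply transfer
      apply (simp add: sum_distrib_right case_prod_unfold)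
      apply (subst sum.Sigma)
        apply (simp_all add: finite_mset_splits[unfolded case_prod_unfold])
      apply (rule sum.reindex_bij_witness[of _ "\<lambda>(a, b, c). ((a + b, c), (a, b))" "\<lambda>((d, c), (a, b)). (a, b, c)"])
      apply auto
      done
    have R: "mcoeff (f * (g * h)) m = (\<Sum>(a, b, c) \<in> ?T. mcoeff f a * mcoeff g b * mcoeff h c)"
      apply transfer
      apply (simp add: sum_distrib_left case_prod_unfold)
      apply (subst sum.Sigma)
        apply (simp_all add: finite_mset_splits[unfolded case_prod_unfold])
      apply (rule sum.reindex_bij_witness[of _ "\<lambda>(a, b, c). ((a, b + c), (b, c))" "\<lambda>((a, d), (b, c)). (a, b, c)"])
      apply (auto simp: algebra_simps)
      done
    show "mcoeff (f * g * h) m = mcoeff (f * (g * h)) m" using L R by simp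
  qed
  show "f * g = g * f"
    apply transfer
    apply (rule ext)
    apply (rule sum.reindex_bij_witness[of _ prod.swap prod.swap])
    apply (auto simp: algebra_simps)
    done
  show "1 * f = f"
  proof (rule mfps_eqI)
    fix m :: "nat multiset"
    let ?t = "\<lambda>(a, b). mcoeff (1 :: 'a mfps) a * mcoeff f b"
    have "mcoeff (1 * f) m = sum ?t {(a, b). a + b = m}" by (simp add: times_mfps.rep_eq)
    also have "\<dots> = sum ?t {({#}, m)}"
      by (rule sum.mono_neutral_right) (auto simp: finite_mset_splits one_mfps.rep_eq split: if_splits)
    finally show "mcoeff (1 * f) m = mcoeff f m" by (simp add: one_mfps.rep_eq)
  qed
  show "(f + g) * h = f * h + g * h"
    by transfer (simp add: fun_eq_iff case_prod_unfold algebra_simps sum.distrib)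
qed (transfer; auto simp: fun_eq_iff)+
end

lemma mcoeff_mult: "mcoeff (f * g) m = (\<Sum>(a, b) | a + b = m. mcoeff f a * mcoeff g b)"
  by transfer simp

instance mfps :: (idom) idom
proof
  fix f g :: "'a mfps"
  assume "f \<noteq> 0" "g \<noteq> 0"
  then have ex: "\<exists>a. mcoeff f a \<noteq> 0" "\<exists>b. mcoeff g b \<noteq> 0"
    by (auto simp: mfps_eq_iff zero_mfps.rep_eq)
  define a where "a = (LEAST a. mcoeff f a \<noteq> 0)"
  define b where "b = (LEAST b. mcoeff g b \<noteq> 0)"
  have a: "mcoeff f a \<noteq> 0" unfolding a_def by (rule LeastI_ex[OF ex(1)])
  have a': "mcoeff f c = 0" if "c < a" for c
    using not_less_Least[OF that[unfolded a_def]] by simp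
  have b: "mcoeff g b \<noteq> 0" unfolding b_def by (rule LeastI_ex[OF ex(2)])
  have b': "mcoeff g c = 0" if "c < b" for c
    using not_less_Least[OF that[unfolded b_def]] by simp
  have "mcoeff (f * g) (a + b) = (\<Sum>(x, y) \<in> {(a, b)}. mcoeff f x * mcoeff g y)"
    unfolding mcoeff_mult
  proof (rule sum.mono_neutral_right; (intro ballI)?)
    fix p assume p: "p \<in> {(x, y). x + y = a + b} - {(a, b)}"
    obtain x y where xy: "p = (x, y)" "x + y = a + b" "(x, y) \<noteq> (a, b)" using p by auto
    have "x < a \<or> y < b"
    proof (rule ccontr)
      assume "\<not> ?thesis"
      then have le: "a \<le> x" "b \<le> y" by auto
      then have "a = x"
        using add_less_le_mono[of a x b y] xy(2) by (auto simp: order_le_less)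
      then show False using xy by auto
    qed
    then show "(case p of (x, y) \<Rightarrow> mcoeff f x * mcoeff g y) = 0" using xy a b a' b' by auto
  qed (auto simp: finite_mset_splits)
  then have "mcoeff (f * g) (a + b) \<noteq> 0" using a b by simp
  then show "f * g \<noteq> 0" by (auto simp: zero_mfps.rep_eq)
qed


lift_definition mvar :: "nat \<Rightarrow> 'a::comm_ring_1 mfps" is "\<lambda>i m. if m = {#i#} then 1 else 0" .

lift_definition mscalar :: "'a::comm_ring_1 \<Rightarrow> 'a mfps" is "\<lambda>c m. if m = {#} then c else 0" .

lift_definition mderiv :: "nat \<Rightarrow> 'a::comm_ring_1 mfps \<Rightarrow> 'a mfps"
  is "\<lambda>i f m. of_nat (Suc (count m i)) * f (add_mset i m)" .

lift_definition mcnj :: "complex mfps \<Rightarrow> complex mfps" is "\<lambda>f m. cnj (f m)" .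

abbreviation mconst :: "'a mfps \<Rightarrow> 'a" where
  "mconst f \<equiv> mcoeff f {#}"

text \<open>
  \<open>msubst f F\<close> is \<open>f(F\<^sub>0, F\<^sub>1, \<dots>)\<close>. Each coefficient is a finite sum if \<open>f\<close> involves only the first
  \<open>dim_vec F\<close> variables and the components of \<open>F\<close> have no constant terms; it is only used then.
\<close>

definition msubst :: "'a::comm_ring_1 mfps \<Rightarrow> 'a mfps vec \<Rightarrow> 'a mfps" where
  "msubst f F = Abs_mfps (\<lambda>m. Sum_any (\<lambda>a. mcoeff f a * mcoeff (\<Prod>i\<in>#a. F $ i) m))"

text \<open>The ring \<open>\<complex>[[x\<^sub>0, \<dots>, x\<^sub>k\<^sub>-\<^sub>1]]\<close>; by construction it increases with \<open>k\<close>.\<close>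

definition mfps_ring :: "nat \<Rightarrow> complex mfps ring" where
  "mfps_ring k = \<lparr>carrier = {f. \<forall>m. mcoeff f m \<noteq> 0 \<longrightarrow> set_mset m \<subseteq> {..<k}},
     monoid.mult = (*), one = 1, zero = 0, add = (+)\<rparr>"

abbreviation mfps_carrier :: "nat \<Rightarrow> complex mfps set" where
  "mfps_carrier k \<equiv> carrier (mfps_ring k)"

lemma mfps_carrier_iff: "f \<in> mfps_carrier k \<longleftrightarrow> (\<forall>m. mcoeff f m \<noteq> 0 \<longrightarrow> set_mset m \<subseteq> {..<k})"
  by (simp add: mfps_ring_def)

lemma cring_mfps_ring: "cring (mfps_ring k)"
proof -
  have simps: "monoid.mult (mfps_ring k) = (*)" "add (mfps_ring k) = (+)"
    "one (mfps_ring k) = 1" "zero (mfps_ring k) = 0"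
    by (simp_all add: mfps_ring_def)
  have add: "f + g \<in> mfps_carrier k" if "f \<in> mfps_carrier k" "g \<in> mfps_carrier k" for f g
    unfolding mfps_carrier_iff
  proof (intro allI impI)
    fix m assume "mcoeff (f + g) m \<noteq> 0"
    then have "mcoeff f m \<noteq> 0 \<or> mcoeff g m \<noteq> 0" by (auto simp: plus_mfps.rep_eq)
    with that show "set_mset m \<subseteq> {..<k}" by (auto simp: mfps_carrier_iff)
  qed
  have neg: "- f \<in> mfps_carrier k" if "f \<in> mfps_carrier k" for f
    using that by (simp add: mfps_carrier_iff uminus_mfps.rep_eq)
  have mult: "f * g \<in> mfps_carrier k" if fg: "f \<in> mfps_carrier k" "g \<in> mfps_carrier k" for f g
    unfolding mfps_carrier_iff
  proof (intro allI impI)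
    fix m assume "mcoeff (f * g) m \<noteq> 0"
    then obtain a b where "a + b = m" "mcoeff f a * mcoeff g b \<noteq> 0"
      unfolding mcoeff_mult by (auto elim!: sum.not_neutral_contains_not_neutral)
    moreover from this have "set_mset a \<subseteq> {..<k}" "set_mset b \<subseteq> {..<k}"
      using fg by (simp_all add: mfps_carrier_iff)
    ultimately show "set_mset m \<subseteq> {..<k}" by auto
  qed
  show ?thesis
  proof (intro cringI abelian_groupI comm_monoidI; (unfold simps)?)
    fix f assume "f \<in> mfps_carrier k"
    then show "\<exists>g\<in>mfps_carrier k. g + f = 0" using neg by (intro bexI[of _ "- f"]) auto
  next
    show "0 \<in> mfps_carrier k" "1 \<in> mfps_carrier k"
      by (auto simp: mfps_carrier_iff zero_mfps.rep_eq one_mfps.rep_eq split: if_splits)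
  qed (simp_all add: add mult algebra_simps)
qed


section \<open>Formal mappings and ranks\<close>

definition formal_map :: "nat \<Rightarrow> nat \<Rightarrow> complex mfps vec \<Rightarrow> bool" where
  "formal_map k p F \<longleftrightarrow> F \<in> carrier_vec p \<and> (\<forall>i<p. F $ i \<in> mfps_carrier k \<and> mconst (F $ i) = 0)"

abbreviation map_subst :: "complex mfps vec \<Rightarrow> complex mfps vec \<Rightarrow> complex mfps vec" where
  "map_subst F G \<equiv> map_vec (\<lambda>f. msubst f G) F"

text \<open>The matrix of derivatives with respect to \<open>x\<^sub>a, \<dots>, x\<^sub>a\<^sub>+\<^sub>b\<^sub>-\<^sub>1\<close>.\<close>

definition jacobian :: "nat \<Rightarrow> nat \<Rightarrow> complex mfps vec \<Rightarrow> complex mfps mat" where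
  "jacobian a b F = mat (dim_vec F) b (\<lambda>(i, j). mderiv (a + j) (F $ i))"

text \<open>
  All the rings \<open>\<complex>[[x\<^sub>0, \<dots>, x\<^sub>k\<^sub>-\<^sub>1]]\<close> are subrings of the domain \<^typ>\<open>complex mfps\<close>, whose field of fractions
  extends theirs. Ranks are computed in the large field. This does not change them, because linear
  dependence of columns does not depend on the field: see \<open>columns_dependent_iff\<close> below.
\<close>

definition rank_frac :: "complex mfps mat \<Rightarrow> nat" where
  "rank_frac A = vec_space.rank (dim_row A) (map_mat (\<lambda>f. Fract f 1) A)"

definition rank_at_0 :: "complex mfps mat \<Rightarrow> nat" where
  "rank_at_0 A = vec_space.rank (dim_row A) (map_mat mconst A)"

definition Rk :: "nat \<Rightarrow> complex mfps vec \<Rightarrow> nat" where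
  "Rk k F = rank_frac (jacobian 0 k F)"

lift_definition mslice :: "nat \<Rightarrow> nat multiset \<Rightarrow> complex mfps \<Rightarrow> complex mfps"
  is "\<lambda>k r f m. if set_mset m \<subseteq> {..<k} then f (m + r) else 0" .

lemma mslice_carrier: "mslice k r f \<in> mfps_carrier k"
  by (auto simp: mfps_carrier_iff mslice.rep_eq split: if_splits)

lemma mcoeff_sum: "mcoeff (sum f S) m = (\<Sum>x\<in>S. mcoeff (f x) m)"
  by (induction S rule: infinite_finite_induct) (auto simp: zero_mfps.rep_eq plus_mfps.rep_eq)

lemma mslice_sum: "mslice k r (sum f S) = (\<Sum>x\<in>S. mslice k r (f x))"
  by (rule mfps_eqI) (simp add: mslice.rep_eq mcoeff_sum)

lemma mslice_mult:
  assumes a: "a \<in> mfps_carrier k" and r: "set_mset r \<inter> {..<k} = {}"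
  shows "mslice k r (f * a) = mslice k r f * a"
proof (rule mfps_eqI)
  fix m
  show "mcoeff (mslice k r (f * a)) m = mcoeff (mslice k r f * a) m"
  proof (cases "set_mset m \<subseteq> {..<k}")
    case True
    have y: "y \<subseteq># m" if xy: "x + y = m + r" and ay: "mcoeff a y \<noteq> 0" for x y
    proof -
      have "count y i \<le> count m i" for i
      proof (cases "i < k")
        case True
        then have "i \<notin># r" using r by auto
        moreover have "count x i + count y i = count m i + count r i"
          using xy by (metis count_union)
        ultimately show ?thesis by (simp add: not_in_iff)
      next
        case False
        then have "i \<notin># y" using a ay by (auto simp: mfps_carrier_iff)
        then show ?thesis by (simp add: not_in_iff)
      qed
      then show ?thesis by (simp add: subseteq_mset_def)
    qed
    let ?L = "{(x, y). x + y = m + r}" and ?R = "{(x, y). x + y = m}"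
    have "mcoeff (mslice k r (f * a)) m = (\<Sum>(x, y)\<in>?L. mcoeff f x * mcoeff a y)"
      using True by (simp add: mslice.rep_eq mcoeff_mult)
    also have "\<dots> = (\<Sum>(x, y)\<in>?L \<inter> {(x, y). y \<subseteq># m}. mcoeff f x * mcoeff a y)"
      using y by (intro sum.mono_neutral_right) (auto simp: finite_mset_splits)
    also have "\<dots> = (\<Sum>(x, y)\<in>?R. mcoeff f (x + r) * mcoeff a y)"
    proof (rule sum.reindex_bij_witness[of _ "\<lambda>(x, y). (x + r, y)" "\<lambda>(x, y). (m - y, y)"])
      have *: "m - y + r = x" if "x + y = m + r" "y \<subseteq># m" for x y
        using that by (metis add_diff_cancel_right' subset_mset.diff_add_assoc2)
      fix p assume p: "p \<in> ?L \<inter> {(x, y). y \<subseteq># m}"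
      then obtain x y where xy: "p = (x, y)" "x + y = m + r" "y \<subseteq># m" by auto
      show "(case case p of (x, y) \<Rightarrow> (m - y, y) of (x, y) \<Rightarrow> (x + r, y)) = p"
        using xy * by simp
      show "(case p of (x, y) \<Rightarrow> (m - y, y)) \<in> ?R" using xy by simp
      show "(case case p of (x, y) \<Rightarrow> (m - y, y) of (x, y) \<Rightarrow> mcoeff f (x + r) * mcoeff a y) =
        (case p of (x, y) \<Rightarrow> mcoeff f x * mcoeff a y)" using xy * by simp
    qed (auto simp: ac_simps)
    also have "\<dots> = (\<Sum>(x, y)\<in>?R. mcoeff (mslice k r f) x * mcoeff a y)"
      using True by (intro sum.cong) (auto simp: mslice.rep_eq)
    finally show ?thesis by (simp add: mcoeff_mult)
  next
    case False
    have "mcoeff (mslice k r f) x * mcoeff a y = 0" if "x + y = m" for x y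
    proof (rule ccontr)
      assume "\<not> ?thesis"
      then have "set_mset x \<subseteq> {..<k}" "set_mset y \<subseteq> {..<k}"
        using a by (auto simp: mslice.rep_eq mfps_carrier_iff split: if_splits)
      with that False show False by auto
    qed
    then have "mcoeff (mslice k r f * a) m = 0" unfolding mcoeff_mult by (intro sum.neutral) auto
    with False show ?thesis by (simp add: mslice.rep_eq)
  qed
qed

lemma Fract_sum: "(\<Sum>x\<in>S. Fract (f x) 1) = Fract (sum f S) (1 :: 'a::idom)"
  by (induction S rule: infinite_finite_induct) (auto simp: Zero_fract_def)

lemma columns_dependent_iff:
  assumes A: "A \<in> carrier_mat p q" "\<And>i j. i < p \<Longrightarrow> j < q \<Longrightarrow> A $$ (i, j) \<in> mfps_carrier k"
  shows "(\<exists>c. (\<exists>j<q. c j \<noteq> 0) \<and> (\<forall>i<p. (\<Sum>j<q. c j * Fract (A $$ (i, j)) 1) = 0)) \<longleftrightarrow>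
    (\<exists>c. (\<forall>j<q. c j \<in> mfps_carrier k) \<and> (\<exists>j<q. c j \<noteq> 0) \<and> (\<forall>i<p. (\<Sum>j<q. c j * A $$ (i, j)) = 0))"
    (is "?L \<longleftrightarrow> ?R")
proof
  assume ?R
  then obtain c where c: "\<exists>j<q. c j \<noteq> 0" "\<forall>i<p. (\<Sum>j<q. c j * A $$ (i, j)) = 0" by blast
  let ?c = "\<lambda>j. Fract (c j) 1"
  have "\<forall>i<p. (\<Sum>j<q. ?c j * Fract (A $$ (i, j)) 1) = 0"
    using c(2) by (simp add: Fract_sum Zero_fract_def)
  moreover have "\<exists>j<q. ?c j \<noteq> 0" using c(1) by (simp add: Zero_fract_def eq_fract)
  ultimately show ?L by (intro exI[of _ ?c]) blast
next
  assume ?L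
  then obtain c where c: "\<exists>j<q. c j \<noteq> 0" "\<forall>i<p. (\<Sum>j<q. c j * Fract (A $$ (i, j)) 1) = 0" by blast
  have "\<exists>ab. c j = Fract (fst ab) (snd ab) \<and> snd ab \<noteq> 0" for j by (cases "c j") auto
  then obtain ab where ab: "\<And>j. c j = Fract (fst (ab j)) (snd (ab j))" "\<And>j. snd (ab j) \<noteq> 0" by metis
  define D where "D = (\<Prod>j<q. snd (ab j))"
  define c' where "c' j = fst (ab j) * (\<Prod>i\<in>{..<q} - {j}. snd (ab i))" for j
  have D: "D \<noteq> 0" unfolding D_def using ab(2) by simp
  have c': "Fract (c' j) 1 = Fract D 1 * c j" if "j < q" for j
  proof -
    have "D = snd (ab j) * (\<Prod>i\<in>{..<q} - {j}. snd (ab i))"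
      unfolding D_def using that by (subst prod.remove[of _ j]) auto
    then show ?thesis using ab by (simp add: c'_def eq_fract)
  qed
  have rel: "(\<Sum>j<q. c' j * A $$ (i, j)) = 0" if "i < p" for i
  proof -
    have "Fract (\<Sum>j<q. c' j * A $$ (i, j)) 1 = (\<Sum>j<q. Fract D 1 * (c j * Fract (A $$ (i, j)) 1))"
      unfolding Fract_sum[symmetric]
    proof (rule sum.cong)
      fix j assume "j \<in> {..<q}"
      then have "Fract (c' j * A $$ (i, j)) 1 = Fract (c' j) 1 * Fract (A $$ (i, j)) 1" by simp
      also have "\<dots> = Fract D 1 * (c j * Fract (A $$ (i, j)) 1)"
        using c' \<open>j \<in> {..<q}\<close> by (simp only: lessThan_iff mult.assoc)
      finally show "Fract (c' j * A $$ (i, j)) 1 = Fract D 1 * (c j * Fract (A $$ (i, j)) 1)" .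
    qed simp
    also have "\<dots> = 0" using c(2) that by (simp only: sum_distrib_left[symmetric]) simp
    finally show ?thesis by (simp add: Zero_fract_def eq_fract)
  qed
  obtain l where l: "l < q" "c l \<noteq> 0" using c(1) by blast
  have "c' l \<noteq> 0"
  proof
    assume "c' l = 0"
    then have "Fract D 1 * c l = 0" using c'[OF l(1)] by (simp add: Zero_fract_def)
    moreover have "Fract D 1 \<noteq> 0" using D by (simp add: Zero_fract_def eq_fract)
    ultimately show False using l(2) by simp
  qed
  then obtain m where m: "mcoeff (c' l) m \<noteq> 0" by (auto simp: mfps_eq_iff zero_mfps.rep_eq)
  define r where "r = filter_mset (\<lambda>i. \<not> i < k) m"
  have "m = filter_mset (\<lambda>i. i < k) m + r" unfolding r_def by (rule multiset_partition)
  with m have "mcoeff (mslice k r (c' l)) (filter_mset (\<lambda>i. i < k) m) \<noteq> 0"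
    by (auto simp: mslice.rep_eq)
  then have "mslice k r (c' l) \<noteq> 0" by (auto simp: zero_mfps.rep_eq)
  moreover have "(\<Sum>j<q. mslice k r (c' j) * A $$ (i, j)) = 0" if "i < p" for i
  proof -
    have "(\<Sum>j<q. mslice k r (c' j) * A $$ (i, j)) = (\<Sum>j<q. mslice k r (c' j * A $$ (i, j)))"
      using A(2) that by (intro sum.cong refl mslice_mult[symmetric]) (auto simp: r_def)
    also have "\<dots> = mslice k r (\<Sum>j<q. c' j * A $$ (i, j))" by (simp add: mslice_sum)
    also have "\<dots> = 0"
      unfolding rel[OF that] by (rule mfps_eqI) (simp add: mslice.rep_eq zero_mfps.rep_eq)
    finally show ?thesis .
  qed
  ultimately show ?R using mslice_carrier l(1) by (intro exI[of _ "\<lambda>j. mslice k r (c' j)"]) blast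
qed


section \<open>Formal manifolds\<close>

text \<open>
  A formal manifold \<open>\<Sigma>\<close> in \<open>\<complex>\<^sup>k\<close> is represented by its ideal, so that \<open>\<Sigma>\<^sub>1 \<subseteq> \<Sigma>\<^sub>2\<close> is the reverse inclusion
  of ideals.
\<close>

definition generators :: "nat \<Rightarrow> nat \<Rightarrow> complex mfps set \<Rightarrow> complex mfps vec \<Rightarrow> bool" where
  "generators k d I f \<longleftrightarrow> f \<in> carrier_vec d \<and> set\<^sub>v f \<subseteq> mfps_carrier k \<and> I = genideal (mfps_ring k) (set\<^sub>v f)"

definition manifold_ideal :: "nat \<Rightarrow> nat \<Rightarrow> complex mfps set \<Rightarrow> bool" where
  "manifold_ideal k d I \<longleftrightarrow> ideal I (mfps_ring k) \<and> (\<forall>f\<in>I. mconst f = 0) \<and>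
     (\<exists>f. generators k d I f \<and>
       (\<forall>c :: nat \<Rightarrow> complex. (\<forall>j<k. (\<Sum>i<d. c i * mconst (mderiv j (f $ i))) = 0) \<longrightarrow> (\<forall>i<d. c i = 0)))"

definition manifold_of_dim :: "nat \<Rightarrow> nat \<Rightarrow> complex mfps set \<Rightarrow> bool" where
  "manifold_of_dim k r I \<longleftrightarrow> (\<exists>d. d + r = k \<and> manifold_ideal k d I)"

definition maps_into :: "complex mfps vec \<Rightarrow> complex mfps set \<Rightarrow> bool" where
  "maps_into F I \<longleftrightarrow> (\<forall>f\<in>I. msubst f F = 0)"


section \<open>Formal vector fields\<close>

text \<open>The vector field \<open>\<Sum>\<^sub>j a\<^sub>j \<partial>/\<partial>x\<^sub>j\<close> is represented by the vector of the \<open>a\<^sub>j\<close>.\<close>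

definition vector_field :: "nat \<Rightarrow> complex mfps vec \<Rightarrow> bool" where
  "vector_field k X \<longleftrightarrow> X \<in> carrier_vec k \<and> set\<^sub>v X \<subseteq> mfps_carrier k"

definition vf_apply :: "complex mfps vec \<Rightarrow> complex mfps \<Rightarrow> complex mfps" where
  "vf_apply X f = (\<Sum>j<dim_vec X. X $ j * mderiv j f)"

definition tangent :: "complex mfps vec \<Rightarrow> complex mfps set \<Rightarrow> bool" where
  "tangent X I \<longleftrightarrow> (\<forall>f\<in>I. vf_apply X f \<in> I)"

text \<open>The commutator \<open>[X, Y]\<close> of derivations; its \<open>j\<close>-th coefficient is \<open>X(Y x\<^sub>j) - Y(X x\<^sub>j)\<close>.\<close>

definition lie_bracket :: "complex mfps vec \<Rightarrow> complex mfps vec \<Rightarrow> complex mfps vec" where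
  "lie_bracket X Y = vec (dim_vec X) (\<lambda>j. vf_apply X (Y $ j) - vf_apply Y (X $ j))"

inductive_set lie_algebra_generated :: "nat \<Rightarrow> complex mfps vec set \<Rightarrow> complex mfps vec set"
  for k :: nat and S :: "complex mfps vec set" where
  base: "X \<in> S \<Longrightarrow> X \<in> lie_algebra_generated k S"
| zero: "0\<^sub>v k \<in> lie_algebra_generated k S"
| add: "\<lbrakk>X \<in> lie_algebra_generated k S; Y \<in> lie_algebra_generated k S\<rbrakk>
    \<Longrightarrow> X + Y \<in> lie_algebra_generated k S"
| scale: "X \<in> lie_algebra_generated k S \<Longrightarrow> mscalar c \<cdot>\<^sub>v X \<in> lie_algebra_generated k S"
| bracket: "\<lbrakk>X \<in> lie_algebra_generated k S; Y \<in> lie_algebra_generated k S\<rbrakk>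
    \<Longrightarrow> lie_bracket X Y \<in> lie_algebra_generated k S"


section \<open>Real, CR and generic manifolds\<close>

text \<open>
  In \<open>\<complex>\<^sup>N \<times> \<complex>\<^sup>N\<close> the variables \<open>0, \<dots>, N - 1\<close> are \<open>Z\<close> and the variables \<open>N, \<dots>, 2N - 1\<close> are \<open>\<zeta>\<close>. Thus
  \<open>\<complex>[[Z]]\<close> is \<^term>\<open>mfps_ring N\<close>, and \<open>\<partial>/\<partial>Z\<close> of a vector \<open>\<rho>\<close> is \<^term>\<open>jacobian 0 N \<rho>\<close>.
\<close>

definition sigma :: "nat \<Rightarrow> complex mfps \<Rightarrow> complex mfps" where
  "sigma N f = msubst (mcnj f) (vec (2 * N) (\<lambda>i. mvar (if i < N then N + i else i - N)))"

definition real_manifold :: "nat \<Rightarrow> nat \<Rightarrow> complex mfps set \<Rightarrow> bool" where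
  "real_manifold N d I \<longleftrightarrow> manifold_ideal (2 * N) d I \<and> sigma N ` I \<subseteq> I"

definition CR_manifold :: "nat \<Rightarrow> nat \<Rightarrow> complex mfps set \<Rightarrow> bool" where
  "CR_manifold N d I \<longleftrightarrow> real_manifold N d I \<and>
     (\<exists>\<rho>. generators (2 * N) d I \<rho> \<and> rank_frac (jacobian 0 N \<rho>) = rank_at_0 (jacobian 0 N \<rho>))"

definition CR_manifold_of_dim :: "nat \<Rightarrow> nat \<Rightarrow> complex mfps set \<Rightarrow> bool" where
  "CR_manifold_of_dim N r I \<longleftrightarrow> (\<exists>d. d + r = 2 * N \<and> CR_manifold N d I)"

definition generic_manifold :: "nat \<Rightarrow> nat \<Rightarrow> complex mfps set \<Rightarrow> bool" where
  "generic_manifold N d I \<longleftrightarrow> real_manifold N d I \<and>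
     (\<exists>\<rho>. generators (2 * N) d I \<rho> \<and> rank_at_0 (jacobian 0 N \<rho>) = d)"

definition coordinate_change :: "nat \<Rightarrow> complex mfps vec \<Rightarrow> bool" where
  "coordinate_change N H \<longleftrightarrow> formal_map N N H \<and> invertible_mat (map_mat mconst (jacobian 0 N H))"

text \<open>The mapping \<open>(Z, \<zeta>) \<mapsto> (H(Z), H\<close>-bar\<open>(\<zeta>))\<close>.\<close>

definition complexified :: "nat \<Rightarrow> complex mfps vec \<Rightarrow> complex mfps vec" where
  "complexified N H = H @\<^sub>v map_subst (map_vec mcnj H) (vec N (\<lambda>i. mvar (N + i)))"

text \<open>A series \<open>f\<close> vanishes on the manifold in the new coordinates \<open>H(Z)\<close> if its pullback vanishes on the original one.\<close>

definition in_coordinates :: "nat \<Rightarrow> complex mfps vec \<Rightarrow> complex mfps set \<Rightarrow> complex mfps set" where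
  "in_coordinates N H I = {f \<in> mfps_carrier (2 * N). msubst f (complexified N H) \<in> I}"

definition vector_field_10 :: "nat \<Rightarrow> complex mfps vec \<Rightarrow> bool" where
  "vector_field_10 N X \<longleftrightarrow> vector_field (2 * N) X \<and> (\<forall>j\<in>{N..<2 * N}. X $ j = 0)"

definition vector_field_01 :: "nat \<Rightarrow> complex mfps vec \<Rightarrow> bool" where
  "vector_field_01 N X \<longleftrightarrow> vector_field (2 * N) X \<and> (\<forall>j<N. X $ j = 0)"

definition CR_vector_field :: "nat \<Rightarrow> complex mfps set \<Rightarrow> complex mfps vec \<Rightarrow> bool" where
  "CR_vector_field N I X \<longleftrightarrow> vector_field_01 N X \<and> tangent X I"

definition lie_algebra :: "nat \<Rightarrow> complex mfps set \<Rightarrow> complex mfps vec set" where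
  "lie_algebra N I =
     lie_algebra_generated (2 * N) {X. (vector_field_01 N X \<or> vector_field_10 N X) \<and> tangent X I}"

definition lie_algebra_dim :: "nat \<Rightarrow> complex mfps set \<Rightarrow> nat" where
  "lie_algebra_dim N I = vectorspace.dim class_ring
     (module_vec TYPE(complex) (2 * N) \<lparr>carrier := map_vec mconst ` lie_algebra N I\<rparr>)"


section \<open>Segre mappings\<close>

text \<open>
  In \<open>\<gamma>(\<zeta>, t)\<close> the variables \<open>0, \<dots>, N - 1\<close> are \<open>\<zeta>\<close> and the following \<open>n = N - d\<close> are \<open>t\<close>. Since \<open>\<zeta>\<close> comes
  first here, \<open>(\<gamma>(\<zeta>, t), \<zeta>)\<close> is \<^term>\<open>\<gamma> @\<^sub>v vec N mvar\<close>.
\<close>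

definition segre_variety_mapping :: "nat \<Rightarrow> nat \<Rightarrow> complex mfps vec \<Rightarrow> complex mfps vec \<Rightarrow> bool" where
  "segre_variety_mapping N d \<rho> \<gamma> \<longleftrightarrow> formal_map (N + (N - d)) N \<gamma> \<and>
     map_subst \<rho> (\<gamma> @\<^sub>v vec N mvar) = 0\<^sub>v d \<and> rank_at_0 (jacobian N (N - d) \<gamma>) = N - d"

text \<open>
  In \<open>v\<^sup>j(t\<^sup>1, \<dots>, t\<^sup>j)\<close> the variables of \<open>t\<^sup>i\<close> are \<open>(i - 1) n, \<dots>, i n - 1\<close>. The recursion starts from
  \<open>v\<^sup>0 = 0\<close>, which gives \<open>v\<^sup>1(t\<^sup>1) = \<gamma>(0, t\<^sup>1)\<close>.
\<close>

primrec segre_mapping :: "nat \<Rightarrow> nat \<Rightarrow> complex mfps vec \<Rightarrow> nat \<Rightarrow> complex mfps vec" where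
  "segre_mapping N n \<gamma> 0 = 0\<^sub>v N"
| "segre_mapping N n \<gamma> (Suc j) =
     map_subst \<gamma> (map_vec mcnj (segre_mapping N n \<gamma> j) @\<^sub>v vec n (\<lambda>i. mvar (j * n + i)))"

end

theory Submission
  imports Defs
begin

text \<open>
  The orbit is obtained without flows: its ideal \<open>J\<close> consists of the series that vanish at the origin
  together with all their iterated derivatives along
  the Lie algebra \<open>\<gg>\<close>. If \<open>X\<^sub>a\<close> are elements of \<open>\<gg>\<close> whose values at \<open>0\<close> are a basis of \<open>\<gg>(0)\<close>,
  a Poincare-Birkhoff-Witt argument shows that the monomials in the \<open>X\<^sub>a\<close> suffice, so that a member of \<open>J\<close>
  that depends only on \<open>dim \<gg>(0)\<close> suitable variables is zero, and that \<open>J\<close> is the ideal of a graph over these variables.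
  It is the largest \<open>\<gg>\<close>-invariant ideal in the maximal ideal, hence invariant under \<open>\<sigma>\<close>, and the CR vector fields in
  normal form show that it is generated by the ideal of the manifold and by series in \<open>Z\<close>.

  The mapping \<open>p\<^sub>j\<close> with the components \<open>Z = v\<^sup>j\<^sup>+\<^sup>1\<close> and \<open>\<zeta>\<close> the conjugate of \<open>v\<^sup>j\<close> maps into the manifold and has rank at
  least \<open>Rk v\<^sup>j + n\<close>. Over the field
  of fractions its tangent space contains all \<open>(1,0)\<close>-vectors tangent to the manifold. The kernel of the projection of the
  tangent space to the \<open>Z\<close>-directions consists of tangent \<open>(0,1)\<close>-vectors, so its dimension is at most \<open>n\<close>, which gives
  \<open>Rk v\<^sup>j \<le> Rk v\<^sup>j\<^sup>+\<^sup>1\<close>. In the case of equality all tangent \<open>(0,1)\<close>-vectors are tangent to \<open>p\<^sub>j\<close>, hence all of \<open>\<gg>\<close> is, and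
  therefore \<open>dim \<gg>(0) \<le> Rk v\<^sup>j + n\<close>. The opposite inequality holds for all \<open>j\<close>, because by induction the generators of \<open>J\<close> in
  \<open>Z\<close> vanish along \<open>v\<^sup>j\<close>. Two Segre variety mappings differ by a reparametrization of \<open>t\<close>, and this changes the
  \<open>v\<^sup>j\<close> by an invertible substitution.
\<close>

text \<open>The only point of a formal manifold is the origin, so arguments at a generic point have
  to be replaced. Two devices do this: the order of vanishing, along which series are constructed
  and identities proved degree by degree, and the field of fractions, over which the image of a
  differential is an ordinary vector space of the generic dimension.

  The bound d + 1 arises as follows. The rank of v^1 is at least n, and no rank exceeds N = n + d,
  so strict growth can occur at most d times. One stationary step is final: it forces the rank to
  attain dim \<gg>(0) + d - N, which bounds the ranks for all j.

  The equations of the orbit in Z alone depend on an adapted basis of \<gg>(0): tangent CR fields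
  supply its \<zeta>-directions, and the remaining directions can be chosen in Z. The formal
  implicit and inverse function theorems behind the reparametrization come from the same orbit
  construction, applied to commuting fields.\<close>

section \<open>Series in a given set of variables\<close>

text \<open>The set of variables is arbitrary and not an initial segment, because the functions
  whose graph is the orbit depend on a scattered set of variables.\<close>

definition mcarr :: "nat set \<Rightarrow> 'a::zero mfps set" where
  "mcarr A = {f. \<forall>m. mcoeff f m \<noteq> 0 \<longrightarrow> set_mset m \<subseteq> A}"

lemma mfps_carrier_eq: "mfps_carrier k = mcarr {..<k}"
  by (rule Set.set_eqI) (simp only: mfps_carrier_iff mcarr_def mem_Collect_eq)

lemma mcarrD: "f \<in> mcarr A \<Longrightarrow> \<not> set_mset m \<subseteq> A \<Longrightarrow> mcoeff f m = 0"
  by (auto simp: mcarr_def)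

lemma mcarrI: "(\<And>m. \<not> set_mset m \<subseteq> A \<Longrightarrow> mcoeff f m = 0) \<Longrightarrow> f \<in> mcarr A"
  by (auto simp: mcarr_def)

lemma mcarr_mono: "f \<in> mcarr A \<Longrightarrow> A \<subseteq> B \<Longrightarrow> f \<in> mcarr B"
  by (auto simp: mcarr_def)

lemmas mcoeff_simps = zero_mfps.rep_eq one_mfps.rep_eq plus_mfps.rep_eq minus_mfps.rep_eq
  uminus_mfps.rep_eq mvar.rep_eq mscalar.rep_eq mderiv.rep_eq mcnj.rep_eq

lemma mcarr_zero [simp]: "0 \<in> mcarr A" and mcarr_one [simp]: "1 \<in> mcarr A"
  and mcarr_mscalar [simp]: "mscalar c \<in> mcarr A"
  and mcarr_mvar: "i \<in> A \<Longrightarrow> mvar i \<in> mcarr A"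
  by (auto simp: mcarr_def mcoeff_simps split: if_splits)

lemma mcarr_mult [simp]:
  assumes "f \<in> mcarr A" "g \<in> mcarr A" shows "f * g \<in> mcarr A"
proof (rule mcarrI)
  fix m assume m: "\<not> set_mset m \<subseteq> A"
  show "mcoeff (f * g) m = 0" unfolding mcoeff_mult
  proof (rule sum.neutral, clarify)
    fix a b assume "m = a + b"
    then have "\<not> set_mset a \<subseteq> A \<or> \<not> set_mset b \<subseteq> A" using m by auto
    then show "mcoeff f a * mcoeff g b = 0" using assms mcarrD by (metis mult_zero_left mult_zero_right)
  qed
qed

lemma mcarr_add [simp]: "f \<in> mcarr A \<Longrightarrow> g \<in> mcarr A \<Longrightarrow> f + g \<in> mcarr A"
  and mcarr_diff [simp]: "f \<in> mcarr A \<Longrightarrow> g \<in> mcarr A \<Longrightarrow> f - g \<in> mcarr A"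
  and mcarr_uminus [simp]: "f \<in> mcarr A \<Longrightarrow> - f \<in> mcarr A"
  by (rule mcarrI; simp add: mcoeff_simps mcarrD)+

lemma mcarr_sum: "(\<And>x. x \<in> S \<Longrightarrow> f x \<in> mcarr A) \<Longrightarrow> sum f S \<in> mcarr A"
  by (induction S rule: infinite_finite_induct) auto

lemma mcarr_prod_mset: "(\<And>i. i \<in># a \<Longrightarrow> \<theta> i \<in> mcarr A) \<Longrightarrow> (\<Prod>i\<in>#a. \<theta> i) \<in> mcarr A"
  by (induction a) auto

lemma mcarr_mderiv [simp]: "f \<in> mcarr A \<Longrightarrow> mderiv i f \<in> mcarr A"
  by (rule mcarrI) (auto simp: mcoeff_simps mcarrD)

lemma mcarr_mcnj [simp]: "f \<in> mcarr A \<Longrightarrow> mcnj f \<in> mcarr A"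
  by (rule mcarrI) (auto simp: mcoeff_simps mcarrD)

lemma mcoeff_mscalar_mult: "mcoeff (mscalar c * f) m = c * mcoeff f m"
proof -
  have "mcoeff (mscalar c * f) m = (\<Sum>(a, b)\<in>{({#}, m)}. mcoeff (mscalar c) a * mcoeff f b)"
    unfolding mcoeff_mult
    by (rule sum.mono_neutral_right) (auto simp: finite_mset_splits mcoeff_simps split: if_splits)
  then show ?thesis by (simp add: mcoeff_simps)
qed

lemma mcoeff_mvar_mult: "mcoeff (mvar i * f) m = (if i \<in># m then mcoeff f (m - {#i#}) else 0)"
proof -
  have "mcoeff (mvar i * f) m
      = (\<Sum>(a, b)\<in>(if i \<in># m then {({#i#}, m - {#i#})} else {}). mcoeff (mvar i) a * mcoeff f b)"
    unfolding mcoeff_mult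
    by (rule sum.mono_neutral_right) (auto simp: finite_mset_splits mcoeff_simps split: if_splits)
  then show ?thesis by (simp add: mcoeff_simps)
qed

lemma mconst_mult: "mconst (f * g) = mconst f * mconst g"
proof -
  have *: "{(a, b). a = {#} \<and> b = ({#} :: nat multiset)} = {({#}, {#})}" by auto
  show ?thesis unfolding mcoeff_mult by (simp add: *)
qed

lemma mscalar_mult: "mscalar (a * b) = mscalar a * mscalar b"
  and mscalar_add: "mscalar (a + b) = mscalar a + mscalar b"
  and mscalar_0 [simp]: "mscalar 0 = 0" and mscalar_1 [simp]: "mscalar 1 = 1"
  by (rule mfps_eqI; simp add: mcoeff_mscalar_mult mcoeff_simps)+

lemma mconst_simps [simp]: "mconst 0 = 0" "mconst 1 = 1" "mconst (f + g) = mconst f + mconst g"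
  "mconst (f - g) = mconst f - mconst g" "mconst (- f) = - mconst f" "mconst (f * g) = mconst f * mconst g"
  "mconst (mscalar c) = c" "mconst (mvar i) = 0" "mconst (mcnj h) = cnj (mconst h)"
  "mconst (sum F S) = (\<Sum>x\<in>S. mconst (F x))"
  by (simp_all add: mcoeff_simps mconst_mult mcoeff_sum)

subsection \<open>Derivations\<close>

lemma mderiv_add [simp]: "mderiv i (f + g) = mderiv i f + mderiv i g"
  and mderiv_diff [simp]: "mderiv i (f - g) = mderiv i f - mderiv i g"
  and mderiv_0 [simp]: "mderiv i 0 = 0"
  and mderiv_mscalar [simp]: "mderiv i (mscalar c) = 0"
  and mderiv_mvar: "mderiv i (mvar j) = (if i = j then 1 else 0)"
  by (rule mfps_eqI; auto simp: mcoeff_simps algebra_simps)+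

lemma mderiv_sum: "mderiv i (sum f S) = (\<Sum>x\<in>S. mderiv i (f x))"
  by (induction S rule: infinite_finite_induct) auto

lemma mderiv_commute: "mderiv i (mderiv j f) = mderiv j (mderiv i f)"
  by (rule mfps_eqI) (auto simp: mcoeff_simps add_mset_commute algebra_simps)

text \<open>The weight \<open>count a i\<close> removes the splittings in which \<open>i\<close>
  does not occur in \<open>a\<close>; the others arise by adding \<open>i\<close> to the first part.
  In terms of coefficients, this differentiates one factor of a product.\<close>

lemma sum_splits_count:
  fixes F :: "'b multiset \<Rightarrow> 'b multiset \<Rightarrow> 'a::comm_ring_1"
  shows "(\<Sum>(a, b) | a + b = add_mset i m. of_nat (count a i) * F a b) =
    (\<Sum>(a, b) | a + b = m. of_nat (Suc (count a i)) * F (add_mset i a) b)"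
proof -
  have "(\<Sum>(a, b) | a + b = add_mset i m. of_nat (count a i) * F a b)
      = (\<Sum>(a, b) \<in> {(a, b). a + b = add_mset i m \<and> i \<in># a}. of_nat (count a i) * F a b)"
    by (rule sum.mono_neutral_right) (auto simp: finite_mset_splits intro!: count_inI)
  also have "\<dots> = (\<Sum>(a, b) | a + b = m. of_nat (Suc (count a i)) * F (add_mset i a) b)"
    by (rule sum.reindex_bij_witness[of _ "\<lambda>(a, b). (add_mset i a, b)" "\<lambda>(a, b). (a - {#i#}, b)"])
      (auto dest!: multi_member_split)
  finally show ?thesis .
qed

lemma mderiv_mult: "mderiv i (f * g) = mderiv i f * g + f * mderiv i g"
proof (rule mfps_eqI)
  fix m
  let ?S = "{(a, b). a + b = add_mset i m}"
  have swap: "(\<Sum>(a, b) | a + b = c. F a b) = (\<Sum>(a, b) | a + b = c. F b a)"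
    for c :: "nat multiset" and F :: "nat multiset \<Rightarrow> nat multiset \<Rightarrow> 'a"
    by (rule sum.reindex_bij_witness[of _ prod.swap prod.swap]) (auto simp: ac_simps)
  \<comment> \<open>The exponent of \<open>i\<close> in a product is the sum of its exponents in the
    factors, so the number brought down by the derivative splits into the two terms of the Leibniz
    rule.\<close>
  have c: "Suc (count m i) = count a i + count b i" if "a + b = add_mset i m" for a b
    using that by (metis count_add_mset count_union)
  have "mcoeff (mderiv i (f * g)) m = (\<Sum>(a, b)\<in>?S. of_nat (Suc (count m i)) * (mcoeff f a * mcoeff g b))"
    by (simp only: mderiv.rep_eq mcoeff_mult sum_distrib_left) (simp add: case_prod_unfold)
  also have "\<dots> = (\<Sum>(a, b)\<in>?S. of_nat (count a i) * (mcoeff f a * mcoeff g b)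
      + of_nat (count b i) * (mcoeff f a * mcoeff g b))"
    by (rule sum.cong) (auto simp: c algebra_simps simp del: of_nat_Suc)
  also have "\<dots> = (\<Sum>(a, b)\<in>?S. of_nat (count a i) * (mcoeff f a * mcoeff g b))
      + (\<Sum>(a, b)\<in>?S. of_nat (count a i) * (mcoeff f b * mcoeff g a))"
    by (subst (2) swap) (simp add: sum.distrib case_prod_unfold)
  also have "\<dots> = mcoeff (mderiv i f * g) m + mcoeff (f * mderiv i g) m"
    unfolding sum_splits_count mcoeff_mult
    by (subst (3) swap) (simp add: mderiv.rep_eq algebra_simps)
  finally show "mcoeff (mderiv i (f * g)) m = mcoeff (mderiv i f * g + f * mderiv i g) m"
    by (simp add: mcoeff_simps)
qed

subsection \<open>Order\<close>

text \<open>This filtration by total degree replaces a topology: a series that belongs to all its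
  steps is zero.\<close>

definition ordge :: "nat \<Rightarrow> 'a::zero mfps \<Rightarrow> bool" where
  "ordge k f \<longleftrightarrow> (\<forall>m. size m < k \<longrightarrow> mcoeff f m = 0)"

lemma ordge_0 [simp]: "ordge k 0" and ordge_le: "ordge k f \<Longrightarrow> l \<le> k \<Longrightarrow> ordge l f"
  and ordge_zero [simp]: "ordge 0 f" and ordge_Suc_0 [simp]: "ordge (Suc 0) f \<longleftrightarrow> mconst f = 0"
  by (auto simp: ordge_def mcoeff_simps)

lemma ordge_add [simp]: "ordge k f \<Longrightarrow> ordge k g \<Longrightarrow> ordge k (f + g)"
  and ordge_diff [simp]: "ordge k f \<Longrightarrow> ordge k g \<Longrightarrow> ordge k (f - g)"
  and ordge_mscalar: "ordge k f \<Longrightarrow> ordge k (mscalar c * f)"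
  and ordge_mderiv: "ordge (Suc k) f \<Longrightarrow> ordge k (mderiv i f)"
  by (simp_all add: ordge_def mcoeff_simps mcoeff_mscalar_mult)

lemma ordge_sum: "(\<And>x. x \<in> S \<Longrightarrow> ordge k (f x)) \<Longrightarrow> ordge k (sum f S)"
  by (induction S rule: infinite_finite_induct) auto

lemma ordge_mult:
  assumes "ordge k f" "ordge l g" shows "ordge (k + l) (f * g)"
  unfolding ordge_def mcoeff_mult
proof (intro allI impI sum.neutral, clarify)
  fix a b :: "nat multiset" assume "size (a + b) < k + l"
  then have "size a < k \<or> size b < l" by auto
  then show "mcoeff f a * mcoeff g b = 0" using assms by (auto simp: ordge_def)
qed

lemma ordge_mult': "ordge k f \<Longrightarrow> ordge k (g * f)" "ordge k f \<Longrightarrow> ordge k (f * g)"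
  using ordge_mult[of 0 g k f] ordge_mult[of k f 0 g] by auto

lemma ordge_prod_mset:
  "(\<And>i. i \<in># a \<Longrightarrow> mconst (\<theta> i) = 0) \<Longrightarrow> ordge (size a) (\<Prod>i\<in>#a. \<theta> i)"
proof (induction a)
  case (add x a)
  then show ?case using ordge_mult[of 1 "\<theta> x" "size a"] by simp
qed simp

lemma eq_0_if_ordge: "(\<And>k. ordge k f) \<Longrightarrow> f = 0"
  by (rule mfps_eqI) (metis lessI ordge_def zero_mfps.rep_eq)

subsection \<open>Monomials\<close>

definition mmon :: "nat multiset \<Rightarrow> 'a::comm_ring_1 mfps" where
  "mmon a = (\<Prod>i\<in>#a. mvar i)"

lemma mmon_simps [simp]: "mmon {#} = 1" "mmon (add_mset i a) = mvar i * mmon a"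
  "mmon (a + b) = mmon a * mmon b"
  by (simp_all add: mmon_def)

lemma mcoeff_mmon: "mcoeff (mmon a) m = (if m = a then 1 else 0)"
proof (induction a arbitrary: m)
  case (add i a)
  then show ?case by (auto simp: mcoeff_mvar_mult)
qed (simp add: mcoeff_simps)

lemma mcarr_mmon: "set_mset a \<subseteq> A \<Longrightarrow> mmon a \<in> mcarr A"
  by (rule mcarrI) (auto simp: mcoeff_mmon)

definition msets :: "nat set \<Rightarrow> nat \<Rightarrow> nat multiset set" where
  "msets A q = {a. set_mset a \<subseteq> A \<and> size a \<le> q}"

lemma finite_msets: assumes "finite A" shows "finite (msets A q)"
proof -
  have "msets A q \<subseteq> mset ` {xs. set xs \<subseteq> A \<and> length xs \<le> q}"
  proof
    fix a assume a: "a \<in> msets A q"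
    obtain xs where "mset xs = a" using ex_mset by blast
    with a show "a \<in> mset ` {xs. set xs \<subseteq> A \<and> length xs \<le> q}" by (auto simp: msets_def)
  qed
  then show ?thesis using finite_lists_length_le[OF assms] finite_subset by blast
qed

text \<open>The Taylor polynomial of degree \<open>q\<close>. For finite \<open>A\<close> it is a
  finite sum of terms, so an additive map can be evaluated on it.\<close>

definition mtrunc :: "nat set \<Rightarrow> nat \<Rightarrow> 'a::comm_ring_1 mfps \<Rightarrow> 'a mfps" where
  "mtrunc A q f = (\<Sum>a\<in>msets A q. mscalar (mcoeff f a) * mmon a)"

lemma ordge_mtrunc:
  assumes "finite A" "f \<in> mcarr A" shows "ordge (Suc q) (f - mtrunc A q f)"
  unfolding ordge_def
proof (intro allI impI)
  fix m :: "nat multiset" assume "size m < Suc q"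
  then have "mcoeff (mtrunc A q f) m = mcoeff f m"
    using mcarrD[OF assms(2), of m]
    by (simp add: mtrunc_def mcoeff_sum mcoeff_mscalar_mult mcoeff_mmon if_distrib finite_msets[OF assms(1)]
        cong: if_cong) (auto simp: msets_def)
  then show "mcoeff (f - mtrunc A q f) m = 0" by (simp add: mcoeff_simps)
qed

text \<open>Up to arbitrarily high order a series is a finite sum of terms, on which
  \<open>D\<close> vanishes; since \<open>D\<close> lowers the order by at most \<open>s\<close>,
  \<open>D f\<close> vanishes to every order. It is applied to the difference of the two sides of an
  identity, with \<open>s = 0\<close> for substitutions and \<open>s = 1\<close> if a derivative
  occurs.\<close>

lemma mfps_continuity:
  fixes D :: "'a::comm_ring_1 mfps \<Rightarrow> 'b::comm_ring_1 mfps"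
  assumes A: "finite A" and f: "f \<in> mcarr A"
    and add: "\<And>f g. f \<in> mcarr A \<Longrightarrow> g \<in> mcarr A \<Longrightarrow> D (f + g) = D f + D g"
    and cont: "\<And>k f. f \<in> mcarr A \<Longrightarrow> ordge (k + s) f \<Longrightarrow> ordge k (D f)"
    and mon: "\<And>c a. set_mset a \<subseteq> A \<Longrightarrow> D (mscalar c * mmon a) = 0"
  shows "D f = 0"
proof (rule eq_0_if_ordge)
  fix k
  have D0: "D 0 = 0" using add[of 0 0] by simp
  have D_sum: "D (sum h S) = 0" if "finite S" "\<And>x. x \<in> S \<Longrightarrow> h x \<in> mcarr A \<and> D (h x) = 0" for h S
    using that by (induction S) (auto simp: D0 add mcarr_sum)
  let ?P = "mtrunc A (k + s) f"
  have P: "?P \<in> mcarr A" unfolding mtrunc_def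
    by (intro mcarr_sum mcarr_mult mcarr_mscalar mcarr_mmon) (auto simp: msets_def)
  have "D ?P = 0" unfolding mtrunc_def
    by (rule D_sum[OF finite_msets[OF A]]) (auto simp: mcarr_mmon msets_def mon)
  then have "D f = D (f - ?P)" using add[of "f - ?P" ?P] P f by simp
  moreover have "ordge k (D (f - ?P))"
    using cont[of "f - ?P" k] ordge_mtrunc[OF A f, of "k + s"] P f by (simp add: ordge_le)
  ultimately show "ordge k (D f)" by simp
qed

subsection \<open>Substitution\<close>

text \<open>Indexing by a function instead of a vector removes the bookkeeping of dimensions: by
  \<open>msub_cong\<close> only the values at variables of \<open>f\<close> matter.\<close>

definition msub :: "(nat \<Rightarrow> 'a::comm_ring_1 mfps) \<Rightarrow> 'a mfps \<Rightarrow> 'a mfps" where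
  "msub \<theta> f = Abs_mfps (\<lambda>m. Sum_any (\<lambda>a. mcoeff f a * mcoeff (\<Prod>i\<in>#a. \<theta> i) m))"

lemma msubst_eq_msub: "msubst f F = msub (\<lambda>i. F $ i) f"
  by (simp add: msubst_def msub_def)

definition zconst :: "nat set \<Rightarrow> (nat \<Rightarrow> 'a::zero mfps) \<Rightarrow> bool" where
  "zconst A \<theta> \<longleftrightarrow> (\<forall>i\<in>A. mconst (\<theta> i) = 0)"

text \<open>A product of \<open>size a\<close> series without constant terms vanishes to order
  \<open>size a\<close>, so only finitely many monomials of \<open>f\<close> contribute. The bound
  \<open>q\<close> is free, so that the range can be enlarged to contain a given monomial.\<close>

lemma mcoeff_msub:
  assumes A: "finite A" and f: "f \<in> mcarr A" and \<theta>: "zconst A \<theta>" and q: "size m \<le> q"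
  shows "mcoeff (msub \<theta> f) m = (\<Sum>a\<in>msets A q. mcoeff f a * mcoeff (\<Prod>i\<in>#a. \<theta> i) m)"
proof -
  have "{a. mcoeff f a * mcoeff (\<Prod>i\<in>#a. \<theta> i) m \<noteq> 0} \<subseteq> msets A q"
  proof
    fix a assume a: "a \<in> {a. mcoeff f a * mcoeff (\<Prod>i\<in>#a. \<theta> i) m \<noteq> 0}"
    then have nz: "mcoeff f a \<noteq> 0" "mcoeff (\<Prod>i\<in>#a. \<theta> i) m \<noteq> 0" by auto
    then have sa: "set_mset a \<subseteq> A" using f mcarrD by blast
    then have "ordge (size a) (\<Prod>i\<in>#a. \<theta> i)" using \<theta> by (intro ordge_prod_mset) (auto simp: zconst_def)
    then have "\<not> size m < size a" using nz by (auto simp: ordge_def)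
    then show "a \<in> msets A q" using sa q by (simp add: msets_def)
  qed
  then show ?thesis
    unfolding msub_def by (simp add: Abs_mfps_inverse Sum_any.expand_superset[OF finite_msets[OF A]])
qed

context
  fixes A :: "nat set" and \<theta> :: "nat \<Rightarrow> 'a::comm_ring_1 mfps"
  assumes A: "finite A" and \<theta>: "zconst A \<theta>"
begin

lemma msub_add: "f \<in> mcarr A \<Longrightarrow> g \<in> mcarr A \<Longrightarrow> msub \<theta> (f + g) = msub \<theta> f + msub \<theta> g"
  by (rule mfps_eqI) (simp add: mcoeff_msub[OF A _ \<theta> order_refl] plus_mfps.rep_eq sum.distrib algebra_simps)

lemma msub_diff: "f \<in> mcarr A \<Longrightarrow> g \<in> mcarr A \<Longrightarrow> msub \<theta> (f - g) = msub \<theta> f - msub \<theta> g"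
  by (rule mfps_eqI) (simp add: mcoeff_msub[OF A _ \<theta> order_refl] minus_mfps.rep_eq sum_subtractf algebra_simps)

lemma msub_mscalar_mult: "f \<in> mcarr A \<Longrightarrow> msub \<theta> (mscalar c * f) = mscalar c * msub \<theta> f"
  by (rule mfps_eqI)
    (simp add: mcoeff_msub[OF A _ \<theta> order_refl] mcoeff_mscalar_mult sum_distrib_left mult.assoc)

lemma msub_0 [simp]: "msub \<theta> 0 = 0"
  using msub_diff[of 0 0] by simp

lemma msub_sum: "(\<And>x. x \<in> S \<Longrightarrow> f x \<in> mcarr A) \<Longrightarrow> msub \<theta> (sum f S) = (\<Sum>x\<in>S. msub \<theta> (f x))"
  by (induction S rule: infinite_finite_induct) (auto simp: msub_add mcarr_sum)

lemma ordge_msub: "f \<in> mcarr A \<Longrightarrow> ordge k f \<Longrightarrow> ordge k (msub \<theta> f)"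
  unfolding ordge_def
proof (intro allI impI)
  fix m :: "nat multiset" assume f: "f \<in> mcarr A" "\<forall>m. size m < k \<longrightarrow> mcoeff f m = 0" and m: "size m < k"
  show "mcoeff (msub \<theta> f) m = 0"
    unfolding mcoeff_msub[OF A f(1) \<theta> order_refl]
    by (rule sum.neutral) (use f(2) m in \<open>auto simp: msets_def\<close>)
qed

lemma msub_mmon: assumes "set_mset a \<subseteq> A" shows "msub \<theta> (mmon a) = (\<Prod>i\<in>#a. \<theta> i)"
proof (rule mfps_eqI)
  fix m
  have "mcoeff (msub \<theta> (mmon a)) m
      = (\<Sum>b\<in>msets A (max (size m) (size a)). (if b = a then 1 else 0) * mcoeff (\<Prod>i\<in>#b. \<theta> i) m)"
    using mcoeff_msub[OF A mcarr_mmon[OF assms] \<theta>, of m "max (size m) (size a)"] by (simp add: mcoeff_mmon)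
  also have "\<dots> = mcoeff (\<Prod>i\<in>#a. \<theta> i) m"
    using assms by (simp add: if_distrib[of "\<lambda>x. x * _"] finite_msets[OF A] cong: if_cong) (simp add: msets_def)
  finally show "mcoeff (msub \<theta> (mmon a)) m = mcoeff (\<Prod>i\<in>#a. \<theta> i) m" .
qed

lemma msub_mvar: "i \<in> A \<Longrightarrow> msub \<theta> (mvar i) = \<theta> i"
  using msub_mmon[of "{#i#}"] by simp

lemma msub_1: "msub \<theta> 1 = 1"
  using msub_mmon[of "{#}"] by simp

lemma msub_mscalar: "msub \<theta> (mscalar c) = mscalar c"
  using msub_mscalar_mult[of 1 c] by (simp add: msub_1)

text \<open>Both sides are additive and continuous in each factor, which reduces the claim to two
  monomials.\<close>

lemma msub_mult:
  assumes f: "f \<in> mcarr A" and g: "g \<in> mcarr A"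
  shows "msub \<theta> (f * g) = msub \<theta> f * msub \<theta> g"
proof -
  have 1: "msub \<theta> (mmon a * g) = msub \<theta> (mmon a) * msub \<theta> g" if a: "set_mset a \<subseteq> A" and g: "g \<in> mcarr A" for a g
  proof -
    note ca = mcarr_mmon[OF a]
    have "msub \<theta> (mmon a * g) - msub \<theta> (mmon a) * msub \<theta> g = 0"
    proof (rule mfps_continuity[OF A g, of _ 0])
      fix c b assume b: "set_mset b \<subseteq> A"
      have "msub \<theta> (mmon a * (mscalar c * mmon b)) = msub \<theta> (mscalar c * mmon (a + b))"
        by (simp add: algebra_simps)
      also have "\<dots> = mscalar c * (msub \<theta> (mmon a) * msub \<theta> (mmon b))"
        using a b by (subst msub_mscalar_mult) (auto simp only: mcarr_mmon msub_mmon set_mset_union Un_subset_iff image_mset_union prod_mset_Un)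
      finally show "msub \<theta> (mmon a * (mscalar c * mmon b)) - msub \<theta> (mmon a) * msub \<theta> (mscalar c * mmon b) = 0"
        by (simp add: msub_mscalar_mult[OF mcarr_mmon[OF b]])
    qed (auto simp: algebra_simps msub_add ca intro!: ordge_diff ordge_mult' ordge_msub)
    then show ?thesis by simp
  qed
  have "msub \<theta> (f * g) - msub \<theta> f * msub \<theta> g = 0"
  proof (rule mfps_continuity[OF A f, of _ 0])
    fix c a assume a: "set_mset a \<subseteq> A"
    show "msub \<theta> (mscalar c * mmon a * g) - msub \<theta> (mscalar c * mmon a) * msub \<theta> g = 0"
      using 1[OF a g] a g by (simp add: msub_mscalar_mult mcarr_mmon mult.assoc)
  qed (auto simp: algebra_simps msub_add g intro!: ordge_diff ordge_mult' ordge_msub)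
  then show ?thesis by simp
qed

lemma mconst_msub: assumes "f \<in> mcarr A" shows "mconst (msub \<theta> f) = mconst f"
proof -
  have "msets A 0 = {{#}}" by (auto simp: msets_def)
  then show ?thesis using mcoeff_msub[OF A assms \<theta>, of "{#}" 0] by simp
qed

lemma mcarr_msub:
  assumes f: "f \<in> mcarr A" and B: "\<And>i. i \<in> A \<Longrightarrow> \<theta> i \<in> mcarr B"
  shows "msub \<theta> f \<in> mcarr B"
proof (rule mcarrI)
  fix m assume m: "\<not> set_mset m \<subseteq> B"
  show "mcoeff (msub \<theta> f) m = 0"
    unfolding mcoeff_msub[OF A f \<theta> order_refl]
  proof (rule sum.neutral, safe)
    fix a assume "a \<in> msets A (size m)"
    then have "(\<Prod>i\<in>#a. \<theta> i) \<in> mcarr B" using B by (intro mcarr_prod_mset) (auto simp: msets_def)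
    then show "mcoeff f a * mcoeff (\<Prod>i\<in>#a. \<theta> i) m = 0" using m mcarrD by (metis mult_zero_right)
  qed
qed

lemma mderiv_msub:
  assumes f: "f \<in> mcarr A"
  shows "mderiv i (msub \<theta> f) = (\<Sum>j\<in>A. msub \<theta> (mderiv j f) * mderiv i (\<theta> j))"
proof -
  have mon: "mderiv i (msub \<theta> (mmon a)) = (\<Sum>j\<in>A. msub \<theta> (mderiv j (mmon a)) * mderiv i (\<theta> j))"
    if "set_mset a \<subseteq> A" for a using that
  proof (induction a)
    case empty
    have "mderiv j (1 :: 'a mfps) = 0" for j using mderiv_mscalar[of j 1] by (simp del: mderiv_mscalar)
    then show ?case by (simp add: msub_1)
  next
    case (add x a)
    then have a: "set_mset a \<subseteq> A" "x \<in> A" by auto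
    note c = mcarr_mmon[OF a(1)] mcarr_mvar[OF a(2)]
    have "mderiv i (msub \<theta> (mmon (add_mset x a))) = mderiv i (\<theta> x) * msub \<theta> (mmon a) + \<theta> x * mderiv i (msub \<theta> (mmon a))"
      using a by (simp add: c msub_mult mderiv_mult msub_mvar)
    also have "\<theta> x * mderiv i (msub \<theta> (mmon a)) = (\<Sum>j\<in>A. \<theta> x * msub \<theta> (mderiv j (mmon a)) * mderiv i (\<theta> j))"
      using add.IH a by (simp add: sum_distrib_left mult.assoc)
    also have "mderiv i (\<theta> x) * msub \<theta> (mmon a) = (\<Sum>j\<in>A. msub \<theta> (mderiv j (mvar x) * mmon a) * mderiv i (\<theta> j))"
      using a A by (simp add: mderiv_mvar if_distrib if_distribR mult.commute cong: if_cong)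
    finally have "mderiv i (msub \<theta> (mmon (add_mset x a))) =
        (\<Sum>j\<in>A. msub \<theta> (mderiv j (mvar x) * mmon a) * mderiv i (\<theta> j) + \<theta> x * msub \<theta> (mderiv j (mmon a)) * mderiv i (\<theta> j))"
      by (simp add: sum.distrib)
    also have "\<dots> = (\<Sum>j\<in>A. msub \<theta> (mderiv j (mmon (add_mset x a))) * mderiv i (\<theta> j))"
      using a by (intro sum.cong refl) (simp add: c mderiv_mult msub_add msub_mult msub_mvar distrib_right)
    finally show ?case .
  qed
  have "mderiv i (msub \<theta> f) - (\<Sum>j\<in>A. msub \<theta> (mderiv j f) * mderiv i (\<theta> j)) = 0"
  \<comment> \<open>One order is lost, because \<open>mderiv\<close> lowers the order of a series by
    one.\<close>
  proof (rule mfps_continuity[OF A f, of _ 1])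
    fix c :: 'a and a assume a: "set_mset a \<subseteq> A"
    have *: "mderiv j (mscalar c * mmon a) = mscalar c * mderiv j (mmon a)" for j
      by (simp add: mderiv_mult)
    show "mderiv i (msub \<theta> (mscalar c * mmon a))
        - (\<Sum>j\<in>A. msub \<theta> (mderiv j (mscalar c * mmon a)) * mderiv i (\<theta> j)) = 0"
      by (simp add: mcarr_mmon[OF a] msub_mscalar_mult * mderiv_mult mon[OF a] sum_distrib_left mult.assoc)
  qed (auto simp: msub_add algebra_simps sum.distrib
      intro!: ordge_diff ordge_mderiv ordge_msub ordge_sum ordge_mult'(1))
  then show ?thesis by simp
qed

end

lemma msub_cong: "finite A \<Longrightarrow> f \<in> mcarr A \<Longrightarrow> zconst A \<theta> \<Longrightarrow>
    (\<And>i. i \<in> A \<Longrightarrow> \<theta> i = \<theta>' i) \<Longrightarrow> msub \<theta> f = msub \<theta>' f"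
proof (rule mfps_eqI)
  fix m :: "nat multiset" assume *: "finite A" "f \<in> mcarr A" "zconst A \<theta>" "\<And>i. i \<in> A \<Longrightarrow> \<theta> i = \<theta>' i"
  have "image_mset \<theta> a = image_mset \<theta>' a" if "a \<in> msets A (size m)" for a
    using that *(4) by (intro image_mset_cong) (auto simp: msets_def)
  then show "mcoeff (msub \<theta> f) m = mcoeff (msub \<theta>' f) m"
    using *(3,4) by (simp add: mcoeff_msub[OF *(1,2) _ order_refl] zconst_def)
qed

lemma msub_id:
  assumes A: "finite A" and f: "f \<in> mcarr A" and \<theta>: "\<And>i. i \<in> A \<Longrightarrow> \<theta> i = mvar i"
  shows "msub \<theta> f = f"
proof -
  have z: "zconst A mvar" by (simp add: zconst_def)
  have "msub mvar f - f = 0"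
    by (rule mfps_continuity[OF A f, of _ 0])
      (auto simp: msub_add[OF A z] msub_mscalar_mult[OF A z] mcarr_mmon msub_mmon[OF A z] mmon_def[symmetric]
        intro!: ordge_diff ordge_msub[OF A z])
  then show ?thesis using msub_cong[OF A f, of \<theta> mvar] \<theta> by (simp add: zconst_def)
qed

lemma msub_msub:
  assumes A: "finite A" and f: "f \<in> mcarr A" and B: "finite B"
    and \<theta>: "zconst A \<theta>" "\<And>i. i \<in> A \<Longrightarrow> \<theta> i \<in> mcarr B"
    and \<eta>: "zconst B \<eta>"
  shows "msub \<eta> (msub \<theta> f) = msub (\<lambda>i. msub \<eta> (\<theta> i)) f"
proof -
  have c: "zconst A (\<lambda>i. msub \<eta> (\<theta> i))"
    using mconst_msub[OF B \<eta>] \<theta> by (simp add: zconst_def)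
  have mon: "msub \<eta> (\<Prod>i\<in>#a. \<theta> i) = (\<Prod>i\<in>#a. msub \<eta> (\<theta> i))" if "set_mset a \<subseteq> A" for a
    using that by (induction a) (auto simp: msub_1[OF B \<eta>] msub_mult[OF B \<eta>] \<theta>(2) mcarr_prod_mset subset_iff)
  have "msub \<eta> (msub \<theta> f) - msub (\<lambda>i. msub \<eta> (\<theta> i)) f = 0"
  proof (rule mfps_continuity[OF A f, of _ 0])
    fix a :: "nat multiset" and d assume a: "set_mset a \<subseteq> A"
    have "(\<Prod>i\<in>#a. \<theta> i) \<in> mcarr B" using a \<theta>(2) by (intro mcarr_prod_mset) auto
    then show "msub \<eta> (msub \<theta> (mscalar d * mmon a)) - msub (\<lambda>i. msub \<eta> (\<theta> i)) (mscalar d * mmon a) = 0"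
      using a
      by (simp add: mcarr_mmon[OF a] msub_mscalar_mult[OF A \<theta>(1)] msub_mscalar_mult[OF A c] msub_mmon[OF A \<theta>(1)] msub_mmon[OF A c]
        msub_mscalar_mult[OF B \<eta>] mon)
  qed (auto simp: msub_add[OF A \<theta>(1)] msub_add[OF A c] msub_add[OF B \<eta>] mcarr_msub[OF A \<theta>(1)] \<theta>(2)
      intro!: ordge_diff ordge_msub[OF A \<theta>(1)] ordge_msub[OF A c] ordge_msub[OF B \<eta>])
  then show ?thesis by simp
qed

section \<open>Conjugation of the coefficients\<close>

lemma mcnj_simps [simp]: "mcnj (f + g) = mcnj f + mcnj g" "mcnj (f * g) = mcnj f * mcnj g"
  "mcnj 0 = 0" "mcnj 1 = 1" "mcnj (mvar i) = mvar i" "mcnj (mscalar c) = mscalar (cnj c)" "mcnj (mcnj f) = f"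
  "mcnj (f - g) = mcnj f - mcnj g"
  "mcnj (mderiv i f) = mderiv i (mcnj f)"
  by (rule mfps_eqI; simp add: mcoeff_simps mcoeff_mult case_prod_unfold)+

lemma mcnj_sum: "mcnj (sum f S) = (\<Sum>x\<in>S. mcnj (f x))"
  by (induction S rule: infinite_finite_induct) auto

lemma mcnj_prod_mset: "mcnj (\<Prod>i\<in>#a. \<theta> i) = (\<Prod>i\<in>#a. mcnj (\<theta> i))"
  by (induction a) auto

lemma mcnj_eq_0 [simp]: "mcnj f = 0 \<longleftrightarrow> f = 0"
  by (metis mcnj_simps(3,7))

lemma mcnj_msub:
  assumes A: "finite A" and f: "f \<in> mcarr A" and \<theta>: "zconst A \<theta>"
  shows "mcnj (msub \<theta> f) = msub (\<lambda>i. mcnj (\<theta> i)) (mcnj f)"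
proof (rule mfps_eqI)
  fix m
  have "cnj (mcoeff (\<Prod>i\<in>#a. \<theta> i) m) = mcoeff (\<Prod>i\<in>#a. mcnj (\<theta> i)) m" for a
    by (metis mcnj_prod_mset mcnj.rep_eq)
  then show "mcoeff (mcnj (msub \<theta> f)) m = mcoeff (msub (\<lambda>i. mcnj (\<theta> i)) (mcnj f)) m"
    using mcoeff_msub[OF A f \<theta> order_refl, of m]
      mcoeff_msub[OF A mcarr_mcnj[OF f], of "\<lambda>i. mcnj (\<theta> i)", OF _ order_refl, of m] \<theta>
    by (simp add: mcnj.rep_eq zconst_def)
qed

section \<open>Units, Taylor expansion and linear systems over power series\<close>

text \<open>The inverse is 1 / f(0) times the geometric series evaluated at q = 1 - f / f(0), which
  has no constant term. Evaluating a series in one variable turns the infinite sum into a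
  substitution.\<close>

lemma mfps_unit:
  fixes f :: "'a::field mfps"
  assumes f: "f \<in> mcarr A" and c: "mconst f \<noteq> 0"
  obtains g where "g \<in> mcarr A" "f * g = 1"
proof -
  \<comment> \<open>The geometric series in the variable 0.\<close>
  define G :: "'a mfps" where "G = Abs_mfps (\<lambda>m. if set_mset m \<subseteq> {0} then 1 else 0)"
  have G: "mcoeff G m = (if set_mset m \<subseteq> {0} then 1 else 0)" for m
    by (simp add: G_def Abs_mfps_inverse)
  have Gc: "G \<in> mcarr {0}" by (rule mcarrI) (simp add: G)
  have sub: "set_mset (m - {#0#}) \<subseteq> {0} \<longleftrightarrow> set_mset m \<subseteq> {0}" for m :: "nat multiset"
  proof -
    have "x \<in># m - {#0#} \<longleftrightarrow> x \<in># m" if "x \<noteq> 0" for x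
      using that by (simp add: in_diff_count)
    then show ?thesis by auto
  qed
  have "G * (1 - mvar 0) = 1"
  proof (rule mfps_eqI)
    fix m :: "nat multiset"
    have "mcoeff (G * (1 - mvar 0)) m = mcoeff G m - mcoeff (mvar 0 * G) m"
      by (simp add: algebra_simps mcoeff_simps)
    then show "mcoeff (G * (1 - mvar 0)) m = mcoeff 1 m"
      unfolding mcoeff_mvar_mult G sub by (auto simp: mcoeff_simps)
  qed
  moreover define q where "q = 1 - mscalar (1 / mconst f) * f"
  have z: "zconst {0} (\<lambda>_. q)" using c by (simp add: zconst_def q_def)
  have "q \<in> mcarr A" using f by (simp add: q_def)
  then have "msub (\<lambda>_. q) G \<in> mcarr A" using mcarr_msub[OF _ z Gc] by simp
  moreover have "msub (\<lambda>_. q) (G * (1 - mvar 0)) = msub (\<lambda>_. q) G * (1 - q)"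
    by (subst msub_mult[OF _ z Gc])
      (simp_all add: mcarr_mvar msub_diff[OF _ z] msub_1[OF _ z] msub_mvar[OF _ z])
  ultimately have "f * (mscalar (1 / mconst f) * msub (\<lambda>_. q) G) = 1"
    using msub_1[OF _ z] by (simp add: q_def mult.assoc mult.commute mult.left_commute)
  then show ?thesis by (rule that[rotated]) (use \<open>msub (\<lambda>_. q) G \<in> mcarr A\<close> in simp)
qed

text \<open>A monomial with variables from \<open>K\<close> on is assigned to the smallest of them,
  \<open>K + i\<close>, so that it is counted once; hence \<open>g i\<close> retains only monomials
  free of the variables \<open>K, ..., K + i - 1\<close>.\<close>

lemma mfps_split_vars:
  fixes h :: "'a::comm_ring_1 mfps"
  assumes h: "h \<in> mcarr {..<2 * K}"
  obtains h\<^sub>0 g where "h\<^sub>0 \<in> mcarr {..<K}" "\<And>i. g i \<in> mcarr {..<2 * K}"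
    "\<And>i. mconst (g i) = mconst (mderiv (K + i) h)" "h = h\<^sub>0 + (\<Sum>i<K. mvar (K + i) * g i)"
proof -
  define h0 where "h0 = Abs_mfps (\<lambda>m. if set_mset m \<subseteq> {..<K} then mcoeff h m else 0)"
  define g where "g i = Abs_mfps (\<lambda>m. if set_mset m \<subseteq> {..<K} \<union> {K + i..} then mcoeff h (add_mset (K + i) m) else 0)" for i
  have h0: "mcoeff h0 m = (if set_mset m \<subseteq> {..<K} then mcoeff h m else 0)" for m
    by (simp add: h0_def Abs_mfps_inverse)
  have g: "mcoeff (g i) m = (if set_mset m \<subseteq> {..<K} \<union> {K + i..} then mcoeff h (add_mset (K + i) m) else 0)" for i m
    by (simp add: g_def Abs_mfps_inverse)
  have "h = h0 + (\<Sum>i<K. mvar (K + i) * g i)"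
  proof (rule mfps_eqI)
    fix m
    let ?I = "{i\<in>{..<K}. K + i \<in># m \<and> set_mset (m - {#K + i#}) \<subseteq> {..<K} \<union> {K + i..}}"
    have "mcoeff (\<Sum>i<K. mvar (K + i) * g i) m = (\<Sum>i<K. if K + i \<in># m \<and> set_mset (m - {#K + i#}) \<subseteq> {..<K} \<union> {K + i..} then mcoeff h m else 0)"
      unfolding mcoeff_sum by (rule sum.cong) (auto simp: mcoeff_mvar_mult g)
    also have "\<dots> = (\<Sum>i\<in>?I. mcoeff h m)" by (rule sum.inter_filter[symmetric]) simp
    also have "\<dots> = mcoeff h m - mcoeff h0 m"
    proof (cases "set_mset m \<subseteq> {..<K}")
      case True
      then have I: "?I = {}" by auto
      show ?thesis unfolding I using True by (simp add: h0)
    next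
      case F: False
      show ?thesis
      proof (cases "set_mset m \<subseteq> {..<2 * K}")
        case True
        let ?J = "{j\<in>set_mset m. K \<le> j}"
        have J: "finite ?J" "?J \<noteq> {}" using F by auto
        define i where "i = Min ?J - K"
        have i: "Min ?J = K + i" "K + i \<in># m" "i < K"
          using Min_in[OF J] True by (auto simp: i_def)
        have le: "K + i \<le> j" if "j \<in># m" "K \<le> j" for j
          using Min_le[OF J(1), of j] that i by auto
        have I: "?I = {i}"
        proof (intro equalityI subsetI)
          fix l assume l: "l \<in> ?I"
          then have "K + i \<le> K + l" using le[of "K + l"] by simp
          moreover have "\<not> i < l"
          proof
            assume "i < l"
            then have "K + i \<in># m - {#K + l#}" using i by (simp add: in_diff_count)
            then show False using l \<open>i < l\<close> by auto
          qed
          ultimately show "l \<in> {i}" by auto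
        next
          fix l assume "l \<in> {i}"
          moreover have "x < K \<or> K + i \<le> x" if "x \<in># m - {#K + i#}" for x
            using le in_diffD[OF that] by (metis not_le)
          ultimately show "l \<in> ?I" using i by auto
        qed
        show ?thesis unfolding I using F by (simp add: h0)
      next
        case False
        then show ?thesis using mcarrD[OF h False] F by (simp add: h0)
      qed
    qed
    finally show "mcoeff h m = mcoeff (h0 + (\<Sum>i<K. mvar (K + i) * g i)) m"
      by (simp add: mcoeff_simps)
  qed
  moreover have "h0 \<in> mcarr {..<K}" by (rule mcarrI) (simp add: h0)
  moreover have "g i \<in> mcarr {..<2 * K}" for i
    by (rule mcarrI) (use mcarrD[OF h] in \<open>auto simp: g\<close>)
  moreover have "mconst (g i) = mconst (mderiv (K + i) h)" for i
    by (simp add: g mcoeff_simps)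
  ultimately show ?thesis using that by blast
qed

text \<open>In f(x + y) every term of positive degree in y has a factor y_i, which
  \<open>mfps_split_vars\<close> extracts; substituting x = \<theta>' and y = \<theta> - \<theta>'
  gives the quotients. Their constant terms are the first derivatives of f at the origin.\<close>

lemma mfps_taylor:
  fixes f :: "'a::comm_ring_1 mfps"
  assumes f: "f \<in> mcarr {..<K}" and z: "zconst {..<K} \<theta>" "zconst {..<K} \<theta>'"
    and B: "\<And>i. i < K \<Longrightarrow> \<theta> i \<in> mcarr B" "\<And>i. i < K \<Longrightarrow> \<theta>' i \<in> mcarr B"
  obtains Q where "\<And>i. i < K \<Longrightarrow> Q i \<in> mcarr B" "\<And>i. i < K \<Longrightarrow> mconst (Q i) = mconst (mderiv i f)"
    "msub \<theta> f - msub \<theta>' f = (\<Sum>i<K. (\<theta> i - \<theta>' i) * Q i)"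
proof -
  let ?s = "\<lambda>i. mvar i + mvar (K + i) :: 'a mfps"
  have zs: "zconst {..<K} ?s" by (simp add: zconst_def)
  have sc: "?s i \<in> mcarr {..<2 * K}" if "i < K" for i using that by (simp add: mcarr_mvar)
  define h where "h = msub ?s f"
  have h: "h \<in> mcarr {..<2 * K}" unfolding h_def using mcarr_msub[OF _ zs f] sc by simp
  obtain h0 g where g: "h0 \<in> mcarr {..<K}" "\<And>i. g i \<in> mcarr {..<2 * K}"
    "\<And>i. mconst (g i) = mconst (mderiv (K + i) h)" "h = h0 + (\<Sum>i<K. mvar (K + i) * g i)"
    by (rule mfps_split_vars[OF h]) blast
  define \<eta> where "\<eta> i = (if i < K then \<theta>' i else \<theta> (i - K) - \<theta>' (i - K))" for i
  define \<eta>' where "\<eta>' i = (if i < K then \<theta>' i else 0)" for i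
  have z\<eta>: "zconst {..<2 * K} \<eta>" "zconst {..<2 * K} \<eta>'" using z by (auto simp: zconst_def \<eta>_def \<eta>'_def)
  have g0: "h0 \<in> mcarr {..<2 * K}" using g(1) by (rule mcarr_mono) auto
  have ev: "msub e h = msub e h0 + (\<Sum>i<K. e (K + i) * msub e (g i))" if e: "zconst {..<2 * K} e" for e
  proof -
    have c: "mvar (K + i) * g i \<in> mcarr {..<2 * K}" if "i < K" for i
      using that g by (auto simp: mcarr_mvar)
    have cs: "(\<Sum>i<K. mvar (K + i) * g i) \<in> mcarr {..<2 * K}"
      using c by (intro mcarr_sum) blast
    have "msub e h = msub e h0 + msub e (\<Sum>i<K. mvar (K + i) * g i)"
      by (subst g(4)) (rule msub_add[OF _ e g0 cs], simp)
    also have "msub e (\<Sum>i<K. mvar (K + i) * g i) = (\<Sum>i<K. msub e (mvar (K + i) * g i))"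
      by (rule msub_sum[OF _ e]) (use c in auto)
    also have "(\<Sum>i<K. msub e (mvar (K + i) * g i)) = (\<Sum>i<K. e (K + i) * msub e (g i))"
      by (rule sum.cong) (simp_all add: msub_mult[OF _ e] g mcarr_mvar msub_mvar[OF _ e])
    finally show ?thesis .
  qed
  have hs: "msub e h = msub (\<lambda>i. e i + e (K + i)) f" if e: "zconst {..<2 * K} e" for e
  proof -
    have "zconst {..<K} (\<lambda>i. msub e (?s i))" 
      using e by (auto simp: zconst_def msub_add[OF _ e] msub_mvar[OF _ e] mcarr_mvar)
    then show ?thesis unfolding h_def
      by (subst msub_msub[OF _ f _ zs _ e])
        (use sc e in \<open>auto simp: msub_add[OF _ e] mcarr_mvar msub_mvar[OF _ e] intro!: msub_cong[OF _ f]\<close>)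
  qed
  have "msub \<eta> h = msub \<theta> f" unfolding hs[OF z\<eta>(1)]
    using z by (intro msub_cong[OF _ f]) (auto simp: \<eta>_def zconst_def)
  moreover have "msub \<eta>' h = msub \<theta>' f" unfolding hs[OF z\<eta>(2)]
    using z by (intro msub_cong[OF _ f]) (auto simp: \<eta>'_def zconst_def)
  moreover have "msub \<eta> h0 = msub \<eta>' h0"
    using z by (intro msub_cong[OF _ g(1)]) (auto simp: \<eta>_def \<eta>'_def zconst_def)
  ultimately have "msub \<theta>' f + (\<Sum>i<K. (\<theta> i - \<theta>' i) * msub \<eta> (g i)) = msub \<theta> f"
    using ev[OF z\<eta>(1)] ev[OF z\<eta>(2)] by (simp add: \<eta>_def \<eta>'_def)
  then have "msub \<theta> f - msub \<theta>' f = (\<Sum>i<K. (\<theta> i - \<theta>' i) * msub \<eta> (g i))"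
    by (metis add_diff_cancel_left')
  moreover have "msub \<eta> (g i) \<in> mcarr B" for i
    by (rule mcarr_msub[OF _ z\<eta>(1) g(2)]) (auto simp: \<eta>_def B)
  moreover have "mconst (msub \<eta> (g i)) = mconst (mderiv i f)" if "i < K" for i
  proof -
    have "mderiv (K + i) h = (\<Sum>j<K. msub ?s (mderiv j f) * (if i = j then 1 else 0))"
      unfolding h_def by (subst mderiv_msub[OF _ zs f]) (auto simp: mderiv_mvar intro!: sum.cong)
    also have "\<dots> = msub ?s (mderiv i f)" using that by (simp add: if_distrib cong: if_cong)
    finally show ?thesis
      by (simp add: mconst_msub[OF _ z\<eta>(1) g(2)] g(3) mconst_msub[OF _ zs] f)
  qed
  ultimately show ?thesis using that[of "\<lambda>i. msub \<eta> (g i)"] by simp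
qed

text \<open>Gaussian elimination: the matrix is the identity at the origin, so the pivot is a unit,
  and the Schur complement \<open>P'\<close> is again the identity at the origin.\<close>

lemma mfps_linear_system:
  fixes P :: "'b \<Rightarrow> 'b \<Rightarrow> 'a::field mfps"
  assumes B: "finite B" and P: "\<And>b c. b \<in> B \<Longrightarrow> c \<in> B \<Longrightarrow> P b c \<in> mcarr A \<and> mconst (P b c) = (if b = c then 1 else 0)"
    and r: "\<And>b. b \<in> B \<Longrightarrow> r b \<in> mcarr A"
  shows "\<exists>y. \<forall>b\<in>B. y b \<in> mcarr A \<and> (\<Sum>c\<in>B. P b c * y c) = r b"
  using assms
proof (induction B arbitrary: P r)
  case (insert p B)
  obtain s where s: "s \<in> mcarr A" "P p p * s = 1"
    using mfps_unit[of "P p p" A] insert.prems(1)[of p p] by auto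
  define P' where "P' b c = P b c - P b p * s * P p c" for b c
  define r' where "r' b = r b - P b p * s * r p" for b
  have "\<exists>y. \<forall>b\<in>B. y b \<in> mcarr A \<and> (\<Sum>c\<in>B. P' b c * y c) = r' b"
    using insert.prems insert.hyps s(1) by (intro insert.IH) (auto simp: P'_def r'_def)
  then obtain y where y: "\<And>b. b \<in> B \<Longrightarrow> y b \<in> mcarr A" "\<And>b. b \<in> B \<Longrightarrow> (\<Sum>c\<in>B. P' b c * y c) = r' b" by blast
  define yp where "yp = s * (r p - (\<Sum>c\<in>B. P p c * y c))"
  let ?y = "\<lambda>b. if b = p then yp else y b"
  have sum: "(\<Sum>c\<in>insert p B. P b c * ?y c) = P b p * yp + (\<Sum>c\<in>B. P b c * y c)" for b
    using insert.hyps by (simp, intro sum.cong) auto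
  have "yp \<in> mcarr A" unfolding yp_def using insert.prems y(1) s(1) by (intro mcarr_mult mcarr_diff mcarr_sum) auto
  moreover have "P p p * yp + (\<Sum>c\<in>B. P p c * y c) = r p"
    using s(2) by (simp add: yp_def mult.assoc[symmetric])
  moreover have "P b p * yp + (\<Sum>c\<in>B. P b c * y c) = r b" if "b \<in> B" for b
  proof -
    have "(\<Sum>c\<in>B. P' b c * y c) = (\<Sum>c\<in>B. P b c * y c) - P b p * s * (\<Sum>c\<in>B. P p c * y c)"
      by (simp add: P'_def algebra_simps sum_subtractf sum_distrib_left)
    moreover have "P b p * yp + (\<Sum>c\<in>B. P b c * y c)
        = P b p * s * r p + ((\<Sum>c\<in>B. P b c * y c) - P b p * s * (\<Sum>c\<in>B. P p c * y c))"
      by (simp add: yp_def algebra_simps)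
    ultimately have "P b p * yp + (\<Sum>c\<in>B. P b c * y c) = P b p * s * r p + r' b"
      using y(2)[OF that] by simp
    then show ?thesis by (simp add: r'_def)
  qed
  ultimately show ?case
    using y(1) by (intro exI[of _ ?y]) (auto simp only: sum insert_iff if_True split: if_split)
qed simp

text \<open>Subtracting the constant term of \<open>f\<close> raises the order of the product by
  one.\<close>

lemma mcoeff_mult_ordge:
  assumes "ordge (size m) k" shows "mcoeff (f * k) m = mconst f * mcoeff k m"
proof -
  have "ordge (1 + size m) ((f - mscalar (mconst f)) * k)"
    by (rule ordge_mult) (use assms in auto)
  then have "mcoeff ((f - mscalar (mconst f)) * k) m = 0" by (simp add: ordge_def)
  then have "mcoeff (f * k) m = mcoeff (mscalar (mconst f) * k) m"
    by (simp add: algebra_simps mcoeff_simps)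
  then show ?thesis by (simp add: mcoeff_mscalar_mult)
qed

text \<open>The lowest-order parts of the \<open>k i\<close> form a solution of the system with the constant matrix.\<close>

lemma mfps_linear_system_unique:
  fixes k :: "'b \<Rightarrow> 'a::comm_ring_1 mfps"
  assumes J: "finite J"
    and inj: "\<And>u i. (\<And>r. r \<in> R \<Longrightarrow> (\<Sum>i\<in>J. mconst (Q r i) * u i) = 0) \<Longrightarrow> i \<in> J \<Longrightarrow> u i = 0"
    and k: "\<And>r. r \<in> R \<Longrightarrow> (\<Sum>i\<in>J. Q r i * k i) = 0" and i: "i \<in> J"
  shows "k i = 0"
proof -
  have "\<forall>i\<in>J. ordge q (k i)" for q
  proof (induction q)
    case (Suc q)
    show ?case unfolding ordge_def
    proof (intro ballI allI impI)
      fix i and m :: "nat multiset" assume i: "i \<in> J" and m: "size m < Suc q"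
      then have o: "ordge (size m) (k i)" if "i \<in> J" for i using Suc that by (auto intro: ordge_le)
      have "(\<Sum>i\<in>J. mconst (Q r i) * mcoeff (k i) m) = 0" if "r \<in> R" for r
      proof -
        have "(\<Sum>i\<in>J. mconst (Q r i) * mcoeff (k i) m) = mcoeff (\<Sum>i\<in>J. Q r i * k i) m"
          unfolding mcoeff_sum by (rule sum.cong) (use mcoeff_mult_ordge[OF o] in auto)
        then show ?thesis using k[OF that] by (simp add: mcoeff_simps)
      qed
      then show "mcoeff (k i) m = 0" using inj[of "\<lambda>i. mcoeff (k i) m"] i by blast
    qed
  qed simp
  then show ?thesis using i by (intro eq_0_if_ordge) blast
qed

subsection \<open>Spaces of functions of finite dimension\<close>

text \<open>Vectors are functions on all natural numbers, so that spaces of different dimensions and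
  their restrictions to some coordinates live in one type. Families are indexed, and a repeated
  vector makes a family dependent.\<close>

definition spn :: "'i set \<Rightarrow> ('i \<Rightarrow> nat \<Rightarrow> 'k::field) \<Rightarrow> (nat \<Rightarrow> 'k) set" where
  "spn S w = {v. \<exists>c. v = (\<lambda>i. \<Sum>l\<in>S. c l * w l i)}"

definition indep :: "'i set \<Rightarrow> ('i \<Rightarrow> nat \<Rightarrow> 'k::field) \<Rightarrow> bool" where
  "indep S w \<longleftrightarrow> (\<forall>c. (\<forall>i. (\<Sum>l\<in>S. c l * w l i) = 0) \<longrightarrow> (\<forall>l\<in>S. c l = 0))"

definition lsub :: "(nat \<Rightarrow> 'k::field) set \<Rightarrow> bool" where
  "lsub V \<longleftrightarrow> (\<lambda>_. 0) \<in> V \<and> (\<forall>v\<in>V. \<forall>w\<in>V. \<forall>c. (\<lambda>i. v i + c * w i) \<in> V)"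

text \<open>A reduced basis: the coordinates in the set \<open>A\<close> of pivots identify \<open>V\<close> with the functions on \<open>A\<close>.\<close>

definition pivot_basis :: "(nat \<Rightarrow> 'k::field) set \<Rightarrow> nat set \<Rightarrow> (nat \<Rightarrow> nat \<Rightarrow> 'k) \<Rightarrow> bool" where
  "pivot_basis V A E \<longleftrightarrow> finite A \<and> (\<forall>a\<in>A. E a \<in> V \<and> (\<forall>b\<in>A. E a b = (if a = b then 1 else 0))) \<and>
     (\<forall>v\<in>V. \<forall>i. v i = (\<Sum>a\<in>A. v a * E a i))"

text \<open>A relation, so that no dimension is assigned to a space without a finite pivot basis;
  \<open>hasdim_unique\<close> makes it single-valued.\<close>

definition hasdim :: "(nat \<Rightarrow> 'k::field) set \<Rightarrow> nat \<Rightarrow> bool" where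
  "hasdim V r \<longleftrightarrow> (\<exists>A E. pivot_basis V A E \<and> card A = r)"

lemma lsubI: "(\<lambda>_. 0) \<in> V \<Longrightarrow> (\<And>v w c. v \<in> V \<Longrightarrow> w \<in> V \<Longrightarrow> (\<lambda>i. v i + c * w i) \<in> V) \<Longrightarrow> lsub V"
  by (simp add: lsub_def)

lemma lsubD: "lsub V \<Longrightarrow> v \<in> V \<Longrightarrow> w \<in> V \<Longrightarrow> (\<lambda>i. v i + c * w i) \<in> V"
  by (simp add: lsub_def)

lemma spnI: "v = (\<lambda>i. \<Sum>l\<in>S. c l * w l i) \<Longrightarrow> v \<in> spn S w"
  by (auto simp: spn_def)

lemma spnE: assumes "v \<in> spn S w" obtains c where "v = (\<lambda>i. \<Sum>l\<in>S. c l * w l i)"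
  using assms by (auto simp: spn_def)

lemma pivot_basisI:
  assumes "finite A" "\<And>a. a \<in> A \<Longrightarrow> E a \<in> V"
    "\<And>a b. a \<in> A \<Longrightarrow> b \<in> A \<Longrightarrow> E a b = (if a = b then 1 else 0)"
    "\<And>v i. v \<in> V \<Longrightarrow> v i = (\<Sum>a\<in>A. v a * E a i)"
  shows "pivot_basis V A E"
  unfolding pivot_basis_def using assms by blast

lemma pivot_basisD:
  assumes "pivot_basis V A E"
  shows "finite A" "a \<in> A \<Longrightarrow> E a \<in> V" "a \<in> A \<Longrightarrow> b \<in> A \<Longrightarrow> E a b = (if a = b then 1 else 0)"
    "v \<in> V \<Longrightarrow> v i = (\<Sum>a\<in>A. v a * E a i)"
  using assms unfolding pivot_basis_def by blast+

lemma hasdimE: assumes "hasdim V r" obtains A E where "pivot_basis V A E" "card A = r"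
  using assms by (auto simp: hasdim_def)

lemma lsub_spn: "lsub (spn S w)"
proof (rule lsubI)
  show "(\<lambda>_. 0) \<in> spn S w" by (rule spnI[of _ "\<lambda>_. 0"]) simp
  fix u v a assume "u \<in> spn S w" "v \<in> spn S w"
  then obtain c d where "u = (\<lambda>i. \<Sum>l\<in>S. c l * w l i)" "v = (\<lambda>i. \<Sum>l\<in>S. d l * w l i)"
    by (elim spnE)
  then show "(\<lambda>i. u i + a * v i) \<in> spn S w"
    by (intro spnI[of _ "\<lambda>l. c l + a * d l"])
      (simp add: distrib_right sum.distrib sum_distrib_left mult.assoc)
qed

lemma lsub_sum:
  assumes "lsub V" "finite S" "\<And>l. l \<in> S \<Longrightarrow> w l \<in> V"
  shows "(\<lambda>i. \<Sum>l\<in>S. c l * w l i) \<in> V"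
  using assms(2,3)
proof (induction S rule: finite_induct)
  case (insert x F)
  then have "(\<lambda>i. (\<Sum>l\<in>F. c l * w l i) + c x * w x i) \<in> V" using lsubD[OF assms(1)] by simp
  with insert show ?case by (simp add: add.commute)
qed (use assms(1) in \<open>simp add: lsub_def\<close>)

lemma spn_subset: "lsub V \<Longrightarrow> finite S \<Longrightarrow> (\<And>l. l \<in> S \<Longrightarrow> w l \<in> V) \<Longrightarrow> spn S w \<subseteq> V"
  using lsub_sum[of V S w] by (auto elim!: spnE)

lemma in_spn: "finite S \<Longrightarrow> l \<in> S \<Longrightarrow> w l \<in> spn S w"
  by (rule spnI[of _ "\<lambda>k. if k = l then 1 else 0"]) (simp add: if_distrib[of "\<lambda>x. x * _"] cong: if_cong)

text \<open>Elimination: an unknown that occurs in the equation \<open>x\<close> is solved for,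
  which leaves one equation and one unknown fewer.\<close>

lemma homogeneous_system_solvable:
  fixes w :: "'i \<Rightarrow> 'j \<Rightarrow> 'k::field"
  assumes "finite X" "finite S" "card X < card S"
  shows "\<exists>c. (\<exists>l\<in>S. c l \<noteq> 0) \<and> (\<forall>x\<in>X. (\<Sum>l\<in>S. c l * w l x) = 0)"
  using assms
proof (induction X arbitrary: S w rule: finite_induct)
  case empty
  then have "S \<noteq> {}" by auto
  then show ?case by (intro exI[of _ "\<lambda>_. 1"]) auto
next
  case (insert x X)
  show ?case
  proof (cases "\<forall>l\<in>S. w l x = 0")
    case True
    have "card X < card S" using insert by simp
    then obtain c where c: "\<exists>l\<in>S. c l \<noteq> 0" "\<forall>j\<in>X. (\<Sum>l\<in>S. c l * w l j) = 0"
      using insert.IH[of S w] insert.prems by blast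
    moreover have "(\<Sum>l\<in>S. c l * w l x) = 0" using True by (intro sum.neutral) simp
    ultimately show ?thesis by blast
  next
    case False
    then obtain p where p: "p \<in> S" "w p x \<noteq> 0" by blast
    define w' where "w' l j = w l j - w l x / w p x * w p j" for l j
    have "card X < card (S - {p})" using insert p by simp
    then obtain c where c: "\<exists>l\<in>S - {p}. c l \<noteq> 0" "\<forall>j\<in>X. (\<Sum>l\<in>S - {p}. c l * w' l j) = 0"
      using insert.IH[of "S - {p}" w'] insert.prems by blast
    define t where "t = - (\<Sum>l\<in>S - {p}. c l * w l x) / w p x"
    let ?c = "\<lambda>l. if l = p then t else c l"
    have sum: "(\<Sum>l\<in>S. ?c l * w l j) = t * w p j + (\<Sum>l\<in>S - {p}. c l * w l j)" for j
      using p insert.prems by (subst sum.remove[of _ p]) (auto intro!: sum.cong)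
    have "(\<Sum>l\<in>S - {p}. c l * w' l j) = (\<Sum>l\<in>S - {p}. c l * w l j - (c l * w l x) * (w p j / w p x))" for j
      by (intro sum.cong refl) (simp add: w'_def right_diff_distrib)
    then have "(\<Sum>l\<in>S - {p}. c l * w' l j) = (\<Sum>l\<in>S - {p}. c l * w l j) + t * w p j" for j
      by (simp only: sum_subtractf sum_distrib_right[symmetric]) (simp add: t_def)
    then have "(\<Sum>l\<in>S. ?c l * w l j) = 0" if "j \<in> insert x X" for j
      using that c(2) p(2) unfolding sum by (auto simp: t_def add.commute)
    then show ?thesis using c(1) by (intro exI[of _ ?c]) auto
  qed
qed

text \<open>The vectors vanishing at \<open>x\<close> form a subspace determined by the other
  coordinates; if it is proper, one vector normalized at \<open>x\<close> and cleared at the other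
  pivots completes its basis. The pivots lie in \<open>X\<close>, so a caller can prescribe the
  coordinates from which they are taken.\<close>

lemma pivot_basis_exists:
  fixes V :: "(nat \<Rightarrow> 'k::field) set"
  assumes "finite X" "lsub V" "\<And>v. v \<in> V \<Longrightarrow> (\<forall>x\<in>X. v x = 0) \<Longrightarrow> v = (\<lambda>_. 0)"
  shows "\<exists>A\<subseteq>X. \<exists>E. pivot_basis V A E"
  using assms
proof (induction X arbitrary: V rule: finite_induct)
  case empty
  then have "V = {\<lambda>_. 0}" by (auto simp: lsub_def)
  then show ?case by (auto simp: pivot_basis_def)
next
  case (insert x X)
  define V' where "V' = {v\<in>V. v x = 0}"
  have "lsub V'" using insert.prems(1) by (auto simp: V'_def lsub_def)
  moreover have "v = (\<lambda>_. 0)" if "v \<in> V'" "\<forall>x\<in>X. v x = 0" for v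
    using that insert.prems(2)[of v] by (auto simp: V'_def)
  ultimately obtain A E where A: "A \<subseteq> X" "pivot_basis V' A E"
    using insert.IH by blast
  show ?case
  proof (cases "V' = V")
    case True
    then show ?thesis using A by blast
  next
    case False
    then obtain u where u: "u \<in> V" "u x \<noteq> 0" by (auto simp: V'_def)
    have E: "E a \<in> V" "E a x = 0" if "a \<in> A" for a using pivot_basisD(2)[OF A(2) that] by (auto simp: V'_def)
    have fin: "finite A" using pivot_basisD(1)[OF A(2)] .
    have xA: "x \<notin> A" using A insert by auto
    define w where "w i = (u i - (\<Sum>a\<in>A. u a * E a i)) / u x" for i
    have "(\<lambda>i. (\<Sum>a\<in>A. (- (u a / u x)) * E a i) + (1 / u x) * u i) \<in> V"
      by (rule lsubD[OF insert.prems(1) lsub_sum[OF insert.prems(1) fin] u(1)]) (rule E)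
    moreover have "(\<lambda>i. (\<Sum>a\<in>A. (- (u a / u x)) * E a i) + (1 / u x) * u i) = w"
      by (rule ext) (simp add: w_def diff_divide_distrib sum_divide_distrib sum_negf)
    ultimately have w: "w \<in> V" by simp
    have wx: "w x = 1" using u by (simp add: w_def E)
    have wa: "w b = 0" if "b \<in> A" for b
    proof -
      have "(\<Sum>a\<in>A. u a * E a b) = (\<Sum>a\<in>A. u a * (if a = b then 1 else 0))"
        using pivot_basisD(3)[OF A(2)] that by (intro sum.cong) auto
      also have "\<dots> = u b" using that fin by (simp add: if_distrib cong: if_cong)
      finally show ?thesis by (simp add: w_def)
    qed
    define E' where "E' = E(x := w)"
    have "pivot_basis V (insert x A) E'"
    proof (rule pivot_basisI)
      fix v i assume v: "v \<in> V"
      have "(\<lambda>i. v i + (- v x) * w i) \<in> V" using lsubD[OF insert.prems(1) v w] .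
      then have "(\<lambda>i. v i - v x * w i) \<in> V'" using wx by (simp add: V'_def)
      then have "v i - v x * w i = (\<Sum>a\<in>A. (v a - v x * w a) * E a i)"
        by (rule pivot_basisD(4)[OF A(2)])
      also have "\<dots> = (\<Sum>a\<in>A. v a * E' a i)"
        using xA by (intro sum.cong) (auto simp: E'_def wa)
      finally show "v i = (\<Sum>a\<in>insert x A. v a * E' a i)"
        using fin xA by (simp add: E'_def algebra_simps)
    next
      fix a b assume "a \<in> insert x A" "b \<in> insert x A"
      then show "E' a b = (if a = b then 1 else 0)"
        using pivot_basisD(3)[OF A(2)] xA wx wa E by (auto simp: E'_def)
    next
      fix a assume "a \<in> insert x A"
      then show "E' a \<in> V" using w E xA by (auto simp: E'_def)
    qed (use fin in simp)
    then show ?thesis using A(1) by blast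
  qed
qed

lemma pivot_basis_indep: "pivot_basis V A E \<Longrightarrow> indep A E"
  unfolding indep_def
proof (intro allI impI ballI)
  fix c a assume p: "pivot_basis V A E" and 0: "\<forall>i. (\<Sum>l\<in>A. c l * E l i) = 0" and a: "a \<in> A"
  have "(\<Sum>l\<in>A. c l * E l a) = (\<Sum>l\<in>A. c l * (if l = a then 1 else 0))"
    using pivot_basisD(3)[OF p] a by (intro sum.cong) auto
  also have "\<dots> = c a" using a pivot_basisD(1)[OF p] by (simp add: if_distrib cong: if_cong)
  finally show "c a = 0" using 0 by simp
qed

text \<open>A vector of \<open>V\<close> is determined by its values at the \<open>r\<close> pivots,
  so a relation between the values at the pivots is a relation between the vectors.\<close>

lemma indep_card_le:
  assumes "hasdim V r" "finite S" "\<And>l. l \<in> S \<Longrightarrow> w l \<in> V" "indep S w"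
  shows "card S \<le> r"
proof (rule ccontr)
  obtain A E where A: "pivot_basis V A E" "card A = r" using assms(1) by (rule hasdimE)
  have fin: "finite A" using A(1) by (rule pivot_basisD)
  assume "\<not> card S \<le> r"
  then obtain c where c: "\<exists>l\<in>S. c l \<noteq> 0" "\<forall>a\<in>A. (\<Sum>l\<in>S. c l * w l a) = 0"
    using homogeneous_system_solvable[OF fin assms(2), of w] A(2) by auto
  have "(\<Sum>l\<in>S. c l * w l i) = 0" for i
  proof -
    have "(\<Sum>l\<in>S. c l * w l i) = (\<Sum>l\<in>S. \<Sum>a\<in>A. c l * w l a * E a i)"
    proof (intro sum.cong refl)
      fix l assume "l \<in> S"
      then have "w l i = (\<Sum>a\<in>A. w l a * E a i)" using pivot_basisD(4)[OF A(1)] assms(3) by blast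
      then have "c l * w l i = c l * (\<Sum>a\<in>A. w l a * E a i)" by simp
      then show "c l * w l i = (\<Sum>a\<in>A. c l * w l a * E a i)"
        by (simp only: sum_distrib_left mult.assoc)
    qed
    also have "\<dots> = (\<Sum>a\<in>A. (\<Sum>l\<in>S. c l * w l a) * E a i)"
      by (subst sum.swap) (simp add: sum_distrib_right)
    finally show ?thesis using c(2) by simp
  qed
  then show False using assms(4) c(1) by (auto simp: indep_def)
qed

lemma hasdim_unique: "hasdim V r \<Longrightarrow> hasdim V s \<Longrightarrow> r = s"
proof -
  have "r \<le> s" if "hasdim V r" "hasdim V s" for r s
  proof -
    obtain A E where A: "pivot_basis V A E" "card A = r" by (rule hasdimE[OF \<open>hasdim V r\<close>])
    then show ?thesis
      using indep_card_le[OF that(2), of A E] pivot_basis_indep[OF A(1)] pivot_basisD[OF A(1)] A(2) by blast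
  qed
  then show "hasdim V r \<Longrightarrow> hasdim V s \<Longrightarrow> r = s" by (meson order_antisym)
qed

lemma hasdim_exists:
  assumes "lsub V" "finite X" "\<And>v. v \<in> V \<Longrightarrow> (\<forall>x\<in>X. v x = 0) \<Longrightarrow> v = (\<lambda>_. 0)"
  obtains r where "r \<le> card X" "hasdim V r"
proof -
  obtain A E where "A \<subseteq> X" "pivot_basis V A E" using pivot_basis_exists[OF assms(2,1,3)] by blast
  then show ?thesis using that[of "card A"] assms(2) by (auto simp: hasdim_def card_mono)
qed

lemma hasdim_spn_le:
  assumes "hasdim (spn S w) r" "finite S" shows "r \<le> card S"
proof (rule ccontr)
  obtain A E where A: "pivot_basis (spn S w) A E" "card A = r" using assms(1) by (rule hasdimE)
  have fin: "finite A" using A(1) by (rule pivot_basisD)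
  have "\<forall>a\<in>A. \<exists>c. E a = (\<lambda>i. \<Sum>l\<in>S. c l * w l i)"
    using pivot_basisD(2)[OF A(1)] by (auto simp: spn_def)
  then obtain M where M: "\<And>a. a \<in> A \<Longrightarrow> E a = (\<lambda>i. \<Sum>l\<in>S. M a l * w l i)" by metis
  assume "\<not> r \<le> card S"
  then obtain c where c: "\<exists>a\<in>A. c a \<noteq> 0" "\<forall>l\<in>S. (\<Sum>a\<in>A. c a * M a l) = 0"
    using homogeneous_system_solvable[OF assms(2) fin, of M] A(2) by auto
  have "(\<Sum>a\<in>A. c a * E a i) = 0" for i
  proof -
    have "(\<Sum>a\<in>A. c a * E a i) = (\<Sum>a\<in>A. \<Sum>l\<in>S. c a * M a l * w l i)"
      by (intro sum.cong refl) (simp add: M sum_distrib_left mult.assoc)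
    also have "\<dots> = (\<Sum>l\<in>S. (\<Sum>a\<in>A. c a * M a l) * w l i)"
      by (subst sum.swap) (simp add: sum_distrib_right)
    finally show ?thesis using c(2) by simp
  qed
  then show False using pivot_basis_indep[OF A(1)] c(1) unfolding indep_def by blast
qed

lemma hasdim_spn_exists:
  assumes "finite S" "finite X" "\<And>l i. l \<in> S \<Longrightarrow> i \<notin> X \<Longrightarrow> w l i = 0"
  obtains r where "hasdim (spn S w) r"
proof -
  have "v = (\<lambda>_. 0)" if v: "v \<in> spn S w" "\<forall>x\<in>X. v x = 0" for v
  proof
    fix i
    show "v i = 0"
    proof (cases "i \<in> X")
      case False
      then show ?thesis using v(1) assms(3) by (auto simp: spn_def)
    qed (use v in auto)
  qed
  then show ?thesis using hasdim_exists[OF lsub_spn assms(2), of S w] that by blast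
qed

lemma hasdim_spn_indep:
  assumes "finite S" "finite X" "\<And>l i. l \<in> S \<Longrightarrow> i \<notin> X \<Longrightarrow> w l i = 0" "indep S w"
  shows "hasdim (spn S w) (card S)"
proof -
  obtain r where r: "hasdim (spn S w) r" by (rule hasdim_spn_exists[of S X w]) (use assms in blast)+
  then have "r \<le> card S" using hasdim_spn_le assms(1) by blast
  moreover have "card S \<le> r"
    using indep_card_le[OF r assms(1) _ assms(4)] in_spn[OF assms(1)] by blast
  ultimately show ?thesis using r by simp
qed

lemma indep_if_hasdim:
  assumes "hasdim (spn S w) (card S)" "finite S" shows "indep S w"
proof (rule ccontr)
  assume "\<not> indep S w"
  then obtain c p where c: "\<And>i. (\<Sum>l\<in>S. c l * w l i) = 0" "p \<in> S" "c p \<noteq> 0" by (auto simp: indep_def)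
  have wp: "w p = (\<lambda>i. \<Sum>l\<in>S - {p}. (- c l / c p) * w l i)"
  proof
    fix i
    have "c p * w p i + (\<Sum>l\<in>S - {p}. c l * w l i) = 0"
      using c(1)[of i] c(2) assms(2) by (simp add: sum.remove)
    then have "w p i = - (\<Sum>l\<in>S - {p}. c l * w l i) / c p" using c(3)
      by (simp add: field_simps add_eq_0_iff)
    then show "w p i = (\<Sum>l\<in>S - {p}. (- c l / c p) * w l i)"
      by (simp add: sum_divide_distrib sum_negf)
  qed
  have "spn S w \<subseteq> spn (S - {p}) w"
  proof (rule spn_subset[OF lsub_spn assms(2)])
    fix l assume "l \<in> S"
    then show "w l \<in> spn (S - {p}) w"
      using in_spn[of "S - {p}" l w] assms(2) spnI[OF wp] by (cases "l = p") auto
  qed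
  moreover have "spn (S - {p}) w \<subseteq> spn S w"
    using assms(2) by (intro spn_subset[OF lsub_spn]) (auto intro: in_spn)
  ultimately have "hasdim (spn (S - {p}) w) (card S)" using assms(1) by simp
  then have "card S \<le> card (S - {p})" using hasdim_spn_le assms(2) by blast
  then show False using c(2) assms(2) by (metis card_Diff1_less not_less)
qed

lemma hasdim_spanned:
  assumes V: "hasdim V r" "lsub V" and S: "finite S" "card S = r" "indep S w" "\<And>l. l \<in> S \<Longrightarrow> w l \<in> V"
  shows "spn S w = V"
proof
  show "spn S w \<subseteq> V" using spn_subset[OF V(2) S(1)] S(4) by blast
  show "V \<subseteq> spn S w"
  proof
    fix v assume v: "v \<in> V"
    \<comment> \<open>The index \<open>None\<close> adds \<open>v\<close> to the family, which then
      has more than \<open>r\<close> members and is dependent.\<close>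
    define w' where "w' k = (case k of None \<Rightarrow> v | Some l \<Rightarrow> w l)" for k
    define T where "T = insert None (Some ` S)"
    have "card T = Suc r" using S(1,2) by (simp add: T_def card_image)
    then have "\<not> indep T w'"
    proof -
      have "w' k \<in> V" if "k \<in> T" for k using that S(4) v by (auto simp: T_def w'_def)
      moreover have "finite T" using S(1) by (simp add: T_def)
      ultimately show ?thesis using indep_card_le[OF V(1), of T w'] \<open>card T = Suc r\<close> by auto
    qed
    then obtain c p where c: "\<And>i. (\<Sum>l\<in>T. c l * w' l i) = 0" "p \<in> T" "c p \<noteq> 0" by (auto simp: indep_def)
    have eq: "c None * v i + (\<Sum>l\<in>S. c (Some l) * w l i) = 0" for i
      using c(1)[of i] S(1) by (simp add: T_def w'_def sum.reindex)
    have n: "c None \<noteq> 0"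
    proof
      assume "c None = 0"
      then have "\<forall>i. (\<Sum>l\<in>S. c (Some l) * w l i) = 0" using eq by simp
      then have "\<forall>l\<in>S. c (Some l) = 0"
        using spec[OF S(3)[unfolded indep_def], of "\<lambda>l. c (Some l)"] by (rule rev_mp)
      then show False using c(2,3) \<open>c None = 0\<close> by (auto simp: T_def)
    qed
    have "v = (\<lambda>i. \<Sum>l\<in>S. (- c (Some l) / c None) * w l i)"
    proof
      fix i
      have "v i = - (\<Sum>l\<in>S. c (Some l) * w l i) / c None"
        using eq[of i] n by (simp add: field_simps add_eq_0_iff)
      then show "v i = (\<Sum>l\<in>S. (- c (Some l) / c None) * w l i)"
        by (simp add: sum_divide_distrib sum_negf)
    qed
    then show "v \<in> spn S w" by (rule spnI)
  qed
qed

lemma hasdim_mono: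
  assumes "hasdim V r" "hasdim W s" "V \<subseteq> W" shows "r \<le> s"
proof -
  obtain A E where A: "pivot_basis V A E" "card A = r" using assms(1) by (rule hasdimE)
  then show ?thesis
    using indep_card_le[OF assms(2), of A E] pivot_basis_indep[OF A(1)] pivot_basisD[OF A(1)] A(2) assms(3) by blast
qed

lemma hasdim_eq:
  assumes "hasdim V r" "hasdim W r" "V \<subseteq> W" "lsub V" "lsub W" shows "V = W"
proof -
  obtain A E where A: "pivot_basis V A E" "card A = r" using assms(1) by (rule hasdimE)
  show ?thesis
    using hasdim_spanned[OF assms(2,5) pivot_basisD(1)[OF A(1)] A(2) pivot_basis_indep[OF A(1)]]
      hasdim_spanned[OF assms(1,4) pivot_basisD(1)[OF A(1)] A(2) pivot_basis_indep[OF A(1)]]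
      assms(3) pivot_basisD(2)[OF A(1)] by blast
qed

text \<open>Identifies a space of solutions with a span: injectivity on the coordinates
  \<open>X\<close> bounds the dimension from above, the independent family bounds it from
  below.\<close>

lemma hasdim_full:
  assumes U: "lsub U" "finite X" "\<And>v. v \<in> U \<Longrightarrow> (\<forall>x\<in>X. v x = 0) \<Longrightarrow> v = (\<lambda>_. 0)"
    and S: "finite S" "card X \<le> card S" "indep S w" "\<And>l. l \<in> S \<Longrightarrow> w l \<in> U"
  shows "spn S w = U" "hasdim U (card S)"
proof -
  obtain r where r: "r \<le> card X" "hasdim U r" using hasdim_exists[OF U] by blast
  moreover have "card S \<le> r" using indep_card_le[OF r(2) S(1,4,3)] by simp
  ultimately show "hasdim U (card S)" using S(2) by (metis le_antisym le_trans)
  then show "spn S w = U" by (rule hasdim_spanned[OF _ U(1) S(1) refl S(3,4)])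
qed

text \<open>Rank-nullity for the restriction of functions to a set \<open>X\<close> of coordinates.\<close>

lemma hasdim_restrict:
  fixes T :: "(nat \<Rightarrow> 'k::field) set"
  assumes T: "lsub T" and D: "hasdim ((\<lambda>v i. if i \<in> X then v i else 0) ` T) r"
    and K: "hasdim {v\<in>T. \<forall>i\<in>X. v i = 0} s"
  shows "hasdim T (r + s)"
proof -
  let ?\<pi> = "\<lambda>v i. if i \<in> X then v i else (0 :: 'k)"
  obtain A E where A: "pivot_basis (?\<pi> ` T) A E" "card A = r" using D by (rule hasdimE)
  obtain B F where B: "pivot_basis {v\<in>T. \<forall>i\<in>X. v i = 0} B F" "card B = s" using K by (rule hasdimE)
  note fin = pivot_basisD(1)[OF A(1)] pivot_basisD(1)[OF B(1)]
  have "\<forall>a\<in>A. \<exists>v\<in>T. E a = ?\<pi> v" using pivot_basisD(2)[OF A(1)] by blast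
  then obtain L where L: "\<And>a. a \<in> A \<Longrightarrow> L a \<in> T" "\<And>a. a \<in> A \<Longrightarrow> E a = ?\<pi> (L a)" by metis
  have AX: "a \<in> X" if "a \<in> A" for a
  proof (rule ccontr)
    assume "a \<notin> X"
    then have "E a a = 0" using L(2)[OF that] by simp
    then show False using pivot_basisD(3)[OF A(1) that that] by simp
  qed
  have F: "F b \<in> T" "\<And>i. i \<in> X \<Longrightarrow> F b i = 0" "\<And>b'. b' \<in> B \<Longrightarrow> F b b' = (if b = b' then 1 else 0)"
    if "b \<in> B" for b using pivot_basisD(2,3)[OF B(1)] that by blast+
  have BX: "b \<notin> X" if "b \<in> B" for b
    using F(2)[OF that, of b] F(3)[OF that that] by auto
  \<comment> \<open>Each lift is corrected by the kernel so that it vanishes at the pivots of the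
    kernel; then both groups together form a reduced basis.\<close>
  define L' where "L' a = (\<lambda>i. L a i - (\<Sum>b\<in>B. L a b * F b i))" for a
  have L'T: "L' a \<in> T" if "a \<in> A" for a
  proof -
    have "(\<lambda>i. L a i + (- 1) * (\<Sum>b\<in>B. L a b * F b i)) \<in> T"
      using lsubD[OF T L(1)[OF that] lsub_sum[OF T fin(2)]] F(1) by blast
    then show ?thesis by (simp add: L'_def)
  qed
  have L'X: "L' a i = E a i" if "a \<in> A" "i \<in> X" for a i
    using that F(2) L(2)[OF that(1)] by (simp add: L'_def)
  have L'B: "L' a c = 0" if "a \<in> A" "c \<in> B" for a c
  proof -
    have "(\<Sum>b\<in>B. L a b * F b c) = (\<Sum>b\<in>B. L a b * (if b = c then 1 else 0))"
      using that F(3) by (intro sum.cong) auto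
    also have "\<dots> = L a c" using that fin by (simp add: if_distrib cong: if_cong)
    finally show ?thesis by (simp add: L'_def)
  qed
  define G where "G c = (if c \<in> A then L' c else F c)" for c
  have AB: "A \<inter> B = {}" using AX BX by auto
  have "pivot_basis T (A \<union> B) G"
  proof (rule pivot_basisI)
    fix c d assume cd: "c \<in> A \<union> B" "d \<in> A \<union> B"
    have "E c d = (if c = d then 1 else 0)" if "c \<in> A" "d \<in> A" using pivot_basisD(3)[OF A(1) that] .
    then show "G c d = (if c = d then 1 else 0)"
      using cd AB F AX L'X L'B unfolding G_def by (smt (verit) Un_iff disjoint_iff)
  next
    fix v i assume v: "v \<in> T"
    have "(\<lambda>i. v i + (- 1) * (\<Sum>a\<in>A. v a * L' a i)) \<in> T"
      using lsubD[OF T v lsub_sum[OF T fin(1)]] L'T by blast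
    moreover have "v j - (\<Sum>a\<in>A. v a * L' a j) = 0" if j: "j \<in> X" for j
    proof -
      have "?\<pi> v j = (\<Sum>a\<in>A. ?\<pi> v a * E a j)" using v by (intro pivot_basisD(4)[OF A(1)]) blast
      also have "\<dots> = (\<Sum>a\<in>A. v a * L' a j)" using AX L'X j by (intro sum.cong) auto
      finally show ?thesis using j by simp
    qed
    ultimately have "(\<lambda>i. v i - (\<Sum>a\<in>A. v a * L' a i)) \<in> {v\<in>T. \<forall>i\<in>X. v i = 0}" by simp
    then have "v i - (\<Sum>a\<in>A. v a * L' a i) = (\<Sum>b\<in>B. (v b - (\<Sum>a\<in>A. v a * L' a b)) * F b i)"
      by (rule pivot_basisD(4)[OF B(1)])
    also have "\<dots> = (\<Sum>b\<in>B. v b * F b i)" using L'B by (intro sum.cong) auto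
    finally have "v i = (\<Sum>a\<in>A. v a * L' a i) + (\<Sum>b\<in>B. v b * F b i)" by (simp add: algebra_simps)
    also have "\<dots> = (\<Sum>a\<in>A. v a * G a i) + (\<Sum>b\<in>B. v b * G b i)"
      using AB by (intro arg_cong2[of _ _ _ _ "(+)"] sum.cong) (auto simp: G_def)
    finally show "v i = (\<Sum>c\<in>A \<union> B. v c * G c i)" using AB fin by (simp add: sum.union_disjoint)
  qed (use fin L'T F(1) in \<open>auto simp: G_def\<close>)
  moreover have "card (A \<union> B) = r + s" using AB fin A(2) B(2) by (simp add: card_Un_disjoint)
  ultimately show ?thesis by (auto simp: hasdim_def)
qed

text \<open>Injectivity makes every coordinate in \<open>X\<close> a pivot of the row space, so the
  reduced basis consists of unit vectors, and their expressions by the rows form the left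
  inverse.\<close>

lemma left_inverse_exists:
  fixes r :: "'i \<Rightarrow> nat \<Rightarrow> 'k::field"
  assumes I: "finite I" and X: "finite X"
    and inj: "\<And>u x. (\<And>i. i \<in> I \<Longrightarrow> (\<Sum>x\<in>X. r i x * u x) = 0) \<Longrightarrow> x \<in> X \<Longrightarrow> u x = 0"
  obtains C where "\<And>x y. x \<in> X \<Longrightarrow> y \<in> X \<Longrightarrow> (\<Sum>i\<in>I. C x i * r i y) = (if x = y then 1 else 0)"
proof -
  define w where "w i x = (if x \<in> X then r i x else 0)" for i x
  have "v = (\<lambda>_. 0)" if v: "v \<in> spn I w" "\<forall>x\<in>X. v x = 0" for v
  proof
    fix x show "v x = 0" using v by (cases "x \<in> X") (auto simp: spn_def w_def)
  qed
  then obtain A E where A: "A \<subseteq> X" "pivot_basis (spn I w) A E"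
    using pivot_basis_exists[OF X lsub_spn] by blast
  note fin = pivot_basisD(1)[OF A(2)]
  have "X \<subseteq> A"
  proof (rule ccontr)
    assume "\<not> X \<subseteq> A"
    then obtain p where p: "p \<in> X" "p \<notin> A" by auto
    \<comment> \<open>If \<open>p\<close> is not a pivot, the reduced basis yields this nonzero
      vector, which all rows annihilate.\<close>
    define u where "u x = (if x = p then 1 else if x \<in> A then - E x p else 0)" for x
    have "(\<Sum>x\<in>X. r i x * u x) = 0" if i: "i \<in> I" for i
    proof -
      have "(\<Sum>x\<in>X. r i x * u x) = (\<Sum>x\<in>insert p A. w i x * u x)"
        using X A(1) p by (intro sum.mono_neutral_cong_right) (auto simp: w_def u_def)
      also have "\<dots> = w i p - (\<Sum>x\<in>A. w i x * E x p)"
        using fin p by (simp add: u_def sum_negf[symmetric]) (intro sum.cong, auto)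
      also have "\<dots> = 0" using pivot_basisD(4)[OF A(2) in_spn[OF I i], of p] by simp
      finally show ?thesis .
    qed
    then have "u p = 0" using inj p(1) by blast
    then show False by (simp add: u_def)
  qed
  then have XA: "A = X" using A(1) by auto
  have "\<forall>x\<in>X. \<exists>c. E x = (\<lambda>y. \<Sum>i\<in>I. c i * w i y)" using pivot_basisD(2)[OF A(2)] by (auto simp: XA spn_def)
  then obtain C where C: "\<And>x. x \<in> X \<Longrightarrow> E x = (\<lambda>y. \<Sum>i\<in>I. C x i * w i y)" by metis
  show ?thesis
  proof (rule that[of C])
    fix x y assume xy: "x \<in> X" "y \<in> X"
    then have "(\<Sum>i\<in>I. C x i * r i y) = E x y" using C by (simp add: w_def)
    then show "(\<Sum>i\<in>I. C x i * r i y) = (if x = y then 1 else 0)"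
      using pivot_basisD(3)[OF A(2)] xy by (simp add: XA)
  qed
qed

subsection \<open>Ranks of matrices\<close>

definition colf :: "'k::field mat \<Rightarrow> nat \<Rightarrow> nat \<Rightarrow> 'k" where
  "colf A l i = (if i < dim_row A then A $$ (i, l) else 0)"

definition vecf :: "'k::field vec \<Rightarrow> nat \<Rightarrow> 'k" where
  "vecf v i = (if i < dim_vec v then v $ i else 0)"

lemma lin_indpt_iff_indep:
  assumes S: "finite S" "S \<subseteq> carrier_vec n"
  shows "module.lin_dep class_ring (module_vec TYPE('k::field) n) S \<longleftrightarrow> \<not> indep S vecf"
proof -
  interpret vec_space "TYPE('k)" n .
  have lc: "lincomb c S $ i = (\<Sum>v\<in>S. c v * vecf v i)" if "i < n" for c i
    using S that by (subst lincomb_index) (auto simp: vecf_def intro!: sum.cong)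
  have iff: "lincomb c S = 0\<^sub>v n \<longleftrightarrow> (\<forall>i. (\<Sum>v\<in>S. c v * vecf v i) = 0)" for c
  proof
    assume 0: "lincomb c S = 0\<^sub>v n"
    show "\<forall>i. (\<Sum>v\<in>S. c v * vecf v i) = 0"
    proof
      fix i show "(\<Sum>v\<in>S. c v * vecf v i) = 0"
        using lc[of i c] 0 S(2) by (cases "i < n") (auto simp: vecf_def intro!: sum.neutral)
    qed
  next
    assume "\<forall>i. (\<Sum>v\<in>S. c v * vecf v i) = 0"
    then show "lincomb c S = 0\<^sub>v n" using lc lincomb_dim[OF S] by (intro eq_vecI) auto
  qed
  have "lin_dep S \<longleftrightarrow> (\<exists>c v. lincomb c S = 0\<^sub>v n \<and> v \<in> S \<and> c v \<noteq> 0)"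
  proof
    assume "lin_dep S"
    then show "\<exists>c v. lincomb c S = 0\<^sub>v n \<and> v \<in> S \<and> c v \<noteq> 0"
      using finite_lin_dep[OF S(1) _ S(2)] by auto
  next
    assume "\<exists>c v. lincomb c S = 0\<^sub>v n \<and> v \<in> S \<and> c v \<noteq> 0"
    then obtain c v where "lincomb c S = 0\<^sub>v n" "v \<in> S" "c v \<noteq> 0" by blast
    then show "lin_dep S" by (intro lin_dep_crit[where A = S and a = c and v = v]) (use S in auto)
  qed
  then show ?thesis using iff by (auto simp: indep_def)
qed

text \<open>The rank is the size of a maximal independent set of columns, and such a set spans all
  the columns.\<close>

lemma hasdim_rank: "hasdim (spn {..<dim_col A} (colf A)) (vec_space.rank (dim_row A) A)"
proof -
  interpret vec_space "TYPE('a)" "dim_row A" .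
  have cols: "set (cols A) \<subseteq> carrier_vec (dim_row A)" using cols_dim by blast
  have "lin_indpt {}" by (simp add: lin_dep_def)
  then obtain S where S: "maximal S (\<lambda>T. T \<subseteq> set (cols A) \<and> lin_indpt T)"
    using maximal_exists_superset[of "set (cols A)" "\<lambda>T. T \<subseteq> set (cols A) \<and> lin_indpt T" "{}"] by auto
  then have Ss: "S \<subseteq> set (cols A)" "lin_indpt S" by (auto simp: maximal_def)
  then have fin: "finite S" using finite_subset by blast
  have rank: "rank A = card S" by (rule rank_card_indpt[OF carrier_matI[OF refl refl] S])
  have iS: "indep S vecf" using Ss lin_indpt_iff_indep[OF fin] cols by blast
  have sup: "vecf v i = 0" if "v \<in> S" "i \<notin> {..<dim_row A}" for v i
    using carrier_vecD[OF subsetD[OF subset_trans[OF Ss(1) cols] that(1)]] that(2) by (simp add: vecf_def)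
  have colf: "colf A l = vecf (col A l)" if "l < dim_col A" for l
    using that by (intro ext) (simp add: colf_def vecf_def)
  have "spn {..<dim_col A} (colf A) = spn S vecf"
  proof
    show "spn {..<dim_col A} (colf A) \<subseteq> spn S vecf"
    proof (rule spn_subset[OF lsub_spn], simp)
      fix l assume l: "l \<in> {..<dim_col A}"
      show "colf A l \<in> spn S vecf"
      proof (cases "col A l \<in> S")
        case True
        then show ?thesis using in_spn[OF fin, of _ vecf] colf l by simp
      next
        case False
        let ?T = "insert (col A l) S"
        have T: "?T \<subseteq> set (cols A)" using l Ss by (auto simp: cols_def)
        then have "\<not> lin_indpt ?T" using S False unfolding maximal_def by blast
        then have "\<not> indep ?T vecf" using lin_indpt_iff_indep[of ?T] fin T cols by blast
        then obtain c p where c: "\<And>i. (\<Sum>v\<in>?T. c v * vecf v i) = 0" "p \<in> ?T" "c p \<noteq> 0"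
          by (auto simp: indep_def)
        have eq: "c (col A l) * vecf (col A l) i + (\<Sum>v\<in>S. c v * vecf v i) = 0" for i
          using c(1)[of i] fin False by simp
        have n: "c (col A l) \<noteq> 0"
        proof
          assume 0: "c (col A l) = 0"
          then have "\<forall>v\<in>S. c v = 0" using eq iS by (auto simp: indep_def)
          then show False using c(2,3) 0 by auto
        qed
        have "vecf (col A l) = (\<lambda>i. \<Sum>v\<in>S. (- c v / c (col A l)) * vecf v i)"
        proof
          fix i
          have "vecf (col A l) i = - (\<Sum>v\<in>S. c v * vecf v i) / c (col A l)"
            using eq[of i] n by (simp add: field_simps add_eq_0_iff)
          then show "vecf (col A l) i = (\<Sum>v\<in>S. (- c v / c (col A l)) * vecf v i)"
            by (simp add: sum_divide_distrib sum_negf)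
        qed
        then have "vecf (col A l) \<in> spn S vecf" by (rule spnI)
        then show ?thesis using colf l by simp
      qed
    qed
    show "spn S vecf \<subseteq> spn {..<dim_col A} (colf A)"
    proof (rule spn_subset[OF lsub_spn fin])
      fix v assume "v \<in> S"
      then obtain l where "l < dim_col A" "v = col A l" using Ss(1) by (auto simp: cols_def)
      then show "vecf v \<in> spn {..<dim_col A} (colf A)"
        using in_spn[of "{..<dim_col A}" l "colf A"] colf by simp
    qed
  qed
  then show ?thesis
    using hasdim_spn_indep[OF fin finite_lessThan sup iS] rank by simp
qed

text \<open>Lets the dimension of \<gg>(0), which is defined through carriers, be computed from a
  pivot basis of the corresponding functions.\<close>

lemma dim_subspace_eq:
  fixes W :: "'k::field vec set"
  assumes W: "W \<subseteq> carrier_vec n" "lsub (vecf ` W)" and d: "hasdim (vecf ` W) r"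
  shows "vectorspace.dim class_ring (module_vec TYPE('k) n \<lparr>carrier := W\<rparr>) = r"
proof -
  interpret vec_space "TYPE('k)" n .
  have inj: "v = w" if "vecf v = vecf w" "v \<in> carrier_vec n" "w \<in> carrier_vec n" for v w :: "'k vec"
  proof (rule eq_vecI)
    fix i assume "i < dim_vec w"
    moreover have "vecf v i = vecf w i" by (simp only: that(1))
    ultimately show "v $ i = w $ i"
      using carrier_vecD[OF that(2)] carrier_vecD[OF that(3)] by (simp add: vecf_def)
  qed (use that in auto)
  have lin: "v + c \<cdot>\<^sub>v w \<in> W" if "v \<in> W" "w \<in> W" for v w c
  proof -
    have "vecf v \<in> vecf ` W" "vecf w \<in> vecf ` W" using that by auto
    then have "(\<lambda>i. vecf v i + c * vecf w i) \<in> vecf ` W" using lsubD[OF W(2)] by blast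
    moreover have "(\<lambda>i. vecf v i + c * vecf w i) = vecf (v + c \<cdot>\<^sub>v w)"
      using carrier_vecD[OF subsetD[OF W(1) that(1)]] carrier_vecD[OF subsetD[OF W(1) that(2)]]
      by (simp add: vecf_def fun_eq_iff)
    ultimately obtain u where "u \<in> W" "vecf (v + c \<cdot>\<^sub>v w) = vecf u" by auto
    then show ?thesis using inj[of "v + c \<cdot>\<^sub>v w" u] that W(1) by (metis add_carrier_vec smult_carrier_vec subsetD)
  qed
  have "(\<lambda>_. 0) \<in> vecf ` W" using W(2) by (simp add: lsub_def)
  then obtain z where z: "z \<in> W" "vecf z = (\<lambda>_. 0)" by auto
  have "z = 0\<^sub>v n" by (rule inj) (use z W(1) in \<open>auto simp: vecf_def fun_eq_iff\<close>)
  then have 0: "0\<^sub>v n \<in> W" using z by simp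
  have sm: "submodule class_ring W V"
  proof (rule submodule.intro)
    fix v w assume vw: "v \<in> W" "w \<in> W"
    then show "v \<oplus>\<^bsub>V\<^esub> w \<in> W" using lin[of v w 1] W(1) by (auto dest!: subsetD)
  next
    fix c :: 'k and v assume "c \<in> carrier class_ring" "v \<in> W"
    then show "c \<odot>\<^bsub>V\<^esub> v \<in> W" using lin[OF 0, of v c] W(1) by (auto dest!: subsetD)
  qed (use W(1) 0 module_axioms in \<open>auto simp: module_vec_def\<close>)
  then have sub: "subspace class_ring W V" by (simp add: subspace_def vectorspace_axioms)
  obtain A E where A: "pivot_basis (vecf ` W) A E" "card A = r" using d by (rule hasdimE)
  then have finA: "finite A" and "\<forall>a\<in>A. \<exists>v\<in>W. E a = vecf v" using pivot_basisD(1,2) by blast+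
  then obtain e where e: "\<And>a. a \<in> A \<Longrightarrow> e a \<in> W" "\<And>a. a \<in> A \<Longrightarrow> E a = vecf (e a)" by metis
  have inje: "inj_on e A"
  proof (rule inj_onI)
    fix a b assume ab: "a \<in> A" "b \<in> A" "e a = e b"
    then have "E a a = E b a" using e by simp
    then show "a = b" using pivot_basisD(3)[OF A(1)] ab by (auto split: if_splits)
  qed
  let ?S = "e ` A"
  have SW: "?S \<subseteq> W" "finite ?S" "?S \<subseteq> carrier_vec n" using e finA W(1) by auto
  have "indep ?S vecf" unfolding indep_def
  proof (intro allI impI)
    fix c assume 0: "\<forall>i. (\<Sum>v\<in>?S. c v * vecf v i) = 0"
    have "\<forall>i. (\<Sum>a\<in>A. c (e a) * E a i) = 0"
      using 0 by (simp add: sum.reindex[OF inje] e(2) cong: sum.cong)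
    then have "\<forall>a\<in>A. c (e a) = 0"
      using spec[OF pivot_basis_indep[OF A(1), unfolded indep_def], of "\<lambda>a. c (e a)"] by (rule rev_mp)
    then show "\<forall>l\<in>?S. c l = 0" by blast
  qed
  then have li: "lin_indpt ?S" using lin_indpt_iff_indep[OF SW(2,3)] by simp
  have sp: "span ?S = W"
  proof
    show "span ?S \<subseteq> W" using span_is_subset[OF SW(1) sm] .
    show "W \<subseteq> span ?S"
    proof
      fix v assume v: "v \<in> W"
      define c where "c x = vecf v (inv_into A e x)" for x
      have "lincomb c ?S = v"
      proof (rule eq_vecI)
        fix i assume "i < dim_vec v"
        then have i: "i < n" using v W(1) by auto
        have "lincomb c ?S $ i = (\<Sum>x\<in>?S. c x * x $ i)" using lincomb_index[OF i SW(3)] .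
        also have "\<dots> = (\<Sum>a\<in>A. vecf v a * E a i)"
          unfolding sum.reindex[OF inje] using inje i e SW(1) W(1)
          by (intro sum.cong) (auto simp: c_def vecf_def dest!: subsetD)
        also have "\<dots> = vecf v i" using v by (intro pivot_basisD(4)[OF A(1), symmetric]) blast
        finally show "lincomb c ?S $ i = v $ i" using i v W(1) by (auto simp: vecf_def)
      qed (use lincomb_dim[OF SW(2,3)] v W(1) in auto)
      then show "v \<in> span ?S" using SW(2,3) by (auto simp: span_def intro!: exI[of _ c] exI[of _ ?S])
    qed
  qed
  interpret W: vectorspace class_ring "V\<lparr>carrier := W\<rparr>" by (rule subspace_is_vs[OF sub])
  have "W.basis ?S" unfolding W.basis_def
    using span_li_not_depend[OF SW(1) sm] li sp SW(1) by simp
  then have "W.dim = card ?S" using SW(2) W.dim_basis by blast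
  then show ?thesis using A(2) card_image[OF inje] by simp
qed

section \<open>Criteria for independence, and the rank by rows\<close>

lemma indep_if_delta:
  assumes "finite S" "\<And>b c. b \<in> S \<Longrightarrow> c \<in> S \<Longrightarrow> w b (\<kappa> c) = (if b = c then 1 else 0)"
  shows "indep S w"
  unfolding indep_def
proof (intro allI impI ballI)
  fix x c assume 0: "\<forall>i. (\<Sum>l\<in>S. x l * w l i) = 0" and c: "c \<in> S"
  have "(\<Sum>l\<in>S. x l * w l (\<kappa> c)) = (\<Sum>l\<in>S. if c = l then x l else 0)"
    using assms(2) c by (intro sum.cong refl) simp
  then show "x c = 0" using spec[OF 0, of "\<kappa> c"] c assms(1) by simp
qed

text \<open>Block-triangular: on \<open>Y\<close> the first family vanishes, which forces the
  coefficients of the second to be zero; then only the first family remains.\<close>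

lemma indep_Plus:
  assumes fin: "finite S" "finite T" and S: "indep S (\<lambda>l. w (Inl l))"
    and T: "indep T (\<lambda>l i. if i \<in> Y then w (Inr l) i else 0)" and 0: "\<And>l i. l \<in> S \<Longrightarrow> i \<in> Y \<Longrightarrow> w (Inl l) i = 0"
  shows "indep (S <+> T) w"
  unfolding indep_def
proof (intro allI impI)
  fix x assume x: "\<forall>i. (\<Sum>l\<in>S <+> T. x l * w l i) = 0"
  have eq: "(\<Sum>l\<in>S <+> T. x l * w l i) = (\<Sum>l\<in>S. x (Inl l) * w (Inl l) i) + (\<Sum>l\<in>T. x (Inr l) * w (Inr l) i)" for i
    by (simp add: sum.Plus[OF fin])
  have "(\<Sum>l\<in>T. x (Inr l) * (if i \<in> Y then w (Inr l) i else 0)) = 0" for i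
    using spec[OF x, of i] eq[of i] 0 by (cases "i \<in> Y") simp_all
  then have "\<forall>i. (\<Sum>l\<in>T. x (Inr l) * (if i \<in> Y then w (Inr l) i else 0)) = 0" by blast
  then have y: "\<forall>l\<in>T. x (Inr l) = 0" using spec[OF T[unfolded indep_def], of "\<lambda>l. x (Inr l)"] by (rule rev_mp)
  have "\<forall>i. (\<Sum>l\<in>S. x (Inl l) * w (Inl l) i) = 0" using x y by (simp add: eq)
  then have "\<forall>l\<in>S. x (Inl l) = 0" using spec[OF S[unfolded indep_def], of "\<lambda>l. x (Inl l)"] by (rule rev_mp)
  then show "\<forall>l\<in>S <+> T. x l = 0" using y by auto
qed

lemma indep_cong: assumes "\<And>l. l \<in> S \<Longrightarrow> w l = w' l" "indep S w" shows "indep S w'"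
proof -
  have "(\<Sum>l\<in>S. c l * w l i) = (\<Sum>l\<in>S. c l * w' l i)" for c i using assms(1) by (intro sum.cong) auto
  then show ?thesis using assms(2) by (simp only: indep_def)
qed

lemma indep_reindex:
  assumes "bij_betw e T S" "indep S w" shows "indep T (\<lambda>i. w (e i))"
  unfolding indep_def
proof (intro allI impI ballI)
  fix x l assume x: "\<forall>i. (\<Sum>l\<in>T. x l * w (e l) i) = 0" and l: "l \<in> T"
  define y where "y l = x (inv_into T e l)" for l
  have ye: "y (e l) = x l" if "l \<in> T" for l using that assms(1) by (simp add: y_def bij_betw_def)
  have "(\<Sum>l\<in>S. y l * w l i) = (\<Sum>l\<in>T. x l * w (e l) i)" for i
    by (subst sum.reindex_bij_betw[OF assms(1), symmetric]) (simp add: ye)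
  then have "\<forall>i. (\<Sum>l\<in>S. y l * w l i) = 0" using x by simp
  then have "\<forall>l\<in>S. y l = 0" using spec[OF assms(2)[unfolded indep_def], of y] by (rule rev_mp)
  moreover have "e l \<in> S" using l assms(1) by (auto simp: bij_betw_def)
  ultimately show "x l = 0" using ye[OF l] by simp
qed

lemma indep_subset:
  assumes "finite S" "T \<subseteq> S" "indep S w" shows "indep T w"
  unfolding indep_def
proof (intro allI impI ballI)
  fix c l assume 0: "\<forall>i. (\<Sum>l\<in>T. c l * w l i) = 0" and l: "l \<in> T"
  have "(\<Sum>l\<in>S. (if l \<in> T then c l else 0) * w l i) = (\<Sum>l\<in>T. c l * w l i)" for i
    using assms(1,2) by (intro sum.mono_neutral_cong_right) auto
  then have "\<forall>i. (\<Sum>l\<in>S. (if l \<in> T then c l else 0) * w l i) = 0" using 0 by simp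
  then have "\<forall>l\<in>S. (if l \<in> T then c l else 0) = 0"
    using spec[OF assms(3)[unfolded indep_def], of "\<lambda>l. if l \<in> T then c l else 0"] by (rule rev_mp)
  then show "c l = 0" using l assms(2) by force
qed

text \<open>Independence of the rows provides combinations of the columns equal to the unit vectors
  indexed by \<open>I\<close>, and these form a pivot basis of the column space. For the orbit it is
  applied with the same \<open>I\<close> at the origin and over the field of fractions, so the two
  ranks agree.\<close>

lemma rank_rows:
  fixes A :: "'k::field mat"
  assumes I: "I \<subseteq> {..<dim_row A}"
    and 0: "\<And>i j. i < dim_row A \<Longrightarrow> i \<notin> I \<Longrightarrow> j < dim_col A \<Longrightarrow> A $$ (i, j) = 0"
    and ind: "indep I (\<lambda>i j. if j < dim_col A then A $$ (i, j) else 0)"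
  shows "vec_space.rank (dim_row A) A = card I"
proof -
  have fin: "finite I" using I finite_subset by blast
  have inj: "u x = 0" if u: "\<And>j. j \<in> {..<dim_col A} \<Longrightarrow> (\<Sum>x\<in>I. A $$ (x, j) * u x) = 0" and x: "x \<in> I" for u x
  proof -
    have "(\<Sum>x\<in>I. u x * (if j < dim_col A then A $$ (x, j) else 0)) = 0" for j
      using u[of j] by (cases "j < dim_col A") (simp_all add: mult.commute)
    then have "\<forall>j. (\<Sum>x\<in>I. u x * (if j < dim_col A then A $$ (x, j) else 0)) = 0" by blast
    then have "\<forall>x\<in>I. u x = 0" using spec[OF ind[unfolded indep_def], of u] by (rule rev_mp)
    then show ?thesis using x by blast
  qed
  obtain C where C: "\<And>x y. x \<in> I \<Longrightarrow> y \<in> I \<Longrightarrow> (\<Sum>j\<in>{..<dim_col A}. C x j * A $$ (y, j)) = (if x = y then 1 else 0)"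
    by (rule left_inverse_exists[of "{..<dim_col A}" I "\<lambda>j x. A $$ (x, j)"]) (use fin inj in blast)+
  let ?V = "spn {..<dim_col A} (colf A)"
  define E where "E x i = (\<Sum>j<dim_col A. C x j * colf A j i)" for x i
  have out: "colf A j i = 0" if "i \<notin> I" "j < dim_col A" for i j using that 0 by (simp add: colf_def)
  have E: "E x i = (if x = i then 1 else 0)" if x: "x \<in> I" for x i
  proof (cases "i \<in> I")
    case True
    then have "E x i = (\<Sum>j<dim_col A. C x j * A $$ (i, j))" using I by (auto simp: E_def colf_def)
    then show ?thesis using C[OF x True] by simp
  next
    case False
    then show ?thesis using x out by (auto simp: E_def)
  qed
  have "pivot_basis ?V I E"
  proof (rule pivot_basisI[OF fin])
    show "E a \<in> ?V" for a by (rule spnI[of _ "C a"]) (simp add: E_def fun_eq_iff)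
    fix v i assume v: "v \<in> ?V"
    have "v i = 0" if "i \<notin> I" using v out that by (auto elim!: spnE)
    moreover have "(\<Sum>a\<in>I. v a * E a i) = (\<Sum>a\<in>I. if a = i then v a else 0)" using E by (intro sum.cong refl) simp
    ultimately show "v i = (\<Sum>a\<in>I. v a * E a i)" using fin by simp
  qed (simp add: E)
  then have "hasdim ?V (card I)" by (auto simp: hasdim_def)
  then show ?thesis using hasdim_unique[OF hasdim_rank] by blast
qed

subsection \<open>Vector fields\<close>

lemma mfps_taylor_ex:
  assumes "f \<in> mcarr {..<K}" "zconst {..<K} \<theta>" "zconst {..<K} \<theta>'" "\<forall>i<K. \<theta> i \<in> mcarr B" "\<forall>i<K. \<theta>' i \<in> mcarr B"
  shows "\<exists>Q. (\<forall>i<K. Q i \<in> mcarr B \<and> mconst (Q i) = mconst (mderiv i f)) \<and>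
    msub \<theta> f - msub \<theta>' f = (\<Sum>i<K. (\<theta> i - \<theta>' i) * Q i)"
  by (rule mfps_taylor[of f K \<theta> \<theta>' B]) (use assms in blast)+

lemma mderiv_notin: "f \<in> mcarr A \<Longrightarrow> i \<notin> A \<Longrightarrow> mderiv i f = 0"
  by (rule mfps_eqI) (simp add: mcoeff_simps mcarrD)

lemma vector_fieldI: "X \<in> carrier_vec k \<Longrightarrow> (\<And>j. j < k \<Longrightarrow> X $ j \<in> mcarr {..<k}) \<Longrightarrow> vector_field k X"
  by (auto simp: vector_field_def mfps_carrier_eq vec_set_def)

lemma vector_fieldD:
  assumes "vector_field k X"
  shows "dim_vec X = k" "X \<in> carrier_vec k" "j < k \<Longrightarrow> X $ j \<in> mcarr {..<k}"
proof -
  show *: "dim_vec X = k" "X \<in> carrier_vec k" using assms by (auto simp: vector_field_def)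
  show "X $ j \<in> mcarr {..<k}" if "j < k"
    using assms that * by (auto simp: vector_field_def mfps_carrier_eq vec_set_def)
qed

lemma vf_apply_add: "vf_apply X (f + g) = vf_apply X f + vf_apply X g"
  and vf_apply_diff: "vf_apply X (f - g) = vf_apply X f - vf_apply X g"
  and vf_apply_0: "vf_apply X 0 = 0"
  by (simp_all add: vf_apply_def algebra_simps sum.distrib sum_subtractf)

lemma vf_apply_1: "vf_apply X 1 = 0"
  using mderiv_mscalar[of _ "1 :: complex"] by (simp add: vf_apply_def del: mderiv_mscalar)

lemma vf_apply_mult: "vf_apply X (f * g) = vf_apply X f * g + f * vf_apply X g"
  by (simp add: vf_apply_def mderiv_mult algebra_simps sum.distrib sum_distrib_left sum_distrib_right)

lemma vf_apply_mscalar: "vf_apply X (mscalar c * f) = mscalar c * vf_apply X f"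
  by (simp add: vf_apply_def mderiv_mult sum_distrib_left mult.left_commute)

lemma vf_apply_sum: "vf_apply X (sum f S) = (\<Sum>x\<in>S. vf_apply X (f x))"
  by (induction S rule: infinite_finite_induct) (auto simp: vf_apply_0 vf_apply_add)

lemma vf_apply_mvar: "j < dim_vec X \<Longrightarrow> vf_apply X (mvar j) = X $ j"
  by (simp add: vf_apply_def mderiv_mvar if_distrib cong: if_cong)

lemma vf_apply_carr: "vector_field k X \<Longrightarrow> f \<in> mcarr {..<k} \<Longrightarrow> vf_apply X f \<in> mcarr {..<k}"
  unfolding vf_apply_def by (intro mcarr_sum mcarr_mult mcarr_mderiv) (auto simp: vector_fieldD)

lemma vf_apply_zero_vec: "vf_apply (0\<^sub>v k) f = 0"
  by (simp add: vf_apply_def)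

lemma vf_apply_add_vec: "dim_vec X = dim_vec Y \<Longrightarrow> vf_apply (X + Y) f = vf_apply X f + vf_apply Y f"
  by (simp add: vf_apply_def distrib_right sum.distrib)

lemma vf_apply_smult_vec: "vf_apply (a \<cdot>\<^sub>v X) f = a * vf_apply X f"
  by (simp add: vf_apply_def sum_distrib_left mult.assoc)

lemma ordge_vf_apply: "ordge (Suc q) f \<Longrightarrow> ordge q (vf_apply X f)"
  unfolding vf_apply_def by (intro ordge_sum ordge_mult'(1) ordge_mderiv)

lemma lie_bracket_field:
  "vector_field k X \<Longrightarrow> vector_field k Y \<Longrightarrow> vector_field k (lie_bracket X Y)"
  by (intro vector_fieldI) (auto simp: lie_bracket_def vector_fieldD vf_apply_carr)

lemma vf_apply_lie_bracket:
  assumes "dim_vec X = k" "dim_vec Y = k"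
  shows "vf_apply (lie_bracket X Y) f = vf_apply X (vf_apply Y f) - vf_apply Y (vf_apply X f)"
proof -
  have *: "vf_apply X (vf_apply Y f) = (\<Sum>j<k. vf_apply X (Y $ j) * mderiv j f)
      + (\<Sum>j<k. \<Sum>i<k. X $ i * Y $ j * mderiv i (mderiv j f))"
    if "dim_vec X = k" "dim_vec Y = k" for X Y
    using that by (simp add: vf_apply_def[of Y] vf_apply_sum vf_apply_mult sum.distrib)
      (simp add: vf_apply_def sum_distrib_left algebra_simps)
  have "(\<Sum>j<k. \<Sum>i<k. X $ i * Y $ j * mderiv i (mderiv j f)) = (\<Sum>j<k. \<Sum>i<k. Y $ i * X $ j * mderiv i (mderiv j f))"
    by (subst sum.swap) (simp add: mderiv_commute mult.commute)
  moreover have "vf_apply (lie_bracket X Y) f = (\<Sum>j<k. (vf_apply X (Y $ j) - vf_apply Y (X $ j)) * mderiv j f)"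
    unfolding vf_apply_def[of "lie_bracket X Y"] by (simp add: lie_bracket_def assms)
  ultimately show ?thesis using assms by (simp add: * left_diff_distrib sum_subtractf)
qed

lemma lie_bracket_zero:
  assumes "dim_vec Z = k"
  shows "lie_bracket (0\<^sub>v k) Z = 0\<^sub>v k" "lie_bracket Z (0\<^sub>v k) = 0\<^sub>v k"
  by (rule eq_vecI; simp add: lie_bracket_def vf_apply_0 vf_apply_zero_vec assms)+

subsection \<open>Orbit ideals of Lie algebras of vector fields\<close>

text \<open>Closure under brackets and a basis of the values at the origin are all that is demanded,
  so that the construction serves both \<gg> and the finite sets of commuting fields in
  \<open>implicit_function\<close>.\<close>

locale orbit_ideal =
  fixes k :: nat and L :: "complex mfps vec set" and A :: "nat set" and X :: "nat \<Rightarrow> complex mfps vec"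
  assumes A: "A \<subseteq> {..<k}"
    and L: "\<And>Y. Y \<in> L \<Longrightarrow> vector_field k Y"
    and bracket: "\<And>Y Z. Y \<in> L \<Longrightarrow> Z \<in> L \<Longrightarrow> lie_bracket Y Z \<in> L"
    and X: "\<And>a. a \<in> A \<Longrightarrow> X a \<in> L"
    and X_delta: "\<And>a b. a \<in> A \<Longrightarrow> b \<in> A \<Longrightarrow> mconst (X a $ b) = (if a = b then 1 else 0)"
    and span: "\<And>Y i. Y \<in> L \<Longrightarrow> i < k \<Longrightarrow> mconst (Y $ i) = (\<Sum>a\<in>A. mconst (Y $ a) * mconst (X a $ i))"
begin

abbreviation word :: "complex mfps vec list \<Rightarrow> complex mfps \<Rightarrow> complex mfps" where
  "word ys f \<equiv> foldr vf_apply ys f"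

definition J :: "complex mfps set" where
  "J = {f\<in>mcarr {..<k}. \<forall>ys. set ys \<subseteq> L \<longrightarrow> mconst (word ys f) = 0}"

lemma finA: "finite A" using A finite_subset by blast

lemma word_add: "word ys (f + g) = word ys f + word ys g"
  and word_diff: "word ys (f - g) = word ys f - word ys g"
  and word_0: "word ys 0 = 0"
  and word_mscalar: "word ys (mscalar c * f) = mscalar c * word ys f"
  by (induction ys) (simp_all add: vf_apply_add vf_apply_diff vf_apply_0 vf_apply_mscalar)

lemma word_sum: "word ys (sum f S) = (\<Sum>x\<in>S. word ys (f x))"
  by (induction S rule: infinite_finite_induct) (auto simp: word_0 word_add)

lemma ordge_word: "ordge (q + length ys) f \<Longrightarrow> ordge q (word ys f)"
proof (induction ys arbitrary: q)
  case (Cons y ys)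
  then have "ordge (Suc q) (word ys f)" using Cons.IH[of "Suc q"] by simp
  then show ?case by (simp add: ordge_vf_apply)
qed simp

text \<open>The value of Y g at the origin depends only on Y(0). Such a replacement is possible only
  for the first letter, which is applied last.\<close>

lemma word_Cons_span:
  assumes "Y \<in> L"
  shows "mconst (word (Y # ys) f) = (\<Sum>a\<in>A. mconst (Y $ a) * mconst (word (X a # ys) f))"
proof -
  let ?g = "word ys f"
  have *: "mconst (vf_apply Z ?g) = (\<Sum>i<k. mconst (Z $ i) * mconst (mderiv i ?g))" if "Z \<in> L" for Z
    using vector_fieldD(1)[OF L[OF that]] by (simp add: vf_apply_def del: mderiv.rep_eq)
  have "(\<Sum>i<k. mconst (Y $ i) * mconst (mderiv i ?g))
      = (\<Sum>i<k. \<Sum>a\<in>A. mconst (Y $ a) * (mconst (X a $ i) * mconst (mderiv i ?g)))"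
    by (intro sum.cong refl) (simp add: span[OF assms] sum_distrib_right mult.assoc)
  also have "\<dots> = (\<Sum>a\<in>A. mconst (Y $ a) * mconst (vf_apply (X a) ?g))"
    by (subst sum.swap) (simp add: * X sum_distrib_left)
  finally show ?thesis by (simp add: *[OF assms])
qed

text \<open>
  As in the Poincare-Birkhoff-Witt theorem: modulo shorter words the order of the letters does not matter, and at
  the origin the first letter can be replaced by a combination of the \<open>X a\<close>.
\<close>

lemma J_criterion:
  assumes f: "f \<in> mcarr {..<k}"
    and 0: "\<And>as. set as \<subseteq> A \<Longrightarrow> sorted as \<Longrightarrow> mconst (word (map X as) f) = 0"
  shows "f \<in> J"
proof -
  have "\<forall>ys. length ys = n \<longrightarrow> set ys \<subseteq> L \<longrightarrow> mconst (word ys f) = 0" for n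
  proof (induction n rule: less_induct)
    case (less n)
    \<comment> \<open>Exchanging two neighbours produces their bracket, a letter of \<open>L\<close>
      in a word shorter by one, whose value is zero by induction.\<close>
    have swap: "mconst (word (us @ [Y, Z] @ vs) f) = mconst (word (us @ [Z, Y] @ vs) f)"
      if "length (us @ [Y, Z] @ vs) = n" "set (us @ [Y, Z] @ vs) \<subseteq> L" for us Y Z vs
    proof -
      have dim: "dim_vec Y = k" "dim_vec Z = k" using that L vector_fieldD(1) by auto
      have "word (us @ [Y, Z] @ vs) f - word (us @ [Z, Y] @ vs) f = word (us @ [lie_bracket Y Z] @ vs) f"
        by (simp add: word_diff[symmetric] vf_apply_lie_bracket[OF dim])
      moreover have "mconst (word (us @ [lie_bracket Y Z] @ vs) f) = 0"
      proof -
        have "length (us @ [lie_bracket Y Z] @ vs) < n" "set (us @ [lie_bracket Y Z] @ vs) \<subseteq> L"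
          using that bracket by auto
        then show ?thesis using less by blast
      qed
      ultimately show ?thesis by (metis eq_iff_diff_eq_0 mconst_simps(4))
    qed
    have move: "mconst (word (us @ vs @ [y] @ ws) f) = mconst (word (us @ [y] @ vs @ ws) f)"
      if "length (us @ vs @ [y] @ ws) = n" "set (us @ vs @ [y] @ ws) \<subseteq> L" for us y vs ws
      using that
    proof (induction vs arbitrary: us)
      case (Cons v vs)
      have "mconst (word ((us @ [v]) @ vs @ [y] @ ws) f) = mconst (word ((us @ [v]) @ [y] @ vs @ ws) f)"
        using Cons.prems by (intro Cons.IH) auto
      also have "\<dots> = mconst (word (us @ [v, y] @ vs @ ws) f)" by simp
      also have "\<dots> = mconst (word (us @ [y, v] @ vs @ ws) f)"
        using Cons.prems by (intro swap) auto
      finally show ?case by simp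
    qed simp
    have perm: "mconst (word (pre @ us) f) = mconst (word (pre @ vs) f)"
      if "mset us = mset vs" "length (pre @ us) = n" "set (pre @ us) \<subseteq> L" for pre us vs
      using that
    proof (induction us arbitrary: pre vs)
      case (Cons y us)
      then have "y \<in> set vs" by (metis list.set_intros(1) mset_eq_setD)
      then obtain v w where vs: "vs = v @ y # w" by (meson split_list)
      then have m: "mset us = mset (v @ w)" using Cons.prems(1) by simp
      then have len: "length us = length v + length w" and st: "set us = set v \<union> set w"
        by (metis length_append mset_eq_length, metis set_append mset_eq_setD)
      have "mconst (word ((pre @ [y]) @ us) f) = mconst (word ((pre @ [y]) @ v @ w) f)"
        using Cons.prems m by (intro Cons.IH) auto
      also have "\<dots> = mconst (word (pre @ v @ [y] @ w) f)"
        using Cons.prems len st by (subst move) auto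
      finally show ?case by (simp add: vs)
    qed simp
    \<comment> \<open>The letters already of the form \<open>X a\<close> are collected at the end;
      the first of the others is expanded at the origin, and its replacements are moved behind the
      remaining ones.\<close>
    have "mconst (word (us @ map X as) f) = 0"
      if "set us \<subseteq> L" "set as \<subseteq> A" "length us + length as = n" for us as
      using that
    proof (induction us arbitrary: as)
      case Nil
      then have "mconst (word ([] @ map X as) f) = mconst (word ([] @ map X (sort as)) f)"
        using X by (intro perm) auto
      then show ?case using 0[of "sort as"] Nil by simp
    next
      case (Cons Y us)
      have "mconst (word (X a # us @ map X as) f) = 0" if a: "a \<in> A" for a
      proof -
        have "mconst (word ([] @ X a # us @ map X as) f) = mconst (word ([] @ us @ map X (a # as)) f)"
          using Cons.prems a X by (intro perm) auto
        then show ?thesis using Cons.IH[of "a # as"] Cons.prems a by simp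
      qed
      then show ?case using word_Cons_span[of Y "us @ map X as" f] Cons.prems by simp
    qed
    from this[of _ "[]"] show ?case by simp
  qed
  then show ?thesis using f by (auto simp: J_def)
qed

lemma foldr_mderiv_carr: "h \<in> mcarr A \<Longrightarrow> foldr mderiv as h \<in> mcarr A"
  by (induction as) auto

lemma ordge_foldr_mderiv: "ordge (q + length as) h \<Longrightarrow> ordge q (foldr mderiv as h)"
proof (induction as arbitrary: q)
  case (Cons y ys)
  then have "ordge (Suc q) (foldr mderiv ys h)" using Cons.IH[of "Suc q"] by simp
  then show ?case by (simp add: ordge_mderiv)
qed simp

text \<open>On series in the variables \<open>A\<close> the field \<open>X a\<close> is
  \<partial>/\<partial>x_a plus terms whose coefficients vanish at the origin and which therefore do
  not lower the order. So the lowest-order part of a word is given by the operator with constant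
  coefficients.\<close>

lemma word_symbol:
  assumes h: "h \<in> mcarr A"
  shows "set as \<subseteq> A \<Longrightarrow> ordge (q + length as) h \<Longrightarrow>
    ordge (Suc q) (word (map X as) h - foldr mderiv as h)"
proof (induction as arbitrary: q)
  case (Cons a as)
  let ?g = "word (map X as) h" and ?d = "foldr mderiv as h"
  have a: "a \<in> A" "dim_vec (X a) = k" using Cons X L vector_fieldD(1) by auto
  have d: "?d \<in> mcarr A" using foldr_mderiv_carr[OF h] .
  have od: "ordge (Suc q) ?d" using Cons.prems by (intro ordge_foldr_mderiv) simp
  have "ordge (Suc (Suc q)) (?g - ?d)" using Cons by simp
  then have 1: "ordge (Suc q) (vf_apply (X a) (?g - ?d))" by (rule ordge_vf_apply)
  have "vf_apply (X a) ?d = (\<Sum>j\<in>A. X a $ j * mderiv j ?d)"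
    unfolding vf_apply_def a by (rule sum.mono_neutral_right) (use A mderiv_notin[OF d] in auto)
  moreover have "mderiv a ?d = (\<Sum>j\<in>A. (if a = j then 1 else 0) * mderiv j ?d)"
    using a finA by (simp add: if_distrib[of "\<lambda>x. x * _"] cong: if_cong)
  ultimately have "vf_apply (X a) ?d - mderiv a ?d = (\<Sum>j\<in>A. (X a $ j - (if a = j then 1 else 0)) * mderiv j ?d)"
    by (simp add: left_diff_distrib sum_subtractf)
  moreover have "ordge (1 + q) ((X a $ j - (if a = j then 1 else 0)) * mderiv j ?d)" if "j \<in> A" for j
    using X_delta[OF a(1) that] od by (intro ordge_mult ordge_mderiv) auto
  ultimately have 2: "ordge (Suc q) (vf_apply (X a) ?d - mderiv a ?d)" by (simp add: ordge_sum)
  have "word (map X (a # as)) h - foldr mderiv (a # as) h = vf_apply (X a) (?g - ?d) + (vf_apply (X a) ?d - mderiv a ?d)"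
    by (simp add: vf_apply_diff)
  then show ?case using ordge_add[OF 1 2] by (simp only:)
qed simp

text \<open>The factor is the product of the exponents brought down; it depends on \<open>as\<close>
  and \<open>m\<close>, not on the series.\<close>

lemma mcoeff_foldr_mderiv:
  "\<exists>c. c \<noteq> 0 \<and> (\<forall>h :: complex mfps. mcoeff (foldr mderiv as h) m = c * mcoeff h (mset as + m))"
proof (induction as arbitrary: m)
  case (Cons a as)
  from Cons[of "add_mset a m"] obtain c :: complex where
    "c \<noteq> 0" "\<forall>h :: complex mfps. mcoeff (foldr mderiv as h) (add_mset a m) = c * mcoeff h (mset as + add_mset a m)" by blast
  then show ?case
    by (intro exI[of _ "of_nat (Suc (count m a)) * c"]) (simp add: mderiv.rep_eq del: of_nat_Suc)
qed (auto intro!: exI[of _ 1])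

text \<open>By \<open>J_criterion\<close> the functionals with \<open>m\<close> over
  \<open>A\<close> cut out \<open>J\<close>; by \<open>word_symbol\<close> they are triangular with
  respect to the degree of a series in the variables \<open>A\<close>.\<close>

definition Fm :: "nat multiset \<Rightarrow> complex mfps \<Rightarrow> complex" where
  "Fm m f = mconst (word (map X (sorted_list_of_multiset m)) f)"

lemma Fm_symbol:
  assumes "set_mset m \<subseteq> A"
  obtains c where "c \<noteq> 0" "\<And>h. h \<in> mcarr A \<Longrightarrow> ordge (size m) h \<Longrightarrow> Fm m h = c * mcoeff h m"
proof -
  let ?as = "sorted_list_of_multiset m"
  obtain c :: complex where c: "c \<noteq> 0" "\<And>h. mconst (foldr mderiv ?as h) = c * mcoeff h m"
    using mcoeff_foldr_mderiv[of ?as "{#}"] by auto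
  have "Fm m h = c * mcoeff h m" if "h \<in> mcarr A" "ordge (size m) h" for h
    using word_symbol[OF that(1), of ?as 0] that(2) assms c(2)[of h]
      size_mset[of ?as] by (simp add: Fm_def)
  then show ?thesis using that c(1) by blast
qed

lemma Fm_high_order: "ordge (Suc (size m)) f \<Longrightarrow> Fm m f = 0"
  using ordge_word[of 1 "map X (sorted_list_of_multiset m)" f] size_mset[of "sorted_list_of_multiset m"]
  by (simp add: Fm_def)

lemma J_carr: "f \<in> J \<Longrightarrow> f \<in> mcarr {..<k}" and J_const: "f \<in> J \<Longrightarrow> mconst f = 0"
  unfolding J_def by (simp, metis (mono_tags, lifting) empty_subsetI foldr_Nil id_apply list.set(1) mem_Collect_eq)

lemma J_Fm: "f \<in> mcarr {..<k} \<Longrightarrow> (\<And>m. set_mset m \<subseteq> A \<Longrightarrow> Fm m f = 0) \<Longrightarrow> f \<in> J"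
proof (rule J_criterion)
  fix as assume *: "\<And>m. set_mset m \<subseteq> A \<Longrightarrow> Fm m f = 0" and as: "set as \<subseteq> A" "sorted as"
  have "sorted_list_of_multiset (mset as) = as" using as(2) by (simp add: sorted_list_of_multiset_mset sort_key_id_if_sorted)
  then show "mconst (word (map X as) f) = 0" using *[of "mset as"] as by (simp add: Fm_def)
qed

lemma Fm_J: "f \<in> J \<Longrightarrow> set_mset m \<subseteq> A \<Longrightarrow> Fm m f = 0"
proof -
  assume "f \<in> J" "set_mset m \<subseteq> A"
  moreover from this have "set (map X (sorted_list_of_multiset m)) \<subseteq> L" using X by auto
  ultimately show ?thesis unfolding Fm_def J_def by blast
qed

text \<open>If \<open>h\<close> vanishes to order \<open>q\<close>, its coefficients of degree
  \<open>q\<close> are, up to nonzero factors, values of \<open>Fm\<close>, and these are zero on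
  \<open>J\<close>.\<close>

lemma J_Int_carr: assumes "h \<in> J" "h \<in> mcarr A" shows "h = 0"
proof (rule eq_0_if_ordge)
  fix q show "ordge q h"
  proof (induction q)
    case (Suc q)
    show ?case unfolding ordge_def
    proof (intro allI impI)
      fix m :: "nat multiset" assume m: "size m < Suc q"
      show "mcoeff h m = 0"
      proof (cases "set_mset m \<subseteq> A")
        case True
        have o: "ordge (size m) h" using Suc m by (simp add: ordge_le)
        obtain c where "c \<noteq> 0" "\<And>h. h \<in> mcarr A \<Longrightarrow> ordge (size m) h \<Longrightarrow> Fm m h = c * mcoeff h m"
          by (rule Fm_symbol[OF True]) blast
        then show ?thesis using Fm_J[OF assms(1) True] assms(2) o by simp
      qed (use assms(2) mcarrD in blast)
    qed
  qed simp
qed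

lemma Fm_add: "Fm m (f + g) = Fm m f + Fm m g" and Fm_diff: "Fm m (f - g) = Fm m f - Fm m g"
  and Fm_mscalar: "Fm m (mscalar c * f) = c * Fm m f" and Fm_sum: "Fm m (sum F S) = (\<Sum>x\<in>S. Fm m (F x))"
  by (simp_all add: Fm_def word_add word_diff word_mscalar word_sum)

text \<open>The conditions that \<open>Fm m\<close> vanish on \<open>f - h\<close> are solved degree
  by degree: on homogeneous polynomials of degree \<open>q\<close> the functionals of degree
  \<open>q\<close> are diagonal, and corrections of higher degree do not affect them.\<close>

lemma J_reduce:
  assumes f: "f \<in> mcarr {..<k}"
  obtains h where "h \<in> mcarr A" "f - h \<in> J"
proof -
  have "\<forall>m. \<exists>c. set_mset m \<subseteq> A \<longrightarrow> c \<noteq> 0 \<and> (\<forall>h. h \<in> mcarr A \<longrightarrow> ordge (size m) h \<longrightarrow> Fm m h = c * mcoeff h m)"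
    by (metis Fm_symbol)
  then obtain c where c: "\<And>m. set_mset m \<subseteq> A \<Longrightarrow> c m \<noteq> 0"
    "\<And>m h. set_mset m \<subseteq> A \<Longrightarrow> h \<in> mcarr A \<Longrightarrow> ordge (size m) h \<Longrightarrow> Fm m h = c m * mcoeff h m" by metis
  define M where "M q = {m. set_mset m \<subseteq> A \<and> size m = q}" for q
  have finM: "finite (M q)" for q by (rule finite_subset[OF _ finite_msets[OF finA, of q]]) (auto simp: M_def msets_def)
  \<comment> \<open>The homogeneous polynomial of degree \<open>q\<close> whose addition to
    \<open>h\<close> makes all functionals of degree \<open>q\<close> agree with those of
    \<open>f\<close>.\<close>
  define p where "p q h = (\<Sum>m\<in>M q. mscalar (Fm m (f - h) / c m) * mmon m)" for q h
  define H where "H = rec_nat 0 (\<lambda>q h. h + p q h)"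
  have H: "H 0 = 0" "\<And>q. H (Suc q) = H q + p q (H q)" by (simp_all add: H_def)
  have p: "p q h \<in> mcarr A" "ordge q (p q h)" for q h
    unfolding p_def by (intro mcarr_sum mcarr_mult mcarr_mscalar mcarr_mmon, simp add: M_def)
      (intro ordge_sum ordge_mscalar, auto simp: ordge_def mcoeff_mmon M_def)
  have Hc: "H q \<in> mcarr A" for q by (induction q) (simp_all add: H p)
  have stable: "ordge q (H (q + r) - H q)" for q r
  proof (induction r)
    case (Suc r)
    have "H (q + Suc r) - H q = (H (q + r) - H q) + p (q + r) (H (q + r))" by (simp add: H)
    moreover have "ordge q (p (q + r) (H (q + r)))" by (rule ordge_le[OF p(2)]) simp
    ultimately show ?case using ordge_add[OF Suc] by (simp only:)
  qed simp
  \<comment> \<open>The correction made in step \<open>q\<close> has degree \<open>q\<close>, so the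
    coefficients of degree \<open>q\<close> are final from \<open>H (q + 1)\<close> on.\<close>
  define h where "h = Abs_mfps (\<lambda>m. mcoeff (H (Suc (size m))) m)"
  have h: "mcoeff h m = mcoeff (H (Suc (size m))) m" for m by (simp add: h_def Abs_mfps_inverse)
  have hH: "ordge q (H q - h)" for q
    unfolding ordge_def
  proof (intro allI impI)
    fix m :: "nat multiset" assume "size m < q"
    then obtain r where "q = Suc (size m) + r" using less_iff_Suc_add by auto
    then show "mcoeff (H q - h) m = 0"
      using stable[of "Suc (size m)" r] by (simp add: ordge_def h mcoeff_simps)
  qed
  have hc: "h \<in> mcarr A" by (rule mcarrI) (use Hc mcarrD h in metis)
  have Fm_mmon: "Fm m (mmon m') = (if m = m' then c m else 0)" if "m \<in> M q" "m' \<in> M q" for m m' q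
    using c(2)[of m "mmon m'"] that by (auto simp: M_def mcarr_mmon ordge_def mcoeff_mmon)
  have "f - h \<in> J"
  proof (rule J_Fm)
    show "f - h \<in> mcarr {..<k}" using f mcarr_mono[OF hc A] by simp
    fix m assume m: "set_mset m \<subseteq> A"
    let ?q = "size m"
    have mM: "m \<in> M ?q" using m by (simp add: M_def)
    have "Fm m (p ?q (H ?q)) = (\<Sum>m'\<in>M ?q. Fm m' (f - H ?q) / c m' * (if m = m' then c m else 0))"
      unfolding p_def Fm_sum by (intro sum.cong refl) (simp add: Fm_mscalar Fm_mmon[OF mM])
    also have "\<dots> = (\<Sum>m'\<in>M ?q. if m = m' then Fm m (f - H ?q) else 0)"
      using c(1)[OF m] by (intro sum.cong) auto
    also have "\<dots> = Fm m (f - H ?q)" using mM finM by simp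
    finally have "Fm m (f - H (Suc ?q)) = 0" by (simp add: H Fm_diff Fm_add)
    moreover have "Fm m (H (Suc ?q) - h) = 0" by (rule Fm_high_order[OF hH])
    ultimately show "Fm m (f - h) = 0" by (simp add: Fm_diff)
  qed
  then show ?thesis using that hc by blast
qed

lemma J_zero: "0 \<in> J" and J_add: "f \<in> J \<Longrightarrow> g \<in> J \<Longrightarrow> f + g \<in> J"
  by (auto simp: J_def word_0 word_add)

lemma J_vf: "f \<in> J \<Longrightarrow> Y \<in> L \<Longrightarrow> vf_apply Y f \<in> J"
proof -
  assume f: "f \<in> J" and Y: "Y \<in> L"
  have "mconst (word (ys @ [Y]) f) = 0" if "set ys \<subseteq> L" for ys
    using f Y that unfolding J_def by (simp del: foldr_append)
  then show ?thesis using J_carr[OF f] L[OF Y] by (simp add: J_def vf_apply_carr)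
qed

lemma J_mult: assumes "f \<in> J" "a \<in> mcarr {..<k}" shows "a * f \<in> J"
proof -
  have "mconst (word ys (a * f)) = 0" if "set ys \<subseteq> L" for ys
    using that assms
  proof (induction ys arbitrary: a f rule: rev_induct)
    case Nil
    then show ?case by (simp add: J_const)
  next
    case (snoc Y ys)
    then have "mconst (word ys (vf_apply Y a * f)) = 0" "mconst (word ys (a * vf_apply Y f)) = 0"
      using J_vf vf_apply_carr[OF L] by auto
    then show ?case by (simp add: vf_apply_mult word_add)
  qed
  then show ?thesis using assms(2) J_carr[OF assms(1)] by (simp add: J_def)
qed

lemma J_diff: "f \<in> J \<Longrightarrow> g \<in> J \<Longrightarrow> f - g \<in> J"
  using J_add[of f "(- 1) * g"] J_mult[of g "- 1"] by simp

text \<open>Reducing the variables outside \<open>A\<close> modulo \<open>J\<close> to series in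
  \<open>A\<close> gives the graph functions. The Taylor formula compares a member \<open>f\<close>
  of \<open>J\<close> with its restriction to the graph; the restriction lies in \<open>J\<close>
  and involves only \<open>A\<close>, hence is zero.\<close>

lemma J_graph:
  obtains h where "\<And>b. b \<in> {..<k} - A \<Longrightarrow> h b \<in> mcarr A \<and> mconst (h b) = 0 \<and> mvar b - h b \<in> J"
    "\<And>f. f \<in> J \<Longrightarrow> \<exists>Q. (\<forall>b\<in>{..<k} - A. Q b \<in> mcarr {..<k}) \<and> f = (\<Sum>b\<in>{..<k} - A. Q b * (mvar b - h b))"
proof -
  have "\<forall>b\<in>{..<k} - A. \<exists>h. h \<in> mcarr A \<and> mvar b - h \<in> J"
    by (meson DiffD1 J_reduce mcarr_mvar)
  then obtain h where h: "\<And>b. b \<in> {..<k} - A \<Longrightarrow> h b \<in> mcarr A" "\<And>b. b \<in> {..<k} - A \<Longrightarrow> mvar b - h b \<in> J"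
    by metis
  have h0: "mconst (h b) = 0" if "b \<in> {..<k} - A" for b using J_const[OF h(2)[OF that]] by simp
  define \<theta> where "\<theta> i = (if i \<in> A then mvar i else h i)" for i
  have z: "zconst {..<k} mvar" "zconst {..<k} \<theta>" using h0 by (auto simp: zconst_def \<theta>_def)
  have \<theta>A: "\<theta> i \<in> mcarr A" if "i < k" for i using h that by (auto simp: \<theta>_def mcarr_mvar)
  have "\<exists>Q. (\<forall>b\<in>{..<k} - A. Q b \<in> mcarr {..<k}) \<and> f = (\<Sum>b\<in>{..<k} - A. Q b * (mvar b - h b))" if f: "f \<in> J" for f
  proof -
    note fc = J_carr[OF f]
    have "\<forall>i<k. mvar i \<in> mcarr {..<k}" "\<forall>i<k. \<theta> i \<in> mcarr {..<k}"
      using mcarr_mono[OF \<theta>A A] by (auto simp: mcarr_mvar)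
    then obtain Q where Q: "\<forall>i<k. Q i \<in> mcarr {..<k} \<and> mconst (Q i) = mconst (mderiv i f)"
      "msub mvar f - msub \<theta> f = (\<Sum>i<k. (mvar i - \<theta> i) * Q i)"
      using mfps_taylor_ex[OF fc z] by blast
    have "(\<Sum>i<k. (mvar i - \<theta> i) * Q i) = (\<Sum>b\<in>{..<k} - A. Q b * (mvar b - h b))"
      by (rule sum.mono_neutral_cong_right) (auto simp: \<theta>_def)
    then have eq: "f - msub \<theta> f = (\<Sum>b\<in>{..<k} - A. Q b * (mvar b - h b))"
      using Q(2) msub_id[OF _ fc, of mvar] by simp
    have sumJ: "sum F S \<in> J" if "\<And>b. b \<in> S \<Longrightarrow> F b \<in> J" for F and S :: "nat set"
      using that by (induction S rule: infinite_finite_induct) (auto simp: J_zero J_add)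
    have "f - msub \<theta> f \<in> J" unfolding eq
      by (rule sumJ) (use J_mult[OF h(2)] Q(1) in auto)
    then have "f - (f - msub \<theta> f) \<in> J" using J_diff f by blast
    moreover have "msub \<theta> f \<in> mcarr A" using mcarr_msub[OF _ z(2) fc] \<theta>A by auto
    ultimately have "msub \<theta> f = 0" using J_Int_carr by simp
    then show ?thesis using eq Q(1) by (intro exI[of _ Q]) auto
  qed
  then show ?thesis by (intro that[of h]) (use h h0 in blast)+
qed

end

subsection \<open>Implicit functions\<close>

text \<open>The graph is the orbit through the origin of fields that annihilate all
  \<open>E b\<close>. These fields commute, so together with 0 they satisfy the axioms of
  \<open>orbit_ideal\<close>, and every \<open>E b\<close> belongs to the orbit ideal.\<close>

lemma implicit_function:
  fixes E :: "nat \<Rightarrow> complex mfps"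
  assumes B: "B \<subseteq> {..<k}" and E: "\<And>b. b \<in> B \<Longrightarrow> E b \<in> mcarr {..<k}" "\<And>b. b \<in> B \<Longrightarrow> mconst (E b) = 0"
    and delta: "\<And>b c. b \<in> B \<Longrightarrow> c \<in> B \<Longrightarrow> mconst (mderiv c (E b)) = (if b = c then 1 else 0)"
  obtains h where "\<And>b. b \<in> B \<Longrightarrow> h b \<in> mcarr ({..<k} - B)" "\<And>b. b \<in> B \<Longrightarrow> mconst (h b) = 0"
    "\<And>b. b \<in> B \<Longrightarrow> msub (\<lambda>i. if i \<in> B then h i else mvar i) (E b) = 0"
proof -
  have finB: "finite B" using B finite_subset by blast
  let ?A = "{..<k} - B"
  have "\<forall>a. \<exists>y. \<forall>b\<in>B. y b \<in> mcarr {..<k} \<and> (\<Sum>c\<in>B. mderiv c (E b) * y c) = - mderiv a (E b)"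
    using E(1) delta by (intro allI mfps_linear_system[OF finB]) auto
  then obtain y where y: "\<And>a b. b \<in> B \<Longrightarrow> y a b \<in> mcarr {..<k}"
    "\<And>a b. b \<in> B \<Longrightarrow> (\<Sum>c\<in>B. mderiv c (E b) * y a c) = - mderiv a (E b)" by metis
  \<comment> \<open>The field \<partial>/\<partial>x_a, corrected in the directions \<open>B\<close>
    so that it annihilates every \<open>E b\<close>.\<close>
  define X where "X a = vec k (\<lambda>i. if i \<in> B then y a i else if i = a then 1 else 0)" for a
  have XE: "vf_apply (X a) (E b) = 0" if a: "a \<in> ?A" and b: "b \<in> B" for a b
  proof -
    have "vf_apply (X a) (E b) = (\<Sum>i\<in>insert a B. X a $ i * mderiv i (E b))"
      unfolding vf_apply_def using a B by (intro sum.mono_neutral_right) (auto simp: X_def finB)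
    also have "\<dots> = mderiv a (E b) + (\<Sum>c\<in>B. mderiv c (E b) * y a c)"
      using a B finB by (simp, intro arg_cong2[of _ _ _ _ "(+)"] sum.cong) (auto simp: X_def mult.commute)
    finally show ?thesis by (simp add: y(2)[OF b])
  qed
  have Xf: "vector_field k (X a)" for a
    by (rule vector_fieldI) (auto simp: X_def y)
  have commute: "lie_bracket (X a) (X a') = 0\<^sub>v k" if a: "a \<in> ?A" "a' \<in> ?A" for a a'
  proof (rule eq_vecI)
    \<comment> \<open>The bracket has no components outside \<open>B\<close> and annihilates every
      \<open>E b\<close>, whose Jacobian matrix in the directions \<open>B\<close> is the identity
      at the origin; so it is zero.\<close>
    define Z where "Z = lie_bracket (X a) (X a')"
    have dims: "dim_vec (X a) = k" "dim_vec (X a') = k" "dim_vec Z = k"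
      by (simp_all add: X_def Z_def lie_bracket_def)
    have ZA: "Z $ i = 0" if "i < k" "i \<notin> B" for i
      using that by (simp add: Z_def lie_bracket_def X_def vf_apply_0 vf_apply_1)
    have "(\<Sum>i\<in>B. mderiv i (E b) * Z $ i) = 0" if b: "b \<in> B" for b
    proof -
      have "(\<Sum>i\<in>B. mderiv i (E b) * Z $ i) = vf_apply Z (E b)"
        unfolding vf_apply_def dims using B ZA
        by (intro sum.mono_neutral_cong_left) (auto simp: mult.commute)
      also have "\<dots> = 0" unfolding Z_def
        using vf_apply_lie_bracket[OF dims(1,2)] XE a b by (simp add: vf_apply_0)
      finally show ?thesis .
    qed
    moreover have "u i = 0" if "\<And>b. b \<in> B \<Longrightarrow> (\<Sum>i\<in>B. mconst (mderiv i (E b)) * u i) = 0" "i \<in> B"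
      for u :: "nat \<Rightarrow> complex" and i
    proof -
      have "(\<Sum>j\<in>B. mconst (mderiv j (E i)) * u j) = (\<Sum>j\<in>B. if i = j then u j else 0)"
        using delta[OF that(2)] by (intro sum.cong) auto
      then show ?thesis using that(1)[OF that(2)] that(2) finB by simp
    qed
    ultimately have ZB: "Z $ i = 0" if "i \<in> B" for i
      using mfps_linear_system_unique[OF finB, of B "\<lambda>b i. mderiv i (E b)" "\<lambda>i. Z $ i"] that by blast
    show "lie_bracket (X a) (X a') $ i = 0\<^sub>v k $ i" if "i < dim_vec (0\<^sub>v k)" for i
      using that ZA[of i] ZB[of i] by (cases "i \<in> B") (auto simp: Z_def)
  qed (simp add: lie_bracket_def X_def)
  define L where "L = insert (0\<^sub>v k) (X ` ?A)"
  have Xd: "mconst (X a $ i) = (if a = i then 1 else 0)" if "a \<in> ?A" "i \<in> ?A" for a i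
    using that by (auto simp: X_def)
  interpret orbit_ideal k L ?A X
  proof
    show "vector_field k Y" if "Y \<in> L" for Y
    proof -
      have "vector_field k (0\<^sub>v k)" by (rule vector_fieldI) auto
      then show ?thesis using that Xf by (auto simp: L_def)
    qed
    show "lie_bracket Y Z \<in> L" if "Y \<in> L" "Z \<in> L" for Y Z
    proof -
      have "lie_bracket Y Z = 0\<^sub>v k"
      proof (cases "Y = 0\<^sub>v k \<or> Z = 0\<^sub>v k")
        case True
        have "dim_vec Y = k" "dim_vec Z = k" using that by (auto simp: L_def X_def)
        then show ?thesis using True lie_bracket_zero by (elim disjE; simp only:)
      qed (use that commute in \<open>auto simp: L_def\<close>)
      then show ?thesis by (simp add: L_def)
    qed
    show "mconst (Y $ i) = (\<Sum>a\<in>?A. mconst (Y $ a) * mconst (X a $ i))" if "Y \<in> L" "i < k" for Y i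
    proof (cases "Y = 0\<^sub>v k")
      case False
      then obtain c where c: "c \<in> ?A" "Y = X c" using \<open>Y \<in> L\<close> by (auto simp: L_def)
      have "(\<Sum>a\<in>?A. mconst (Y $ a) * mconst (X a $ i)) = (\<Sum>a\<in>?A. (if c = a then mconst (X a $ i) else 0))"
        using c Xd by (intro sum.cong) auto
      then show ?thesis using c by simp
    qed (use that in auto)
  qed (auto simp: L_def Xd)
  have EJ: "E b \<in> J" if b: "b \<in> B" for b
  proof -
    have "mconst (word ys (E b)) = 0" if "set ys \<subseteq> L" for ys
    proof (cases ys rule: rev_cases)
      case (snoc zs z)
      then have "vf_apply z (E b) = 0" using that XE b by (auto simp: L_def vf_apply_zero_vec)
      then show ?thesis using snoc by (simp add: word_0)
    qed (use E b in simp)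
    then show ?thesis using E b by (simp add: J_def)
  qed
  have AB: "{..<k} - ?A = B" using B by auto
  obtain h where h: "\<And>b. b \<in> B \<Longrightarrow> h b \<in> mcarr ?A \<and> mconst (h b) = 0 \<and> mvar b - h b \<in> J"
    "\<And>f. f \<in> J \<Longrightarrow> \<exists>Q. (\<forall>b\<in>B. Q b \<in> mcarr {..<k}) \<and> f = (\<Sum>b\<in>B. Q b * (mvar b - h b))"
    by (rule J_graph[unfolded AB]) blast
  let ?\<theta> = "\<lambda>i. if i \<in> B then h i else mvar i"
  have z: "zconst {..<k} ?\<theta>" using h by (simp add: zconst_def)
  have "msub ?\<theta> (E b) = 0" if "b \<in> B" for b
  proof -
    obtain Q where Q: "\<forall>b\<in>B. Q b \<in> mcarr {..<k}" "E b = (\<Sum>b\<in>B. Q b * (mvar b - h b))"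
      using h(2)[OF EJ[OF \<open>b \<in> B\<close>]] by blast
    have hk: "h b \<in> mcarr {..<k}" if "b \<in> B" for b using h(1)[OF that] mcarr_mono by blast
    have mv: "(mvar b :: complex mfps) \<in> mcarr {..<k}" if "b \<in> B" for b using that B by (auto intro: mcarr_mvar)
    have hh: "msub ?\<theta> (h b) = h b" if "b \<in> B" for b
    proof -
      have "msub ?\<theta> (h b) = msub mvar (h b)"
        using h(1)[OF that] by (intro msub_cong[of ?A]) (auto simp: zconst_def)
      then show ?thesis using h(1)[OF that] msub_id[of ?A "h b" mvar] by simp
    qed
    have "msub ?\<theta> (E b) = (\<Sum>b\<in>B. msub ?\<theta> (Q b * (mvar b - h b)))"
      unfolding Q(2) by (rule msub_sum[OF _ z]) (use Q(1) hk mv in auto)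
    also have "\<dots> = 0"
    proof (rule sum.neutral, rule ballI)
      fix b assume b: "b \<in> B"
      then have bk: "b \<in> {..<k}" using B by auto
      have "msub ?\<theta> (mvar b - h b) = 0"
        using b hh[OF b] by (simp add: msub_diff[OF _ z mv[OF b] hk[OF b]] msub_mvar[OF _ z bk])
      then show "msub ?\<theta> (Q b * (mvar b - h b)) = 0"
        using Q(1) b mv hk by (simp add: msub_mult[OF _ z])
    qed
    finally show ?thesis .
  qed
  then show ?thesis using that h by blast
qed

subsection \<open>Ideals\<close>

definition is_ideal :: "nat \<Rightarrow> complex mfps set \<Rightarrow> bool" where
  "is_ideal k I \<longleftrightarrow> I \<subseteq> mcarr {..<k} \<and> 0 \<in> I \<and> (\<forall>f\<in>I. \<forall>g\<in>I. f + g \<in> I) \<and>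
     (\<forall>f\<in>I. \<forall>a\<in>mcarr {..<k}. a * f \<in> I)"

text \<open>Explicit combinations over an index set, which may be a disjoint sum, make the
  coefficient matrices available that \<open>genideal\<close> hides.\<close>

definition lideal :: "nat \<Rightarrow> 'i set \<Rightarrow> ('i \<Rightarrow> complex mfps) \<Rightarrow> complex mfps set" where
  "lideal k S f = {g. \<exists>a. (\<forall>i\<in>S. a i \<in> mcarr {..<k}) \<and> g = (\<Sum>i\<in>S. a i * f i)}"

lemma is_idealD:
  assumes "is_ideal k I"
  shows "f \<in> I \<Longrightarrow> f \<in> mcarr {..<k}" "0 \<in> I" "f \<in> I \<Longrightarrow> g \<in> I \<Longrightarrow> f + g \<in> I"
    "f \<in> I \<Longrightarrow> a \<in> mcarr {..<k} \<Longrightarrow> a * f \<in> I" "f \<in> I \<Longrightarrow> g \<in> I \<Longrightarrow> f - g \<in> I"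
proof -
  show 4: "f \<in> I \<Longrightarrow> a \<in> mcarr {..<k} \<Longrightarrow> a * f \<in> I" for f a using assms by (simp add: is_ideal_def)
  show 3: "f \<in> I \<Longrightarrow> g \<in> I \<Longrightarrow> f + g \<in> I" for f g using assms by (simp add: is_ideal_def)
  show "f \<in> I \<Longrightarrow> g \<in> I \<Longrightarrow> f - g \<in> I" using 3[of f "(- 1) * g"] 4[of g "- 1"] by simp
qed (use assms in \<open>auto simp: is_ideal_def\<close>)

lemma is_ideal_sum: "is_ideal k I \<Longrightarrow> (\<And>i. i \<in> S \<Longrightarrow> F i \<in> I) \<Longrightarrow> sum F S \<in> I"
  by (induction S rule: infinite_finite_induct) (auto simp: is_idealD)

lemma lidealI: "(\<And>i. i \<in> S \<Longrightarrow> a i \<in> mcarr {..<k}) \<Longrightarrow> g = (\<Sum>i\<in>S. a i * f i) \<Longrightarrow> g \<in> lideal k S f"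
  by (auto simp: lideal_def)

lemma lidealE:
  assumes "g \<in> lideal k S f"
  obtains a where "\<And>i. i \<in> S \<Longrightarrow> a i \<in> mcarr {..<k}" "g = (\<Sum>i\<in>S. a i * f i)"
  using assms by (auto simp: lideal_def)

lemma lideal_mem: "finite S \<Longrightarrow> i \<in> S \<Longrightarrow> f i \<in> lideal k S f"
  by (rule lidealI[of _ "\<lambda>j. if j = i then 1 else 0"]) (simp_all add: if_distrib[of "\<lambda>x. x * _"] cong: if_cong)

lemma lideal_is_ideal: assumes "\<And>i. i \<in> S \<Longrightarrow> f i \<in> mcarr {..<k}" shows "is_ideal k (lideal k S f)"
  unfolding is_ideal_def
proof (intro conjI ballI subsetI)
  fix g assume "g \<in> lideal k S f"
  then obtain a where "\<And>i. i \<in> S \<Longrightarrow> a i \<in> mcarr {..<k}" "g = (\<Sum>i\<in>S. a i * f i)" by (elim lidealE) blast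
  then show "g \<in> mcarr {..<k}" using assms by (auto intro!: mcarr_sum)
next
  show "0 \<in> lideal k S f" by (rule lidealI[of _ "\<lambda>_. 0"]) auto
next
  fix g h assume "g \<in> lideal k S f" "h \<in> lideal k S f"
  then obtain a b where "\<And>i. i \<in> S \<Longrightarrow> a i \<in> mcarr {..<k}" "g = (\<Sum>i\<in>S. a i * f i)"
    "\<And>i. i \<in> S \<Longrightarrow> b i \<in> mcarr {..<k}" "h = (\<Sum>i\<in>S. b i * f i)" by (elim lidealE) blast
  then show "g + h \<in> lideal k S f"
    by (intro lidealI[of _ "\<lambda>i. a i + b i"]) (auto simp: distrib_right sum.distrib)
next
  fix g and c :: "complex mfps" assume "g \<in> lideal k S f" and c: "c \<in> mcarr {..<k}"
  then obtain a where "\<And>i. i \<in> S \<Longrightarrow> a i \<in> mcarr {..<k}" "g = (\<Sum>i\<in>S. a i * f i)" by (elim lidealE) blast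
  then show "c * g \<in> lideal k S f"
    using c by (intro lidealI[of _ "\<lambda>i. c * a i"]) (auto simp: sum_distrib_left mult.assoc)
qed

lemma lideal_subset:
  assumes "is_ideal k I" "\<And>i. i \<in> S \<Longrightarrow> f i \<in> I" shows "lideal k S f \<subseteq> I"
proof
  fix g assume "g \<in> lideal k S f"
  then obtain a where "\<And>i. i \<in> S \<Longrightarrow> a i \<in> mcarr {..<k}" "g = (\<Sum>i\<in>S. a i * f i)" by (elim lidealE) blast
  then show "g \<in> I" using is_idealD(4)[OF assms(1) assms(2)] by (auto intro!: is_ideal_sum[OF assms(1)])
qed

lemma mfps_ring_simps: "monoid.mult (mfps_ring k) = (*)" "add (mfps_ring k) = (+)"
    "one (mfps_ring k) = 1" "zero (mfps_ring k) = 0"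
  by (simp_all add: mfps_ring_def)

lemma ideal_iff: "ideal I (mfps_ring k) \<longleftrightarrow> is_ideal k I"
proof
  assume "ideal I (mfps_ring k)"
  then interpret ideal I "mfps_ring k" .
  show "is_ideal k I" unfolding is_ideal_def
    using a_subset additive_subgroup.zero_closed[OF is_additive_subgroup]
      additive_subgroup.a_closed[OF is_additive_subgroup] I_l_closed by (auto simp: mfps_ring_simps mfps_carrier_eq)
next
  interpret cring "mfps_ring k" by (rule cring_mfps_ring)
  assume I: "is_ideal k I"
  show "ideal I (mfps_ring k)"
  proof (rule idealI[OF ring_axioms])
    show "subgroup I (add_monoid (mfps_ring k))"
    proof (rule add.subgroupI)
      fix f assume f: "f \<in> I"
      then have "f \<in> mfps_carrier k" "- f \<in> mfps_carrier k"
        using is_idealD(1)[OF I] by (auto simp: mfps_carrier_eq)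
      then have "\<ominus>\<^bsub>mfps_ring k\<^esub> f = - f" by (intro minus_equality) (simp_all add: mfps_ring_simps)
      moreover have "- f \<in> I" using is_idealD(4)[OF I f, of "- 1"] by simp
      ultimately show "\<ominus>\<^bsub>mfps_ring k\<^esub> f \<in> I" by simp
    qed (use is_idealD[OF I] in \<open>auto simp: mfps_ring_simps mfps_carrier_eq\<close>)
  qed (use is_idealD[OF I] in \<open>auto simp: mfps_ring_simps mfps_carrier_eq mult.commute\<close>)
qed

lemma genideal_eq:
  assumes "finite S" "\<And>i. i \<in> S \<Longrightarrow> f i \<in> mcarr {..<k}"
  shows "genideal (mfps_ring k) (f ` S) = lideal k S f"
proof
  show "genideal (mfps_ring k) (f ` S) \<subseteq> lideal k S f"
    unfolding genideal_def using lideal_is_ideal[of S f k] assms lideal_mem[OF assms(1), of _ f k]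
    by (intro Inter_lower) (auto simp: ideal_iff)
  show "lideal k S f \<subseteq> genideal (mfps_ring k) (f ` S)"
    unfolding genideal_def
  proof (rule Inter_greatest)
    fix I assume "I \<in> {I. ideal I (mfps_ring k) \<and> f ` S \<subseteq> I}"
    then show "lideal k S f \<subseteq> I" by (intro lideal_subset) (auto simp: ideal_iff)
  qed
qed

lemma generators_iff:
  "generators k d I f \<longleftrightarrow> f \<in> carrier_vec d \<and> (\<forall>i<d. f $ i \<in> mcarr {..<k}) \<and> I = lideal k {..<d} (($) f)"
proof -
  have *: "set\<^sub>v f = ($) f ` {..<d}" if "f \<in> carrier_vec d" using that by (auto simp: vec_set_def)
  show ?thesis
  proof (cases "f \<in> carrier_vec d \<and> (\<forall>i<d. f $ i \<in> mcarr {..<k})")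
    case True
    then have "genideal (mfps_ring k) (set\<^sub>v f) = lideal k {..<d} (($) f)"
      using genideal_eq[of "{..<d}" "($) f" k] * by simp
    then show ?thesis using True * unfolding generators_def mfps_carrier_eq by auto
  qed (use * in \<open>auto simp: generators_def mfps_carrier_eq\<close>)
qed

subsection \<open>Differentials and generators of manifold ideals\<close>

definition dcov :: "nat \<Rightarrow> complex mfps \<Rightarrow> nat \<Rightarrow> complex" where
  "dcov k f j = (if j < k then mconst (mderiv j f) else 0)"

lemma mconst_mderiv_mult: "mconst f = 0 \<Longrightarrow> mconst (mderiv j (a * f)) = mconst a * mconst (mderiv j f)"
  by (simp only: mderiv_mult mconst_simps) simp

lemma dcov_mult: "mconst f = 0 \<Longrightarrow> dcov k (a * f) j = mconst a * dcov k f j"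
  by (simp add: dcov_def mconst_mderiv_mult del: mderiv.rep_eq)

lemma dcov_sum: "dcov k (sum F S) j = (\<Sum>x\<in>S. dcov k (F x) j)"
  by (simp add: dcov_def mderiv_sum mcoeff_sum)

lemma dcov_lincomb:
  "(\<And>i. i \<in> S \<Longrightarrow> mconst (f i) = 0) \<Longrightarrow> dcov k (\<Sum>i\<in>S. a i * f i) j = (\<Sum>i\<in>S. mconst (a i) * dcov k (f i) j)"
  unfolding dcov_sum by (rule sum.cong) (auto simp: dcov_mult)

lemma indep_iff_manifold:
  "indep {..<d} (\<lambda>i. dcov k (f $ i)) \<longleftrightarrow>
     (\<forall>c :: nat \<Rightarrow> complex. (\<forall>j<k. (\<Sum>i<d. c i * mconst (mderiv j (f $ i))) = 0) \<longrightarrow> (\<forall>i<d. c i = 0))"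
proof -
  have "(\<Sum>i<d. c i * dcov k (f $ i) j) = (if j < k then \<Sum>i<d. c i * mconst (mderiv j (f $ i)) else 0)"
    for c :: "nat \<Rightarrow> complex" and j
    by (simp add: dcov_def)
  then have "(\<forall>j. (\<Sum>i<d. c i * dcov k (f $ i) j) = 0) \<longleftrightarrow> (\<forall>j<k. (\<Sum>i<d. c i * mconst (mderiv j (f $ i))) = 0)"
    for c :: "nat \<Rightarrow> complex"
    by metis
  then show ?thesis unfolding indep_def by (simp add: Ball_def del: mderiv.rep_eq)
qed

text \<open>The dimension of the span is at least \<open>card T = card S\<close>, so no member of
  the spanning family is redundant.\<close>

lemma indep_exchange:
  assumes "finite S" "finite T" "card S = card T" "indep T u" "\<And>t. t \<in> T \<Longrightarrow> u t \<in> spn S w"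
    and "finite X" "\<And>l i. l \<in> S \<Longrightarrow> i \<notin> X \<Longrightarrow> w l i = 0"
  shows "indep S w"
proof -
  obtain r where r: "hasdim (spn S w) r" by (rule hasdim_spn_exists[of S X w]) (use assms in blast)+
  then have "r \<le> card S" using hasdim_spn_le assms(1) by blast
  moreover have "card T \<le> r" using indep_card_le[OF r assms(2) _ assms(4)] assms(5) by blast
  ultimately have "hasdim (spn S w) (card S)" using r assms(3) by simp
  then show ?thesis by (rule indep_if_hasdim) (rule assms(1))
qed

text \<open>Normal form of a manifold ideal. Statements about other generators are derived from the
  \<open>mvar b - h b\<close>, whose differentials contain an identity block in the columns
  \<open>B\<close>.\<close>

locale graph_ideal =
  fixes k :: nat and B :: "nat set" and h :: "nat \<Rightarrow> complex mfps" and J :: "complex mfps set"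
  assumes B: "B \<subseteq> {..<k}"
    and h: "\<And>b. b \<in> B \<Longrightarrow> h b \<in> mcarr ({..<k} - B)" "\<And>b. b \<in> B \<Longrightarrow> mconst (h b) = 0"
    and J: "J = lideal k B (\<lambda>b. mvar b - h b)"
begin

lemma finB: "finite B" using B finite_subset by blast

lemma u_carr: "b \<in> B \<Longrightarrow> mvar b - h b \<in> mcarr {..<k}"
  using B h(1)[of b] mcarr_mono[of "h b" "{..<k} - B" "{..<k}"] by (auto simp: mcarr_mvar)

lemma J_ideal: "is_ideal k J" unfolding J by (rule lideal_is_ideal) (rule u_carr)

lemma J_const: "f \<in> J \<Longrightarrow> mconst f = 0"
  unfolding J using h(2) by (auto elim!: lidealE)

lemma dcov_u: "b \<in> B \<Longrightarrow> c \<in> B \<Longrightarrow> dcov k (mvar b - h b) c = (if b = c then 1 else 0)"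
  using B mderiv_notin[OF h(1)[of b], of c] by (auto simp: dcov_def mderiv_mvar simp del: mderiv.rep_eq)

lemma indep_u: "indep B (\<lambda>b. dcov k (mvar b - h b))"
  unfolding indep_def
proof (intro allI impI ballI)
  fix c b assume 0: "\<forall>i. (\<Sum>l\<in>B. c l * dcov k (mvar l - h l) i) = 0" and b: "b \<in> B"
  have "(\<Sum>l\<in>B. c l * dcov k (mvar l - h l) b) = (\<Sum>l\<in>B. if l = b then c l else 0)"
    using b dcov_u by (intro sum.cong) auto
  then show "c b = 0" using 0 b finB by simp
qed

text \<open>A form of Nakayama's lemma: independent differentials make the matrix that expresses the
  \<open>f i\<close> by the distinguished generators invertible at the origin, hence invertible over
  the power series.\<close>

lemma J_generated:
  assumes S: "finite S" "card S = card B" and f: "\<And>i. i \<in> S \<Longrightarrow> f i \<in> J"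
    and ind: "indep S (\<lambda>i. dcov k (f i))"
  shows "lideal k S f = J"
proof
  show "lideal k S f \<subseteq> J" using lideal_subset[OF J_ideal] f by blast
  have "\<forall>i\<in>S. \<exists>a. (\<forall>b\<in>B. a b \<in> mcarr {..<k}) \<and> f i = (\<Sum>b\<in>B. a b * (mvar b - h b))"
    using f unfolding J lideal_def by blast
  then obtain Q where Q: "\<And>i b. i \<in> S \<Longrightarrow> b \<in> B \<Longrightarrow> Q i b \<in> mcarr {..<k}"
    "\<And>i. i \<in> S \<Longrightarrow> f i = (\<Sum>b\<in>B. Q i b * (mvar b - h b))" by metis
  have df: "dcov k (f i) j = (\<Sum>b\<in>B. mconst (Q i b) * dcov k (mvar b - h b) j)" if "i \<in> S" for i j
    by (subst Q(2)[OF that], rule dcov_lincomb) (simp add: h)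
  define w where "w i b = (if b \<in> B then mconst (Q i b) else 0)" for i b
  have "indep S w" unfolding indep_def
  proof (intro allI impI)
    fix c assume 0: "\<forall>b. (\<Sum>i\<in>S. c i * w i b) = 0"
    have "(\<Sum>i\<in>S. c i * dcov k (f i) j) = 0" for j
    proof -
      have "(\<Sum>i\<in>S. c i * dcov k (f i) j) = (\<Sum>i\<in>S. \<Sum>b\<in>B. c i * w i b * dcov k (mvar b - h b) j)"
        by (intro sum.cong refl) (simp add: df w_def sum_distrib_left mult.assoc)
      also have "\<dots> = (\<Sum>b\<in>B. (\<Sum>i\<in>S. c i * w i b) * dcov k (mvar b - h b) j)"
        by (subst sum.swap) (simp add: sum_distrib_right)
      finally show ?thesis using 0 by simp
    qed
    then have "\<forall>j. (\<Sum>i\<in>S. c i * dcov k (f i) j) = 0" by blast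
    then show "\<forall>l\<in>S. c l = 0" using spec[OF ind[unfolded indep_def], of c] by (rule rev_mp)
  qed
  moreover define U where "U = {v :: nat \<Rightarrow> complex. \<forall>i. i \<notin> B \<longrightarrow> v i = 0}"
  have "lsub U" by (rule lsubI) (auto simp: U_def)
  moreover have "v = (\<lambda>_. 0)" if "v \<in> U" "\<forall>b\<in>B. v b = 0" for v using that by (auto simp: U_def)
  ultimately have U: "spn S w = U"
    using hasdim_full(1)[of U B S w] finB S by (auto simp: U_def w_def)
  have "\<forall>b\<in>B. \<exists>C. (\<lambda>c. if b = c then 1 else 0) = (\<lambda>c. \<Sum>i\<in>S. C i * w i c)"
  proof
    fix b assume "b \<in> B"
    then have "(\<lambda>c. if b = c then 1 else 0) \<in> spn S w" unfolding U by (auto simp: U_def)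
    then show "\<exists>C. (\<lambda>c. if b = c then 1 else 0) = (\<lambda>c. \<Sum>i\<in>S. C i * w i c)" by (auto elim: spnE)
  qed
  then obtain C where C: "\<And>b. b \<in> B \<Longrightarrow> (\<lambda>c. if b = c then 1 else 0) = (\<lambda>c. \<Sum>i\<in>S. C b i * w i c)" by metis
  \<comment> \<open>Constant combinations of the \<open>f i\<close> normalize this matrix to the
    identity at the origin.\<close>
  define P where "P b c = (\<Sum>i\<in>S. mscalar (C b i) * Q i c)" for b c
  have P: "P b c \<in> mcarr {..<k}" "mconst (P b c) = (if b = c then 1 else 0)" if "b \<in> B" "c \<in> B" for b c
    using Q(1) that fun_cong[OF C[OF that(1)], of c] by (auto simp: P_def w_def mcoeff_mscalar_mult intro!: mcarr_sum)
  define g where "g b = (\<Sum>i\<in>S. mscalar (C b i) * f i)" for b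
  have g: "g b = (\<Sum>c\<in>B. P b c * (mvar c - h c))" for b
  proof -
    have "g b = (\<Sum>i\<in>S. \<Sum>c\<in>B. mscalar (C b i) * Q i c * (mvar c - h c))"
      unfolding g_def by (intro sum.cong refl) (simp add: Q(2) sum_distrib_left mult.assoc)
    also have "\<dots> = (\<Sum>c\<in>B. P b c * (mvar c - h c))"
      by (subst sum.swap) (simp add: P_def sum_distrib_right)
    finally show ?thesis .
  qed
  have id: "is_ideal k (lideal k S f)"
    using f is_idealD(1)[OF J_ideal] by (intro lideal_is_ideal) blast
  have fS: "mscalar a * f i \<in> lideal k S f" if "i \<in> S" for i a
    using is_idealD(4)[OF id lideal_mem[OF S(1) that]] by simp
  have gS: "g b \<in> lideal k S f" for b unfolding g_def by (intro is_ideal_sum[OF id] fS)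
  have "mvar b - h b \<in> lideal k S f" if b: "b \<in> B" for b
  proof -
    \<comment> \<open>The transposed system: its solution recovers the generator of \<open>b\<close>
      as a combination of the \<open>g a\<close>.\<close>
    have "\<exists>y. \<forall>c\<in>B. y c \<in> mcarr {..<k} \<and> (\<Sum>a\<in>B. P a c * y a) = (if c = b then 1 else 0)"
      by (rule mfps_linear_system[OF finB]) (use P in auto)
    then obtain y where y: "\<And>c. c \<in> B \<Longrightarrow> y c \<in> mcarr {..<k}"
      "\<And>c. c \<in> B \<Longrightarrow> (\<Sum>a\<in>B. P a c * y a) = (if c = b then 1 else 0)" by blast
    have "(\<Sum>a\<in>B. y a * g a) = (\<Sum>a\<in>B. \<Sum>c\<in>B. P a c * y a * (mvar c - h c))"
      by (simp add: g sum_distrib_left mult.assoc mult.left_commute)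
    also have "\<dots> = (\<Sum>c\<in>B. (\<Sum>a\<in>B. P a c * y a) * (mvar c - h c))"
      by (subst sum.swap) (simp add: sum_distrib_right)
    also have "\<dots> = (\<Sum>c\<in>B. if c = b then mvar c - h c else 0)"
      by (intro sum.cong refl) (simp add: y(2))
    also have "\<dots> = mvar b - h b" using b finB by simp
    finally have "mvar b - h b = (\<Sum>a\<in>B. y a * g a)" by simp
    then show ?thesis using y(1) is_idealD(4)[OF id gS] by (auto intro!: is_ideal_sum[OF id])
  qed
  then show "J \<subseteq> lideal k S f" unfolding J by (intro lideal_subset[OF id])
qed

text \<open>The distinguished generators are combinations of the \<open>f i\<close>, so their
  independent differentials lie in the span of equally many differentials.\<close>

lemma generators_indep:
  assumes S: "finite S" "card S = card B" and f: "lideal k S f = J"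
  shows "indep S (\<lambda>i. dcov k (f i))"
proof (rule indep_exchange[OF S(1) finB S(2) indep_u _ finite_lessThan[of k]])
  have f0: "mconst (f i) = 0" if "i \<in> S" for i
    using J_const lideal_mem[OF S(1) that, of f k] f by blast
  fix b assume "b \<in> B"
  then have "mvar b - h b \<in> lideal k S f" unfolding f J by (rule lideal_mem[OF finB])
  then obtain a where "mvar b - h b = (\<Sum>i\<in>S. a i * f i)" by (elim lidealE)
  then show "dcov k (mvar b - h b) \<in> spn S (\<lambda>i. dcov k (f i))"
    using dcov_lincomb[of S f k a] f0 by (intro spnI[of _ "\<lambda>i. mconst (a i)"]) auto
qed (auto simp: dcov_def)

end

subsection \<open>The conjugation of the doubled space\<close>

definition sw :: "nat \<Rightarrow> nat \<Rightarrow> nat" where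
  "sw N i = (if i < N then N + i else i - N)"

lemma sw: "i < 2 * N \<Longrightarrow> sw N i < 2 * N" "i < 2 * N \<Longrightarrow> sw N (sw N i) = i" "i < N \<Longrightarrow> sw N i = N + i"
  "sw N (N + i) = i"
  by (auto simp: sw_def)

lemma sigma_eq: "f \<in> mcarr {..<2 * N} \<Longrightarrow> sigma N f = msub (\<lambda>i. mvar (sw N i)) (mcnj f)"
  unfolding sigma_def msubst_eq_msub by (rule msub_cong[of "{..<2 * N}"]) (auto simp: zconst_def sw_def)

context
  fixes N :: nat
begin

lemma sw_z: "zconst A (\<lambda>i. mvar (sw N i))" by (simp add: zconst_def)

lemma sigma_add: "f \<in> mcarr {..<2 * N} \<Longrightarrow> g \<in> mcarr {..<2 * N} \<Longrightarrow> sigma N (f + g) = sigma N f + sigma N g"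
  and sigma_diff: "f \<in> mcarr {..<2 * N} \<Longrightarrow> g \<in> mcarr {..<2 * N} \<Longrightarrow> sigma N (f - g) = sigma N f - sigma N g"
  and sigma_mult: "f \<in> mcarr {..<2 * N} \<Longrightarrow> g \<in> mcarr {..<2 * N} \<Longrightarrow> sigma N (f * g) = sigma N f * sigma N g"
  by (simp_all add: sigma_eq msub_add[OF _ sw_z, of "{..<2 * N}"] msub_mult[OF _ sw_z, of "{..<2 * N}"]
      msub_diff[OF _ sw_z, of "{..<2 * N}"])

lemma sigma_0: "sigma N 0 = 0"
  by (simp add: sigma_eq msub_0[OF _ sw_z, of "{..<2 * N}"])

lemma sigma_sum: "(\<And>x. x \<in> S \<Longrightarrow> F x \<in> mcarr {..<2 * N}) \<Longrightarrow> sigma N (sum F S) = (\<Sum>x\<in>S. sigma N (F x))"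
  by (induction S rule: infinite_finite_induct) (auto simp: sigma_0 sigma_add mcarr_sum)

lemma sigma_mscalar: "sigma N (mscalar c) = mscalar (cnj c)"
  by (simp add: sigma_eq msub_mscalar[OF _ sw_z, of "{..<2 * N}"])

lemma sigma_carr: assumes "f \<in> mcarr {..<2 * N}" shows "sigma N f \<in> mcarr {..<2 * N}"
  unfolding sigma_eq[OF assms]
  by (rule mcarr_msub[OF _ sw_z mcarr_mcnj[OF assms]]) (auto simp: sw intro: mcarr_mvar)

lemma sigma_carr_Z: assumes "f \<in> mcarr {..<N}" shows "sigma N f \<in> mcarr {N..<2 * N}"
proof -
  have "f \<in> mcarr {..<2 * N}" by (rule mcarr_mono[OF assms]) auto
  from sigma_eq[OF this] show ?thesis
    by (simp only:) (rule mcarr_msub[OF _ sw_z mcarr_mcnj[OF assms]], auto simp: sw intro!: mcarr_mvar)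
qed

lemma mconst_sigma: "f \<in> mcarr {..<2 * N} \<Longrightarrow> mconst (sigma N f) = cnj (mconst f)"
  by (simp add: sigma_eq mconst_msub[OF _ sw_z, of "{..<2 * N}"])

lemma sigma_sigma: assumes f: "f \<in> mcarr {..<2 * N}" shows "sigma N (sigma N f) = f"
proof -
  have "sigma N (sigma N f) = msub (\<lambda>i. mvar (sw N i)) (mcnj (msub (\<lambda>i. mvar (sw N i)) (mcnj f)))"
    using sigma_carr[OF f] by (simp add: sigma_eq f)
  also have "mcnj (msub (\<lambda>i. mvar (sw N i)) (mcnj f)) = msub (\<lambda>i. mvar (sw N i)) f"
    by (subst mcnj_msub[OF _ mcarr_mcnj[OF f] sw_z]) auto
  also have "msub (\<lambda>i. mvar (sw N i)) \<dots> = msub (\<lambda>i. msub (\<lambda>i. mvar (sw N i)) (mvar (sw N i))) f"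
    by (rule msub_msub[OF _ f _ sw_z, of "{..<2 * N}"]) (auto simp: sw zconst_def intro: mcarr_mvar)
  also have "\<dots> = f"
    by (rule msub_id[OF _ f]) (auto simp: sw msub_mvar[OF _ sw_z, of "{..<2 * N}"])
  finally show ?thesis .
qed

lemma mderiv_sigma:
  assumes f: "f \<in> mcarr {..<2 * N}" and j: "j < 2 * N"
  shows "mderiv j (sigma N f) = sigma N (mderiv (sw N j) f)"
proof -
  have "mderiv j (sigma N f) = (\<Sum>i<2 * N. msub (\<lambda>i. mvar (sw N i)) (mderiv i (mcnj f)) * (if j = sw N i then 1 else 0))"
    unfolding sigma_eq[OF f] by (subst mderiv_msub[OF _ sw_z mcarr_mcnj[OF f]]) (auto simp: mderiv_mvar)
  also have "\<dots> = (\<Sum>i<2 * N. if i = sw N j then msub (\<lambda>i. mvar (sw N i)) (mderiv i (mcnj f)) else 0)"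
    using j sw by (intro sum.cong) (auto simp: sw_def split: if_splits)
  also have "\<dots> = sigma N (mderiv (sw N j) f)"
    using j by (simp add: sw sigma_eq f)
  finally show ?thesis .
qed

text \<open>The coordinate form of the derivation \<sigma> X \<sigma>; it exchanges (1,0)- and
  (0,1)-fields.\<close>

definition vsigma :: "complex mfps vec \<Rightarrow> complex mfps vec" where
  "vsigma X = vec (2 * N) (\<lambda>i. sigma N (X $ sw N i))"

lemma vsigma_field: "vector_field (2 * N) X \<Longrightarrow> vector_field (2 * N) (vsigma X)"
  by (rule vector_fieldI) (auto simp: vsigma_def vector_fieldD sw sigma_carr)

lemma vsigma_vsigma: "vector_field (2 * N) X \<Longrightarrow> vsigma (vsigma X) = X"
  by (rule eq_vecI) (auto simp: vsigma_def vector_fieldD sw sigma_sigma)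

lemma vf_apply_sigma:
  assumes X: "vector_field (2 * N) X" and f: "f \<in> mcarr {..<2 * N}"
  shows "vf_apply (vsigma X) (sigma N f) = sigma N (vf_apply X f)"
proof -
  have "sigma N (vf_apply X f) = (\<Sum>j<2 * N. sigma N (X $ j) * sigma N (mderiv j f))"
    unfolding vf_apply_def vector_fieldD(1)[OF X]
    by (subst sigma_sum) (use X f in \<open>auto simp: vector_fieldD sigma_mult\<close>)
  also have "\<dots> = (\<Sum>j<2 * N. sigma N (X $ sw N j) * sigma N (mderiv (sw N j) f))"
    by (rule sum.reindex_bij_witness[of _ "sw N" "sw N"]) (auto simp: sw)
  also have "\<dots> = vf_apply (vsigma X) (sigma N f)"
    by (simp add: vf_apply_def vsigma_def mderiv_sigma f)
  finally show ?thesis by simp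
qed

lemma vsigma_add: "vector_field (2 * N) X \<Longrightarrow> vector_field (2 * N) Y \<Longrightarrow> vsigma (X + Y) = vsigma X + vsigma Y"
  by (rule eq_vecI) (auto simp: vsigma_def vector_fieldD sw sigma_add)

lemma vsigma_scale: "vector_field (2 * N) X \<Longrightarrow> vsigma (mscalar c \<cdot>\<^sub>v X) = mscalar (cnj c) \<cdot>\<^sub>v vsigma X"
  by (rule eq_vecI) (auto simp: vsigma_def vector_fieldD sw sigma_mult sigma_mscalar)

lemma vsigma_zero: "vsigma (0\<^sub>v (2 * N)) = 0\<^sub>v (2 * N)"
  by (rule eq_vecI) (auto simp: vsigma_def sw sigma_0)

lemma vsigma_bracket:
  assumes "vector_field (2 * N) X" "vector_field (2 * N) Y"
  shows "vsigma (lie_bracket X Y) = lie_bracket (vsigma X) (vsigma Y)"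
proof (rule eq_vecI)
  fix i assume "i < dim_vec (lie_bracket (vsigma X) (vsigma Y))"
  then have i: "i < 2 * N" by (simp add: lie_bracket_def vsigma_def)
  have s: "sw N i < 2 * N" using i by (rule sw)
  have c: "X $ sw N i \<in> mcarr {..<2 * N}" "Y $ sw N i \<in> mcarr {..<2 * N}"
    using assms s by (auto simp: vector_fieldD)
  have "vsigma (lie_bracket X Y) $ i = sigma N (vf_apply X (Y $ sw N i)) - sigma N (vf_apply Y (X $ sw N i))"
    using i s assms c by (simp add: vsigma_def lie_bracket_def vector_fieldD(1) sigma_diff vf_apply_carr)
  also have "\<dots> = vf_apply (vsigma X) (vsigma Y $ i) - vf_apply (vsigma Y) (vsigma X $ i)"
    using i by (simp add: vf_apply_sigma[OF assms(1) c(2), symmetric] vf_apply_sigma[OF assms(2) c(1), symmetric]) (simp add: vsigma_def)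
  finally show "vsigma (lie_bracket X Y) $ i = lie_bracket (vsigma X) (vsigma Y) $ i"
    using i by (simp add: lie_bracket_def vsigma_def)
qed (simp add: vsigma_def lie_bracket_def)

end

subsection \<open>Generic manifolds\<close>

text \<open>Generators normalized so that their Jacobian matrix in the variables \<open>B\<close> is
  the identity at the origin. Genericity is what allows \<open>B\<close> to be chosen among the
  Z-variables.\<close>

locale generic_normal =
  fixes N d :: nat and M :: "complex mfps set" and B :: "nat set" and r :: "nat \<Rightarrow> complex mfps"
  assumes M_ideal: "is_ideal (2 * N) M" and M_const: "\<And>f. f \<in> M \<Longrightarrow> mconst f = 0"
    and M_sigma: "\<And>f. f \<in> M \<Longrightarrow> sigma N f \<in> M"
    and B: "B \<subseteq> {..<N}" "card B = d"
    and r: "\<And>b. b \<in> B \<Longrightarrow> r b \<in> M"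
    and r_delta: "\<And>b c. b \<in> B \<Longrightarrow> c \<in> B \<Longrightarrow> mconst (mderiv c (r b)) = (if b = c then 1 else 0)"
    and M_r: "M = lideal (2 * N) B r"

section \<open>Normalized generators and the Lie algebra of a generic manifold\<close>

text \<open>With full rank the columns span all unit vectors, while a relation between the rows
  annihilates every column.\<close>

lemma full_rank_rows_indep:
  fixes A :: "'k::field mat"
  assumes "vec_space.rank (dim_row A) A = dim_row A"
  shows "indep {..<dim_row A} (\<lambda>i j. if j < dim_col A then A $$ (i, j) else 0)"
proof -
  define U where "U = {v :: nat \<Rightarrow> 'k. \<forall>i. i \<notin> {..<dim_row A} \<longrightarrow> v i = 0}"
  define e where "e l = (\<lambda>i :: nat. if i = l then 1 else 0 :: 'k)" for l
  have eU: "e l \<in> U" if "l \<in> {..<dim_row A}" for l using that by (auto simp: U_def e_def)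
  have "pivot_basis U {..<dim_row A} e"
  proof (rule pivot_basisI)
    fix v i assume "v \<in> U"
    then show "v i = (\<Sum>a<dim_row A. v a * e a i)"
      by (simp add: U_def e_def if_distrib[of "\<lambda>x. _ * x"] cong: if_cong)
  qed (use eU in \<open>auto simp: e_def\<close>)
  then have U: "hasdim U (dim_row A)" by (auto simp: hasdim_def)
  have "lsub U" by (rule lsubI) (auto simp: U_def)
  moreover have "spn {..<dim_col A} (colf A) \<subseteq> U"
    by (rule spn_subset[OF \<open>lsub U\<close>]) (auto simp: U_def colf_def)
  ultimately have eq: "spn {..<dim_col A} (colf A) = U"
    using hasdim_eq[OF _ U _ lsub_spn] hasdim_rank[of A] assms by simp
  show ?thesis unfolding indep_def
  proof (intro allI impI ballI)
    fix c l assume 0: "\<forall>j. (\<Sum>i<dim_row A. c i * (if j < dim_col A then A $$ (i, j) else 0)) = 0"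
      and l: "l \<in> {..<dim_row A}"
    have "e l \<in> spn {..<dim_col A} (colf A)" using eU[OF l] eq by simp
    then obtain a where a: "e l = (\<lambda>i. \<Sum>j<dim_col A. a j * colf A j i)" by (elim spnE)
    have "c l = (\<Sum>i<dim_row A. c i * e l i)"
      using l by (simp add: e_def if_distrib[of "\<lambda>x. _ * x"] cong: if_cong)
    also have "\<dots> = (\<Sum>i<dim_row A. \<Sum>j<dim_col A. a j * (c i * A $$ (i, j)))"
      by (intro sum.cong refl) (simp add: a colf_def sum_distrib_left mult.left_commute)
    also have "\<dots> = (\<Sum>j<dim_col A. a j * (\<Sum>i<dim_row A. c i * A $$ (i, j)))"
      by (subst sum.swap) (simp add: sum_distrib_left)
    also have "\<dots> = 0"
    proof (rule sum.neutral, rule ballI)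
      fix j assume "j \<in> {..<dim_col A}"
      then show "a j * (\<Sum>i<dim_row A. c i * A $$ (i, j)) = 0" using spec[OF 0, of j] by simp
    qed
    finally show "c l = 0" .
  qed
qed

text \<open>A reduced basis of the row space of \<partial>\<rho>/\<partial>Z at the origin selects
  \<open>B\<close> and the constant combinations \<open>r\<close> of the generators. These
  combinations are invertible, so the ideal is the same.\<close>

lemma generic_normal_exists:
  assumes "generic_manifold N d M"
  obtains B r where "generic_normal N d M B r"
proof -
  from assms obtain \<rho> where \<rho>: "generators (2 * N) d M \<rho>" "rank_at_0 (jacobian 0 N \<rho>) = d"
    and M: "ideal M (mfps_ring (2 * N))" "\<forall>f\<in>M. mconst f = 0" "sigma N ` M \<subseteq> M"
    by (auto simp: generic_manifold_def real_manifold_def manifold_ideal_def)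
  have I: "is_ideal (2 * N) M" using M(1) by (simp add: ideal_iff)
  have \<rho>': "\<rho> \<in> carrier_vec d" "M = lideal (2 * N) {..<d} (($) \<rho>)" using \<rho>(1) by (auto simp: generators_iff)
  have \<rho>M: "\<rho> $ i \<in> M" if "i < d" for i unfolding \<rho>'(2) using that by (intro lideal_mem) auto
  let ?A = "map_mat mconst (jacobian 0 N \<rho>)"
  define w where "w i j = (if j < N then mconst (mderiv j (\<rho> $ i)) else 0)" for i j
  have dA: "dim_row ?A = d" "dim_col ?A = N" using \<rho>' by (auto simp: jacobian_def)
  have "indep {..<d} (\<lambda>i j. if j < N then ?A $$ (i, j) else 0)"
    using full_rank_rows_indep[of ?A] \<rho>(2) \<rho>'(1) unfolding dA by (simp add: rank_at_0_def jacobian_def)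
  also have "?this \<longleftrightarrow> indep {..<d} w"
    using \<rho>'(1) unfolding indep_def by (intro all_cong1 imp_cong refl arg_cong2[of _ _ _ _ "(=)"] sum.cong)
      (auto simp: w_def jacobian_def simp del: mderiv.rep_eq)
  finally have iw: "indep {..<d} w" .
  have wN: "w i j = 0" if "j \<notin> {..<N}" for i j using that by (simp add: w_def)
  have dim: "hasdim (spn {..<d} w) d" using hasdim_spn_indep[OF _ finite_lessThan[of N] _ iw] wN by simp
  have "v = (\<lambda>_. 0)" if "v \<in> spn {..<d} w" "\<forall>x\<in>{..<N}. v x = 0" for v
  proof
    fix j show "v j = 0" using that wN by (cases "j < N") (auto elim!: spnE)
  qed
  then obtain B E where BE: "B \<subseteq> {..<N}" "pivot_basis (spn {..<d} w) B E"
    using pivot_basis_exists[OF finite_lessThan[of N] lsub_spn] by blast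
  note finB = pivot_basisD(1)[OF BE(2)]
  have cardB: "card B = d" using hasdim_unique[OF dim, of "card B"] BE(2) by (auto simp: hasdim_def)
  have "\<forall>b\<in>B. \<exists>c. E b = (\<lambda>j. \<Sum>i<d. c i * w i j)" using pivot_basisD(2)[OF BE(2)] by (auto simp: spn_def)
  then obtain C where C: "\<And>b. b \<in> B \<Longrightarrow> E b = (\<lambda>j. \<Sum>i<d. C b i * w i j)" by metis
  define r where "r b = (\<Sum>i<d. mscalar (C b i) * \<rho> $ i)" for b
  have rM: "r b \<in> M" for b unfolding r_def using \<rho>M is_idealD(4)[OF I] by (intro is_ideal_sum[OF I]) auto
  have rd: "mconst (mderiv c (r b)) = (if b = c then 1 else 0)" if "b \<in> B" "c \<in> B" for b c
  proof -
    have "c < N" using that BE(1) by auto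
    then have "mconst (mderiv c (r b)) = (\<Sum>i<d. C b i * w i c)"
      using \<rho>M M(2) by (simp add: r_def mderiv_sum mcoeff_sum mconst_mderiv_mult w_def del: mderiv.rep_eq)
    also have "\<dots> = E b c" using C[OF that(1)] by simp
    finally show ?thesis using pivot_basisD(3)[OF BE(2) that] by simp
  qed
  \<comment> \<open>Independence of the rows of \<open>w\<close> turns an identity of row vectors
    into an identity of coefficients, which inverts the combinations defining
    \<open>r\<close>.\<close>
  have \<rho>r: "\<rho> $ i = (\<Sum>b\<in>B. mscalar (w i b) * r b)" if i: "i < d" for i
  proof -
    define e where "e l = (\<Sum>b\<in>B. w i b * C b l) - (if l = i then 1 else 0)" for l
    have "(\<Sum>l<d. e l * w l j) = 0" for j
    proof -
      have "(\<Sum>l<d. (\<Sum>b\<in>B. w i b * C b l) * w l j) = (\<Sum>b\<in>B. w i b * (\<Sum>l<d. C b l * w l j))"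
        by (simp only: sum_distrib_right sum_distrib_left mult.assoc) (rule sum.swap)
      also have "\<dots> = (\<Sum>b\<in>B. w i b * E b j)" by (intro sum.cong refl) (simp add: C)
      also have "\<dots> = w i j"
        using i by (intro pivot_basisD(4)[OF BE(2), symmetric] in_spn) auto
      finally show ?thesis
        using i by (simp add: e_def left_diff_distrib sum_subtractf if_distrib[of "\<lambda>x. x * _"] cong: if_cong)
    qed
    then have "\<forall>l\<in>{..<d}. e l = 0" using iw unfolding indep_def by blast
    then have e: "(\<Sum>b\<in>B. w i b * C b l) = (if l = i then 1 else 0)" if "l < d" for l
      using that by (simp add: e_def)
    have "(\<Sum>b\<in>B. mscalar (w i b) * r b) = (\<Sum>l<d. (\<Sum>b\<in>B. mscalar (w i b * C b l)) * \<rho> $ l)"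
      unfolding r_def sum_distrib_left sum_distrib_right
      by (subst sum.swap) (simp add: mscalar_mult mult.assoc)
    also have "\<dots> = (\<Sum>l<d. if l = i then \<rho> $ l else 0)"
    proof (intro sum.cong refl)
      fix l assume "l \<in> {..<d}"
      have "(\<Sum>b\<in>B. mscalar (w i b * C b l)) = mscalar (\<Sum>b\<in>B. w i b * C b l)"
        using finB by (induction rule: finite_induct) (auto simp: mscalar_add)
      then show "(\<Sum>b\<in>B. mscalar (w i b * C b l)) * \<rho> $ l = (if l = i then \<rho> $ l else 0)"
        using e \<open>l \<in> _\<close> by simp
    qed
    finally show ?thesis using i by simp
  qed
  have idr: "is_ideal (2 * N) (lideal (2 * N) B r)" using is_idealD(1)[OF I rM] by (intro lideal_is_ideal)
  have "M = lideal (2 * N) B r"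
  proof
    have "\<rho> $ i \<in> lideal (2 * N) B r" if "i < d" for i
      by (rule lidealI[of _ "\<lambda>b. mscalar (w i b)"]) (use \<rho>r[OF that] in auto)
    then show "M \<subseteq> lideal (2 * N) B r" unfolding \<rho>'(2) by (intro lideal_subset[OF idr]) auto
    show "lideal (2 * N) B r \<subseteq> M" by (rule lideal_subset[OF I rM])
  qed
  then have "generic_normal N d M B r"
    using I M rM rd BE(1) cardB by unfold_locales auto
  then show ?thesis by (rule that)
qed

context generic_normal
begin

lemma finB: "finite B" using B finite_subset by blast

lemma dN: "d \<le> N" using B card_mono[OF finite_lessThan B(1)] by simp

definition rs :: "nat \<Rightarrow> complex mfps" where "rs b = sigma N (r b)"

lemma r_carr: "b \<in> B \<Longrightarrow> r b \<in> mcarr {..<2 * N}" using is_idealD(1)[OF M_ideal r] .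

lemma rs: "b \<in> B \<Longrightarrow> rs b \<in> M" by (simp add: rs_def M_sigma r)

lemma rs_carr: "b \<in> B \<Longrightarrow> rs b \<in> mcarr {..<2 * N}" using is_idealD(1)[OF M_ideal rs] .

lemma rs_delta: assumes "b \<in> B" "c \<in> B" shows "mconst (mderiv (N + c) (rs b)) = (if b = c then 1 else 0)"
proof -
  have "mderiv (N + c) (rs b) = sigma N (mderiv c (r b))"
    unfolding rs_def using mderiv_sigma[OF r_carr[OF assms(1)], of "N + c"] assms(2) B(1) by (auto simp: sw)
  then show ?thesis
    using r_delta[OF assms] r_carr[OF assms(1)] by (simp add: mconst_sigma del: mderiv.rep_eq)
qed

text \<open>Reality: applying \<sigma> to a representation of \<open>sigma N f\<close> by the
  \<open>r b\<close> represents \<open>f\<close> by their conjugates.\<close>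

lemma M_rs: "M = lideal (2 * N) B rs"
proof
  show "lideal (2 * N) B rs \<subseteq> M" by (rule lideal_subset[OF M_ideal rs])
  show "M \<subseteq> lideal (2 * N) B rs"
  proof
    fix f assume f: "f \<in> M"
    have "sigma N f \<in> lideal (2 * N) B r" using M_sigma[OF f] M_r by simp
    then obtain a where a: "\<And>b. b \<in> B \<Longrightarrow> a b \<in> mcarr {..<2 * N}" "sigma N f = (\<Sum>b\<in>B. a b * r b)"
      by (elim lidealE) blast
    have "f = sigma N (\<Sum>b\<in>B. a b * r b)" using sigma_sigma[OF is_idealD(1)[OF M_ideal f]] a(2) by simp
    also have "\<dots> = (\<Sum>b\<in>B. sigma N (a b) * rs b)"
      by (subst sigma_sum) (auto simp: a r_carr sigma_mult rs_def)
    finally show "f \<in> lideal (2 * N) B rs" by (intro lidealI[of _ "\<lambda>b. sigma N (a b)"]) (auto simp: a sigma_carr)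
  qed
qed

text \<open>The \<zeta>-variables that remain free once the equations \<open>rs b = 0\<close> are
  solved for the others.\<close>

definition A1 :: "nat set" where "A1 = {N..<2 * N} - (+) N ` B"

lemma card_A1: "card A1 = N - d"
proof -
  have "(+) N ` B \<subseteq> {N..<2 * N}" using B(1) by auto
  then have "card A1 = card {N..<2 * N} - card ((+) N ` B)"
    unfolding A1_def using finB by (intro card_Diff_subset) auto
  then show ?thesis using B(2) by (simp add: card_image)
qed

abbreviation L :: "complex mfps vec set" where "L \<equiv> lie_algebra N M"

lemma L_field: "X \<in> L \<Longrightarrow> vector_field (2 * N) X"
  unfolding lie_algebra_def
proof (induction rule: lie_algebra_generated.induct)
  case (add X Y)
  then show ?case by (intro vector_fieldI) (auto simp: vector_fieldD)
next
  case (scale X c)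
  then show ?case by (intro vector_fieldI) (auto simp: vector_fieldD)
qed (auto simp: vector_field_01_def vector_field_10_def intro: vector_fieldI lie_bracket_field)

text \<open>Invariance under the generating fields passes to sums, multiples and brackets. It serves
  \<open>M\<close> itself and, in the proof of uniqueness, any other candidate for the orbit
  ideal.\<close>

lemma L_stable:
  assumes I: "is_ideal (2 * N) I"
    and S: "\<And>X. vector_field_01 N X \<or> vector_field_10 N X \<Longrightarrow> tangent X M \<Longrightarrow> tangent X I"
    and X: "X \<in> L" and f: "f \<in> I"
  shows "vf_apply X f \<in> I"
  using X f L_field unfolding lie_algebra_def
proof (induction arbitrary: f rule: lie_algebra_generated.induct)
  case (base X)
  then show ?case using S by (auto simp: tangent_def)
next
  case zero
  then show ?case using is_idealD(2)[OF I] by (simp add: vf_apply_zero_vec)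
next
  case (add X Y)
  then have "dim_vec X = 2 * N" "dim_vec Y = 2 * N" by (auto simp: vector_fieldD(1))
  then show ?case using add is_idealD(3)[OF I] by (simp add: vf_apply_add_vec)
next
  case (scale X c)
  then show ?case using is_idealD(4)[OF I] by (simp add: vf_apply_smult_vec)
next
  case (bracket X Y)
  then have "dim_vec X = 2 * N" "dim_vec Y = 2 * N" by (auto simp: vector_fieldD(1))
  then show ?case using bracket is_idealD(5)[OF I] by (simp add: vf_apply_lie_bracket)
qed

lemma tangent_vsigma:
  assumes X: "vector_field (2 * N) X" and t: "tangent X I" and I: "is_ideal (2 * N) I"
    and s: "\<And>f. f \<in> I \<Longrightarrow> sigma N f \<in> I"
  shows "tangent (vsigma N X) I"
  unfolding tangent_def
proof
  fix f assume f: "f \<in> I"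
  note c = is_idealD(1)[OF I]
  have "vf_apply (vsigma N X) (sigma N (sigma N f)) = sigma N (vf_apply X (sigma N f))"
    using c s f by (intro vf_apply_sigma[OF X]) auto
  then show "vf_apply (vsigma N X) f \<in> I"
    using s[OF f] t s by (simp add: sigma_sigma[OF c[OF f]] tangent_def)
qed

lemma vsigma_01: "vector_field_01 N X \<Longrightarrow> vector_field_10 N (vsigma N X)"
  and vsigma_10: "vector_field_10 N X \<Longrightarrow> vector_field_01 N (vsigma N X)"
  by (auto simp: vector_field_01_def vector_field_10_def vsigma_field) (auto simp: vsigma_def sw_def sigma_0)

lemma vsigma_L: assumes "X \<in> L" shows "vsigma N X \<in> L"
  using assms L_field unfolding lie_algebra_def
proof (induction rule: lie_algebra_generated.induct)
  case (base X)
  then have X: "vector_field_01 N X \<or> vector_field_10 N X" "tangent X M" by auto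
  then have "vector_field (2 * N) X" by (auto simp: vector_field_01_def vector_field_10_def)
  then have "tangent (vsigma N X) M" by (rule tangent_vsigma[OF _ X(2) M_ideal]) (rule M_sigma)
  then show ?case using X(1) vsigma_01 vsigma_10 by (intro lie_algebra_generated.base) blast
next
  case zero
  then show ?case by (simp add: vsigma_zero lie_algebra_generated.zero)
next
  case (add X Y)
  then show ?case by (simp add: vsigma_add lie_algebra_generated.add)
next
  case (scale X c)
  then show ?case by (simp add: vsigma_scale lie_algebra_generated.scale)
next
  case (bracket X Y)
  then show ?case by (simp add: vsigma_bracket lie_algebra_generated.bracket)
qed

text \<open>The CR vector fields that in the coordinates \<open>Z\<close>, \<open>(\<zeta>\<^sub>j)\<^sub>j\<^sub>\<in>\<^sub>A\<^sub>1\<close> of the manifold are \<open>\<partial>/\<partial>\<zeta>\<^sub>j\<close>.\<close>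

lemma CR_fields_exist:
  obtains Y where "\<And>j. j \<in> A1 \<Longrightarrow> vector_field_01 N (Y j)" "\<And>j. j \<in> A1 \<Longrightarrow> tangent (Y j) M"
    "\<And>i j. j \<in> A1 \<Longrightarrow> i \<in> A1 \<Longrightarrow> Y j $ i = (if i = j then 1 else 0)"
proof -
  \<comment> \<open>The components in the directions \<open>N + c\<close> are determined by the
    condition that all \<open>rs b\<close> are annihilated.\<close>
  have "\<forall>j. \<exists>y. \<forall>b\<in>B. y b \<in> mcarr {..<2 * N} \<and> (\<Sum>c\<in>B. mderiv (N + c) (rs b) * y c) = - mderiv j (rs b)"
    using rs_carr rs_delta by (intro allI mfps_linear_system[OF finB]) auto
  then obtain y where y: "\<And>j b. b \<in> B \<Longrightarrow> y j b \<in> mcarr {..<2 * N}"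
    "\<And>j b. b \<in> B \<Longrightarrow> (\<Sum>c\<in>B. mderiv (N + c) (rs b) * y j c) = - mderiv j (rs b)" by metis
  define Y where "Y j = vec (2 * N) (\<lambda>i. if i = j then 1 else if i \<in> (+) N ` B then y j (i - N) else 0)" for j
  have f: "vector_field_01 N (Y j)" if "j \<in> A1" for j
    using that y(1) by (auto simp: vector_field_01_def Y_def A1_def intro!: vector_fieldI)
  have 0: "vf_apply (Y j) (rs b) = 0" if j: "j \<in> A1" and b: "b \<in> B" for j b
  proof -
    have "vf_apply (Y j) (rs b) = (\<Sum>i\<in>insert j ((+) N ` B). Y j $ i * mderiv i (rs b))"
      unfolding vf_apply_def using j B(1) by (intro sum.mono_neutral_right) (auto simp: Y_def A1_def finB)
    also have "\<dots> = mderiv j (rs b) + (\<Sum>c\<in>B. Y j $ (N + c) * mderiv (N + c) (rs b))"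
      using j finB by (subst sum.insert) (auto simp: A1_def Y_def sum.reindex)
    also have "(\<Sum>c\<in>B. Y j $ (N + c) * mderiv (N + c) (rs b)) = (\<Sum>c\<in>B. mderiv (N + c) (rs b) * y j c)"
    proof (intro sum.cong refl)
      fix c assume "c \<in> B"
      then have "c < N" "j \<noteq> N + c" using B(1) j by (auto simp: A1_def)
      then show "Y j $ (N + c) * mderiv (N + c) (rs b) = mderiv (N + c) (rs b) * y j c"
        using \<open>c \<in> B\<close> by (simp add: Y_def mult.commute)
    qed
    finally show ?thesis by (simp add: y(2)[OF b])
  qed
  have t: "tangent (Y j) M" if j: "j \<in> A1" for j
    unfolding tangent_def
  proof
    fix f assume "f \<in> M"
    then have "f \<in> lideal (2 * N) B rs" using M_rs by simp
    then obtain a where a: "\<And>b. b \<in> B \<Longrightarrow> a b \<in> mcarr {..<2 * N}" "f = (\<Sum>b\<in>B. a b * rs b)"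
      by (elim lidealE) blast
    have "vf_apply (Y j) f = (\<Sum>b\<in>B. vf_apply (Y j) (a b) * rs b)"
      unfolding a(2) vf_apply_sum by (intro sum.cong refl) (simp add: vf_apply_mult 0 j)
    moreover have "vf_apply (Y j) (a b) \<in> mcarr {..<2 * N}" if "b \<in> B" for b
      using f[OF j] a(1)[OF that] by (intro vf_apply_carr) (auto simp: vector_field_01_def)
    ultimately show "vf_apply (Y j) f \<in> M"
      using is_idealD(4)[OF M_ideal rs] by (auto intro!: is_ideal_sum[OF M_ideal])
  qed
  show ?thesis by (rule that[of Y]) (use f t in \<open>auto simp: Y_def A1_def\<close>)
qed

end

subsection \<open>The orbit of the CR and anti-CR vector fields\<close>

text \<open>Interface between the construction of the orbit and its use. \<open>J_max\<close> yields
  \<sigma>-invariance and uniqueness without returning to iterated derivatives; the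
  \<open>F c\<close> are equations in Z alone, in the number required by
  \<open>card C + d = card BJ\<close>.\<close>

locale formal_orbit = generic_normal N d M B r + gi: graph_ideal "2 * N" BJ h J
  for N d :: nat and M :: "complex mfps set" and B :: "nat set" and r :: "nat \<Rightarrow> complex mfps"
    and BJ :: "nat set" and h :: "nat \<Rightarrow> complex mfps" and J :: "complex mfps set" +
  fixes g :: nat and A C :: "nat set" and X :: "nat \<Rightarrow> complex mfps vec" and F :: "nat \<Rightarrow> complex mfps"
  assumes card_BJ: "card BJ + g = 2 * N" and g: "g = lie_algebra_dim N M"
    and J_L: "\<And>Y f. Y \<in> L \<Longrightarrow> f \<in> J \<Longrightarrow> vf_apply Y f \<in> J"
    and J_max: "\<And>I. is_ideal (2 * N) I \<Longrightarrow> (\<And>f. f \<in> I \<Longrightarrow> mconst f = 0) \<Longrightarrow>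
       (\<And>Y f. Y \<in> L \<Longrightarrow> f \<in> I \<Longrightarrow> vf_apply Y f \<in> I) \<Longrightarrow> I \<subseteq> J"
    and C: "C \<subseteq> {..<N}" "card C + d = card BJ"
    and F: "\<And>c. c \<in> C \<Longrightarrow> F c \<in> J" "\<And>c. c \<in> C \<Longrightarrow> F c \<in> mcarr {..<N}"
    and F_delta: "\<And>b c. b \<in> C \<Longrightarrow> c \<in> C \<Longrightarrow> mconst (mderiv c (F b)) = (if b = c then 1 else 0)"
    and A: "A \<subseteq> {..<2 * N}" "card A = g" and X: "\<And>a. a \<in> A \<Longrightarrow> X a \<in> L"
    and X_delta: "\<And>a b. a \<in> A \<Longrightarrow> b \<in> A \<Longrightarrow> mconst (X a $ b) = (if a = b then 1 else 0)"

text \<open>A monomial with a variable of \<open>S\<close> would survive differentiation by it,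
  since its exponent is nonzero in the complex numbers.\<close>

lemma mcarr_diff_if_mderiv_0:
  fixes f :: "complex mfps"
  assumes "f \<in> mcarr A" "\<And>j. j \<in> S \<Longrightarrow> mderiv j f = 0" shows "f \<in> mcarr (A - S)"
proof (rule mcarrI)
  fix m assume m: "\<not> set_mset m \<subseteq> A - S"
  show "mcoeff f m = 0"
  proof (cases "set_mset m \<subseteq> A")
    case True
    then obtain j where j: "j \<in># m" "j \<in> S" using m by auto
    then have m': "add_mset j (m - {#j#}) = m" by simp
    have "mcoeff (mderiv j f) (m - {#j#}) = 0" using assms(2)[OF j(2)] by (simp add: mcoeff_simps)
    then show ?thesis unfolding mderiv.rep_eq m' by (simp del: of_nat_Suc)
  qed (use assms(1) mcarrD in blast)
qed

text \<open>The CR fields \<open>Y j\<close> supply the pivots \<open>A1\<close> of \<gg>(0). Values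
  that vanish at \<open>A1\<close> are determined by their Z-components, which supply the pivots
  \<open>A2\<close>. For the Z-variables outside \<open>A2\<close> the graph functions are constant
  along the \<open>Y j\<close>, hence series in Z alone.\<close>

lemma (in generic_normal) formal_orbit_exists:
  obtains BJ h J A C X F where "formal_orbit N d M B r BJ h J (lie_algebra_dim N M) A C X F"
proof -
  define val where "val X = vecf (map_vec mconst X)" for X :: "complex mfps vec"
  have val: "val X i = (if i < 2 * N then mconst (X $ i) else 0)" if "X \<in> L" for X i
    using vector_fieldD(1)[OF L_field[OF that]] by (auto simp: val_def vecf_def)
  define V where "V = val ` L"
  have lsV: "lsub V"
  proof (rule lsubI)
    have z: "0\<^sub>v (2 * N) \<in> L" unfolding lie_algebra_def by (rule lie_algebra_generated.zero)
    have "(\<lambda>_. 0) = val (0\<^sub>v (2 * N))" by (rule ext) (simp add: val[OF z])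
    then show "(\<lambda>_. 0) \<in> V" using z by (simp add: V_def)
    fix v w c assume "v \<in> V" "w \<in> V"
    then obtain X Y where XY: "X \<in> L" "Y \<in> L" "v = val X" "w = val Y" by (auto simp: V_def)
    have in_L: "X + mscalar c \<cdot>\<^sub>v Y \<in> L" using XY unfolding lie_algebra_def
      by (intro lie_algebra_generated.add lie_algebra_generated.scale)
    have dims: "dim_vec X = 2 * N" "dim_vec Y = 2 * N" using XY L_field vector_fieldD(1) by auto
    have "(\<lambda>i. v i + c * w i) = val (X + mscalar c \<cdot>\<^sub>v Y)"
      using dims by (intro ext) (simp add: XY(3,4) val[OF in_L] val[OF XY(1)] val[OF XY(2)])
    then show "(\<lambda>i. v i + c * w i) \<in> V" using in_L by (simp add: V_def)
  qed
  have LM: "vf_apply X f \<in> M" if "X \<in> L" "f \<in> M" for X f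
    by (rule L_stable[OF M_ideal _ that])
  \<comment> \<open>The ideal \<open>M\<close> is invariant under \<gg>, so every value at the
    origin satisfies the linearized equations of the manifold.\<close>
  have V_rs: "(\<Sum>i<2 * N. v i * mconst (mderiv i (rs b))) = 0" if v: "v \<in> V" and b: "b \<in> B" for v b
  proof -
    obtain X where X: "X \<in> L" "v = val X" using v by (auto simp: V_def)
    have "mconst (vf_apply X (rs b)) = 0" using M_const[OF LM[OF X(1) rs[OF b]]] .
    then show ?thesis
      using vector_fieldD(1)[OF L_field[OF X(1)]] by (simp add: vf_apply_def X(2) val[OF X(1)] del: mderiv.rep_eq)
  qed
  obtain Y where Y: "\<And>j. j \<in> A1 \<Longrightarrow> vector_field_01 N (Y j)" "\<And>j. j \<in> A1 \<Longrightarrow> tangent (Y j) M"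
    "\<And>i j. j \<in> A1 \<Longrightarrow> i \<in> A1 \<Longrightarrow> Y j $ i = (if i = j then 1 else 0)"
    by (rule CR_fields_exist) blast
  have YL: "Y j \<in> L" if "j \<in> A1" for j
    unfolding lie_algebra_def using Y that by (intro lie_algebra_generated.base) auto
  have YZ: "Y j $ i = 0" if "j \<in> A1" "i < N" for i j using Y(1)[OF that(1)] that(2) by (simp add: vector_field_01_def)
  define V0 where "V0 = {v\<in>V. \<forall>j\<in>A1. v j = 0}"
  have lsV0: "lsub V0"
  proof (rule lsubI)
    show "(\<lambda>_. 0) \<in> V0" using lsV by (simp add: V0_def lsub_def)
    show "(\<lambda>i. v i + c * w i) \<in> V0" if "v \<in> V0" "w \<in> V0" for v w c
      using that lsubD[OF lsV] by (simp add: V0_def)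
  qed
  \<comment> \<open>Only the components \<open>N + b\<close> are left, and the linearized equations
    \<open>rs b\<close> make them zero.\<close>
  have V0_inj: "v = (\<lambda>_. 0)" if v: "v \<in> V0" "\<forall>x\<in>{..<N}. v x = 0" for v
  proof
    fix i
    have out: "v i = 0" if "i \<notin> (+) N ` B" for i
    proof (cases "i < 2 * N")
      case True
      then show ?thesis using v that by (cases "i < N") (auto simp: V0_def A1_def)
    next
      case False
      then show ?thesis using v by (auto simp: V0_def V_def val)
    qed
    have "v (N + b) = 0" if b: "b \<in> B" for b
    proof -
      have "0 = (\<Sum>i<2 * N. v i * mconst (mderiv i (rs b)))" using V_rs[of v b] v(1) b by (simp add: V0_def)
      also have "\<dots> = (\<Sum>i\<in>(+) N ` B. v i * mconst (mderiv i (rs b)))"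
        using B(1) out by (intro sum.mono_neutral_right) auto
      also have "\<dots> = (\<Sum>c\<in>B. if b = c then v (N + c) else 0)"
        using b by (subst sum.reindex) (auto simp: rs_delta simp del: mderiv.rep_eq intro!: sum.cong)
      also have "\<dots> = v (N + b)" using b finB by simp
      finally show ?thesis by simp
    qed
    then show "v i = 0" using out by (cases "i \<in> (+) N ` B") auto
  qed
  obtain A2 E where A2: "A2 \<subseteq> {..<N}" "pivot_basis V0 A2 E"
    using pivot_basis_exists[OF finite_lessThan[of N] lsV0] V0_inj by blast
  have "\<forall>a\<in>A2. \<exists>X\<in>L. E a = val X" using pivot_basisD(2)[OF A2(2)] by (auto simp: V0_def V_def)
  then obtain Z where Z: "\<And>a. a \<in> A2 \<Longrightarrow> Z a \<in> L" "\<And>a. a \<in> A2 \<Longrightarrow> E a = val (Z a)" by metis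
  define X where "X a = (if a \<in> A1 then Y a else Z a)" for a
  define A where "A = A1 \<union> A2"
  have disj: "A1 \<inter> A2 = {}" using A2(1) by (auto simp: A1_def)
  have A1: "A1 \<subseteq> {N..<2 * N}" by (auto simp: A1_def)
  have Asub: "A \<subseteq> {..<2 * N}" using A2(1) A1 by (auto simp: A_def)
  have finA: "finite A1" "finite A2" using A1 A2(1) finite_subset by blast+
  have XL: "X a \<in> L" if "a \<in> A" for a using that YL Z(1) by (auto simp: X_def A_def)
  have Xd: "mconst (X a $ b) = (if a = b then 1 else 0)" if ab: "a \<in> A" "b \<in> A" for a b
  proof (cases "a \<in> A1")
    case True
    then show ?thesis using ab(2) Y(3) YZ A2(1) disj by (auto simp: X_def A_def)
  next
    case False
    then have a: "a \<in> A2" using ab by (simp add: A_def)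
    have "mconst (Z a $ b) = E a b" using Z a ab(2) Asub val by auto
    also have "\<dots> = (if a = b then 1 else 0)"
      using a pivot_basisD(2,3)[OF A2(2)] ab(2) disj by (auto simp: A_def V0_def)
    finally show ?thesis using False by (simp add: X_def)
  qed
  have pb: "pivot_basis V A (\<lambda>a. val (X a))"
  proof (rule pivot_basisI)
    show "val (X a) b = (if a = b then 1 else 0)" if "a \<in> A" "b \<in> A" for a b
      using Xd[OF that] val[OF XL[OF that(1)], of b] that(2) Asub by auto
    fix v i assume v: "v \<in> V"
    define v' where "v' i = v i - (\<Sum>j\<in>A1. v j * val (Y j) i)" for i
    have "(\<lambda>i. v i + (- 1) * (\<Sum>j\<in>A1. v j * val (Y j) i)) \<in> V"
      using YL by (intro lsubD[OF lsV v] lsub_sum[OF lsV finA(1)]) (auto simp: V_def)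
    then have v'V: "v' \<in> V" by (simp add: v'_def[abs_def])
    have v'A1: "v' c = 0" if c: "c \<in> A1" for c
    proof -
      have "(\<Sum>j\<in>A1. v j * val (Y j) c) = (\<Sum>j\<in>A1. if c = j then v j else 0)"
        using c A1 by (intro sum.cong refl) (auto simp: val[OF YL] Y(3))
      then show ?thesis using c finA by (simp add: v'_def)
    qed
    have v'A2: "v' a = v a" if a: "a \<in> A2" for a
    proof -
      have "(\<Sum>j\<in>A1. v j * val (Y j) a) = 0"
        using a A2(1) by (intro sum.neutral ballI) (auto simp: val[OF YL] YZ)
      then show ?thesis by (simp add: v'_def)
    qed
    have "v' i = (\<Sum>a\<in>A2. v' a * E a i)"
      using v'V v'A1 by (intro pivot_basisD(4)[OF A2(2)]) (simp add: V0_def)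
    also have "\<dots> = (\<Sum>a\<in>A2. v a * E a i)" using v'A2 by simp
    finally have "v i = (\<Sum>j\<in>A1. v j * val (Y j) i) + (\<Sum>a\<in>A2. v a * E a i)"
      by (simp add: v'_def algebra_simps)
    also have "\<dots> = (\<Sum>j\<in>A1. v j * val (X j) i) + (\<Sum>a\<in>A2. v a * val (X a) i)"
      using disj by (intro arg_cong2[of _ _ _ _ "(+)"] sum.cong refl) (auto simp: X_def Z(2))
    finally show "v i = (\<Sum>a\<in>A. v a * val (X a) i)"
      using finA disj by (simp add: A_def sum.union_disjoint)
  qed (use finA XL in \<open>auto simp: A_def V_def\<close>)
  have g: "lie_algebra_dim N M = card A"
    unfolding lie_algebra_dim_def
  proof (rule dim_subspace_eq)
    show "map_vec mconst ` L \<subseteq> carrier_vec (2 * N)" using L_field vector_fieldD(2) by fastforce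
    have "vecf ` map_vec mconst ` L = V" by (simp add: V_def val_def image_image)
    then show "lsub (vecf ` map_vec mconst ` L)" "hasdim (vecf ` map_vec mconst ` L) (card A)"
      using lsV pb by (auto simp: hasdim_def)
  qed
  interpret O: orbit_ideal "2 * N" L A X
  proof
    show "lie_bracket Y Z \<in> L" if "Y \<in> L" "Z \<in> L" for Y Z
      using that unfolding lie_algebra_def by (rule lie_algebra_generated.bracket)
    show "mconst (Y $ i) = (\<Sum>a\<in>A. mconst (Y $ a) * mconst (X a $ i))" if "Y \<in> L" "i < 2 * N" for Y i
    proof -
      have "val Y i = (\<Sum>a\<in>A. val Y a * val (X a) i)" using that by (intro pivot_basisD(4)[OF pb]) (simp add: V_def)
      also have "\<dots> = (\<Sum>a\<in>A. mconst (Y $ a) * mconst (X a $ i))"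
        using that Asub by (intro sum.cong refl) (auto simp: val XL)
      finally show ?thesis using that by (simp add: val)
    qed
  qed (use Asub L_field XL Xd in auto)
  let ?J = O.J and ?B = "{..<2 * N} - A"
  have J_ideal: "is_ideal (2 * N) ?J"
    using O.J_carr O.J_zero O.J_add O.J_mult by (auto simp: is_ideal_def)
  obtain h where h: "\<And>b. b \<in> ?B \<Longrightarrow> h b \<in> mcarr A \<and> mconst (h b) = 0 \<and> mvar b - h b \<in> ?J"
    "\<And>f. f \<in> ?J \<Longrightarrow> \<exists>Q. (\<forall>b\<in>?B. Q b \<in> mcarr {..<2 * N}) \<and> f = (\<Sum>b\<in>?B. Q b * (mvar b - h b))"
    by (rule O.J_graph) blast
  have BA: "{..<2 * N} - ?B = A" using Asub by auto
  define C where "C = {..<N} - A2"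
  have CB: "C \<subseteq> ?B" using A1 by (auto simp: C_def A_def)
  \<comment> \<open>Applying \<open>Y j\<close> to the member \<open>mvar c - h c\<close> of
    \<open>J\<close> leaves minus the derivative of \<open>h c\<close> in direction
    \<open>j\<close>. This lies in \<open>J\<close> and depends on \<open>A\<close> only, so it is
    zero.\<close>
  have hC: "h c \<in> mcarr A2" if c: "c \<in> C" for c
  proof -
    have "mderiv j (h c) = 0" if j: "j \<in> A1" for j
    proof -
      have hA: "h c \<in> mcarr A" using h(1) c CB by auto
      have dim: "dim_vec (Y j) = 2 * N" using L_field[OF YL[OF j]] vector_fieldD(1) by simp
      have "vf_apply (Y j) (h c) = (\<Sum>i\<in>A. Y j $ i * mderiv i (h c))"
        unfolding vf_apply_def dim using Asub mderiv_notin[OF hA] by (intro sum.mono_neutral_right) auto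
      also have "\<dots> = (\<Sum>i\<in>A. if i = j then mderiv i (h c) else 0)"
        using j Y(3) YZ A2(1) disj by (intro sum.cong refl) (auto simp: A_def)
      also have "\<dots> = mderiv j (h c)" using j finA by (simp add: A_def)
      finally have "vf_apply (Y j) (mvar c - h c) = - mderiv j (h c)"
        using c j YZ dim by (simp add: vf_apply_diff vf_apply_mvar C_def)
      then have "- mderiv j (h c) \<in> ?J" using O.J_vf[OF _ YL[OF j]] h(1) c CB by (metis subsetD)
      then have "- mderiv j (h c) = 0" by (rule O.J_Int_carr) (use hA in simp)
      then show ?thesis by simp
    qed
    then have "h c \<in> mcarr (A - A1)" using h(1) c CB by (intro mcarr_diff_if_mderiv_0) auto
    then show ?thesis by (rule mcarr_mono) (auto simp: A_def)
  qed
  have card: "card ?B + card A = 2 * N"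
    using Asub finA by (simp add: card_Diff_subset A_def) (metis A_def Asub card_lessThan card_mono finite_lessThan le_add_diff_inverse2)
  have cardA: "card A = (N - d) + card A2" using finA disj card_A1 by (simp add: A_def card_Un_disjoint)
  have cardC: "card C = N - card A2" "card A2 \<le> N"
    using A2(1) finA card_mono[OF finite_lessThan A2(1)] by (simp_all add: C_def card_Diff_subset)
  have "formal_orbit N d M B r ?B h ?J (lie_algebra_dim N M) A C X (\<lambda>c. mvar c - h c)"
  proof (unfold_locales, goal_cases)
    case (4)
    show ?case
    proof
      show "?J \<subseteq> lideal (2 * N) ?B (\<lambda>b. mvar b - h b)" using h(2) by (auto simp: lideal_def)
      show "lideal (2 * N) ?B (\<lambda>b. mvar b - h b) \<subseteq> ?J" using h(1) by (intro lideal_subset[OF J_ideal]) auto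
    qed
  next
    \<comment> \<open>Maximality: an invariant ideal contains all words applied to its members, so
      their constant terms vanish.\<close>
    case (8 I)
    show ?case
    proof
      fix f assume f: "f \<in> I"
      have "O.word ys f \<in> I" if "set ys \<subseteq> L" for ys using that f 8(3) by (induction ys) auto
      then show "f \<in> ?J" using f 8(1,2) is_idealD(1) by (auto simp: O.J_def)
    qed
  next
    case (13 b c)
    have "c \<notin> A2" "c \<in> {..<2 * N}" using 13 by (auto simp: C_def)
    then show ?case using mderiv_notin[OF hC[OF 13(1)], of c] by (simp add: mderiv_mvar del: mderiv.rep_eq) 
  next
    case (12 c)
    have "c < N" using 12 by (auto simp: C_def)
    then show ?case using mcarr_mono[OF hC[OF 12] A2(1)] by (simp add: mcarr_mvar)
  qed (use h(1) BA g card cardA cardC dN O.J_vf CB Asub XL Xd in \<open>auto simp: C_def\<close>)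
  then show ?thesis by (rule that)
qed

subsection \<open>Linear algebra over the fraction field\<close>

definition fr :: "'a::idom \<Rightarrow> 'a fract" where "fr x = Fract x 1"

lemma fr_simps: "fr (a + b) = fr a + fr b" "fr (a * b) = fr a * fr b" "fr 0 = 0" "fr 1 = 1" "fr a = 0 \<longleftrightarrow> a = 0"
  by (simp_all add: fr_def Zero_fract_def One_fract_def eq_fract)

lemma fr_eq_iff: "fr a = fr b \<longleftrightarrow> a = b"
  by (simp add: fr_def eq_fract)

lemma fr_sum: "fr (sum f S) = (\<Sum>x\<in>S. fr (f x))"
  unfolding fr_def by (rule Fract_sum[symmetric])

lemma clear_denominators:
  fixes c :: "'i \<Rightarrow> 'a::idom fract"
  assumes "finite S"
  obtains D c' where "D \<noteq> 0" "\<And>i. i \<in> S \<Longrightarrow> fr D * c i = fr (c' i)"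
proof -
  have "\<exists>D c'. D \<noteq> 0 \<and> (\<forall>i\<in>S. fr D * c i = fr (c' i))"
    using assms
  proof (induction S rule: finite_induct)
    case (insert x S)
    then obtain D c' where D: "D \<noteq> 0" "\<forall>i\<in>S. fr D * c i = fr (c' i)" by blast
    obtain a b where ab: "c x = Fract a b" "b \<noteq> 0" by (cases "c x") auto
    have "fr (D * b) * c i = fr (b * c' i)" if "i \<in> S" for i
      using D(2) that by (simp add: fr_simps mult.assoc mult.left_commute)
    moreover have "fr (D * b) * c x = fr (D * a)" using ab by (simp add: fr_def eq_fract)
    ultimately show ?case using D ab insert.hyps
      by (intro exI[of _ "D * b"] exI[of _ "\<lambda>i. if i = x then D * a else b * c' i"]) auto
  qed (intro exI[of _ 1], simp)
  then show ?thesis using that by blast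
qed

text \<open>A relation over the field of fractions becomes one over the ring after multiplication by
  a common denominator.\<close>

lemma indep_fr_iff:
  fixes q :: "'i \<Rightarrow> nat \<Rightarrow> 'a::idom"
  assumes "finite S"
  shows "indep S (\<lambda>l i. fr (q l i)) \<longleftrightarrow>
    (\<forall>k. (\<forall>i. (\<Sum>l\<in>S. k l * q l i) = 0) \<longrightarrow> (\<forall>l\<in>S. k l = 0))"
proof
  assume ind: "indep S (\<lambda>l i. fr (q l i))"
  show "\<forall>k. (\<forall>i. (\<Sum>l\<in>S. k l * q l i) = 0) \<longrightarrow> (\<forall>l\<in>S. k l = 0)"
  proof (intro allI impI)
    fix k assume 0: "\<forall>i. (\<Sum>l\<in>S. k l * q l i) = 0"
    have "\<forall>i. (\<Sum>l\<in>S. fr (k l) * fr (q l i)) = 0" using 0 by (simp only: fr_simps(2)[symmetric] fr_sum[symmetric]) (simp add: fr_simps(3))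
    then have "\<forall>l\<in>S. fr (k l) = 0" using spec[OF ind[unfolded indep_def], of "\<lambda>l. fr (k l)"] by (rule rev_mp)
    then show "\<forall>l\<in>S. k l = 0" by (simp only: fr_simps)
  qed
next
  assume R: "\<forall>k. (\<forall>i. (\<Sum>l\<in>S. k l * q l i) = 0) \<longrightarrow> (\<forall>l\<in>S. k l = 0)"
  show "indep S (\<lambda>l i. fr (q l i))" unfolding indep_def
  proof (intro allI impI ballI)
    fix c l assume 0: "\<forall>i. (\<Sum>l\<in>S. c l * fr (q l i)) = 0" and l: "l \<in> S"
    obtain D c' where D: "D \<noteq> 0" "\<And>i. i \<in> S \<Longrightarrow> fr D * c i = fr (c' i)"
      by (rule clear_denominators[OF assms, of c]) blast
    have "(\<Sum>l\<in>S. c' l * q l i) = 0" for i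
    proof -
      have "fr (\<Sum>l\<in>S. c' l * q l i) = (\<Sum>l\<in>S. fr D * (c l * fr (q l i)))"
        unfolding fr_sum fr_simps(2) by (intro sum.cong refl) (simp only: D(2)[symmetric] mult.assoc)
      also have "\<dots> = 0" using 0 by (simp only: sum_distrib_left[symmetric]) simp
      finally show ?thesis by (simp only: fr_simps)
    qed
    then have "c' l = 0" using R l by blast
    then have "fr D * c l = 0" using D(2)[OF l] by (simp only: fr_simps)
    then show "c l = 0" using D(1) by (simp add: fr_simps)
  qed
qed

text \<open>The lowest-order parts of a relation over the power series would give a relation between
  the constant terms.\<close>

lemma indep_fr_if_const:
  fixes q :: "'i \<Rightarrow> nat \<Rightarrow> 'a::field mfps"
  assumes S: "finite S" and ind: "indep S (\<lambda>l i. mconst (q l i))"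
  shows "indep S (\<lambda>l i. fr (q l i))"
  unfolding indep_fr_iff[OF S]
proof (intro allI impI ballI)
  fix k l assume 0: "\<forall>i. (\<Sum>l\<in>S. k l * q l i) = 0" and l: "l \<in> S"
  show "k l = 0"
  proof (rule mfps_linear_system_unique[OF S, where R = UNIV and Q = "\<lambda>i l. q l i"])
    fix u i assume u: "\<And>r. r \<in> UNIV \<Longrightarrow> (\<Sum>i\<in>S. mconst (q i r) * u i) = 0" and i: "i \<in> S"
    have "\<forall>r. (\<Sum>i\<in>S. u i * mconst (q i r)) = 0" using u by (simp add: mult.commute)
    then have "\<forall>i\<in>S. u i = 0" using spec[OF ind[unfolded indep_def], of u] by (rule rev_mp)
    then show "u i = 0" using i by blast
  qed (use 0 l in \<open>auto simp: mult.commute\<close>)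
qed

lemma spn_basis:
  assumes "finite S"
  obtains S' where "S' \<subseteq> S" "indep S' w" "spn S' w = spn S w"
proof -
  have "\<exists>S'\<subseteq>S. indep S' w \<and> spn S' w = spn S w"
    using assms
  proof (induction S rule: finite_psubset_induct)
    case (psubset S)
    show ?case
    proof (cases "indep S w")
      case False
      then obtain c p where c: "\<And>i. (\<Sum>l\<in>S. c l * w l i) = 0" "p \<in> S" "c p \<noteq> 0" by (auto simp: indep_def)
      have wp: "w p = (\<lambda>i. \<Sum>l\<in>S - {p}. (- c l / c p) * w l i)"
      proof
        fix i
        have "c p * w p i + (\<Sum>l\<in>S - {p}. c l * w l i) = 0"
          using c(1)[of i] c(2) psubset.hyps by (simp add: sum.remove)
        then have "w p i = - (\<Sum>l\<in>S - {p}. c l * w l i) / c p" using c(3)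
          by (simp add: field_simps add_eq_0_iff)
        then show "w p i = (\<Sum>l\<in>S - {p}. (- c l / c p) * w l i)"
          by (simp add: sum_divide_distrib sum_negf)
      qed
      have "spn S w \<subseteq> spn (S - {p}) w"
      proof (rule spn_subset[OF lsub_spn psubset.hyps])
        fix l assume "l \<in> S"
        then show "w l \<in> spn (S - {p}) w"
          using in_spn[of "S - {p}" l w] psubset.hyps spnI[OF wp] by (cases "l = p") auto
      qed
      moreover have "spn (S - {p}) w \<subseteq> spn S w"
        using psubset.hyps by (intro spn_subset[OF lsub_spn]) (auto intro: in_spn)
      moreover obtain S' where "S' \<subseteq> S - {p}" "indep S' w" "spn S' w = spn (S - {p}) w"
        using psubset.IH[of "S - {p}"] c(2) by blast
      ultimately show ?thesis by blast
    qed blast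
  qed
  then show ?thesis using that by blast
qed

lemma hasdim_basis:
  assumes "hasdim (spn S w) r" "finite S" "finite X" "\<And>l i. l \<in> S \<Longrightarrow> i \<notin> X \<Longrightarrow> w l i = 0"
  obtains S' where "S' \<subseteq> S" "indep S' w" "card S' = r"
proof -
  obtain S' where S': "S' \<subseteq> S" "indep S' w" "spn S' w = spn S w" by (rule spn_basis[OF assms(2), of w])
  have "finite S'" using S'(1) assms(2) finite_subset by blast
  then have "hasdim (spn S' w) (card S')" using hasdim_spn_indep[OF _ assms(3) _ S'(2)] assms(4) S'(1) by blast
  then have "card S' = r" using hasdim_unique assms(1) S'(3) by metis
  then show ?thesis using that S' by blast
qed

lemma spn_cong: assumes "\<And>l. l \<in> S \<Longrightarrow> w l = w' l" shows "spn S w = spn S w'"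
proof -
  have "(\<Sum>l\<in>S. c l * w l i) = (\<Sum>l\<in>S. c l * w' l i)" for c i using assms by (intro sum.cong) auto
  then show ?thesis by (simp add: spn_def)
qed

section \<open>Columns of Jacobian matrices, and derivations of the source\<close>

definition jcol :: "nat \<Rightarrow> (nat \<Rightarrow> complex mfps) \<Rightarrow> nat \<Rightarrow> nat \<Rightarrow> complex mfps" where
  "jcol N v l i = (if i < N then mderiv l (v i) else 0)"

lemma jcol_out: "i \<notin> {..<N} \<Longrightarrow> fr (jcol N v l i) = 0"
  by (simp add: jcol_def fr_simps)

lemma hasdim_Rk:
  assumes "v \<in> carrier_vec N"
  shows "hasdim (spn {..<k} (\<lambda>l i. fr (jcol N (($) v) l i))) (Rk k v)"
proof -
  let ?A = "map_mat fr (jacobian 0 k v)"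
  have "dim_row ?A = N" "dim_col ?A = k" using assms by (auto simp: jacobian_def)
  moreover have "colf ?A l = (\<lambda>i. fr (jcol N (($) v) l i))" if "l \<in> {..<k}" for l
    using assms that by (auto simp: colf_def jcol_def jacobian_def fr_simps)
  then have "spn {..<k} (colf ?A) = spn {..<k} (\<lambda>l i. fr (jcol N (($) v) l i))"
    by (rule spn_cong)
  moreover have "dim_row (jacobian 0 k v) = N" using assms by (auto simp: jacobian_def)
  ultimately show ?thesis using hasdim_rank[of ?A] by (simp add: Rk_def rank_frac_def fr_def[abs_def])
qed

text \<open>The equations \<open>Q b\<close>, restricted to the places of \<open>K\<close>, form the
  identity at the origin and so are injective over the field of fractions. This bounds tangent
  spaces by the number of their free components.\<close>

lemma frac_kernel_injective:
  fixes w :: "nat \<Rightarrow> complex mfps fract" and K :: "nat set"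
  assumes K: "finite K" "inj_on \<iota> K" "\<iota> ` K \<subseteq> {..<m}" and Q: "\<And>b c. b \<in> K \<Longrightarrow> c \<in> K \<Longrightarrow> mconst (Q b (\<iota> c)) = (if b = c then 1 else 0)"
    and w: "\<And>i. i \<notin> \<iota> ` K \<Longrightarrow> w i = 0" and 0: "\<And>b. b \<in> K \<Longrightarrow> (\<Sum>i<m. fr (Q b i) * w i) = 0"
  shows "w = (\<lambda>_. 0)"
proof -
  define q where "q c b = (if b \<in> K then Q b (\<iota> c) else 0)" for c b
  have "indep K (\<lambda>c b. fr (q c b))"
  proof (rule indep_fr_if_const[OF K(1)], unfold indep_def, intro allI impI ballI)
    fix a c assume 0: "\<forall>i. (\<Sum>l\<in>K. a l * mconst (q l i)) = 0" and c: "c \<in> K"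
    have "(\<Sum>l\<in>K. a l * mconst (q l c)) = (\<Sum>l\<in>K. if c = l then a l else 0)"
      using c Q by (intro sum.cong refl) (simp add: q_def)
    then show "a c = 0" using spec[OF 0, of c] c K(1) by simp
  qed
  moreover have "\<forall>b. (\<Sum>c\<in>K. w (\<iota> c) * fr (q c b)) = 0"
  proof
    fix b show "(\<Sum>c\<in>K. w (\<iota> c) * fr (q c b)) = 0"
    proof (cases "b \<in> K")
      case True
      have "0 = (\<Sum>i<m. fr (Q b i) * w i)" using 0[OF True] by simp
      also have "\<dots> = (\<Sum>i\<in>\<iota> ` K. fr (Q b i) * w i)" using K w by (intro sum.mono_neutral_right) auto
      also have "\<dots> = (\<Sum>c\<in>K. w (\<iota> c) * fr (q c b))"
        using True by (simp add: sum.reindex[OF K(2)] q_def mult.commute)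
      finally show ?thesis by simp
    qed (simp add: q_def fr_simps)
  qed
  ultimately have "\<forall>c\<in>K. w (\<iota> c) = 0"
    using spec[OF indep_def[THEN iffD1], of K "\<lambda>c b. fr (q c b)" "\<lambda>c. w (\<iota> c)"] by blast
  then show ?thesis using w by (intro ext) (metis imageE)
qed

definition der :: "nat \<Rightarrow> (nat \<Rightarrow> complex mfps) \<Rightarrow> complex mfps \<Rightarrow> complex mfps" where
  "der m a f = (\<Sum>l<m. a l * mderiv l f)"

lemma der_mult: "der m a (f * g) = der m a f * g + f * der m a g"
  by (simp add: der_def mderiv_mult algebra_simps sum.distrib sum_distrib_left sum_distrib_right)

lemma der_sum: "der m a (sum F S) = (\<Sum>x\<in>S. der m a (F x))"
  by (simp add: der_def mderiv_sum sum_distrib_left) (rule sum.swap)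

lemma der_commutator:
  "der m a (der m b f) - der m b (der m a f) = der m (\<lambda>l. der m a (b l) - der m b (a l)) f"
proof -
  have *: "der m a (der m b f) = (\<Sum>l<m. der m a (b l) * mderiv l f) + (\<Sum>l<m. \<Sum>i<m. a i * b l * mderiv i (mderiv l f))" for a b
  proof -
    have "der m a (der m b f) = (\<Sum>l<m. der m a (b l) * mderiv l f) + (\<Sum>l<m. b l * der m a (mderiv l f))"
      unfolding der_def[of m b] der_sum der_mult by (rule sum.distrib)
    also have "(\<Sum>l<m. b l * der m a (mderiv l f)) = (\<Sum>l<m. \<Sum>i<m. a i * b l * mderiv i (mderiv l f))"
      by (intro sum.cong refl) (simp add: der_def sum_distrib_left mult.assoc mult.left_commute)
    finally show ?thesis .
  qed
  have "(\<Sum>l<m. \<Sum>i<m. a i * b l * mderiv i (mderiv l f)) = (\<Sum>l<m. \<Sum>i<m. b i * a l * mderiv i (mderiv l f))"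
    by (subst sum.swap) (simp add: mderiv_commute mult.commute)
  then show ?thesis by (simp add: *) (simp add: der_def left_diff_distrib sum_subtractf)
qed

lemma der_add: "der m (\<lambda>l. x * a l + y * b l) f = x * der m a f + y * der m b f"
  by (simp add: der_def distrib_right sum.distrib sum_distrib_left mult.assoc)

lemma der_add2: "der m (\<lambda>l. x * a l + (y * b l + z * c l)) f = x * der m a f + (y * der m b f + z * der m c f)"
  by (simp add: der_def distrib_right sum.distrib sum_distrib_left mult.assoc)

subsection \<open>Iterated Segre mappings\<close>

text \<open>The mapping (\<gamma>(\<zeta>, t), \<zeta>) into the manifold, with components given as
  a function for use in \<open>msub\<close>.\<close>

definition pgam :: "nat \<Rightarrow> complex mfps vec \<Rightarrow> nat \<Rightarrow> complex mfps" where
  "pgam N \<gamma> i = (if i < N then \<gamma> $ i else mvar (i - N))"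

declare segre_mapping.simps(2) [simp del]

locale segre_map =
  fixes N n :: nat and \<gamma> :: "complex mfps vec"
  assumes \<gamma>: "formal_map (N + n) N \<gamma>"
begin

lemma \<gamma>_dim: "dim_vec \<gamma> = N" and \<gamma>_carr: "i < N \<Longrightarrow> \<gamma> $ i \<in> mcarr {..<N + n}"
  and \<gamma>_const: "i < N \<Longrightarrow> mconst (\<gamma> $ i) = 0"
  using \<gamma> by (auto simp: formal_map_def mfps_carrier_eq)

abbreviation v :: "nat \<Rightarrow> complex mfps vec" where "v \<equiv> segre_mapping N n \<gamma>"

text \<open>Substitutes the conjugate of v^j for \<zeta> and t^(j+1) for t, so that the recursion
  becomes composition with \<open>tau j\<close>.\<close>

definition tau :: "nat \<Rightarrow> nat \<Rightarrow> complex mfps" where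
  "tau j i = (if i < N then mcnj (v j $ i) else mvar (j * n + (i - N)))"

lemma v_dim: "dim_vec (v j) = N"
  by (cases j) (simp_all add: \<gamma>_dim segre_mapping.simps)

lemma v_carrier: "v j \<in> carrier_vec N"
  by (rule carrier_vecI) (rule v_dim)

lemma v_props: "i < N \<Longrightarrow> v j $ i \<in> mcarr {..<j * n} \<and> mconst (v j $ i) = 0"
  and v_Suc: "i < N \<Longrightarrow> v (Suc j) $ i = msub (tau j) (\<gamma> $ i)"
proof -
  have step: "(\<forall>i<N. v (Suc j) $ i = msub (tau j) (\<gamma> $ i)) \<and> (\<forall>i<N. v (Suc j) $ i \<in> mcarr {..<Suc j * n} \<and> mconst (v (Suc j) $ i) = 0)"
    if IH: "\<forall>i<N. v j $ i \<in> mcarr {..<j * n} \<and> mconst (v j $ i) = 0" for j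
  proof -
    have z: "zconst {..<N + n} (tau j)" using IH by (auto simp: zconst_def tau_def)
    have eq: "v (Suc j) $ i = msub (tau j) (\<gamma> $ i)" if i: "i < N" for i
    proof -
      have "v (Suc j) $ i = msub (\<lambda>k. (map_vec mcnj (v j) @\<^sub>v vec n (\<lambda>i. mvar (j * n + i))) $ k) (\<gamma> $ i)"
        using i by (simp add: segre_mapping.simps \<gamma>_dim msubst_eq_msub)
      also have "\<dots> = msub (tau j) (\<gamma> $ i)"
        by (rule msub_cong[OF _ \<gamma>_carr[OF i], symmetric])
          (use z v_dim[of j] in \<open>auto simp: tau_def\<close>)
      finally show ?thesis .
    qed
    moreover have "msub (tau j) (\<gamma> $ i) \<in> mcarr {..<Suc j * n}" if i: "i < N" for i
    proof (rule mcarr_msub[OF _ z \<gamma>_carr[OF i]])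
      fix k assume k: "k \<in> {..<N + n}"
      show "tau j k \<in> mcarr {..<Suc j * n}"
      proof (cases "k < N")
        case True
        then have "mcnj (v j $ k) \<in> mcarr {..<j * n}" using IH by simp
        then have "mcnj (v j $ k) \<in> mcarr {..<Suc j * n}" by (rule mcarr_mono) auto
        then show ?thesis using True by (simp add: tau_def)
      qed (use k in \<open>auto simp: tau_def intro!: mcarr_mvar\<close>)
    qed simp
    moreover have "mconst (msub (tau j) (\<gamma> $ i)) = 0" if i: "i < N" for i
      using mconst_msub[OF _ z \<gamma>_carr[OF i]] \<gamma>_const[OF i] by simp
    ultimately show ?thesis by simp
  qed
  have all: "\<forall>i<N. v j $ i \<in> mcarr {..<j * n} \<and> mconst (v j $ i) = 0" for j
    by (induction j) (simp, use step in blast)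
  show "i < N \<Longrightarrow> v j $ i \<in> mcarr {..<j * n} \<and> mconst (v j $ i) = 0" using all by blast
  show "i < N \<Longrightarrow> v (Suc j) $ i = msub (tau j) (\<gamma> $ i)" using step[OF all] by blast
qed

lemma tau_z: "zconst {..<N + n} (tau j)" using v_props by (auto simp: zconst_def tau_def)

lemma mderiv_v_out: "i < N \<Longrightarrow> \<not> l < j * n \<Longrightarrow> mderiv l (v j $ i) = 0"
  using v_props mderiv_notin[of "v j $ i" "{..<j * n}" l] by auto

end

locale segre = generic_normal N d M B r + segre_map N n \<gamma>
  for N d :: nat and M :: "complex mfps set" and B :: "nat set" and r :: "nat \<Rightarrow> complex mfps"
    and n :: nat and \<gamma> :: "complex mfps vec" +
  assumes n: "n = N - d"
    and \<gamma>_M: "\<And>f. f \<in> M \<Longrightarrow> msub (pgam N \<gamma>) f = 0"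
    and \<gamma>_t: "indep {..<n} (\<lambda>l i. mconst (jcol N (($) \<gamma>) (N + l) i))"
begin

definition p :: "nat \<Rightarrow> nat \<Rightarrow> complex mfps" where
  "p j i = (if i < N then v (Suc j) $ i else mcnj (v j $ (i - N)))"

lemma p_z: "zconst {..<2 * N} (p j)" using v_props by (auto simp: zconst_def p_def)

lemma pgam_z: "zconst {..<2 * N} (pgam N \<gamma>)" using \<gamma>_const by (auto simp: zconst_def pgam_def)

text \<open>\<open>p j\<close> is the composition of \<open>pgam N \<gamma>\<close> with
  \<open>tau j\<close>, and the former maps into the manifold.\<close>

lemma p_M: assumes f: "f \<in> M" shows "msub (p j) f = 0"
proof -
  note c = is_idealD(1)[OF M_ideal f]
  have "msub (tau j) (msub (pgam N \<gamma>) f) = msub (\<lambda>i. msub (tau j) (pgam N \<gamma> i)) f"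
    by (rule msub_msub[OF _ c _ pgam_z _ tau_z]) (auto simp: pgam_def \<gamma>_carr intro: mcarr_mvar)
  also have "\<dots> = msub (p j) f"
  proof (rule msub_cong[OF _ c])
    show *: "msub (tau j) (pgam N \<gamma> i) = p j i" if "i \<in> {..<2 * N}" for i
    proof (cases "i < N")
      case False
      then have "i - N < N" using that by auto
      then show ?thesis using False by (simp add: pgam_def p_def msub_mvar[OF _ tau_z]) (simp add: tau_def)
    qed (simp add: pgam_def p_def v_Suc)
    show "zconst {..<2 * N} (\<lambda>i. msub (tau j) (pgam N \<gamma> i))"
      using p_z[of j] * unfolding zconst_def by simp
  qed simp
  finally show ?thesis using \<gamma>_M[OF f] msub_0[OF _ tau_z] by simp
qed

lemma p_chain:
  assumes f: "f \<in> M" shows "(\<Sum>i<2 * N. msub (p j) (mderiv i f) * mderiv l (p j i)) = 0"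
  using mderiv_msub[OF _ p_z is_idealD(1)[OF M_ideal f], of l j] p_M[OF f, of j] by simp

lemma mderiv_v_Suc:
  assumes i: "i < N" and l: "l < n"
  shows "mderiv (j * n + l) (v (Suc j) $ i) = msub (tau j) (mderiv (N + l) (\<gamma> $ i))"
proof -
  have "mderiv (j * n + l) (v (Suc j) $ i)
      = (\<Sum>k<N + n. msub (tau j) (mderiv k (\<gamma> $ i)) * mderiv (j * n + l) (tau j k))"
    unfolding v_Suc[OF i] by (rule mderiv_msub[OF _ tau_z \<gamma>_carr[OF i]]) simp
  also have "\<dots> = (\<Sum>k<N + n. if k = N + l then msub (tau j) (mderiv k (\<gamma> $ i)) else 0)"
    by (intro sum.cong refl) (use mderiv_v_out in \<open>auto simp: tau_def mderiv_mvar simp flip: mcnj_simps(9)\<close>)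
  finally show ?thesis using l by simp
qed

section \<open>Tangent spaces along the iterated Segre mappings\<close>

abbreviation R :: "nat \<Rightarrow> nat" where "R j \<equiv> Rk (j * n) (v j)"

lemma hasdim_R: "hasdim (spn {..<j * n} (\<lambda>l i. fr (jcol N (($) (v j)) l i))) (R j)"
  by (rule hasdim_Rk[OF v_carrier])

text \<open>Conjugating the coefficients of a relation gives a relation for the conjugate
  mapping.\<close>

lemma indep_cnj:
  assumes "finite S" "indep S (\<lambda>l i. fr (jcol N u l i))"
  shows "indep S (\<lambda>l i. fr (jcol N (\<lambda>i. mcnj (u i)) l i))"
  unfolding indep_fr_iff[OF assms(1)]
proof (intro allI impI)
  fix k assume 0: "\<forall>i. (\<Sum>l\<in>S. k l * jcol N (\<lambda>i. mcnj (u i)) l i) = 0"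
  have "jcol N (\<lambda>i. mcnj (u i)) l i = mcnj (jcol N u l i)" for l i by (simp add: jcol_def)
  then have "(\<Sum>l\<in>S. mcnj (k l) * jcol N u l i) = mcnj (\<Sum>l\<in>S. k l * jcol N (\<lambda>i. mcnj (u i)) l i)" for i
    by (simp add: mcnj_sum)
  then have "\<forall>i. (\<Sum>l\<in>S. mcnj (k l) * jcol N u l i) = 0" using 0 by simp
  then have "\<forall>l\<in>S. mcnj (k l) = 0"
    using spec[OF assms(2)[unfolded indep_fr_iff[OF assms(1)]], of "\<lambda>l. mcnj (k l)"] by (rule rev_mp)
  then show "\<forall>l\<in>S. k l = 0" by simp
qed

text \<open>The image of the differential of \<open>p j\<close> over the field of fractions, its
  tangent space at the generic point.\<close>

definition T :: "nat \<Rightarrow> (nat \<Rightarrow> complex mfps fract) set" where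
  "T j = spn {..<Suc j * n} (\<lambda>l i. fr (jcol (2 * N) (p j) l i))"

text \<open>Block-triangular: the \<zeta>-components involve only t^1, ..., t^j and have the rank of
  the conjugate of v^j; the columns of t^(j+1) have zero \<zeta>-components, and their Z-components
  have rank n by the condition on \<partial>\<gamma>/\<partial>t.\<close>

lemma T_indep:
  obtains S where "finite S" "card S = R j + n" "S \<subseteq> {..<Suc j * n}" "indep S (\<lambda>l i. fr (jcol (2 * N) (p j) l i))"
    "{j * n..<Suc j * n} \<subseteq> S"
proof -
  obtain S' where S': "S' \<subseteq> {..<j * n}" "indep S' (\<lambda>l i. fr (jcol N (($) (v j)) l i))" "card S' = R j"
    by (rule hasdim_basis[OF hasdim_R finite_lessThan finite_lessThan[of N]]) (use jcol_out in blast)+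
  have fin: "finite S'" using S'(1) finite_subset by blast
  let ?Q = "{j * n..<Suc j * n}"
  have disj: "S' \<inter> ?Q = {}" using S'(1) by auto
  note iS = indep_cnj[OF fin S'(2), unfolded indep_fr_iff[OF fin], rule_format]
  have "indep (S' \<union> ?Q) (\<lambda>l i. fr (jcol (2 * N) (p j) l i))"
    unfolding indep_fr_iff[OF finite_UnI[OF fin finite_atLeastLessThan]]
  proof (intro allI impI)
    fix k assume 0: "\<forall>i. (\<Sum>l\<in>S' \<union> ?Q. k l * jcol (2 * N) (p j) l i) = 0"
    have split: "(\<Sum>l\<in>S' \<union> ?Q. k l * jcol (2 * N) (p j) l i)
        = (\<Sum>l\<in>S'. k l * jcol (2 * N) (p j) l i) + (\<Sum>l\<in>?Q. k l * jcol (2 * N) (p j) l i)" for i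
      using fin disj by (intro sum.union_disjoint) auto
    have "(\<Sum>l\<in>S'. k l * jcol N (\<lambda>i. mcnj (v j $ i)) l i) = 0" for i
    proof (cases "i < N")
      case True
      have "(\<Sum>l\<in>?Q. k l * jcol (2 * N) (p j) l (N + i)) = 0"
        using True mderiv_v_out[of i _ j]
        by (intro sum.neutral ballI) (auto simp: jcol_def p_def simp flip: mcnj_simps(9))
      moreover have "(\<Sum>l\<in>S'. k l * jcol (2 * N) (p j) l (N + i)) = (\<Sum>l\<in>S'. k l * jcol N (\<lambda>i. mcnj (v j $ i)) l i)"
        using True by (intro sum.cong refl) (simp add: jcol_def p_def)
      ultimately show ?thesis using spec[OF 0, of "N + i"] split[of "N + i"] by simp
    qed (simp add: jcol_def)
    then have k1: "k l = 0" if "l \<in> S'" for l using iS[of k l] that by simp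
    have Q0: "(\<Sum>l<n. k (j * n + l) * msub (tau j) (jcol N (($) \<gamma>) (N + l) i)) = 0" for i
    proof (cases "i < N")
      case True
      have "(\<Sum>l\<in>?Q. k l * jcol (2 * N) (p j) l i) = 0" using spec[OF 0, of i] split[of i] k1 by simp
      also have "(\<Sum>l\<in>?Q. k l * jcol (2 * N) (p j) l i) = (\<Sum>l<n. k (j * n + l) * jcol (2 * N) (p j) (j * n + l) i)"
        by (rule sum.reindex_bij_witness[of _ "\<lambda>l. j * n + l" "\<lambda>l. l - j * n"]) auto
      also have "\<dots> = (\<Sum>l<n. k (j * n + l) * msub (tau j) (jcol N (($) \<gamma>) (N + l) i))"
        using True by (intro sum.cong refl) (simp add: jcol_def p_def mderiv_v_Suc)
      finally show ?thesis .
    qed (simp add: jcol_def msub_0[OF _ tau_z])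
    have ind: "indep {..<n} (\<lambda>l i. fr (msub (tau j) (jcol N (($) \<gamma>) (N + l) i)))"
    proof (rule indep_fr_if_const)
      have "mconst (msub (tau j) (jcol N (($) \<gamma>) (N + l) i)) = mconst (jcol N (($) \<gamma>) (N + l) i)" for l i
        by (rule mconst_msub[OF _ tau_z]) (auto simp: jcol_def \<gamma>_carr)
      then show "indep {..<n} (\<lambda>l i. mconst (msub (tau j) (jcol N (($) \<gamma>) (N + l) i)))" using \<gamma>_t by simp
    qed simp
    have "\<forall>l\<in>{..<n}. k (j * n + l) = 0"
      using allI[OF Q0] spec[OF ind[unfolded indep_fr_iff[OF finite_lessThan]], of "\<lambda>l. k (j * n + l)"]
      by (rule rev_mp)
    then have *: "k (j * n + l) = 0" if "l < n" for l using that by blast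
    have "k l = 0" if "l \<in> ?Q" for l
    proof -
      have "l - j * n < n" "j * n + (l - j * n) = l" using that by auto
      then show ?thesis using *[of "l - j * n"] by simp
    qed
    then show "\<forall>l\<in>S' \<union> ?Q. k l = 0" using k1 by blast
  qed
  moreover have "card (S' \<union> ?Q) = R j + n" using fin disj S'(3) by (simp add: card_Un_disjoint)
  ultimately show ?thesis using S'(1) fin by (intro that[of "S' \<union> ?Q"]) auto
qed

text \<open>The \<open>(0,1)\<close>- and \<open>(1,0)\<close>-vectors tangent to the manifold along \<open>p j\<close>.\<close>

definition E01 :: "nat \<Rightarrow> (nat \<Rightarrow> complex mfps fract) set" where
  "E01 j = {w. (\<forall>i. i \<notin> {N..<2 * N} \<longrightarrow> w i = 0) \<and> (\<forall>f\<in>M. (\<Sum>i<2 * N. fr (msub (p j) (mderiv i f)) * w i) = 0)}"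

definition E10 :: "nat \<Rightarrow> (nat \<Rightarrow> complex mfps fract) set" where
  "E10 j = {w. (\<forall>i. i \<notin> {..<N} \<longrightarrow> w i = 0) \<and> (\<forall>f\<in>M. (\<Sum>i<2 * N. fr (msub (p j) (mderiv i f)) * w i) = 0)}"

lemma lsub_E: "lsub (E01 j)" "lsub (E10 j)"
proof -
  have "(\<Sum>i<2 * N. q i * (v i + c * w i)) = 0"
    if "(\<Sum>i<2 * N. q i * v i) = 0" "(\<Sum>i<2 * N. q i * w i) = 0" for q v w :: "nat \<Rightarrow> complex mfps fract" and c
  proof -
    have "(\<Sum>i<2 * N. q i * (v i + c * w i)) = (\<Sum>i<2 * N. q i * v i) + c * (\<Sum>i<2 * N. q i * w i)"
      by (simp add: distrib_left sum.distrib sum_distrib_left mult.left_commute)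
    then show ?thesis using that by simp
  qed
  then show "lsub (E01 j)" "lsub (E10 j)" by (auto intro!: lsubI simp: E01_def E10_def)
qed

lemma lsub_T: "lsub (T j)" unfolding T_def by (rule lsub_spn)

lemma T_tangent:
  assumes w: "w \<in> T j" and f: "f \<in> M"
  shows "(\<Sum>i<2 * N. fr (msub (p j) (mderiv i f)) * w i) = 0"
proof -
  obtain c where c: "w = (\<lambda>i. \<Sum>l<Suc j * n. c l * fr (jcol (2 * N) (p j) l i))"
    using w unfolding T_def by (rule spnE)
  have "(\<Sum>i<2 * N. fr (msub (p j) (mderiv i f)) * w i)
      = (\<Sum>i<2 * N. \<Sum>l<Suc j * n. c l * fr (msub (p j) (mderiv i f) * mderiv l (p j i)))"
    unfolding c by (intro sum.cong refl) (simp add: jcol_def fr_simps sum_distrib_left mult.left_commute)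
  also have "\<dots> = (\<Sum>l<Suc j * n. c l * fr (\<Sum>i<2 * N. msub (p j) (mderiv i f) * mderiv l (p j i)))"
    by (subst sum.swap) (simp add: fr_sum fr_simps sum_distrib_left)
  also have "\<dots> = 0" using p_chain[OF f] by (simp add: fr_simps)
  finally show ?thesis .
qed

lemma T_out: "w \<in> T j \<Longrightarrow> \<not> i < 2 * N \<Longrightarrow> w i = 0"
  unfolding T_def by (auto elim!: spnE simp: jcol_def fr_simps)

lemma mconst_msub_p: "f \<in> mcarr {..<2 * N} \<Longrightarrow> mconst (msub (p j) f) = mconst f"
  by (rule mconst_msub[OF _ p_z]) auto

text \<open>The linearized equations \<open>rs b\<close> determine the \<zeta>-components outside
  \<open>A1\<close>, so \<open>E01 j\<close> has dimension at most
  \<open>card A1 = n\<close>.\<close>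

lemma E01_inj: assumes "w \<in> E01 j" "\<forall>x\<in>A1. w x = 0" shows "w = (\<lambda>_. 0)"
proof (rule frac_kernel_injective[where K = B and \<iota> = "(+) N" and m = "2 * N" and Q = "\<lambda>b i. msub (p j) (mderiv i (rs b))"])
  show "mconst (msub (p j) (mderiv (N + c) (rs b))) = (if b = c then 1 else 0)" if "b \<in> B" "c \<in> B" for b c
    using rs_delta[OF that] rs_carr[OF that(1)] by (simp add: mconst_msub_p del: mderiv.rep_eq)
  show "w i = 0" if "i \<notin> (+) N ` B" for i
    using that assms by (cases "i \<in> {N..<2 * N}") (auto simp: E01_def A1_def)
qed (use finB B(1) rs assms(1) in \<open>auto simp: E01_def\<close>)

lemma E10_inj: assumes "w \<in> E10 j" "\<forall>x\<in>{..<N} - B. w x = 0" shows "w = (\<lambda>_. 0)"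
proof (rule frac_kernel_injective[where K = B and \<iota> = "\<lambda>i. i" and m = "2 * N" and Q = "\<lambda>b i. msub (p j) (mderiv i (r b))"])
  show "mconst (msub (p j) (mderiv c (r b))) = (if b = c then 1 else 0)" if "b \<in> B" "c \<in> B" for b c
    using r_delta[OF that] r_carr[OF that(1)] by (simp add: mconst_msub_p del: mderiv.rep_eq)
  show "w i = 0" if "i \<notin> (\<lambda>i. i) ` B" for i using that assms by (auto simp: E10_def)
qed (use finB B(1) r assms(1) in \<open>auto simp: E10_def\<close>)

text \<open>The columns of t^(j+1) are n independent members of \<open>E10 j\<close>, and the
  equations \<open>r b\<close> leave at most N - d = n free components; so these columns span
  it.\<close>

lemma E10_T: "E10 j \<subseteq> T j"
proof -
  obtain S where S: "indep S (\<lambda>l i. fr (jcol (2 * N) (p j) l i))" "{j * n..<Suc j * n} \<subseteq> S" "finite S"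
    by (rule T_indep[of j]) blast
  let ?Q = "{j * n..<Suc j * n}" and ?w = "\<lambda>l i. fr (jcol (2 * N) (p j) l i)"
  have wT: "?w l \<in> T j" if "l \<in> ?Q" for l unfolding T_def using that by (intro in_spn) auto
  have "?w l \<in> E10 j" if l: "l \<in> ?Q" for l
    unfolding E10_def
  proof (intro CollectI conjI allI impI ballI)
    fix i assume "i \<notin> {..<N}"
    then show "?w l i = 0"
      using l mderiv_v_out[of "i - N" l j]
      by (auto simp: jcol_def p_def fr_simps simp flip: mcnj_simps(9))
  qed (use T_tangent[OF wT[OF l]] in auto)
  moreover have "indep ?Q ?w" unfolding indep_def
  proof (intro allI impI ballI)
    fix c l assume 0: "\<forall>i. (\<Sum>l\<in>?Q. c l * ?w l i) = 0" and l: "l \<in> ?Q"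
    have "(\<Sum>l\<in>S. (if l \<in> ?Q then c l else 0) * ?w l i) = (\<Sum>l\<in>?Q. c l * ?w l i)" for i
      using S(2,3) by (intro sum.mono_neutral_cong_right) auto
    then have "\<forall>i. (\<Sum>l\<in>S. (if l \<in> ?Q then c l else 0) * ?w l i) = 0" using 0 by (simp only:) blast
    then have "\<forall>l\<in>S. (if l \<in> ?Q then c l else 0) = 0"
      using spec[OF S(1)[unfolded indep_def], of "\<lambda>l. if l \<in> ?Q then c l else 0"] by (rule rev_mp)
    then show "c l = 0" using l S(2) by force
  qed
  moreover have "card ({..<N} - B) \<le> card ?Q" using B finB by (simp add: card_Diff_subset n)
  ultimately have "spn ?Q ?w = E10 j"
    using hasdim_full(1)[OF lsub_E(2)[of j], of "{..<N} - B" ?Q ?w] E10_inj by simp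
  moreover have "spn ?Q ?w \<subseteq> T j" using wT by (intro spn_subset[OF lsub_T]) auto
  ultimately show ?thesis by simp
qed

text \<open>\<open>s\<close> is the dimension of the kernel of the projection of \<open>T j\<close>
  to the Z-components; equality of \<open>R j\<close> and \<open>R (Suc j)\<close> forces
  \<open>s = n\<close>.\<close>

lemma T_dims:
  obtains s where "s \<le> n" "hasdim (T j) (R (Suc j) + s)" "R j + n \<le> R (Suc j) + s" "s = n \<Longrightarrow> E01 j \<subseteq> T j"
proof -
  let ?K = "{w\<in>T j. \<forall>i\<in>{..<N}. w i = 0}"
  have K_E: "?K \<subseteq> E01 j"
  proof
    fix w assume w: "w \<in> ?K"
    then show "w \<in> E01 j" using T_tangent[of w j] T_out[of w j] by (auto simp: E01_def)
  qed
  have K_sub: "lsub ?K" using lsubD[OF lsub_T] lsub_T[of j] by (intro lsubI) (auto simp: lsub_def)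
  have finA1: "finite A1" by (simp add: A1_def)
  obtain s where s: "s \<le> card A1" "hasdim ?K s"
    by (rule hasdim_exists[OF K_sub finA1]) (use E01_inj K_E in blast)+
  have "(\<lambda>w i. if i \<in> {..<N} then w i else 0) ` T j = spn {..<Suc j * n} (\<lambda>l i. fr (jcol N (($) (v (Suc j))) l i))"
    (is "?\<pi> ` _ = ?V")
  proof -
    have *: "?\<pi> (\<lambda>i. \<Sum>l<Suc j * n. c l * fr (jcol (2 * N) (p j) l i)) = (\<lambda>i. \<Sum>l<Suc j * n. c l * fr (jcol N (($) (v (Suc j))) l i))" for c
      by (rule ext) (auto simp: jcol_def p_def fr_simps)
    show ?thesis
    proof (intro equalityI subsetI)
      fix u assume "u \<in> ?\<pi> ` T j"
      then obtain w where w: "w \<in> T j" "u = ?\<pi> w" by blast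
      obtain c where "w = (\<lambda>i. \<Sum>l<Suc j * n. c l * fr (jcol (2 * N) (p j) l i))" using w(1) unfolding T_def by (rule spnE)
      then have "u = (\<lambda>i. \<Sum>l<Suc j * n. c l * fr (jcol N (($) (v (Suc j))) l i))" using * w(2) by (simp only:)
      then show "u \<in> ?V" by (rule spnI)
    next
      fix u assume "u \<in> ?V"
      then obtain c where c: "u = (\<lambda>i. \<Sum>l<Suc j * n. c l * fr (jcol N (($) (v (Suc j))) l i))" by (rule spnE)
      have "(\<lambda>i. \<Sum>l<Suc j * n. c l * fr (jcol (2 * N) (p j) l i)) \<in> T j" unfolding T_def by (rule spnI) simp
      then show "u \<in> ?\<pi> ` T j" unfolding c *[symmetric] by (rule imageI)
    qed
  qed
  then have "hasdim (?\<pi> ` T j) (R (Suc j))" using hasdim_R[of "Suc j"] by simp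
  then have dT: "hasdim (T j) (R (Suc j) + s)" by (rule hasdim_restrict[OF lsub_T _ s(2)])
  obtain S where S: "finite S" "card S = R j + n" "S \<subseteq> {..<Suc j * n}" "indep S (\<lambda>l i. fr (jcol (2 * N) (p j) l i))"
    by (rule T_indep[of j]) blast
  have "(\<lambda>i. fr (jcol (2 * N) (p j) l i)) \<in> T j" if "l \<in> S" for l
    unfolding T_def using that S(3) by (intro in_spn) auto
  then have ge: "R j + n \<le> R (Suc j) + s" using indep_card_le[OF dT S(1) _ S(4)] S(2) by simp
  have eq: "E01 j \<subseteq> T j" if sn: "s = n"
  proof -
    obtain s' where s': "s' \<le> card A1" "hasdim (E01 j) s'"
      by (rule hasdim_exists[OF lsub_E(1) finA1]) (use E01_inj in blast)+
    then have "s' = n" using hasdim_mono[OF s(2) s'(2) K_E] sn card_A1 n by simp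
    then have "?K = E01 j" using hasdim_eq[OF s(2) _ K_E K_sub lsub_E(1)] s'(2) sn by simp
    then show ?thesis by blast
  qed
  show ?thesis by (rule that[of s]) (use s(1) dT ge eq card_A1 n in auto)
qed

lemma R_mono: "R j \<le> R (Suc j)"
  by (rule T_dims[of j]) simp

text \<open>Tangency to \<open>p j\<close> over the field of fractions, with the denominator \<open>c\<close> cleared.\<close>

definition ptan :: "nat \<Rightarrow> complex mfps vec \<Rightarrow> bool" where
  "ptan j X \<longleftrightarrow> (\<exists>c a. c \<noteq> 0 \<and> (\<forall>i<2 * N. c * msub (p j) (X $ i) = der (Suc j * n) a (p j i)))"

text \<open>By the chain rule, relatedness on the coordinate functions extends to all
  series.\<close>

lemma ptan_chain:
  assumes X: "vector_field (2 * N) X" and f: "f \<in> mcarr {..<2 * N}"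
    and e: "\<And>i. i < 2 * N \<Longrightarrow> c * msub (p j) (X $ i) = der m a (p j i)"
  shows "c * msub (p j) (vf_apply X f) = der m a (msub (p j) f)"
proof -
  have "msub (p j) (vf_apply X f) = (\<Sum>i<2 * N. msub (p j) (X $ i) * msub (p j) (mderiv i f))"
    unfolding vf_apply_def vector_fieldD(1)[OF X]
    by (subst msub_sum[OF _ p_z]) (use X f in \<open>auto simp: vector_fieldD msub_mult[OF _ p_z] intro!: mcarr_mult\<close>)
  then have "c * msub (p j) (vf_apply X f) = (\<Sum>i<2 * N. (c * msub (p j) (X $ i)) * msub (p j) (mderiv i f))"
    by (simp add: sum_distrib_left mult.assoc)
  also have "\<dots> = (\<Sum>i<2 * N. \<Sum>l<m. a l * (msub (p j) (mderiv i f) * mderiv l (p j i)))"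
  proof (intro sum.cong refl)
    fix i assume "i \<in> {..<2 * N}"
    then have "(c * msub (p j) (X $ i)) * msub (p j) (mderiv i f) = (\<Sum>l<m. a l * mderiv l (p j i)) * msub (p j) (mderiv i f)"
      using e[of i] by (simp add: der_def)
    also have "\<dots> = (\<Sum>l<m. a l * (msub (p j) (mderiv i f) * mderiv l (p j i)))"
      unfolding sum_distrib_right by (intro sum.cong refl) (simp only: ac_simps)
    finally show "(c * msub (p j) (X $ i)) * msub (p j) (mderiv i f) = (\<Sum>l<m. a l * (msub (p j) (mderiv i f) * mderiv l (p j i)))" .
  qed
  also have "\<dots> = (\<Sum>l<m. a l * mderiv l (msub (p j) f))"
    by (subst sum.swap) (simp add: mderiv_msub[OF _ p_z f] sum_distrib_left)
  finally show ?thesis by (simp add: der_def)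
qed

text \<open>Fields related to derivations of the source have related commutators. The cleared
  denominators are not constant, so their derivatives enter the lift.\<close>

lemma ptan_bracket:
  assumes X: "vector_field (2 * N) X" "ptan j X" and Y: "vector_field (2 * N) Y" "ptan j Y"
  shows "ptan j (lie_bracket X Y)"
proof -
  let ?m = "Suc j * n" and ?s = "msub (p j)"
  obtain c a where c: "c \<noteq> 0" "\<And>i. i < 2 * N \<Longrightarrow> c * ?s (X $ i) = der ?m a (p j i)"
    using X(2) by (auto simp: ptan_def)
  obtain e b where e: "e \<noteq> 0" "\<And>i. i < 2 * N \<Longrightarrow> e * ?s (Y $ i) = der ?m b (p j i)"
    using Y(2) by (auto simp: ptan_def)
  \<comment> \<open>The commutator [a/c, b/e], multiplied by c^2 e^2.\<close>
  let ?z = "\<lambda>l. (c * e) * (der ?m a (b l) - der ?m b (a l)) + ((- c * der ?m a e) * b l + (e * der ?m b c) * a l)"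
  have "c * c * e * e * ?s (lie_bracket X Y $ i) = der ?m ?z (p j i)" if i: "i < 2 * N" for i
  proof -
    have ci: "X $ i \<in> mcarr {..<2 * N}" "Y $ i \<in> mcarr {..<2 * N}" using X(1) Y(1) i by (auto simp: vector_fieldD)
    define x where "x = ?s (vf_apply X (Y $ i))"
    define y where "y = ?s (vf_apply Y (X $ i))"
    have "der ?m a (e * ?s (Y $ i)) = der ?m a e * ?s (Y $ i) + e * (c * x)"
      using ptan_chain[OF X(1) ci(2) c(2)] by (simp add: der_mult x_def)
    then have 1: "der ?m a (der ?m b (p j i)) = der ?m a e * ?s (Y $ i) + e * (c * x)" by (simp add: e(2)[OF i])
    have "der ?m b (c * ?s (X $ i)) = der ?m b c * ?s (X $ i) + c * (e * y)"
      using ptan_chain[OF Y(1) ci(1) e(2)] by (simp add: der_mult y_def)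
    then have 2: "der ?m b (der ?m a (p j i)) = der ?m b c * ?s (X $ i) + c * (e * y)" by (simp add: c(2)[OF i])
    have "?s (lie_bracket X Y $ i) = x - y"
      using i X(1) Y(1) ci by (simp add: lie_bracket_def vector_fieldD(1) x_def y_def msub_diff[OF _ p_z] vf_apply_carr)
    then have "c * c * e * e * ?s (lie_bracket X Y $ i) = c * e * (e * (c * x) - c * (e * y))"
      by (simp only:) (simp add: algebra_simps)
    also have "e * (c * x) - c * (e * y) = (der ?m a (der ?m b (p j i)) - der ?m b (der ?m a (p j i)))
        - der ?m a e * ?s (Y $ i) + der ?m b c * ?s (X $ i)"
      by (simp only: 1 2) (simp add: algebra_simps)
    also have "c * e * \<dots> = c * e * der ?m (\<lambda>l. der ?m a (b l) - der ?m b (a l)) (p j i)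
        - c * der ?m a e * (e * ?s (Y $ i)) + e * der ?m b c * (c * ?s (X $ i))"
      by (simp add: der_commutator algebra_simps)
    also have "\<dots> = c * e * der ?m (\<lambda>l. der ?m a (b l) - der ?m b (a l)) (p j i)
        + (- c * der ?m a e * der ?m b (p j i) + e * der ?m b c * der ?m a (p j i))"
      by (simp add: c(2)[OF i] e(2)[OF i])
    also have "\<dots> = der ?m ?z (p j i)"
      by (simp only: der_add2)
    finally show ?thesis .
  qed
  moreover have "c * c * e * e \<noteq> 0" using c(1) e(1) by simp
  ultimately show ?thesis unfolding ptan_def by blast
qed

lemma ptan_if_T:
  assumes "(\<lambda>i. if i < 2 * N then fr (msub (p j) (X $ i)) else 0) \<in> T j" shows "ptan j X"
proof -
  obtain k where k: "(\<lambda>i. if i < 2 * N then fr (msub (p j) (X $ i)) else 0)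
      = (\<lambda>i. \<Sum>l<Suc j * n. k l * fr (jcol (2 * N) (p j) l i))" using assms unfolding T_def by (rule spnE)
  obtain D a where D: "D \<noteq> 0" "\<And>l. l \<in> {..<Suc j * n} \<Longrightarrow> fr D * k l = fr (a l)"
    by (rule clear_denominators[where c = k and S = "{..<Suc j * n}"]) auto
  have "D * msub (p j) (X $ i) = der (Suc j * n) a (p j i)" if "i < 2 * N" for i
  proof -
    have "fr (msub (p j) (X $ i)) = (\<Sum>l<Suc j * n. k l * fr (mderiv l (p j i)))"
      using fun_cong[OF k, of i] that by (simp add: jcol_def)
    then have "fr (D * msub (p j) (X $ i)) = (\<Sum>l<Suc j * n. fr D * k l * fr (mderiv l (p j i)))"
      by (simp only: fr_simps sum_distrib_left mult.assoc)
    also have "\<dots> = (\<Sum>l<Suc j * n. fr (a l * mderiv l (p j i)))"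
      by (intro sum.cong refl) (simp only: D(2) fr_simps)
    finally show ?thesis by (simp only: fr_sum[symmetric] fr_eq_iff der_def)
  qed
  then show ?thesis using D(1) unfolding ptan_def by blast
qed

lemma T_if_ptan:
  assumes "ptan j X" shows "(\<lambda>i. if i < 2 * N then fr (msub (p j) (X $ i)) else 0) \<in> T j"
proof -
  obtain c a where c: "c \<noteq> 0" "\<And>i. i < 2 * N \<Longrightarrow> c * msub (p j) (X $ i) = der (Suc j * n) a (p j i)"
    using assms by (auto simp: ptan_def)
  have c0: "fr c \<noteq> 0" using c(1) by (simp add: fr_simps)
  show ?thesis unfolding T_def
  proof (rule spnI[of _ "\<lambda>l. fr (a l) / fr c"], rule ext)
    fix i
    show "(if i < 2 * N then fr (msub (p j) (X $ i)) else 0) = (\<Sum>l<Suc j * n. fr (a l) / fr c * fr (jcol (2 * N) (p j) l i))"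
    proof (cases "i < 2 * N")
      case True
      have "fr c * fr (msub (p j) (X $ i)) = (\<Sum>l<Suc j * n. fr (a l) * fr (mderiv l (p j i)))"
        using arg_cong[OF c(2)[OF True], of fr] by (simp only: der_def fr_sum fr_simps)
      then have "fr (msub (p j) (X $ i)) = (\<Sum>l<Suc j * n. fr (a l) * fr (mderiv l (p j i))) / fr c"
        using c0 by (simp only: nonzero_eq_divide_eq[OF c0] mult.commute)
      then show ?thesis using True by (simp only: jcol_def if_True sum_divide_distrib times_divide_eq_left)
    qed (simp add: jcol_def fr_simps)
  qed
qed

text \<open>Along \<open>p j\<close> the generating (0,1)-fields lie in \<open>E01 j\<close> and the
  (1,0)-fields in \<open>E10 j\<close>, both contained in \<open>T j\<close>; the operations of the
  Lie algebra preserve relatedness.\<close>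

lemma ptan_L:
  assumes eq: "E01 j \<subseteq> T j" and X: "X \<in> L" shows "ptan j X"
  using X L_field unfolding lie_algebra_def
proof (induction rule: lie_algebra_generated.induct)
  case (base X)
  then have X: "vector_field_01 N X \<or> vector_field_10 N X" "tangent X M" by auto
  have Xf: "vector_field (2 * N) X" using X(1) by (auto simp: vector_field_01_def vector_field_10_def)
  let ?w = "\<lambda>i. if i < 2 * N then fr (msub (p j) (X $ i)) else 0"
  have 0: "(\<Sum>i<2 * N. fr (msub (p j) (mderiv i f)) * ?w i) = 0" if f: "f \<in> M" for f
  proof -
    have fc: "f \<in> mcarr {..<2 * N}" using is_idealD(1)[OF M_ideal f] .
    have "(\<Sum>i<2 * N. fr (msub (p j) (mderiv i f)) * ?w i) = fr (\<Sum>i<2 * N. msub (p j) (X $ i) * msub (p j) (mderiv i f))"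
      unfolding fr_sum by (intro sum.cong refl) (simp add: fr_simps mult.commute)
    also have "(\<Sum>i<2 * N. msub (p j) (X $ i) * msub (p j) (mderiv i f)) = msub (p j) (vf_apply X f)"
      unfolding vf_apply_def vector_fieldD(1)[OF Xf]
      by (subst msub_sum[OF _ p_z]) (use Xf fc in \<open>auto simp: vector_fieldD msub_mult[OF _ p_z] intro!: mcarr_mult\<close>)
    also have "\<dots> = 0" using X(2) f by (intro p_M) (auto simp: tangent_def)
    finally show ?thesis by (simp add: fr_simps)
  qed
  have "?w \<in> T j"
  proof (cases "vector_field_01 N X")
    case True
    then have "?w \<in> E01 j" using 0 by (auto simp: E01_def vector_field_01_def msub_0[OF _ p_z] fr_simps)
    then show ?thesis using eq by blast
  next
    case False
    then have "?w \<in> E10 j" using 0 X(1) by (auto simp: E10_def vector_field_10_def msub_0[OF _ p_z] fr_simps)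
    then show ?thesis using E10_T by blast
  qed
  then show ?case by (rule ptan_if_T)
next
  case zero
  then show ?case unfolding ptan_def
    by (intro exI[of _ 1] exI[of _ "\<lambda>_. 0"]) (auto simp: der_def msub_0[OF _ p_z])
next
  case (add X Y)
  then have f: "vector_field (2 * N) X" "vector_field (2 * N) Y" by auto
  obtain c a where c: "c \<noteq> 0" "\<And>i. i < 2 * N \<Longrightarrow> c * msub (p j) (X $ i) = der (Suc j * n) a (p j i)"
    using add by (auto simp: ptan_def)
  obtain e b where e: "e \<noteq> 0" "\<And>i. i < 2 * N \<Longrightarrow> e * msub (p j) (Y $ i) = der (Suc j * n) b (p j i)"
    using add by (auto simp: ptan_def)
  have "c * e * msub (p j) ((X + Y) $ i) = der (Suc j * n) (\<lambda>l. e * a l + c * b l) (p j i)" if i: "i < 2 * N" for i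
    using i f unfolding der_add c(2)[OF i, symmetric] e(2)[OF i, symmetric]
    by (simp add: vector_fieldD msub_add[OF _ p_z] algebra_simps)
  then show ?case using c(1) e(1) unfolding ptan_def by (intro exI[of _ "c * e"]) auto
next
  case (scale X c')
  then have f: "vector_field (2 * N) X" by auto
  obtain c a where c: "c \<noteq> 0" "\<And>i. i < 2 * N \<Longrightarrow> c * msub (p j) (X $ i) = der (Suc j * n) a (p j i)"
    using scale by (auto simp: ptan_def)
  have "c * msub (p j) ((mscalar c' \<cdot>\<^sub>v X) $ i) = der (Suc j * n) (\<lambda>l. mscalar c' * a l + 0 * a l) (p j i)" if i: "i < 2 * N" for i
    using i f unfolding der_add c(2)[OF i, symmetric]
    by (simp add: vector_fieldD msub_mult[OF _ p_z] msub_mscalar[OF _ p_z] algebra_simps)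
  then show ?case using c(1) unfolding ptan_def by blast
next
  case (bracket X Y)
  then show ?case by (intro ptan_bracket) auto
qed

end

subsection \<open>Inverse mappings and reparametrizations\<close>

text \<open>There are \<open>P\<close> common variables, \<open>m\<close> parameters of the
  right-hand sides and \<open>n\<close> unknowns. The \<open>q\<close> equations may outnumber the
  unknowns, so only \<open>n\<close> constant combinations, given by a left inverse \<open>C\<close>
  of the Jacobian matrix, are solved; the applications show that all equations then hold.\<close>

lemma implicit_family:
  fixes f a :: "nat \<Rightarrow> complex mfps"
  assumes f: "\<And>i. i < q \<Longrightarrow> f i \<in> mcarr {..<P + n}" "\<And>i. i < q \<Longrightarrow> mconst (f i) = 0"
    and a: "\<And>i. i < q \<Longrightarrow> a i \<in> mcarr {..<P + m}" "\<And>i. i < q \<Longrightarrow> mconst (a i) = 0"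
    and ind: "indep {..<n} (\<lambda>l i. mconst (jcol q f (P + l) i))"
  obtains \<phi> C where "\<And>l. l < n \<Longrightarrow> \<phi> l \<in> mcarr {..<P + m}" "\<And>l. l < n \<Longrightarrow> mconst (\<phi> l) = 0"
    "\<And>l l'. l < n \<Longrightarrow> l' < n \<Longrightarrow> (\<Sum>i<q. C l i * mconst (mderiv (P + l') (f i))) = (if l = l' then 1 else 0)"
    "\<And>l. l < n \<Longrightarrow> (\<Sum>i<q. mscalar (C l i) * (msub (\<lambda>i. if i < P then mvar i else \<phi> (i - P)) (f i) - a i)) = 0"
proof -
  have inj: "u x = 0" if "\<And>i. i \<in> {..<q} \<Longrightarrow> (\<Sum>x\<in>{..<n}. mconst (mderiv (P + x) (f i)) * u x) = 0" "x \<in> {..<n}"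
    for u :: "nat \<Rightarrow> complex" and x
  proof -
    have "\<forall>i. (\<Sum>l<n. u l * mconst (jcol q f (P + l) i)) = 0"
    proof
      fix i
      show "(\<Sum>l<n. u l * mconst (jcol q f (P + l) i)) = 0"
        using that(1)[of i] by (cases "i < q") (simp_all add: jcol_def mult.commute del: mderiv.rep_eq)
    qed
    then have "\<forall>l\<in>{..<n}. u l = 0" using spec[OF ind[unfolded indep_def], of u] by (rule rev_mp)
    then show ?thesis using that(2) by blast
  qed
  obtain C where C: "\<And>x y. x \<in> {..<n} \<Longrightarrow> y \<in> {..<n} \<Longrightarrow>
      (\<Sum>i\<in>{..<q}. C x i * mconst (mderiv (P + y) (f i))) = (if x = y then 1 else 0)"
    by (rule left_inverse_exists[of "{..<q}" "{..<n}" "\<lambda>i l. mconst (mderiv (P + l) (f i))"])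
      (use inj in blast)+
  define k where "k = P + m + n"
  define B where "B = {P + m..<k}"
  \<comment> \<open>Moves the unknowns behind the parameters, to
    \<open>P + m, ..., P + m + n - 1\<close>.\<close>
  define \<theta> where "\<theta> i = (if i < P then mvar i else mvar (m + i) :: complex mfps)" for i
  have z\<theta>: "zconst {..<P + n} \<theta>" by (auto simp: zconst_def \<theta>_def)
  have f': "msub \<theta> (f i) \<in> mcarr {..<k}" if "i < q" for i
    by (rule mcarr_msub[OF _ z\<theta> f(1)[OF that]]) (auto simp: \<theta>_def k_def intro!: mcarr_mvar)
  have ak: "a i \<in> mcarr {..<k}" if "i < q" for i
    by (rule mcarr_mono[OF a(1)[OF that]]) (auto simp: k_def)
  define E where "E b = (\<Sum>i<q. mscalar (C (b - (P + m)) i) * (msub \<theta> (f i) - a i))" for b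
  have df: "mderiv (P + m + l) (msub \<theta> (f i)) = msub \<theta> (mderiv (P + l) (f i))" if "i < q" "l < n" for i l
  proof -
    have "mderiv (P + m + l) (msub \<theta> (f i)) = (\<Sum>j<P + n. msub \<theta> (mderiv j (f i)) * mderiv (P + m + l) (\<theta> j))"
      by (rule mderiv_msub[OF _ z\<theta> f(1)[OF that(1)]]) simp
    also have "\<dots> = (\<Sum>j<P + n. if j = P + l then msub \<theta> (mderiv j (f i)) else 0)"
      by (intro sum.cong refl) (auto simp: \<theta>_def mderiv_mvar)
    finally show ?thesis using that by simp
  qed
  have delta: "mconst (mderiv c (E b)) = (if b = c then 1 else 0)" if bc: "b \<in> B" "c \<in> B" for b c
  proof -
    have c: "c = P + m + (c - (P + m))" "c - (P + m) < n" "b - (P + m) < n" "b = P + m + (b - (P + m))"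
      using bc by (auto simp: B_def k_def)
    have 1: "mconst (mderiv c (msub \<theta> (f i) - a i)) = mconst (mderiv (P + (c - (P + m))) (f i))" if i: "i < q" for i
    proof -
      have "mderiv c (a i) = 0" using mderiv_notin[OF a(1)[OF i]] bc by (auto simp: B_def)
      then have "mderiv c (msub \<theta> (f i) - a i) = msub \<theta> (mderiv (P + (c - (P + m))) (f i))"
        using df[OF i c(2)] c(1) by simp
      then show ?thesis using mconst_msub[OF _ z\<theta>] f(1)[OF i] by (simp del: mderiv.rep_eq)
    qed
    have "mconst (mderiv c (E b)) = (\<Sum>i<q. C (b - (P + m)) i * mconst (mderiv c (msub \<theta> (f i) - a i)))"
      by (simp add: E_def mderiv_sum mcoeff_sum mderiv_mult del: mderiv.rep_eq mderiv_diff)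
    also have "\<dots> = (if b - (P + m) = c - (P + m) then 1 else 0)"
      using C[of "b - (P + m)" "c - (P + m)"] c 1 by (simp del: mderiv.rep_eq)
    finally show ?thesis using c by (metis (no_types))
  qed
  have Bk: "B \<subseteq> {..<k}" by (auto simp: B_def)
  have Ek: "E b \<in> mcarr {..<k}" for b
    unfolding E_def by (intro mcarr_sum mcarr_mult mcarr_diff mcarr_mscalar) (use f' ak in auto)
  have E0: "mconst (E b) = 0" for b
    by (simp add: E_def mcoeff_sum mconst_msub[OF _ z\<theta>] f a)
  obtain h where h: "\<And>b. b \<in> B \<Longrightarrow> h b \<in> mcarr ({..<k} - B)" "\<And>b. b \<in> B \<Longrightarrow> mconst (h b) = 0"
    "\<And>b. b \<in> B \<Longrightarrow> msub (\<lambda>i. if i \<in> B then h i else mvar i) (E b) = 0"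
    by (rule implicit_function[OF Bk, of E]) (use Ek E0 delta in blast)+
  have kB: "{..<k} - B = {..<P + m}" by (auto simp: B_def k_def)
  define \<phi> where "\<phi> l = h (P + m + l)" for l
  let ?\<eta> = "\<lambda>i. if i \<in> B then h i else mvar i"
  let ?\<theta>' = "\<lambda>i. if i < P then mvar i else \<phi> (i - P)"
  have z\<eta>: "zconst {..<k} ?\<eta>" using h(2) by (auto simp: zconst_def)
  have "(\<Sum>i<q. mscalar (C l i) * (msub ?\<theta>' (f i) - a i)) = 0" if l: "l < n" for l
  proof -
    have 1: "msub ?\<eta> (msub \<theta> (f i)) = msub ?\<theta>' (f i)" if i: "i < q" for i
    proof -
      have "msub ?\<eta> (msub \<theta> (f i)) = msub (\<lambda>j. msub ?\<eta> (\<theta> j)) (f i)"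
        by (rule msub_msub[OF _ f(1)[OF i] _ z\<theta> _ z\<eta>]) (auto simp: \<theta>_def k_def intro!: mcarr_mvar)
      also have "\<dots> = msub ?\<theta>' (f i)"
      proof (rule msub_cong[OF _ f(1)[OF i]])
        show *: "msub ?\<eta> (\<theta> j) = ?\<theta>' j" if "j \<in> {..<P + n}" for j
          using that by (auto simp: \<theta>_def msub_mvar[OF _ z\<eta>] k_def) (auto simp: B_def k_def \<phi>_def algebra_simps)
        have "zconst {..<P + n} ?\<theta>'" using h(2) by (auto simp: zconst_def \<phi>_def B_def k_def)
        then show "zconst {..<P + n} (\<lambda>j. msub ?\<eta> (\<theta> j))" using * unfolding zconst_def by simp
      qed simp
      finally show ?thesis .
    qed
    have 2: "msub ?\<eta> (a i) = a i" if i: "i < q" for i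
      by (rule msub_id[OF _ a(1)[OF i]]) (auto simp: B_def)
    have "0 = msub ?\<eta> (E (P + m + l))" using h(3)[of "P + m + l"] l by (simp add: B_def k_def)
    also have "\<dots> = (\<Sum>i<q. msub ?\<eta> (mscalar (C l i) * (msub \<theta> (f i) - a i)))"
      unfolding E_def by (subst msub_sum[OF _ z\<eta>]) (auto simp: f' ak)
    also have "\<dots> = (\<Sum>i<q. mscalar (C l i) * (msub ?\<theta>' (f i) - a i))"
      by (intro sum.cong refl) (simp add: msub_mult[OF _ z\<eta>] msub_mscalar[OF _ z\<eta>] msub_diff[OF _ z\<eta>] f' ak 1 2)
    finally show ?thesis by simp
  qed
  moreover have "\<phi> l \<in> mcarr {..<P + m}" "mconst (\<phi> l) = 0" if "l < n" for l
    using h(1,2)[of "P + m + l"] that kB by (auto simp: \<phi>_def B_def k_def)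
  moreover have "(\<Sum>i<q. C l i * mconst (mderiv (P + l') (f i))) = (if l = l' then 1 else 0)" if "l < n" "l' < n" for l l'
    using C[of l l'] that by simp
  ultimately show ?thesis using that[of \<phi> C] by blast
qed

text \<open>With as many equations as unknowns \<open>C\<close> is invertible, so the combinations
  vanish only if every equation holds. The result satisfies \<Psi> o G = id.\<close>

lemma inverse_mapping:
  fixes \<Psi> :: "nat \<Rightarrow> complex mfps"
  assumes \<Psi>: "\<And>i. i < m \<Longrightarrow> \<Psi> i \<in> mcarr {..<m}" "\<And>i. i < m \<Longrightarrow> mconst (\<Psi> i) = 0"
    and ind: "indep {..<m} (\<lambda>l i. mconst (jcol m \<Psi> l i))"
  obtains G where "\<And>i. i < m \<Longrightarrow> G i \<in> mcarr {..<m}" "\<And>i. i < m \<Longrightarrow> mconst (G i) = 0"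
    "\<And>i. i < m \<Longrightarrow> msub G (\<Psi> i) = mvar i"
proof -
  obtain \<phi> C where \<phi>: "\<And>l. l < m \<Longrightarrow> \<phi> l \<in> mcarr {..<0 + m}" "\<And>l. l < m \<Longrightarrow> mconst (\<phi> l) = 0"
    "\<And>l l'. l < m \<Longrightarrow> l' < m \<Longrightarrow> (\<Sum>i<m. C l i * mconst (mderiv (0 + l') (\<Psi> i))) = (if l = l' then 1 else 0)"
    "\<And>l. l < m \<Longrightarrow> (\<Sum>i<m. mscalar (C l i) * (msub (\<lambda>i. if i < 0 then mvar i else \<phi> (i - 0)) (\<Psi> i) - mvar i)) = 0"
    by (rule implicit_family[of m \<Psi> 0 m mvar m]) (use \<Psi> ind in \<open>auto intro: mcarr_mvar\<close>)
  have sq: "u i = 0" if u: "\<And>l. l \<in> {..<m} \<Longrightarrow> (\<Sum>i\<in>{..<m}. mconst (mscalar (C l i)) * u i) = 0" and i: "i \<in> {..<m}"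
    for u :: "nat \<Rightarrow> complex" and i
  proof -
    define U where "U = {u :: nat \<Rightarrow> complex. \<forall>i. i \<notin> {..<m} \<longrightarrow> u i = 0}"
    have "lsub U" by (rule lsubI) (auto simp: U_def)
    moreover have "v = (\<lambda>_. 0)" if "v \<in> U" "\<forall>x\<in>{..<m}. v x = 0" for v using that by (auto simp: U_def)
    ultimately have U: "spn {..<m} (\<lambda>l i. mconst (jcol m \<Psi> l i)) = U"
      using hasdim_full(1)[of U "{..<m}" "{..<m}" "\<lambda>l i. mconst (jcol m \<Psi> l i)"] ind
      by (simp add: U_def jcol_def)
    have "(\<lambda>i. if i < m then u i else 0) \<in> U" by (simp add: U_def)
    then obtain k where k: "(\<lambda>i. if i < m then u i else 0) = (\<lambda>i. \<Sum>l<m. k l * mconst (jcol m \<Psi> l i))"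
      unfolding U[symmetric] by (rule spnE)
    have uk: "u i = (\<Sum>l<m. k l * mconst (mderiv l (\<Psi> i)))" if "i < m" for i
      using fun_cong[OF k, of i] that by (simp add: jcol_def del: mderiv.rep_eq)
    have "k l = 0" if l: "l < m" for l
    proof -
      have "0 = (\<Sum>i<m. C l i * u i)" using u[of l] l by simp
      also have "\<dots> = (\<Sum>i<m. \<Sum>l'<m. k l' * (C l i * mconst (mderiv l' (\<Psi> i))))"
        by (intro sum.cong refl) (simp add: uk sum_distrib_left mult.left_commute del: mderiv.rep_eq)
      also have "\<dots> = (\<Sum>l'<m. k l' * (\<Sum>i<m. C l i * mconst (mderiv (0 + l') (\<Psi> i))))"
        by (subst sum.swap) (simp add: sum_distrib_left del: mderiv.rep_eq)
      also have "\<dots> = (\<Sum>l'<m. if l' = l then k l' else 0)"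
      proof (intro sum.cong refl)
        fix x assume "x \<in> {..<m}"
        then have xm: "x < m" by simp
        show "k x * (\<Sum>i<m. C l i * mconst (mderiv (0 + x) (\<Psi> i))) = (if x = l then k x else 0)"
          unfolding \<phi>(3)[OF l xm] by simp
      qed
      also have "\<dots> = k l" using l by simp
      finally show ?thesis by simp
    qed
    then show ?thesis using uk i by (simp del: mderiv.rep_eq)
  qed
  have "msub \<phi> (\<Psi> i) - mvar i = 0" if i: "i < m" for i
  proof (rule mfps_linear_system_unique[where J = "{..<m}" and R = "{..<m}" and Q = "\<lambda>l i. mscalar (C l i)"
        and k = "\<lambda>i. msub \<phi> (\<Psi> i) - mvar i"])
    show "(\<Sum>i\<in>{..<m}. mscalar (C l i) * (msub \<phi> (\<Psi> i) - mvar i)) = 0" if "l \<in> {..<m}" for l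
      using \<phi>(4)[of l] that by simp
    show "u i = 0" if "\<And>l. l \<in> {..<m} \<Longrightarrow> (\<Sum>i\<in>{..<m}. mconst (mscalar (C l i)) * u i) = 0" "i \<in> {..<m}" for u i
      using that by (rule sq)
  qed (use i in simp_all)
  then have "msub \<phi> (\<Psi> i) = mvar i" if "i < m" for i using that by simp
  then show ?thesis using \<phi>(1,2) by (intro that[of \<phi>]) auto
qed

text \<open>By the chain rule a relation between the columns of the Jacobian matrix of
  \<open>v\<close> also holds for its composition with \<open>G\<close>.\<close>

lemma Rk_left_le:
  assumes v: "v \<in> carrier_vec N" "\<And>i. i < N \<Longrightarrow> mconst (v $ i) = 0"
    and G: "\<And>i. i < N \<Longrightarrow> G i \<in> mcarr {..<N}"
    and w: "w \<in> carrier_vec N" "\<And>i. i < N \<Longrightarrow> w $ i = msub (($) v) (G i)"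
  shows "Rk k w \<le> Rk k v"
proof -
  obtain S where S: "S \<subseteq> {..<k}" "indep S (\<lambda>l i. fr (jcol N (($) w) l i))" "card S = Rk k w"
    by (rule hasdim_basis[OF hasdim_Rk[OF w(1), of k] finite_lessThan finite_lessThan[of N]]) (use jcol_out in blast)+
  have fin: "finite S" using S(1) finite_subset by blast
  have z: "zconst {..<N} (($) v)" using v(2) by (simp add: zconst_def)
  have "indep S (\<lambda>l i. fr (jcol N (($) v) l i))" unfolding indep_fr_iff[OF fin]
  proof (intro allI impI)
    fix c assume 0: "\<forall>i. (\<Sum>l\<in>S. c l * jcol N (($) v) l i) = 0"
    have "(\<Sum>l\<in>S. c l * jcol N (($) w) l i) = 0" for i
    proof (cases "i < N")
      case True
      have "(\<Sum>l\<in>S. c l * jcol N (($) w) l i) = (\<Sum>l\<in>S. \<Sum>j<N. msub (($) v) (mderiv j (G i)) * (c l * jcol N (($) v) l j))"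
        using True by (intro sum.cong refl)
          (simp add: jcol_def w(2) mderiv_msub[OF _ z G] sum_distrib_left mult.left_commute)
      also have "\<dots> = (\<Sum>j<N. msub (($) v) (mderiv j (G i)) * (\<Sum>l\<in>S. c l * jcol N (($) v) l j))"
        by (subst sum.swap) (simp add: sum_distrib_left)
      finally show ?thesis using 0 by simp
    qed (simp add: jcol_def)
    then have "\<forall>i. (\<Sum>l\<in>S. c l * jcol N (($) w) l i) = 0" by blast
    then show "\<forall>l\<in>S. c l = 0" using spec[OF S(2)[unfolded indep_fr_iff[OF fin]], of c] by (rule rev_mp)
  qed
  then show ?thesis
    using indep_card_le[OF hasdim_Rk[OF v(1), of k] fin] S(1,3) in_spn[of "{..<k}"] by (metis finite_lessThan subsetD)
qed

text \<open>By the chain rule the columns for \<open>w\<close> lie in the span of those for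
  \<open>v\<close> after substitution of \<Psi>, and a relation between the columns for
  \<open>v\<close> survives the substitution, because \<Psi> kills no nonzero series.\<close>

lemma Rk_right_le:
  assumes v: "v \<in> carrier_vec N" "\<And>i. i < N \<Longrightarrow> v $ i \<in> mcarr {..<k}"
    and \<Psi>: "\<And>l. l < k \<Longrightarrow> mconst (\<Psi> l) = 0" "\<And>f. f \<in> mcarr {..<k} \<Longrightarrow> msub \<Psi> f = 0 \<Longrightarrow> f = 0"
    and w: "w \<in> carrier_vec N" "\<And>i. i < N \<Longrightarrow> w $ i = msub \<Psi> (v $ i)"
  shows "Rk k w \<le> Rk k v"
proof -
  have z: "zconst {..<k} \<Psi>" using \<Psi>(1) by (simp add: zconst_def)
  define u where "u l i = msub \<Psi> (jcol N (($) v) l i)" for l i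
  have jc: "jcol N (($) v) l i \<in> mcarr {..<k}" for l i using v(2) by (simp add: jcol_def)
  have u_out: "fr (u l i) = 0" if "i \<notin> {..<N}" for l i
    using that by (simp add: u_def jcol_def msub_0[OF _ z] fr_simps)
  obtain S where S: "S \<subseteq> {..<k}" "indep S (\<lambda>l i. fr (u l i))" "spn S (\<lambda>l i. fr (u l i)) = spn {..<k} (\<lambda>l i. fr (u l i))"
    by (rule spn_basis[OF finite_lessThan])
  have fin: "finite S" using S(1) finite_subset by blast
  have "spn {..<k} (\<lambda>l i. fr (jcol N (($) w) l i)) \<subseteq> spn {..<k} (\<lambda>l i. fr (u l i))"
  proof (rule spn_subset[OF lsub_spn finite_lessThan], rule spnI, rule ext)
    fix l i
    show "fr (jcol N (($) w) l i) = (\<Sum>j<k. fr (mderiv l (\<Psi> j)) * fr (u j i))"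
    proof (cases "i < N")
      case True
      then have "jcol N (($) w) l i = (\<Sum>j<k. mderiv l (\<Psi> j) * u j i)"
        by (simp add: jcol_def w(2) mderiv_msub[OF _ z v(2)] u_def mult.commute)
      then show ?thesis by (simp add: fr_sum fr_simps)
    qed (simp add: jcol_def u_def msub_0[OF _ z] fr_simps)
  qed
  moreover have "hasdim (spn S (\<lambda>l i. fr (u l i))) (card S)"
    using hasdim_spn_indep[OF fin finite_lessThan[of N] _ S(2)] u_out by blast
  ultimately have le: "Rk k w \<le> card S" using hasdim_mono[OF hasdim_Rk[OF w(1)]] S(3) by simp
  have "indep S (\<lambda>l i. fr (jcol N (($) v) l i))" unfolding indep_fr_iff[OF fin]
  proof (intro allI impI ballI, rule ccontr)
    fix c l assume 0: "\<forall>i. (\<Sum>l\<in>S. c l * jcol N (($) v) l i) = 0" and l: "l \<in> S" "c l \<noteq> 0"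
    \<comment> \<open>The coefficients may involve variables beyond \<open>k\<close>, where \<Psi>
      is not controlled; a suitable slice of the relation has coefficients in the first
      \<open>k\<close> variables, one of them nonzero.\<close>
    obtain m where m: "mcoeff (c l) m \<noteq> 0" using l(2) by (auto simp: mfps_eq_iff zero_mfps.rep_eq)
    define r where "r = filter_mset (\<lambda>i. \<not> i < k) m"
    have "m = filter_mset (\<lambda>i. i < k) m + r" unfolding r_def by (rule multiset_partition)
    with m have "mcoeff (mslice k r (c l)) (filter_mset (\<lambda>i. i < k) m) \<noteq> 0" by (auto simp: mslice.rep_eq)
    then have nz: "mslice k r (c l) \<noteq> 0" by (auto simp: zero_mfps.rep_eq)
    have car: "mslice k r f \<in> mcarr {..<k}" for f using mslice_carrier[of k r f] by (simp add: mfps_carrier_eq)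
    have r0: "set_mset r \<inter> {..<k} = {}" by (auto simp: r_def)
    have "(\<Sum>l\<in>S. msub \<Psi> (mslice k r (c l)) * u l i) = 0" for i
    proof -
      have "(\<Sum>l\<in>S. mslice k r (c l) * jcol N (($) v) l i) = mslice k r (\<Sum>l\<in>S. c l * jcol N (($) v) l i)"
        unfolding mslice_sum using jc by (intro sum.cong refl) (simp add: mslice_mult[OF _ r0] mfps_carrier_eq)
      also have "\<dots> = 0" using 0 by (intro mfps_eqI) (simp add: mslice.rep_eq zero_mfps.rep_eq)
      finally have "msub \<Psi> (\<Sum>l\<in>S. mslice k r (c l) * jcol N (($) v) l i) = 0" by (simp add: msub_0[OF _ z])
      then show ?thesis using jc car
        by (simp add: msub_sum[OF _ z] msub_mult[OF _ z] u_def)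
    qed
    then have "\<forall>i. (\<Sum>l\<in>S. msub \<Psi> (mslice k r (c l)) * u l i) = 0" by blast
    then have "\<forall>l\<in>S. msub \<Psi> (mslice k r (c l)) = 0"
      using spec[OF S(2)[unfolded indep_fr_iff[OF fin]], of "\<lambda>l. msub \<Psi> (mslice k r (c l))"] by (rule rev_mp)
    then have "mslice k r (c l) = 0" using \<Psi>(2)[OF car] l(1) by blast
    then show False using nz by simp
  qed
  then have "card S \<le> Rk k v"
    using indep_card_le[OF hasdim_Rk[OF v(1), of k] fin] S(1) in_spn[of "{..<k}"] by (metis finite_lessThan subsetD)
  then show ?thesis using le by simp
qed

section \<open>Comparison of two Segre variety mappings\<close>

context segre
begin

text \<open>The function \<phi> is chosen so that \<open>n\<close> combinations of the components
  agree. By the Taylor formula for the \<open>r b\<close>, the difference \<delta> of the two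
  mappings satisfies \<open>d\<close> further linear equations. At the origin these N equations have
  only the zero solution, so \<delta> vanishes.\<close>

lemma reparametrization:
  assumes "segre N d M B r n \<gamma>'"
  obtains \<phi> where "\<And>l. l < n \<Longrightarrow> \<phi> l \<in> mcarr {..<N + n}" "\<And>l. l < n \<Longrightarrow> mconst (\<phi> l) = 0"
    "\<And>i. i < N \<Longrightarrow> \<gamma>' $ i = msub (\<lambda>i. if i < N then mvar i else \<phi> (i - N)) (\<gamma> $ i)"
    "indep {..<n} (\<lambda>l i. mconst (jcol n \<phi> (N + l) i))"
proof -
  interpret s': segre N d M B r n \<gamma>' by fact
  obtain \<phi> C where \<phi>: "\<And>l. l < n \<Longrightarrow> \<phi> l \<in> mcarr {..<N + n}" "\<And>l. l < n \<Longrightarrow> mconst (\<phi> l) = 0"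
    and C: "\<And>l l'. l < n \<Longrightarrow> l' < n \<Longrightarrow> (\<Sum>i<N. C l i * mconst (mderiv (N + l') (\<gamma> $ i))) = (if l = l' then 1 else 0)"
    "\<And>l. l < n \<Longrightarrow> (\<Sum>i<N. mscalar (C l i) * (msub (\<lambda>i. if i < N then mvar i else \<phi> (i - N)) (\<gamma> $ i) - \<gamma>' $ i)) = 0"
    by (rule implicit_family[of N "($) \<gamma>" N n "($) \<gamma>'" n])
      (use \<gamma>_carr \<gamma>_const s'.\<gamma>_carr s'.\<gamma>_const \<gamma>_t in blast)+
  let ?\<theta> = "\<lambda>i. if i < N then mvar i else \<phi> (i - N)"
  have z\<theta>: "zconst {..<N + n} ?\<theta>" using \<phi> by (auto simp: zconst_def)
  define \<delta> where "\<delta> i = msub ?\<theta> (\<gamma> $ i) - \<gamma>' $ i" for i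
  define \<Theta> where "\<Theta> i = (if i < N then msub ?\<theta> (\<gamma> $ i) else mvar (i - N))" for i
  have \<Theta>0: "mconst (msub ?\<theta> (\<gamma> $ i)) = 0" if "i < N" for i
    using mconst_msub[OF _ z\<theta> \<gamma>_carr[OF that]] \<gamma>_const[OF that] by simp
  have z\<Theta>: "zconst {..<2 * N} \<Theta>" using \<Theta>0 by (auto simp: zconst_def \<Theta>_def)
  have \<Theta>M: "msub \<Theta> f = 0" if f: "f \<in> M" for f
  proof -
    note c = is_idealD(1)[OF M_ideal f]
    have "msub ?\<theta> (msub (pgam N \<gamma>) f) = msub (\<lambda>i. msub ?\<theta> (pgam N \<gamma> i)) f"
      by (rule msub_msub[OF _ c _ pgam_z _ z\<theta>]) (auto simp: pgam_def \<gamma>_carr intro: mcarr_mvar)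
    also have "\<dots> = msub \<Theta> f"
      using \<Theta>0 by (intro msub_cong[OF _ c]) (auto simp: zconst_def pgam_def \<Theta>_def msub_mvar[OF _ z\<theta>])
    finally show ?thesis using \<gamma>_M[OF f] msub_0[OF _ z\<theta>] by simp
  qed
  have "\<forall>b. \<exists>Q. b \<in> B \<longrightarrow> (\<forall>i<2 * N. Q i \<in> mcarr UNIV \<and> mconst (Q i) = mconst (mderiv i (r b))) \<and>
    msub \<Theta> (r b) - msub (pgam N \<gamma>') (r b) = (\<Sum>i<2 * N. (\<Theta> i - pgam N \<gamma>' i) * Q i)"
    using mfps_taylor_ex[OF r_carr z\<Theta> s'.pgam_z, of _ UNIV] by (auto simp: mcarr_def)
  from choice[OF this] obtain Q where Q: "\<And>b i. b \<in> B \<Longrightarrow> i < 2 * N \<Longrightarrow> mconst (Q b i) = mconst (mderiv i (r b))"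
    "\<And>b. b \<in> B \<Longrightarrow> msub \<Theta> (r b) - msub (pgam N \<gamma>') (r b) = (\<Sum>i<2 * N. (\<Theta> i - pgam N \<gamma>' i) * Q b i)"
    by blast
  have Q0: "(\<Sum>i<N. Q b i * \<delta> i) = 0" if b: "b \<in> B" for b
  proof -
    have "0 = (\<Sum>i<2 * N. (\<Theta> i - pgam N \<gamma>' i) * Q b i)"
      using Q(2)[OF b] \<Theta>M[OF r[OF b]] s'.\<gamma>_M[OF r[OF b]] by simp
    also have "\<dots> = (\<Sum>i<N. Q b i * \<delta> i)"
      by (intro sum.mono_neutral_cong_right) (auto simp: \<Theta>_def pgam_def \<delta>_def mult.commute)
    finally show ?thesis by simp
  qed
  \<comment> \<open>The common kernel of the Z-differentials of the \<open>r b\<close>; it turns out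
    to be spanned by the columns of \<partial>\<gamma>/\<partial>t at the origin.\<close>
  define U where "U = {u :: nat \<Rightarrow> complex. (\<forall>i. i \<notin> {..<N} \<longrightarrow> u i = 0) \<and> (\<forall>b\<in>B. (\<Sum>i<N. mconst (mderiv i (r b)) * u i) = 0)}"
  have lsU: "lsub U"
  proof (rule lsubI)
    show "(\<lambda>_. 0) \<in> U" by (simp add: U_def)
    fix v w c assume vw: "v \<in> U" "w \<in> U"
    have "(\<Sum>i<N. mconst (mderiv i (r b)) * (v i + c * w i))
        = (\<Sum>i<N. mconst (mderiv i (r b)) * v i) + c * (\<Sum>i<N. mconst (mderiv i (r b)) * w i)" for b
      by (simp add: distrib_left sum.distrib sum_distrib_left mult.left_commute del: mderiv.rep_eq)
    then show "(\<lambda>i. v i + c * w i) \<in> U" using vw by (simp add: U_def del: mderiv.rep_eq)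
  qed
  have Uinj: "u = (\<lambda>_. 0)" if u: "u \<in> U" "\<forall>x\<in>{..<N} - B. u x = 0" for u
  proof -
    have out: "u i = 0" if "i \<notin> B" for i using u that by (cases "i < N") (auto simp: U_def)
    have "u b = 0" if b: "b \<in> B" for b
    proof -
      have "0 = (\<Sum>i<N. mconst (mderiv i (r b)) * u i)" using u(1) b by (simp add: U_def del: mderiv.rep_eq)
      also have "\<dots> = (\<Sum>i\<in>B. if b = i then u i else 0)"
        using B(1) out b by (intro sum.mono_neutral_cong_right) (auto simp: finB r_delta simp del: mderiv.rep_eq)
      finally show ?thesis using b finB by simp
    qed
    then show ?thesis using out by blast
  qed
  let ?w = "\<lambda>l i. mconst (jcol N (($) \<gamma>) (N + l) i)"
  have wU: "?w l \<in> U" if l: "l < n" for l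
  proof -
    have "(\<Sum>i<N. mconst (mderiv i (r b)) * ?w l i) = 0" if b: "b \<in> B" for b
    proof -
      have "0 = mderiv (N + l) (msub (pgam N \<gamma>) (r b))" using \<gamma>_M[OF r[OF b]] by simp
      also have "\<dots> = (\<Sum>i<2 * N. msub (pgam N \<gamma>) (mderiv i (r b)) * mderiv (N + l) (pgam N \<gamma> i))"
        by (rule mderiv_msub[OF _ pgam_z r_carr[OF b]]) simp
      also have "\<dots> = (\<Sum>i<N. msub (pgam N \<gamma>) (mderiv i (r b)) * jcol N (($) \<gamma>) (N + l) i)"
        by (intro sum.mono_neutral_cong_right) (auto simp: pgam_def jcol_def mderiv_mvar)
      finally have "mconst (\<Sum>i<N. msub (pgam N \<gamma>) (mderiv i (r b)) * jcol N (($) \<gamma>) (N + l) i) = mconst 0" by simp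
      then show ?thesis using r_carr[OF b]
        by (simp add: mconst_msub[OF _ pgam_z] del: mderiv.rep_eq)
    qed
    then show ?thesis by (simp add: U_def jcol_def del: mderiv.rep_eq)
  qed
  have "card ({..<N} - B) \<le> card {..<n}" using B finB by (simp add: card_Diff_subset n)
  then have spU: "spn {..<n} ?w = U"
    using hasdim_full(1)[OF lsU, of "{..<N} - B" "{..<n}" ?w] Uinj wU \<gamma>_t by simp
  define QQ where "QQ x i = (case x of Inl l \<Rightarrow> mscalar (C l i) | Inr b \<Rightarrow> Q b i)" for x i
  have "\<delta> i = 0" if i: "i < N" for i
  proof (rule mfps_linear_system_unique[where J = "{..<N}" and R = "Inl ` {..<n} \<union> Inr ` B" and Q = QQ and k = \<delta>])
    fix u i assume u: "\<And>x. x \<in> Inl ` {..<n} \<union> Inr ` B \<Longrightarrow> (\<Sum>i\<in>{..<N}. mconst (QQ x i) * u i) = 0" and i: "i \<in> {..<N}"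
    have "(\<lambda>i. if i < N then u i else 0) \<in> U"
      unfolding U_def
    proof (intro CollectI conjI ballI)
      fix b assume b: "b \<in> B"
      have "(\<Sum>i<N. mconst (mderiv i (r b)) * (if i < N then u i else 0)) = (\<Sum>i<N. mconst (QQ (Inr b) i) * u i)"
        using b by (intro sum.cong refl) (simp add: QQ_def Q(1) del: mderiv.rep_eq)
      then show "(\<Sum>i<N. mconst (mderiv i (r b)) * (if i < N then u i else 0)) = 0" using u[of "Inr b"] b by simp
    qed simp
    then obtain k where k: "(\<lambda>i. if i < N then u i else 0) = (\<lambda>i. \<Sum>l<n. k l * ?w l i)"
      unfolding spU[symmetric] by (rule spnE)
    have uk: "u i = (\<Sum>l<n. k l * mconst (mderiv (N + l) (\<gamma> $ i)))" if "i < N" for i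
      using fun_cong[OF k, of i] that by (simp add: jcol_def del: mderiv.rep_eq)
    have "k l = 0" if l: "l < n" for l
    proof -
      have "0 = (\<Sum>i<N. C l i * u i)" using u[of "Inl l"] l by (simp add: QQ_def)
      also have "\<dots> = (\<Sum>i<N. \<Sum>l'<n. k l' * (C l i * mconst (mderiv (N + l') (\<gamma> $ i))))"
        by (intro sum.cong refl) (simp add: uk sum_distrib_left mult.left_commute del: mderiv.rep_eq)
      also have "\<dots> = (\<Sum>l'<n. k l' * (\<Sum>i<N. C l i * mconst (mderiv (N + l') (\<gamma> $ i))))"
        by (subst sum.swap) (simp add: sum_distrib_left del: mderiv.rep_eq)
      also have "\<dots> = (\<Sum>l'<n. if l' = l then k l' else 0)"
        using l by (intro sum.cong refl) (simp add: C(1) del: mderiv.rep_eq)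
      finally show ?thesis using l by simp
    qed
    then show "u i = 0" using uk i by (simp del: mderiv.rep_eq)
  next
    fix x assume "x \<in> Inl ` {..<n} \<union> Inr ` B"
    then show "(\<Sum>i\<in>{..<N}. QQ x i * \<delta> i) = 0" using C(2) Q0 by (auto simp: QQ_def \<delta>_def)
  qed (use i in auto)
  then have eq: "\<gamma>' $ i = msub ?\<theta> (\<gamma> $ i)" if "i < N" for i using that by (simp add: \<delta>_def)
  \<comment> \<open>A relation between the t-derivatives of \<phi> would give one between those of
    \<gamma>'.\<close>
  have "indep {..<n} (\<lambda>l i. mconst (jcol n \<phi> (N + l) i))"
    unfolding indep_def
  proof (intro allI impI)
    fix c assume 0: "\<forall>i. (\<Sum>l<n. c l * mconst (jcol n \<phi> (N + l) i)) = 0"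
    have "(\<Sum>l<n. c l * mconst (jcol N (($) \<gamma>') (N + l) i)) = 0" for i
    proof (cases "i < N")
      case True
      have "mconst (mderiv (N + l) (\<gamma>' $ i)) = (\<Sum>k<n. mconst (mderiv (N + k) (\<gamma> $ i)) * mconst (jcol n \<phi> (N + l) k))" for l
      proof -
        have "mderiv (N + l) (\<gamma>' $ i) = (\<Sum>k<N + n. msub ?\<theta> (mderiv k (\<gamma> $ i)) * mderiv (N + l) (?\<theta> k))"
          unfolding eq[OF True] by (rule mderiv_msub[OF _ z\<theta> \<gamma>_carr[OF True]]) simp
        also have "\<dots> = (\<Sum>k\<in>{N..<N + n}. msub ?\<theta> (mderiv k (\<gamma> $ i)) * mderiv (N + l) (\<phi> (k - N)))"
          by (intro sum.mono_neutral_cong_right) (auto simp: mderiv_mvar)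
        also have "\<dots> = (\<Sum>k<n. msub ?\<theta> (mderiv (N + k) (\<gamma> $ i)) * jcol n \<phi> (N + l) k)"
          by (rule sum.reindex_bij_witness[of _ "\<lambda>k. N + k" "\<lambda>k. k - N"]) (auto simp: jcol_def)
        finally show ?thesis using \<gamma>_carr[OF True]
          by (simp add: mcoeff_sum mconst_msub[OF _ z\<theta>] del: mderiv.rep_eq)
      qed
      then have "(\<Sum>l<n. c l * mconst (jcol N (($) \<gamma>') (N + l) i))
          = (\<Sum>l<n. \<Sum>k<n. mconst (mderiv (N + k) (\<gamma> $ i)) * (c l * mconst (jcol n \<phi> (N + l) k)))"
        using True by (intro sum.cong refl) (simp add: jcol_def sum_distrib_left mult.left_commute del: mderiv.rep_eq)
      also have "\<dots> = (\<Sum>k<n. mconst (mderiv (N + k) (\<gamma> $ i)) * (\<Sum>l<n. c l * mconst (jcol n \<phi> (N + l) k)))"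
        by (subst sum.swap) (simp add: sum_distrib_left del: mderiv.rep_eq)
      finally show ?thesis using 0 by simp
    qed (simp add: jcol_def)
    then have "\<forall>i. (\<Sum>l<n. c l * mconst (jcol N (($) \<gamma>') (N + l) i)) = 0" by blast
    then show "\<forall>l\<in>{..<n}. c l = 0" using spec[OF s'.\<gamma>_t[unfolded indep_def], of c] by (rule rev_mp)
  qed
  then show ?thesis using that[of \<phi>] \<phi> eq by blast
qed

text \<open>The new v^j is the old one after an invertible substitution \<Psi> of (t^1, ..., t^j),
  built recursively. Exchanging the two mappings gives the opposite inequality.\<close>

lemma Rk_reparametrization_le:
  assumes "segre N d M B r n \<gamma>'"
  shows "Rk (j * n) (segre_mapping N n \<gamma>' j) \<le> R j"
proof -
  interpret s': segre N d M B r n \<gamma>' by fact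
  obtain \<phi> where \<phi>: "\<And>l. l < n \<Longrightarrow> \<phi> l \<in> mcarr {..<N + n}" "\<And>l. l < n \<Longrightarrow> mconst (\<phi> l) = 0"
    "\<And>i. i < N \<Longrightarrow> \<gamma>' $ i = msub (\<lambda>i. if i < N then mvar i else \<phi> (i - N)) (\<gamma> $ i)"
    "indep {..<n} (\<lambda>l i. mconst (jcol n \<phi> (N + l) i))"
    by (rule reparametrization[OF assms]) blast
  let ?\<theta> = "\<lambda>i. if i < N then mvar i else \<phi> (i - N)"
  have z\<theta>: "zconst {..<N + n} ?\<theta>" using \<phi> by (auto simp: zconst_def)
  define good where "good j \<Psi> \<longleftrightarrow> (\<forall>l<j * n. \<Psi> l \<in> mcarr {..<j * n} \<and> mconst (\<Psi> l) = 0) \<and>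
    (\<forall>i<N. s'.v j $ i = msub \<Psi> (v j $ i)) \<and> indep {..<j * n} (\<lambda>l i. mconst (jcol (j * n) \<Psi> l i))" for j and \<Psi> :: "nat \<Rightarrow> complex mfps"
  have "\<exists>\<Psi>. good j \<Psi>"
  proof (induction j)
    case 0
    then show ?case by (auto simp: good_def indep_def msub_0[of "{}" mvar] zconst_def intro!: exI[of _ mvar])
  next
    case (Suc j)
    then obtain \<Psi> where \<Psi>: "\<And>l. l < j * n \<Longrightarrow> \<Psi> l \<in> mcarr {..<j * n}" "\<And>l. l < j * n \<Longrightarrow> mconst (\<Psi> l) = 0"
      "\<And>i. i < N \<Longrightarrow> s'.v j $ i = msub \<Psi> (v j $ i)" "indep {..<j * n} (\<lambda>l i. mconst (jcol (j * n) \<Psi> l i))"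
      by (auto simp: good_def)
    \<comment> \<open>On the old variables the previous substitution is conjugated, since v^(j+1)
      contains the conjugate of v^j; the new variables become \<phi> at the conjugate of the new v^j
      and t^(j+1). The Jacobian matrix is block-triangular.\<close>
    define \<Psi>' where "\<Psi>' l = (if l < j * n then mcnj (\<Psi> l) else msub (s'.tau j) (\<phi> (l - j * n)))" for l
    have \<Psi>'0: "mconst (\<Psi>' l) = 0" if "l < Suc j * n" for l
    proof (cases "l < j * n")
      case False
      then have "l - j * n < n" using that by auto
      then show ?thesis using False \<phi> by (simp add: \<Psi>'_def mconst_msub[OF _ s'.tau_z])
    qed (simp add: \<Psi>'_def \<Psi>)
    have z\<Psi>': "zconst {..<Suc j * n} \<Psi>'" using \<Psi>'0 by (simp add: zconst_def)
    have z\<Psi>: "zconst {..<j * n} \<Psi>" using \<Psi>(2) by (simp add: zconst_def)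
    have tau': "s'.tau j k \<in> mcarr {..<Suc j * n}" if "k < N + n" for k
    proof (cases "k < N")
      case True
      then have "mcnj (s'.v j $ k) \<in> mcarr {..<j * n}" using s'.v_props by simp
      then have "mcnj (s'.v j $ k) \<in> mcarr {..<Suc j * n}" by (rule mcarr_mono) auto
      then show ?thesis using True by (simp add: s'.tau_def)
    qed (use that in \<open>auto simp: s'.tau_def intro!: mcarr_mvar\<close>)
    have \<Psi>'c: "\<Psi>' l \<in> mcarr {..<Suc j * n}" if "l < Suc j * n" for l
    proof (cases "l < j * n")
      case True
      then have "mcnj (\<Psi> l) \<in> mcarr {..<j * n}" using \<Psi>(1) by simp
      then have "mcnj (\<Psi> l) \<in> mcarr {..<Suc j * n}" by (rule mcarr_mono) auto
      then show ?thesis using True by (simp add: \<Psi>'_def)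
    next
      case False
      then have "l - j * n < n" using that by auto
      then have "msub (s'.tau j) (\<phi> (l - j * n)) \<in> mcarr {..<Suc j * n}"
        using tau' by (intro mcarr_msub[OF _ s'.tau_z \<phi>(1)]) auto
      then show ?thesis using False by (simp add: \<Psi>'_def)
    qed
    have cnj: "msub \<Psi>' (mcnj (v j $ k)) = mcnj (s'.v j $ k)" if k: "k < N" for k
    proof -
      have c: "v j $ k \<in> mcarr {..<j * n}" using v_props k by blast
      have "mcnj (s'.v j $ k) = msub (\<lambda>i. mcnj (\<Psi> i)) (mcnj (v j $ k))"
        unfolding \<Psi>(3)[OF k] by (rule mcnj_msub[OF _ c z\<Psi>]) simp
      also have "\<dots> = msub \<Psi>' (mcnj (v j $ k))"
        using \<Psi>(2) by (intro msub_cong[OF _ mcarr_mcnj[OF c]]) (auto simp: zconst_def \<Psi>'_def)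
      finally show ?thesis by simp
    qed
    have v': "s'.v (Suc j) $ i = msub \<Psi>' (v (Suc j) $ i)" if i: "i < N" for i
    proof -
      have tc: "tau j k \<in> mcarr {..<Suc j * n}" if "k \<in> {..<N + n}" for k
      proof (cases "k < N")
        case True
        then have "mcnj (v j $ k) \<in> mcarr {..<j * n}" using v_props by simp
        then have "mcnj (v j $ k) \<in> mcarr {..<Suc j * n}" by (rule mcarr_mono) auto
        then show ?thesis using True by (simp add: tau_def)
      qed (use that in \<open>auto simp: tau_def intro!: mcarr_mvar\<close>)
      let ?t = "\<lambda>k. if k < N then mcnj (s'.v j $ k) else msub (s'.tau j) (\<phi> (k - N))"
      have zt: "zconst {..<N + n} ?t" using s'.v_props \<phi> by (auto simp: zconst_def mconst_msub[OF _ s'.tau_z])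
      have "s'.v (Suc j) $ i = msub (s'.tau j) (msub ?\<theta> (\<gamma> $ i))" using s'.v_Suc[OF i] \<phi>(3)[OF i] by simp
      also have "\<dots> = msub (\<lambda>k. msub (s'.tau j) (?\<theta> k)) (\<gamma> $ i)"
        using \<phi> by (intro msub_msub[OF _ \<gamma>_carr[OF i] _ z\<theta> _ s'.tau_z]) (auto intro: mcarr_mvar)
      also have "\<dots> = msub ?t (\<gamma> $ i)"
        using zt by (intro msub_cong[OF _ \<gamma>_carr[OF i], symmetric])
          (auto simp: msub_mvar[OF _ s'.tau_z] s'.tau_def[of j])
      also have "\<dots> = msub (\<lambda>k. msub \<Psi>' (tau j k)) (\<gamma> $ i)"
      proof (rule msub_cong[OF _ \<gamma>_carr[OF i] zt])
        fix k assume k: "k \<in> {..<N + n}"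
        show "?t k = msub \<Psi>' (tau j k)"
        proof (cases "k < N")
          case False
          then have "j * n + (k - N) < Suc j * n" using k by auto
          then have "msub \<Psi>' (mvar (j * n + (k - N))) = \<Psi>' (j * n + (k - N))" by (intro msub_mvar[OF _ z\<Psi>']) auto
          then show ?thesis using False by (simp add: tau_def \<Psi>'_def del: Nat.add_diff_assoc add_diff_assoc2)
        qed (simp add: tau_def cnj)
      qed simp
      also have "\<dots> = msub \<Psi>' (msub (tau j) (\<gamma> $ i))"
        by (rule msub_msub[OF _ \<gamma>_carr[OF i] _ tau_z _ z\<Psi>', symmetric]) (use tc in auto)
      finally show ?thesis using v_Suc[OF i] by simp
    qed
    have ind: "indep {..<Suc j * n} (\<lambda>l i. mconst (jcol (Suc j * n) \<Psi>' l i))"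
      unfolding indep_def
    proof (intro allI impI ballI)
      fix c l assume 0: "\<forall>i. (\<Sum>l<Suc j * n. c l * mconst (jcol (Suc j * n) \<Psi>' l i)) = 0" and l: "l \<in> {..<Suc j * n}"
      have "(\<Sum>l<j * n. cnj (c l) * mconst (jcol (j * n) \<Psi> l i)) = 0" for i
      proof (cases "i < j * n")
        case True
        have "(\<Sum>l<Suc j * n. c l * mconst (jcol (Suc j * n) \<Psi>' l i)) = (\<Sum>l<j * n. c l * mconst (mcnj (mderiv l (\<Psi> i))))"
          using True mderiv_notin[OF \<Psi>(1)[OF True]]
          by (intro sum.mono_neutral_cong_right) (auto simp: jcol_def \<Psi>'_def simp del: mderiv.rep_eq mcnj_simps(9) simp flip: mcnj_simps(9))
        also have "\<dots> = cnj (\<Sum>l<j * n. cnj (c l) * mconst (jcol (j * n) \<Psi> l i))"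
          using True by (simp add: jcol_def del: mderiv.rep_eq mcnj_simps(9))
        finally show ?thesis using spec[OF 0, of i] by (metis complex_cnj_zero_iff)
      qed (simp add: jcol_def)
      then have "\<forall>i. (\<Sum>l<j * n. cnj (c l) * mconst (jcol (j * n) \<Psi> l i)) = 0" by blast
      then have "\<forall>l\<in>{..<j * n}. cnj (c l) = 0"
        using spec[OF \<Psi>(4)[unfolded indep_def], of "\<lambda>l. cnj (c l)"] by (rule rev_mp)
      then have c0: "c l = 0" if "l < j * n" for l using that by simp
      have "(\<Sum>l<n. c (j * n + l) * mconst (jcol n \<phi> (N + l) i)) = 0" for i
      proof (cases "i < n")
        case True
        have d: "mderiv (j * n + l) (\<Psi>' (j * n + i)) = msub (s'.tau j) (mderiv (N + l) (\<phi> i))" if l: "l < n" for l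
        proof -
          have "mderiv (j * n + l) (\<Psi>' (j * n + i)) = (\<Sum>k<N + n. msub (s'.tau j) (mderiv k (\<phi> i)) * mderiv (j * n + l) (s'.tau j k))"
            using mderiv_msub[OF _ s'.tau_z \<phi>(1)[OF True], of "j * n + l" j] by (simp add: \<Psi>'_def)
          also have "\<dots> = (\<Sum>k<N + n. if k = N + l then msub (s'.tau j) (mderiv k (\<phi> i)) else 0)"
            by (intro sum.cong refl) (use s'.mderiv_v_out in \<open>auto simp: s'.tau_def mderiv_mvar simp flip: mcnj_simps(9)\<close>)
          finally show ?thesis using l by simp
        qed
        have "0 = (\<Sum>l<Suc j * n. c l * mconst (jcol (Suc j * n) \<Psi>' l (j * n + i)))" using spec[OF 0, of "j * n + i"] by simp
        also have "\<dots> = (\<Sum>l\<in>{j * n..<Suc j * n}. c l * mconst (jcol (Suc j * n) \<Psi>' l (j * n + i)))"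
          using c0 by (intro sum.mono_neutral_right) auto
        also have "\<dots> = (\<Sum>l<n. c (j * n + l) * mconst (jcol (Suc j * n) \<Psi>' (j * n + l) (j * n + i)))"
          by (rule sum.reindex_bij_witness[of _ "\<lambda>l. j * n + l" "\<lambda>l. l - j * n"]) auto
        also have "\<dots> = (\<Sum>l<n. c (j * n + l) * mconst (jcol n \<phi> (N + l) i))"
          using True \<phi>(1)[OF True] by (intro sum.cong refl) (simp add: jcol_def d mconst_msub[OF _ s'.tau_z] del: mderiv.rep_eq)
        finally show ?thesis by simp
      qed (simp add: jcol_def)
      then have "\<forall>i. (\<Sum>l<n. c (j * n + l) * mconst (jcol n \<phi> (N + l) i)) = 0" by blast
      then have "\<forall>l\<in>{..<n}. c (j * n + l) = 0"
        using spec[OF \<phi>(4)[unfolded indep_def], of "\<lambda>l. c (j * n + l)"] by (rule rev_mp)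
      then have c1: "c (j * n + l) = 0" if "l < n" for l using that by blast
      show "c l = 0"
      proof (cases "l < j * n")
        case False
        then have "l - j * n < n" "j * n + (l - j * n) = l" using l by auto
        then show ?thesis using c1[of "l - j * n"] by simp
      qed (rule c0)
    qed
    show ?case unfolding good_def by (rule exI[of _ \<Psi>']) (use \<Psi>'c \<Psi>'0 v' ind in blast)
  qed
  then obtain \<Psi> where \<Psi>: "\<And>l. l < j * n \<Longrightarrow> \<Psi> l \<in> mcarr {..<j * n}" "\<And>l. l < j * n \<Longrightarrow> mconst (\<Psi> l) = 0"
    "\<And>i. i < N \<Longrightarrow> s'.v j $ i = msub \<Psi> (v j $ i)" "indep {..<j * n} (\<lambda>l i. mconst (jcol (j * n) \<Psi> l i))"
    by (auto simp: good_def)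
  \<comment> \<open>Substituting \<open>G\<close> undoes the substitution of \<Psi>, so the latter
    is injective on series.\<close>
  obtain G where G: "\<And>i. i < j * n \<Longrightarrow> G i \<in> mcarr {..<j * n}" "\<And>i. i < j * n \<Longrightarrow> mconst (G i) = 0"
    "\<And>i. i < j * n \<Longrightarrow> msub G (\<Psi> i) = mvar i"
    by (rule inverse_mapping[of "j * n" \<Psi>]) (use \<Psi> in blast)+
  have zG: "zconst {..<j * n} G" using G(2) by (simp add: zconst_def)
  have z\<Psi>: "zconst {..<j * n} \<Psi>" using \<Psi>(2) by (simp add: zconst_def)
  have inj: "f = 0" if f: "f \<in> mcarr {..<j * n}" "msub \<Psi> f = 0" for f
  proof -
    have "msub G (msub \<Psi> f) = msub (\<lambda>i. msub G (\<Psi> i)) f"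
      by (rule msub_msub[OF _ f(1) _ z\<Psi> _ zG]) (use \<Psi>(1) in auto)
    also have "\<dots> = f" by (rule msub_id[OF _ f(1)]) (use G(3) in auto)
    finally show ?thesis using f(2) msub_0[OF _ zG] by simp
  qed
  show ?thesis
    by (rule Rk_right_le[where \<Psi> = \<Psi> and N = N]) (use v_carrier s'.v_carrier v_props \<Psi> inj in blast)+
qed

end

subsection \<open>Generators of the orbit ideal\<close>

context formal_orbit
begin

lemma finC: "finite C" using C(1) finite_subset by blast

lemma M_J: "M \<subseteq> J"
  by (rule J_max[OF M_ideal M_const])
    (use L_stable[OF M_ideal] in blast)+

lemma J_carr: "f \<in> J \<Longrightarrow> f \<in> mcarr {..<2 * N}" by (rule is_idealD(1)[OF gi.J_ideal])

text \<open>The preimage of \<open>J\<close> under \<sigma> is again a \<gg>-invariant ideal without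
  constant terms, because \<gg> is stable under conjugation; maximality puts it into
  \<open>J\<close>.\<close>

lemma sigma_J: assumes f: "f \<in> J" shows "sigma N f \<in> J"
proof -
  define I where "I = {f \<in> mcarr {..<2 * N}. sigma N f \<in> J}"
  note J = is_idealD[OF gi.J_ideal]
  have I: "is_ideal (2 * N) I"
    unfolding is_ideal_def I_def using J by (auto simp: sigma_add sigma_mult sigma_0 sigma_carr)
  have "I \<subseteq> J"
  proof (rule J_max[OF I])
    show "mconst f = 0" if "f \<in> I" for f
      using that gi.J_const[of "sigma N f"] mconst_sigma[of f N] by (auto simp: I_def)
    show "vf_apply Y f \<in> I" if Y: "Y \<in> L" and f: "f \<in> I" for Y f
    proof -
      have Yf: "vector_field (2 * N) Y" and fc: "f \<in> mcarr {..<2 * N}" using L_field[OF Y] f by (auto simp: I_def)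
      have "vf_apply (vsigma N Y) (sigma N f) \<in> J" using J_L[OF vsigma_L[OF Y]] f by (auto simp: I_def)
      then show ?thesis using vf_apply_sigma[OF Yf fc] vf_apply_carr[OF Yf fc] by (simp add: I_def)
    qed
  qed
  moreover have "sigma N f \<in> I" using f J_carr[OF f] by (simp add: I_def sigma_carr sigma_sigma)
  ultimately show ?thesis by blast
qed

text \<open>Among these generators only the \<open>r b\<close> involve the variables \<open>Z\<close>.\<close>

definition gen :: "nat + nat \<Rightarrow> complex mfps" where
  "gen x = (case x of Inl c \<Rightarrow> sigma N (F c) | Inr b \<Rightarrow> r b)"

lemma F_carr: "c \<in> C \<Longrightarrow> F c \<in> mcarr {..<2 * N}" using F(1) J_carr by blast

lemma sigma_F: "c \<in> C \<Longrightarrow> sigma N (F c) \<in> mcarr {N..<2 * N}" by (rule sigma_carr_Z[OF F(2)])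

lemma gen_J: "x \<in> C <+> B \<Longrightarrow> gen x \<in> J"
  using F(1) sigma_J r M_J by (auto simp: gen_def)

lemma card_CB: "card (C <+> B) = card BJ"
  using C(2) B(2) finC finB by (simp add: card_Plus)

lemma indep_r: "indep B (\<lambda>b j. if j < N then mconst (mderiv j (r b)) else 0)"
  by (rule indep_if_delta[where \<kappa> = "\<lambda>b. b", OF finB]) (use B(1) r_delta in \<open>auto simp del: mderiv.rep_eq\<close>)

text \<open>The \<sigma>(F c) have no Z-differentials and are independent in \<zeta>, while the
  \<open>r b\<close> are independent in Z.\<close>

lemma indep_gen: "indep (C <+> B) (\<lambda>x. dcov (2 * N) (gen x))"
proof (rule indep_Plus[OF finC finB, where Y = "{..<N}"])
  show "indep C (\<lambda>l. dcov (2 * N) (gen (Inl l)))"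
  proof (rule indep_if_delta[OF finC, where \<kappa> = "(+) N"])
    fix b c assume bc: "b \<in> C" "c \<in> C"
    then have c: "N + c < 2 * N" using C(1) by auto
    have "mderiv (N + c) (sigma N (F b)) = sigma N (mderiv c (F b))"
      using mderiv_sigma[OF F_carr[OF bc(1)] c] by (simp add: sw)
    then show "dcov (2 * N) (gen (Inl b)) (N + c) = (if b = c then 1 else 0)"
      using F_delta[OF bc] c F_carr[OF bc(1)] by (simp add: dcov_def gen_def mconst_sigma del: mderiv.rep_eq)
  qed
  have "(\<lambda>l i. if i \<in> {..<N} then dcov (2 * N) (gen (Inr l)) i else 0) = (\<lambda>b j. if j < N then mconst (mderiv j (r b)) else 0)"
    by (auto simp: fun_eq_iff dcov_def gen_def simp del: mderiv.rep_eq)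
  then show "indep B (\<lambda>l i. if i \<in> {..<N} then dcov (2 * N) (gen (Inr l)) i else 0)" using indep_r by simp
  show "dcov (2 * N) (gen (Inl l)) i = 0" if "l \<in> C" "i \<in> {..<N}" for l i
    using that mderiv_notin[OF sigma_F[OF that(1)], of i] by (simp add: dcov_def gen_def del: mderiv.rep_eq)
qed

lemma J_gen: "J = lideal (2 * N) (C <+> B) gen"
  using gi.J_generated[of "C <+> B" gen] finC finB card_CB gen_J indep_gen by simp

text \<open>In the matrix of Z-derivatives of the \<open>gen x\<close> the rows of the \<sigma>(F c)
  are zero, and those of the \<open>r b\<close> are independent at the origin, hence also over the
  field of fractions. Both ranks are the number of these rows.\<close>

lemma CR_J: "CR_manifold_of_dim N g J"
proof -
  let ?d = "card BJ"
  obtain e where e: "bij_betw e {..<?d} (C <+> B)"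
    using ex_bij_betw_nat_finite[of "C <+> B"] finC finB card_CB by (auto simp: atLeast0LessThan)
  have eCB: "e i \<in> C <+> B" if "i < ?d" for i using e that by (auto simp: bij_betw_def)
  define G where "G = vec ?d (\<lambda>i. gen (e i))"
  have dG: "dim_vec G = ?d" and G: "\<And>i. i < ?d \<Longrightarrow> G $ i = gen (e i)" by (simp_all add: G_def)
  have ind: "indep {..<?d} (\<lambda>i. dcov (2 * N) (G $ i))"
  proof -
    have "indep {..<?d} (\<lambda>i. dcov (2 * N) (gen (e i)))" by (rule indep_reindex[OF e indep_gen])
    then show ?thesis by (rule indep_cong[rotated]) (simp add: G)
  qed
  have gG: "generators (2 * N) ?d J G"
    unfolding generators_iff
  proof (intro conjI allI impI)
    show "J = lideal (2 * N) {..<?d} (($) G)"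
      using gi.J_generated[of "{..<?d}" "($) G"] ind gen_J eCB G by simp
  qed (use dG G gen_J[OF eCB] J_carr in \<open>auto intro!: carrier_vecI\<close>)
  have real: "real_manifold N ?d J"
    unfolding real_manifold_def manifold_ideal_def ideal_iff
    using gi.J_ideal gi.J_const sigma_J gG ind unfolding indep_iff_manifold by blast
  define I where "I = {i. i < ?d \<and> e i \<in> Inr ` B}"
  have I: "I \<subseteq> {..<?d}" by (auto simp: I_def)
  have bijI: "bij_betw (\<lambda>i. projr (e i)) I B"
  proof (rule bij_betwI')
    show "projr (e x) = projr (e y) \<longleftrightarrow> x = y" if "x \<in> I" "y \<in> I" for x y
      using that e by (auto simp: I_def bij_betw_def inj_on_def)
    show "projr (e x) \<in> B" if "x \<in> I" for x using that by (auto simp: I_def)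
    show "\<exists>x\<in>I. b = projr (e x)" if "b \<in> B" for b
    proof -
      have "Inr b \<in> e ` {..<?d}" using that by (simp add: bij_betw_imp_surj_on[OF e] InrI)
      then obtain x where "x < ?d" "Inr b = e x" by (elim imageE) simp
      then show ?thesis using \<open>b \<in> B\<close> by (intro bexI[of _ x]) (simp_all add: I_def flip: \<open>Inr b = e x\<close>)
    qed
  qed
  have row0: "mderiv j (G $ i) = 0" if i: "i < ?d" "i \<notin> I" and j: "j < N" for i j
  proof -
    obtain c where "c \<in> C" "e i = Inl c" using eCB[OF i(1)] i by (auto simp: I_def)
    then show ?thesis using mderiv_notin[OF sigma_F, of c j] j i by (simp add: G gen_def)
  qed
  define q where "q i j = (if j < N then mderiv j (G $ i) else 0)" for i j
  have "indep I (\<lambda>i j. if j < N then mconst (mderiv j (r (projr (e i)))) else 0)"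
    by (rule indep_reindex[OF bijI indep_r])
  then have ind0: "indep I (\<lambda>i j. mconst (q i j))"
    by (rule indep_cong[rotated]) (use I in \<open>auto simp: fun_eq_iff q_def G I_def gen_def simp del: mderiv.rep_eq\<close>)
  have dims: "dim_row (jacobian 0 N G) = ?d" "dim_col (jacobian 0 N G) = N"
    and ent: "\<And>i j. i < ?d \<Longrightarrow> j < N \<Longrightarrow> jacobian 0 N G $$ (i, j) = mderiv j (G $ i)"
    using dG by (auto simp: jacobian_def)
  have rk: "vec_space.rank ?d (map_mat \<phi> (jacobian 0 N G)) = card I" if "indep I (\<lambda>i j. \<phi> (q i j))" "\<phi> 0 = 0"
    for \<phi> :: "complex mfps \<Rightarrow> 'b::field"
  proof -
    have "(\<Sum>l\<in>I. c l * (if j < N then map_mat \<phi> (jacobian 0 N G) $$ (l, j) else 0)) = (\<Sum>l\<in>I. c l * \<phi> (q l j))" for c j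
      using I that(2) dims ent by (intro sum.cong refl) (auto simp: q_def)
    then have "indep I (\<lambda>i j. if j < N then map_mat \<phi> (jacobian 0 N G) $$ (i, j) else 0)"
      using that(1) by (simp only: indep_def)
    then show ?thesis
      using rank_rows[of I "map_mat \<phi> (jacobian 0 N G)"] I dims ent row0 that(2) by simp
  qed
  have "rank_at_0 (jacobian 0 N G) = card I"
    using rk[of mconst] ind0 dims by (simp add: rank_at_0_def)
  moreover have "indep I (\<lambda>i j. fr (q i j))"
    by (rule indep_fr_if_const[OF _ ind0]) (use I finite_subset in blast)
  then have "rank_frac (jacobian 0 N G) = card I"
    using rk[of fr] dims by (simp add: fr_simps) (simp add: rank_frac_def fr_def[abs_def])
  ultimately show ?thesis
    unfolding CR_manifold_of_dim_def CR_manifold_def using real gG card_BJ by metis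
qed

lemma CR_field_J: assumes "CR_vector_field N M Y" shows "tangent Y J"
proof -
  have "Y \<in> L" using assms unfolding lie_algebra_def CR_vector_field_def by (intro lie_algebra_generated.base) simp
  then show ?thesis using J_L by (simp add: tangent_def)
qed

text \<open>Tangency is given for the CR fields; reality of \<open>Or\<close> transfers it to the
  (1,0)-fields, so \<open>Or\<close> is \<gg>-invariant and contained in \<open>J\<close>. The
  codimensions agree, so generators of \<open>Or\<close> with independent differentials also
  generate \<open>J\<close>.\<close>

lemma orbit_unique:
  assumes Or: "CR_manifold_of_dim N g Or" "M \<subseteq> Or" "\<And>Y. CR_vector_field N M Y \<Longrightarrow> tangent Y Or"
  shows "Or = J"
proof -
  obtain d' where d': "d' + g = 2 * N" "manifold_ideal (2 * N) d' Or" "sigma N ` Or \<subseteq> Or"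
    using Or(1) unfolding CR_manifold_of_dim_def CR_manifold_def real_manifold_def by blast
  have dB: "d' = card BJ" using d'(1) card_BJ by simp
  have I: "is_ideal (2 * N) Or" and c: "\<And>f. f \<in> Or \<Longrightarrow> mconst f = 0"
    using d'(2) by (auto simp: manifold_ideal_def ideal_iff)
  obtain f where f: "generators (2 * N) d' Or f" "indep {..<d'} (\<lambda>i. dcov (2 * N) (f $ i))"
    using d'(2) unfolding manifold_ideal_def indep_iff_manifold by blast
  have s: "\<And>f. f \<in> Or \<Longrightarrow> sigma N f \<in> Or" using d'(3) by blast
  have "tangent Y Or" if Y: "vector_field_01 N Y \<or> vector_field_10 N Y" "tangent Y M" for Y
  proof (cases "vector_field_01 N Y")
    case True
    then show ?thesis using Or(3) Y(2) by (simp add: CR_vector_field_def)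
  next
    case False
    then have Y10: "vector_field_10 N Y" using Y(1) by blast
    then have Yf: "vector_field (2 * N) Y" by (simp add: vector_field_10_def)
    have "CR_vector_field N M (vsigma N Y)"
      unfolding CR_vector_field_def using vsigma_10[OF Y10] tangent_vsigma[OF Yf Y(2) M_ideal M_sigma] by blast
    then have "tangent (vsigma N (vsigma N Y)) Or"
      by (intro tangent_vsigma[OF vsigma_field[OF Yf] Or(3) I s])
    then show ?thesis by (simp add: vsigma_vsigma[OF Yf])
  qed
  then have "Or \<subseteq> J" using J_max[OF I c] L_stable[OF I] by blast
  moreover have "\<And>i. i < d' \<Longrightarrow> f $ i \<in> Or"
    using f(1) lideal_mem[of "{..<d'}" _ "($) f"] by (auto simp: generators_iff)
  ultimately have "lideal (2 * N) {..<d'} (($) f) = J"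
    using f(2) dB by (intro gi.J_generated) auto
  then show ?thesis using f(1) by (simp add: generators_iff)
qed

text \<open>The \<open>rs b\<close> are combinations of the given generators, and their
  \<zeta>-differentials are independent; hence so are those of the equally many given ones.\<close>

lemma generators_indep_zeta:
  assumes "generators (2 * N) d M \<rho>"
  shows "indep {..<d} (\<lambda>i j. if j \<in> {N..<2 * N} then dcov (2 * N) (\<rho> $ i) j else 0)"
proof (rule indep_exchange[where T = B and u = "\<lambda>b j. if j \<in> {N..<2 * N} then dcov (2 * N) (rs b) j else 0" and X = "{N..<2 * N}"])
  have M\<rho>: "M = lideal (2 * N) {..<d} (($) \<rho>)" using assms by (simp add: generators_iff)
  show "indep B (\<lambda>b j. if j \<in> {N..<2 * N} then dcov (2 * N) (rs b) j else 0)"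
    by (rule indep_if_delta[OF finB, where \<kappa> = "(+) N"]) (use B(1) rs_delta in \<open>auto simp: dcov_def simp del: mderiv.rep_eq\<close>)
  fix b assume b: "b \<in> B"
  then obtain a where a: "rs b = (\<Sum>i<d. a i * \<rho> $ i)" using rs[of b] unfolding M\<rho> by (auto elim!: lidealE)
  have "mconst (\<rho> $ i) = 0" if "i \<in> {..<d}" for i
    using M_const lideal_mem[of "{..<d}" i "($) \<rho>"] that unfolding M\<rho> by blast
  then have "dcov (2 * N) (rs b) j = (\<Sum>i<d. mconst (a i) * dcov (2 * N) (\<rho> $ i) j)" for j
    unfolding a by (intro dcov_lincomb)
  then show "(\<lambda>j. if j \<in> {N..<2 * N} then dcov (2 * N) (rs b) j else 0)
      \<in> spn {..<d} (\<lambda>i j. if j \<in> {N..<2 * N} then dcov (2 * N) (\<rho> $ i) j else 0)"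
    by (intro spnI[of _ "\<lambda>i. mconst (a i)"]) (auto simp: fun_eq_iff)
qed (use finB B in auto)

lemma bij_Plus: fixes e d' :: nat shows "bij_betw (\<lambda>i. if i < e then Inl i else Inr (i - e)) {..<e + d'} ({..<e} <+> {..<d'})"
  by (rule bij_betw_byWitness[where f' = "case_sum id ((+) e)"]) auto

text \<open>The \<open>F c\<close> have no \<zeta>-differentials and the given generators are
  independent in \<zeta>, so all differentials together are independent, and their number is the
  codimension of \<open>J\<close>.\<close>

lemma orbit_equations_exist:
  assumes \<rho>: "generators (2 * N) d M \<rho>"
  obtains f where "f \<in> carrier_vec (card C)" "set\<^sub>v f \<subseteq> mfps_carrier N" "generators (2 * N) (card C + d) J (f @\<^sub>v \<rho>)"
proof -
  let ?e = "card C"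
  obtain s where s: "bij_betw s {..<?e} C"
    using ex_bij_betw_nat_finite[OF finC] by (auto simp: atLeast0LessThan)
  have sC: "s i \<in> C" if "i < ?e" for i using s that by (auto simp: bij_betw_def)
  define f where "f = vec ?e (\<lambda>i. F (s i))"
  have f: "f \<in> carrier_vec ?e" "\<And>i. i < ?e \<Longrightarrow> f $ i = F (s i)" by (simp_all add: f_def)
  have \<rho>d: "dim_vec \<rho> = d" "\<And>i. i < d \<Longrightarrow> \<rho> $ i \<in> M"
    using \<rho> lideal_mem[of "{..<d}" _ "($) \<rho>"] by (auto simp: generators_iff)
  have ind: "indep {..<?e + d} (\<lambda>i. dcov (2 * N) ((f @\<^sub>v \<rho>) $ i))"
  proof -
    let ?w = "\<lambda>x. dcov (2 * N) (case x of Inl i \<Rightarrow> F (s i) | Inr i \<Rightarrow> \<rho> $ i)"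
    have "indep ({..<?e} <+> {..<d}) ?w"
    proof (rule indep_Plus[where Y = "{N..<2 * N}"])
      have "indep C (\<lambda>c. dcov (2 * N) (F c))"
        by (rule indep_if_delta[OF finC, where \<kappa> = "\<lambda>c. c"]) (use C(1) F_delta in \<open>auto simp: dcov_def simp del: mderiv.rep_eq\<close>)
      then show "indep {..<?e} (\<lambda>l. ?w (Inl l))" using indep_reindex[OF s, of "\<lambda>c. dcov (2 * N) (F c)"] by simp
      show "?w (Inl l) i = 0" if "l \<in> {..<?e}" "i \<in> {N..<2 * N}" for l i
        using that mderiv_notin[OF F(2)[OF sC], of l i] by (simp add: dcov_def del: mderiv.rep_eq)
      show "indep {..<d} (\<lambda>l i. if i \<in> {N..<2 * N} then ?w (Inr l) i else 0)"
        using generators_indep_zeta[OF \<rho>] by (simp only: sum.case)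
    qed simp_all
    then have "indep {..<?e + d} (\<lambda>i. ?w (if i < ?e then Inl i else Inr (i - ?e)))"
      by (rule indep_reindex[OF bij_Plus])
    moreover have "?w (if i < ?e then Inl i else Inr (i - ?e)) = dcov (2 * N) ((f @\<^sub>v \<rho>) $ i)" if "i < ?e + d" for i
      using that f \<rho>d(1) by auto
    ultimately show ?thesis by (rule indep_cong[rotated]) (simp only: lessThan_iff)
  qed
  have J: "(f @\<^sub>v \<rho>) $ i \<in> J" if "i < ?e + d" for i
    using that f \<rho>d M_J F(1) sC by auto
  have "lideal (2 * N) {..<?e + d} (($) (f @\<^sub>v \<rho>)) = J"
    using ind J C(2) by (intro gi.J_generated) auto
  then have "generators (2 * N) (?e + d) J (f @\<^sub>v \<rho>)"
    unfolding generators_iff using f(1) \<rho>d(1) J J_carr by (auto intro!: carrier_vecI)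
  moreover have "set\<^sub>v f \<subseteq> mfps_carrier N" using f sC F(2) by (auto simp: vec_set_def mfps_carrier_eq)
  ultimately show ?thesis using f(1) that by blast
qed

text \<open>Covers every admissible \<open>f\<close>, not only the constructed one. As many
  generators as the codimension have independent differentials; this passes to the
  \<open>f $ i\<close>, whose differentials involve Z only.\<close>

lemma orbit_equations:
  assumes f: "f \<in> carrier_vec e" "set\<^sub>v f \<subseteq> mfps_carrier N" "generators (2 * N) (e + d) J (f @\<^sub>v \<rho>)"
    and e: "e + d = card BJ"
  shows "genideal (mfps_ring N) (set\<^sub>v f) = lideal N {..<e} (($) f)"
    and "\<And>i. i < e \<Longrightarrow> f $ i \<in> J \<and> f $ i \<in> mcarr {..<N}"
    and "manifold_ideal N e (genideal (mfps_ring N) (set\<^sub>v f))"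
proof -
  have fi: "set\<^sub>v f = ($) f ` {..<e}" using f(1) by (auto simp: vec_set_def)
  then have fN: "f $ i \<in> mcarr {..<N}" if "i < e" for i using f(2) that by (auto simp: mfps_carrier_eq)
  have fJ: "f $ i \<in> J" if "i < e" for i
  proof -
    have "(f @\<^sub>v \<rho>) $ i \<in> J" using f(3) that lideal_mem[of "{..<e + d}" i "($) (f @\<^sub>v \<rho>)"] by (simp add: generators_iff)
    moreover have "dim_vec (f @\<^sub>v \<rho>) = e + d" using f(3) carrier_vecD unfolding generators_iff by blast
    ultimately show ?thesis using f(1) that by simp
  qed
  show W: "genideal (mfps_ring N) (set\<^sub>v f) = lideal N {..<e} (($) f)"
    unfolding fi using fN by (intro genideal_eq) auto
  have "indep {..<e + d} (\<lambda>i. dcov (2 * N) ((f @\<^sub>v \<rho>) $ i))"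
    using f(3) e by (intro gi.generators_indep) (auto simp: generators_iff)
  then have "indep {..<e} (\<lambda>i. dcov (2 * N) ((f @\<^sub>v \<rho>) $ i))" by (rule indep_subset[rotated 2]) auto
  moreover have "dcov (2 * N) ((f @\<^sub>v \<rho>) $ i) = dcov N (f $ i)" if "i < e" for i
  proof -
    have "dim_vec (f @\<^sub>v \<rho>) = e + d" using f(3) carrier_vecD unfolding generators_iff by blast
    then have "(f @\<^sub>v \<rho>) $ i = f $ i" using f(1) that by simp
    then show ?thesis using mderiv_notin[OF fN[OF that]] by (auto simp: dcov_def fun_eq_iff simp del: mderiv.rep_eq)
  qed
  ultimately have ind: "indep {..<e} (\<lambda>i. dcov N (f $ i))" by (rule indep_cong[rotated]) simp
  have "mconst g = 0" if "g \<in> lideal N {..<e} (($) f)" for g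
    using that gi.J_const[OF fJ] by (auto elim!: lidealE)
  moreover have "is_ideal N (lideal N {..<e} (($) f))" using fN by (intro lideal_is_ideal) auto
  moreover have "generators N e (lideal N {..<e} (($) f)) f" using f(1) fN by (auto simp: generators_iff)
  ultimately show "manifold_ideal N e (genideal (mfps_ring N) (set\<^sub>v f))"
    unfolding W manifold_ideal_def ideal_iff using ind unfolding indep_iff_manifold by blast
  show "f $ i \<in> J \<and> f $ i \<in> mcarr {..<N}" if "i < e" for i using fN fJ that by blast
qed

end

subsection \<open>The ranks of the iterated Segre mappings\<close>

lemma msub_eq_0:
  assumes A: "finite A" and f: "f \<in> mcarr A" "mconst f = 0" and \<theta>: "\<And>i. i \<in> A \<Longrightarrow> \<theta> i = 0"
  shows "msub \<theta> f = 0"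
proof (rule mfps_eqI)
  have z: "zconst A \<theta>" using \<theta> by (simp add: zconst_def)
  have c: "msub \<theta> f \<in> mcarr {}" by (rule mcarr_msub[OF A z f(1)]) (simp add: \<theta>)
  fix m show "mcoeff (msub \<theta> f) m = mcoeff 0 m"
  proof (cases "m = {#}")
    case True
    then show ?thesis using mconst_msub[OF A z f(1)] f(2) by simp
  next
    case False
    then show ?thesis using mcarrD[OF c, of m] by (simp add: zero_mfps.rep_eq)
  qed
qed

locale segre_orbit = segre N d M B r n \<gamma> + formal_orbit N d M B r BJ h J g A C X F
  for N d :: nat and M :: "complex mfps set" and B :: "nat set" and r :: "nat \<Rightarrow> complex mfps"
    and n :: nat and \<gamma> :: "complex mfps vec"
    and BJ :: "nat set" and h :: "nat \<Rightarrow> complex mfps" and J :: "complex mfps set"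
    and g :: nat and A C :: "nat set" and X :: "nat \<Rightarrow> complex mfps vec" and F :: "nat \<Rightarrow> complex mfps"
begin

lemma v_z: "zconst {..<N} (($) (v j))" using v_props by (simp add: zconst_def)

lemma msub_p_sigma:
  assumes f: "f \<in> mcarr {..<N}" shows "msub (p j) (sigma N f) = mcnj (msub (($) (v j)) f)"
proof -
  have f2: "f \<in> mcarr {..<2 * N}" by (rule mcarr_mono[OF f]) auto
  have "msub (p j) (sigma N f) = msub (\<lambda>i. msub (p j) (mvar (sw N i))) (mcnj f)"
    unfolding sigma_eq[OF f2]
    by (rule msub_msub[OF _ mcarr_mcnj[OF f] _ _ _ p_z]) (auto simp: zconst_def sw_def intro!: mcarr_mvar)
  also have "\<dots> = msub (\<lambda>i. mcnj (v j $ i)) (mcnj f)"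
  proof (rule msub_cong[OF _ mcarr_mcnj[OF f]])
    show *: "msub (p j) (mvar (sw N i)) = mcnj (v j $ i)" if "i \<in> {..<N}" for i
    proof -
      have "msub (p j) (mvar (sw N i)) = p j (sw N i)" using that by (intro msub_mvar[OF _ p_z]) (auto simp: sw_def)
      then show ?thesis using that by (simp add: sw_def p_def)
    qed
    show "zconst {..<N} (\<lambda>i. msub (p j) (mvar (sw N i)))" using * v_props by (auto simp: zconst_def)
  qed simp
  also have "\<dots> = mcnj (msub (($) (v j)) f)" by (rule mcnj_msub[OF _ f v_z, symmetric]) simp
  finally show ?thesis .
qed

text \<open>
  The ideal is generated by the \<open>\<sigma> (F c)\<close> and the \<open>r b\<close>. Along \<open>p j\<close>, whose components are \<open>v (j + 1)\<close> and
  the conjugate of \<open>v j\<close>, the latter vanish, and so do the former because the \<open>F c\<close> vanish along \<open>v j\<close>.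
\<close>

lemma msub_v_J: "f \<in> J \<Longrightarrow> f \<in> mcarr {..<N} \<Longrightarrow> msub (($) (v j)) f = 0"
proof (induction j arbitrary: f)
  case 0
  then show ?case by (intro msub_eq_0[of "{..<N}"] gi.J_const) simp_all
next
  case (Suc j)
  have gc: "gen x \<in> mcarr {..<2 * N}" if "x \<in> C <+> B" for x using J_carr[OF gen_J[OF that]] .
  obtain a where a: "\<And>x. x \<in> C <+> B \<Longrightarrow> a x \<in> mcarr {..<2 * N}" "f = (\<Sum>x\<in>C <+> B. a x * gen x)"
    using Suc.prems(1) unfolding J_gen by (rule lidealE) (rule that)
  have 0: "msub (p j) (gen x) = 0" if "x \<in> C <+> B" for x
    using that
  proof (rule PlusE)
    fix c assume "c \<in> C" "x = Inl c"
    then show ?thesis using msub_p_sigma[OF F(2)] Suc.IH[OF F] by (simp add: gen_def)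
  next
    fix b assume "b \<in> B" "x = Inr b"
    then show ?thesis using p_M[OF r] by (simp add: gen_def)
  qed
  have "msub (p j) f = (\<Sum>x\<in>C <+> B. msub (p j) (a x) * msub (p j) (gen x))"
    unfolding a(2) by (subst msub_sum[OF _ p_z]) (simp_all add: msub_mult[OF _ p_z] a(1) gc)
  also have "\<dots> = 0" using 0 by simp
  also have "msub (p j) f = msub (($) (v (Suc j))) f"
    using v_props by (intro msub_cong[OF _ Suc.prems(2)]) (auto simp: p_def zconst_def)
  finally show ?case .
qed

text \<open>The \<open>F c\<close> vanish along v^j, so their differentials annihilate the columns
  of its Jacobian matrix and determine the components in \<open>C\<close> by the others.\<close>

lemma R_le: "R j + card C \<le> N"
proof -
  let ?V = "spn {..<j * n} (\<lambda>l i. fr (jcol N (($) (v j)) l i))"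
  have inj: "w = (\<lambda>_. 0)" if w: "w \<in> ?V" "\<forall>x\<in>{..<N} - C. w x = 0" for w
  proof (rule frac_kernel_injective[where K = C and \<iota> = "\<lambda>i. i" and m = N and Q = "\<lambda>c i. msub (($) (v j)) (mderiv i (F c))"])
    obtain k where k: "w = (\<lambda>i. \<Sum>l<j * n. k l * fr (jcol N (($) (v j)) l i))" using w(1) by (rule spnE)
    show "mconst (msub (($) (v j)) (mderiv c (F b))) = (if b = c then 1 else 0)" if "b \<in> C" "c \<in> C" for b c
      using mconst_msub[OF _ v_z mcarr_mderiv[OF F(2)[OF that(1)]]] F_delta[OF that] by (simp del: mderiv.rep_eq)
    show "w i = 0" if "i \<notin> (\<lambda>i. i) ` C" for i
      using that w(2) unfolding k by (cases "i < N") (auto simp: jcol_def fr_simps)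
    fix c assume c: "c \<in> C"
    have 0: "(\<Sum>i<N. msub (($) (v j)) (mderiv i (F c)) * mderiv l (v j $ i)) = 0" for l
      using mderiv_msub[OF _ v_z F(2)[OF c], of l j] msub_v_J[OF F[OF c], of j] by simp
    have "(\<Sum>i<N. fr (msub (($) (v j)) (mderiv i (F c))) * w i)
        = (\<Sum>i<N. \<Sum>l<j * n. k l * fr (msub (($) (v j)) (mderiv i (F c)) * mderiv l (v j $ i)))"
      unfolding k by (intro sum.cong refl) (simp add: jcol_def fr_simps sum_distrib_left mult.left_commute)
    also have "\<dots> = (\<Sum>l<j * n. k l * fr (\<Sum>i<N. msub (($) (v j)) (mderiv i (F c)) * mderiv l (v j $ i)))"
      by (subst sum.swap) (simp add: fr_sum fr_simps sum_distrib_left)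
    also have "\<dots> = 0" using 0 by (simp add: fr_simps)
    finally show "(\<Sum>i<N. fr (msub (($) (v j)) (mderiv i (F c))) * w i) = 0" .
  qed (use C(1) finC in auto)
  obtain s where s: "s \<le> card ({..<N} - C)" "hasdim ?V s"
    by (rule hasdim_exists[OF lsub_spn, of "{..<N} - C"]) (use inj in blast)+
  then have "R j \<le> card ({..<N} - C)" using hasdim_unique[OF hasdim_R] by blast
  also have "\<dots> = N - card C" using C(1) finC by (simp add: card_Diff_subset)
  finally show ?thesis using card_mono[OF finite_lessThan C(1)] by simp
qed

lemma R_le': "R j + N \<le> g + d" using R_le[of j] C(2) card_BJ by simp

text \<open>If the rank is stationary, then the values of the Lie algebra span at most the tangent space of \<open>p j\<close>.\<close>

lemma g_le: assumes "R (Suc j) = R j" shows "g \<le> R j + n"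
proof -
  obtain s where s: "s \<le> n" "hasdim (T j) (R (Suc j) + s)" "R j + n \<le> R (Suc j) + s" "s = n \<Longrightarrow> E01 j \<subseteq> T j"
    by (rule T_dims[of j]) (rule that; simp)
  have sn: "s = n" using s(1,3) assms by simp
  have finA: "finite A" using A(1) finite_subset by blast
  let ?w = "\<lambda>a i. if i < 2 * N then msub (p j) (X a $ i) else 0"
  have "(\<lambda>i. fr (?w a i)) \<in> T j" if a: "a \<in> A" for a
  proof -
    have "(\<lambda>i. fr (?w a i)) = (\<lambda>i. if i < 2 * N then fr (msub (p j) (X a $ i)) else 0)"
      by (simp add: fun_eq_iff fr_simps)
    then show ?thesis using T_if_ptan[OF ptan_L[OF s(4)[OF sn] X[OF a]]] by simp
  qed
  moreover have "indep A (\<lambda>a i. fr (?w a i))"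
  proof (rule indep_fr_if_const[OF finA], rule indep_if_delta[OF finA, where \<kappa> = "\<lambda>a. a"])
    fix a b assume ab: "a \<in> A" "b \<in> A"
    then have b: "b < 2 * N" using A(1) by auto
    then have "X a $ b \<in> mcarr {..<2 * N}" using L_field[OF X[OF ab(1)]] by (simp add: vector_fieldD)
    then show "mconst (?w a b) = (if a = b then 1 else 0)" using b X_delta[OF ab] by (simp add: mconst_msub_p)
  qed
  ultimately have "card A \<le> R (Suc j) + s" by (intro indep_card_le[OF s(2) finA])
  then show ?thesis using A(2) sn assms by simp
qed

text \<open>At the origin the Jacobian matrix of v^1 is \<partial>\<gamma>/\<partial>t.\<close>

lemma n_le_R: "n \<le> R (Suc 0)"
proof -
  have "indep {..<n} (\<lambda>l i. fr (jcol N (($) (v (Suc 0))) l i))"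
  proof (rule indep_fr_if_const)
    show "indep {..<n} (\<lambda>l i. mconst (jcol N (($) (v (Suc 0))) l i))"
    proof (rule indep_cong[OF _ \<gamma>_t], rule ext)
      fix l i assume l: "l \<in> {..<n}"
      show "mconst (jcol N (($) \<gamma>) (N + l) i) = mconst (jcol N (($) (v (Suc 0))) l i)"
      proof (cases "i < N")
        case True
        have "mderiv l (v (Suc 0) $ i) = msub (tau 0) (mderiv (N + l) (\<gamma> $ i))"
          using mderiv_v_Suc[OF True, of l 0] l by simp
        moreover have "mconst (msub (tau 0) (mderiv (N + l) (\<gamma> $ i))) = mconst (mderiv (N + l) (\<gamma> $ i))"
          by (rule mconst_msub[OF _ tau_z]) (simp_all add: \<gamma>_carr[OF True])
        ultimately show ?thesis using True by (simp only: jcol_def if_True)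
      qed (simp add: jcol_def)
    qed
  qed simp
  then have "card {..<n} \<le> R (Suc 0)"
    by (intro indep_card_le[OF hasdim_R[of "Suc 0"] finite_lessThan in_spn]) simp_all
  then show ?thesis by simp
qed

text \<open>At the first equality of consecutive ranks \<open>g_le\<close> and \<open>R_le'\<close>
  pin the rank to g + d - N. The upper bound \<open>R_le'\<close> holds for all j, so by
  monotonicity the rank stays there.\<close>

lemma stabilization:
  obtains k\<^sub>0 where "1 \<le> k\<^sub>0" "k\<^sub>0 \<le> d + 1" "\<And>j. j \<ge> k\<^sub>0 \<Longrightarrow> R j = R (Suc j)"
    "\<And>j. 1 \<le> j \<Longrightarrow> j < k\<^sub>0 \<Longrightarrow> R j < R (Suc j)" "R k\<^sub>0 + N = g + d"
proof -
  have ex: "\<exists>j. 1 \<le> j \<and> j \<le> d + 1 \<and> R (Suc j) = R j"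
  proof (rule ccontr)
    assume "\<not> ?thesis"
    then have less: "R j < R (Suc j)" if "1 \<le> j" "j \<le> d + 1" for j using that R_mono[of j] by (metis le_neq_implies_less)
    \<comment> \<open>For i = d + 1 this would give a rank of at least N + 1.\<close>
    have "n + i \<le> R (Suc i)" if "i \<le> d + 1" for i
      using that
    proof (induction i)
      case (Suc i)
      then show ?case using less[of "Suc i"] by simp
    qed (use n_le_R in simp)
    from this[of "d + 1"] show False using R_le[of "Suc (d + 1)"] n dN by simp
  qed
  define k where "k = (LEAST j. 1 \<le> j \<and> R (Suc j) = R j)"
  have k: "1 \<le> k" "R (Suc k) = R k" "k \<le> d + 1"
  proof -
    from ex obtain j where j: "1 \<le> j" "j \<le> d + 1" "R (Suc j) = R j" by blast
    then show "1 \<le> k" "R (Suc k) = R k" unfolding k_def by (metis (mono_tags, lifting) LeastI)+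
    show "k \<le> d + 1" unfolding k_def using j by (metis (mono_tags, lifting) Least_le order_trans)
  qed
  have mono: "R k \<le> R j" if "k \<le> j" for j using that
    by (induction j rule: dec_induct) (use R_mono order_trans in blast)+
  have ge: "g + d \<le> R k + N" using g_le[OF k(2)] n dN by simp
  have eq: "R j + N = g + d" if "k \<le> j" for j using R_le'[of j] mono[OF that] ge by simp
  have "R j < R (Suc j)" if "1 \<le> j" "j < k" for j
  proof -
    have "R (Suc j) \<noteq> R j" using not_less_Least[of j "\<lambda>j. 1 \<le> j \<and> R (Suc j) = R j"] that by (auto simp: k_def)
    then show ?thesis using R_mono[of j] by simp
  qed
  moreover have "R j = R (Suc j)" if "k \<le> j" for j using eq[OF that] eq[of "Suc j"] that by simp
  ultimately show ?thesis using k(1,3) eq[of k] by (intro that[of k]) auto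
qed

end

subsection \<open>Changes of coordinates\<close>

text \<open>The condition on the generators extends to the whole ideal, which frees the later
  arguments from the choice of \<rho>.\<close>

lemma segre_variety_kills:
  assumes \<rho>: "generators (2 * N) d M \<rho>" and \<gamma>: "segre_variety_mapping N d \<rho> \<gamma>" and f: "f \<in> M"
  shows "msub (pgam N \<gamma>) f = 0"
proof -
  have M: "\<rho> \<in> carrier_vec d" "\<And>i. i < d \<Longrightarrow> \<rho> $ i \<in> mcarr {..<2 * N}" "M = lideal (2 * N) {..<d} (($) \<rho>)"
    using \<rho> by (auto simp: generators_iff)
  have \<gamma>': "dim_vec \<gamma> = N" "\<And>i. i < N \<Longrightarrow> mconst (\<gamma> $ i) = 0" "map_subst \<rho> (\<gamma> @\<^sub>v vec N mvar) = 0\<^sub>v d"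
    using \<gamma> by (auto simp: segre_variety_mapping_def formal_map_def)
  have z: "zconst {..<2 * N} (pgam N \<gamma>)" using \<gamma>'(2) by (auto simp: zconst_def pgam_def)
  have 0: "msub (pgam N \<gamma>) (\<rho> $ i) = 0" if i: "i < d" for i
  proof -
    have "msub (pgam N \<gamma>) (\<rho> $ i) = msub (\<lambda>k. (\<gamma> @\<^sub>v vec N mvar) $ k) (\<rho> $ i)"
      by (rule msub_cong[OF _ M(2)[OF i] z]) (use \<gamma>'(1) in \<open>auto simp: pgam_def\<close>)
    also have "\<dots> = map_subst \<rho> (\<gamma> @\<^sub>v vec N mvar) $ i" using i M(1) by (simp add: msubst_eq_msub)
    finally show ?thesis using i by (simp add: \<gamma>'(3))
  qed
  obtain a where a: "\<And>i. i \<in> {..<d} \<Longrightarrow> a i \<in> mcarr {..<2 * N}" "f = (\<Sum>i<d. a i * \<rho> $ i)"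
    using f unfolding M(3) by (rule lidealE) (rule that)
  have "msub (pgam N \<gamma>) f = (\<Sum>i<d. msub (pgam N \<gamma>) (a i) * msub (pgam N \<gamma>) (\<rho> $ i))"
    unfolding a(2) using a(1) M(2) by (subst msub_sum[OF _ z]) (simp_all add: msub_mult[OF _ z])
  then show ?thesis using 0 by simp
qed

lemma segre_variety_t:
  assumes "segre_variety_mapping N d \<rho> \<gamma>"
  shows "indep {..<N - d} (\<lambda>l i. mconst (jcol N (($) \<gamma>) (N + l) i))"
proof -
  let ?A = "map_mat mconst (jacobian N (N - d) \<gamma>)"
  have "dim_vec \<gamma> = N" and rk: "rank_at_0 (jacobian N (N - d) \<gamma>) = N - d"
    using assms by (auto simp: segre_variety_mapping_def formal_map_def)
  then have d: "dim_row ?A = N" "dim_col ?A = N - d" "dim_row (jacobian N (N - d) \<gamma>) = N" by (simp_all add: jacobian_def)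
  then have "hasdim (spn {..<N - d} (colf ?A)) (card {..<N - d})" using hasdim_rank[of ?A] rk by (simp add: rank_at_0_def)
  then have "indep {..<N - d} (colf ?A)" by (rule indep_if_hasdim) simp
  then show ?thesis
    by (rule indep_cong[rotated])
      (use \<open>dim_vec \<gamma> = N\<close> in \<open>auto simp: fun_eq_iff colf_def jcol_def jacobian_def simp del: mderiv.rep_eq\<close>)
qed

lemma (in generic_normal) segre_if_segre_variety_mapping:
  assumes "generators (2 * N) d M \<rho>" "segre_variety_mapping N d \<rho> \<gamma>"
  shows "segre N d M B r (N - d) \<gamma>"
  using assms segre_variety_kills[OF assms] segre_variety_t[OF assms(2)]
  by unfold_locales (simp_all add: segre_variety_mapping_def)

lemma coordinate_change_indep:
  assumes "coordinate_change N H"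
  shows "indep {..<N} (\<lambda>l i. mconst (jcol N (($) H) l i))"
proof -
  let ?A = "map_mat mconst (jacobian 0 N H)"
  have H: "dim_vec H = N" using assms by (auto simp: coordinate_change_def formal_map_def)
  have A: "?A \<in> carrier_mat N N" using H by (auto simp: jacobian_def)
  obtain Q where Q: "?A * Q = 1\<^sub>m (dim_row ?A)" "Q * ?A = 1\<^sub>m (dim_row Q)"
    using assms by (auto simp: coordinate_change_def invertible_mat_def inverts_mat_def)
  have dQ: "Q \<in> carrier_mat N N"
    using arg_cong[OF Q(1), of dim_col] arg_cong[OF Q(2), of dim_col] A by auto
  have \<delta>: "(\<Sum>i<N. Q $$ (k, i) * mconst (mderiv l (H $ i))) = (if k = l then 1 else 0)" if "k < N" "l < N" for k l
  proof -
    have "(\<Sum>i<N. Q $$ (k, i) * mconst (mderiv l (H $ i))) = (Q * ?A) $$ (k, l)"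
      using that dQ A H by (simp add: scalar_prod_def jacobian_def atLeast0LessThan del: mderiv.rep_eq)
    then show ?thesis using Q(2) dQ that by simp
  qed
  show ?thesis unfolding indep_def
  proof (intro allI impI ballI)
    fix c k assume 0: "\<forall>i. (\<Sum>l<N. c l * mconst (jcol N (($) H) l i)) = 0" and k: "k \<in> {..<N}"
    have "0 = (\<Sum>i<N. Q $$ (k, i) * (\<Sum>l<N. c l * mconst (jcol N (($) H) l i)))" using 0 by simp
    also have "\<dots> = (\<Sum>i<N. \<Sum>l<N. c l * (Q $$ (k, i) * mconst (mderiv l (H $ i))))"
      by (intro sum.cong refl) (simp add: jcol_def sum_distrib_left mult.left_commute del: mderiv.rep_eq)
    also have "\<dots> = (\<Sum>l<N. c l * (\<Sum>i<N. Q $$ (k, i) * mconst (mderiv l (H $ i))))"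
      by (subst sum.swap) (simp add: sum_distrib_left del: mderiv.rep_eq)
    also have "\<dots> = (\<Sum>l<N. if k = l then c l else 0)"
      using k \<delta> by (intro sum.cong refl) (simp del: mderiv.rep_eq)
    finally show "c k = 0" using k by simp
  qed
qed

text \<open>\<open>inverse_mapping\<close> gives G with H o G = id and K with G o K = id; then K =
  H, so G is a two-sided inverse.\<close>

lemma coordinate_inverse:
  assumes H: "coordinate_change N H"
  obtains G where "\<And>i. i < N \<Longrightarrow> G i \<in> mcarr {..<N}" "\<And>i. i < N \<Longrightarrow> mconst (G i) = 0"
    "\<And>i. i < N \<Longrightarrow> msub G (H $ i) = mvar i" "\<And>i. i < N \<Longrightarrow> msub (($) H) (G i) = mvar i"
    "indep {..<N} (\<lambda>l i. mconst (jcol N G l i))"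
proof -
  have Hc: "H $ i \<in> mcarr {..<N}" and H0: "mconst (H $ i) = 0" if "i < N" for i
    using H that by (auto simp: coordinate_change_def formal_map_def mfps_carrier_eq)
  obtain G where G: "\<And>i. i < N \<Longrightarrow> G i \<in> mcarr {..<N}" "\<And>i. i < N \<Longrightarrow> mconst (G i) = 0"
    "\<And>i. i < N \<Longrightarrow> msub G (H $ i) = mvar i"
    by (rule inverse_mapping[of N "($) H"]) (use Hc H0 coordinate_change_indep[OF H] in blast)+
  have zG: "zconst {..<N} G" using G(2) by (simp add: zconst_def)
  have ind: "indep {..<N} (\<lambda>l i. mconst (jcol N G l i))"
    unfolding indep_def
  proof (intro allI impI ballI)
    fix c k assume 0: "\<forall>i. (\<Sum>l<N. c l * mconst (jcol N G l i)) = 0" and k: "k \<in> {..<N}"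
    have chain: "(\<Sum>j<N. mconst (mderiv j (H $ k)) * mconst (jcol N G l j)) = (if l = k then 1 else 0)" for l
    proof -
      have "mderiv l (msub G (H $ k)) = (\<Sum>j<N. msub G (mderiv j (H $ k)) * jcol N G l j)"
        using mderiv_msub[OF _ zG Hc[of k], of l] k by (simp add: jcol_def)
      then have "mconst (\<Sum>j<N. msub G (mderiv j (H $ k)) * jcol N G l j) = mconst (mderiv l (mvar k))"
        using G(3)[of k] k by (simp only: lessThan_iff)
      then show ?thesis using k by (simp add: mconst_msub[OF _ zG] Hc mderiv_mvar del: mderiv.rep_eq split: if_splits)
    qed
    have "0 = (\<Sum>j<N. mconst (mderiv j (H $ k)) * (\<Sum>l<N. c l * mconst (jcol N G l j)))" using 0 by simp
    also have "\<dots> = (\<Sum>j<N. \<Sum>l<N. c l * (mconst (mderiv j (H $ k)) * mconst (jcol N G l j)))"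
      by (intro sum.cong refl) (simp add: sum_distrib_left mult.left_commute del: mderiv.rep_eq)
    also have "\<dots> = (\<Sum>l<N. c l * (\<Sum>j<N. mconst (mderiv j (H $ k)) * mconst (jcol N G l j)))"
      by (subst sum.swap) (simp add: sum_distrib_left del: mderiv.rep_eq)
    also have "\<dots> = (\<Sum>l<N. if l = k then c l else 0)" by (intro sum.cong refl) (simp add: chain)
    finally show "c k = 0" using k by simp
  qed
  obtain K where K: "\<And>i. i < N \<Longrightarrow> K i \<in> mcarr {..<N}" "\<And>i. i < N \<Longrightarrow> mconst (K i) = 0"
    "\<And>i. i < N \<Longrightarrow> msub K (G i) = mvar i"
    by (rule inverse_mapping[of N G]) (use G(1,2) ind in blast)+
  have zK: "zconst {..<N} K" using K(2) by (simp add: zconst_def)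
  have KH: "K i = H $ i" if i: "i < N" for i
  proof -
    have "K i = msub K (msub G (H $ i))" using i G(3)[OF i] msub_mvar[OF _ zK, of i] by simp
    also have "\<dots> = msub (\<lambda>k. msub K (G k)) (H $ i)"
      by (rule msub_msub[OF _ Hc[OF i] _ zG _ zK]) (use G(1) in auto)
    also have "\<dots> = H $ i" by (rule msub_id[OF _ Hc[OF i]]) (use K(3) in auto)
    finally show ?thesis .
  qed
  have "msub (($) H) (G i) = mvar i" if i: "i < N" for i
    using msub_cong[OF _ G(1)[OF i] zK, of "($) H"] KH K(3)[OF i] by simp
  then show ?thesis using G ind by (intro that) auto
qed

text \<open>The mapping \<gamma>' is transported back: G applied to \<gamma>' at (conjugate of
  H)(\<zeta>) and t, with G the inverse of H, is a Segre variety mapping \<gamma>'' of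
  \<open>M\<close>, and its iterates are those of \<gamma>' composed with G. Composition with G and
  H preserves ranks, and \<gamma>'' is compared with \<gamma> by reparametrization.\<close>

lemma Rk_coordinates:
  assumes s: "segre N d M B r (N - d) \<gamma>" and H: "coordinate_change N H"
    and \<rho>': "generators (2 * N) d (in_coordinates N H M) \<rho>'" and \<gamma>': "segre_variety_mapping N d \<rho>' \<gamma>'"
  shows "Rk (j * (N - d)) (segre_mapping N (N - d) \<gamma>' j) = Rk (j * (N - d)) (segre_mapping N (N - d) \<gamma> j)"
proof -
  let ?n = "N - d"
  interpret s: segre N d M B r ?n \<gamma> by fact
  interpret s': segre_map N ?n \<gamma>' using \<gamma>' by unfold_locales (simp add: segre_variety_mapping_def)
  have Hc: "H $ i \<in> mcarr {..<N}" and H0: "mconst (H $ i) = 0" if "i < N" for i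
    using H that by (auto simp: coordinate_change_def formal_map_def mfps_carrier_eq)
  have dH: "dim_vec H = N" using H by (auto simp: coordinate_change_def formal_map_def)
  obtain G where G: "\<And>i. i < N \<Longrightarrow> G i \<in> mcarr {..<N}" "\<And>i. i < N \<Longrightarrow> mconst (G i) = 0"
    "\<And>i. i < N \<Longrightarrow> msub G (H $ i) = mvar i" "\<And>i. i < N \<Longrightarrow> msub (($) H) (G i) = mvar i"
    "indep {..<N} (\<lambda>l i. mconst (jcol N G l i))"
    by (rule coordinate_inverse[OF H]) (rule that)
  have zG: "zconst {..<N} G" using G(2) by (simp add: zconst_def)
  have zH: "zconst {..<N} (($) H)" using H0 by (simp add: zconst_def)
  \<comment> \<open>Substitutes the conjugate of H for \<zeta> and keeps t.\<close>
  define \<kappa> where "\<kappa> k = (if k < N then mcnj (H $ k) else mvar k)" for k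
  have z\<kappa>: "zconst S \<kappa>" for S using H0 by (auto simp: zconst_def \<kappa>_def)
  have \<kappa>c: "\<kappa> k \<in> mcarr {..<N + ?n}" if "k < N + ?n" for k
  proof (cases "k < N")
    case True
    then have "mcnj (H $ k) \<in> mcarr {..<N}" using Hc by simp
    then show ?thesis using True mcarr_mono[of "mcnj (H $ k)" "{..<N}" "{..<N + ?n}"] by (simp add: \<kappa>_def)
  qed (use that in \<open>simp add: \<kappa>_def mcarr_mvar\<close>)
  have zg: "zconst {..<N} (($) \<gamma>')" using s'.\<gamma>_const by (simp add: zconst_def)
  define \<gamma>'' where "\<gamma>'' = vec N (\<lambda>i. msub \<kappa> (msub (($) \<gamma>') (G i)))"
  have g'': "\<gamma>'' $ i = msub \<kappa> (msub (($) \<gamma>') (G i))" if "i < N" for i using that by (simp add: \<gamma>''_def)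
  have gG: "msub (($) \<gamma>') (G i) \<in> mcarr {..<N + ?n}" "mconst (msub (($) \<gamma>') (G i)) = 0" if "i < N" for i
    using mcarr_msub[OF _ zg G(1)[OF that], of "{..<N + ?n}"] s'.\<gamma>_carr mconst_msub[OF _ zg G(1)[OF that]] G(2)[OF that] by auto
  interpret s'': segre N d M B r ?n \<gamma>''
  proof unfold_locales
    show "formal_map (N + ?n) N \<gamma>''"
      unfolding formal_map_def mfps_carrier_eq
    proof (intro conjI allI impI)
      fix i assume i: "i < N"
      show "\<gamma>'' $ i \<in> mcarr {..<N + ?n}" unfolding g''[OF i]
        by (rule mcarr_msub[OF _ z\<kappa> gG(1)[OF i]]) (use \<kappa>c in auto)
      show "mconst (\<gamma>'' $ i) = 0" unfolding g''[OF i] using mconst_msub[OF _ z\<kappa> gG(1)[OF i]] gG(2)[OF i] by simp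
    qed (simp add: \<gamma>''_def)
    fix f assume f: "f \<in> M"
    note fc = is_idealD(1)[OF s.M_ideal f]
    define \<Phi> where "\<Phi> i = complexified N H $ i" for i
    \<comment> \<open>The inverse of the complexified coordinate change; substituting it into
      \<open>f\<close> yields a member of the ideal in the new coordinates, on which \<gamma>' can
      be used.\<close>
    define \<Psi> where "\<Psi> i = (if i < N then G i else msub (\<lambda>k. mvar (N + k)) (mcnj (G (i - N))))" for i
    have zs: "zconst S (\<lambda>k. mvar (N + k) :: complex mfps)" for S by (simp add: zconst_def)
    have \<Phi>: "\<Phi> i = (if i < N then H $ i else msub (\<lambda>k. mvar (N + k)) (mcnj (H $ (i - N))))" if i: "i < 2 * N" for i
    proof (cases "i < N")
      case False
      then have "i - N < N" using i by simp
      then have "mcnj (H $ (i - N)) \<in> mcarr {..<N}" using Hc by simp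
      then have "msub (($) (vec N (\<lambda>i. mvar (N + i)))) (mcnj (H $ (i - N))) = msub (\<lambda>k. mvar (N + k)) (mcnj (H $ (i - N)))"
        by (intro msub_cong[of "{..<N}"]) (auto simp: zconst_def)
      then show ?thesis using False i dH by (simp add: \<Phi>_def complexified_def msubst_eq_msub)
    qed (use dH in \<open>simp add: \<Phi>_def complexified_def\<close>)
    have shift: "msub (\<lambda>k. mvar (N + k)) (mcnj x) \<in> mcarr {..<2 * N} \<and> mconst (msub (\<lambda>k. mvar (N + k)) (mcnj x)) = 0"
      if "x \<in> mcarr {..<N}" "mconst x = 0" for x
    proof
      show "msub (\<lambda>k. mvar (N + k)) (mcnj x) \<in> mcarr {..<2 * N}"
        by (rule mcarr_msub[OF _ zs mcarr_mcnj[OF that(1)]]) (auto intro: mcarr_mvar)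
    qed (use mconst_msub[OF _ zs mcarr_mcnj[OF that(1)]] that(2) in simp)
    have up: "x \<in> mcarr {..<2 * N}" if "x \<in> mcarr {..<N}" for x :: "complex mfps" by (rule mcarr_mono[OF that]) auto
    have \<Phi>z: "zconst {..<2 * N} \<Phi>" using \<Phi> H0 shift Hc by (auto simp: zconst_def)
    have \<Psi>z: "zconst {..<2 * N} \<Psi>" and \<Psi>c: "\<And>i. i \<in> {..<2 * N} \<Longrightarrow> \<Psi> i \<in> mcarr {..<2 * N}"
      using G(1,2) shift up by (auto simp: zconst_def \<Psi>_def)
    have inv: "msub \<Phi> (\<Psi> i) = mvar i" if i: "i \<in> {..<2 * N}" for i
    proof (cases "i < N")
      case True
      have "msub \<Phi> (G i) = msub (($) H) (G i)"
        by (rule msub_cong[OF _ G(1)[OF True], symmetric]) (use zH \<Phi> in auto)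
      then show ?thesis using True G(4) by (simp add: \<Psi>_def)
    next
      case False
      then have m: "i - N < N" using i by simp
      note Gm = mcarr_mcnj[OF G(1)[OF m]]
      have "msub \<Phi> (\<Psi> i) = msub (\<lambda>k. msub \<Phi> (mvar (N + k))) (mcnj (G (i - N)))"
        using False by (simp add: \<Psi>_def) (rule msub_msub[OF _ Gm _ zs _ \<Phi>z]; auto intro: mcarr_mvar)
      also have "\<dots> = msub (\<lambda>k. msub (\<lambda>k. mvar (N + k)) (mcnj (H $ k))) (mcnj (G (i - N)))"
      proof (rule msub_cong[OF _ Gm])
        show *: "msub \<Phi> (mvar (N + k)) = msub (\<lambda>k. mvar (N + k)) (mcnj (H $ k))" if "k \<in> {..<N}" for k
          using that msub_mvar[OF _ \<Phi>z, of "N + k"] \<Phi>[of "N + k"] by simp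
        show "zconst {..<N} (\<lambda>k. msub \<Phi> (mvar (N + k)))" using * shift Hc H0 by (simp add: zconst_def)
      qed simp
      also have "\<dots> = msub (\<lambda>k. mvar (N + k)) (msub (\<lambda>k. mcnj (H $ k)) (mcnj (G (i - N))))"
        by (rule msub_msub[OF _ Gm _ _ _ zs, symmetric, where B = "{..<N}"]) (use H0 Hc in \<open>auto simp: zconst_def\<close>)
      also have "msub (\<lambda>k. mcnj (H $ k)) (mcnj (G (i - N))) = mvar (i - N)"
        using mcnj_msub[OF _ G(1)[OF m] zH] G(4)[OF m] by simp
      also have "msub (\<lambda>k. mvar (N + k)) (mvar (i - N)) = (mvar i :: complex mfps)"
        using False msub_mvar[OF _ zs, of "{i - N}" "i - N"] by simp
      finally show ?thesis .
    qed
    have "msub \<Phi> (msub \<Psi> f) = msub (\<lambda>i. msub \<Phi> (\<Psi> i)) f"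
      by (rule msub_msub[OF _ fc _ \<Psi>z \<Psi>c \<Phi>z]) auto
    also have "\<dots> = f" by (rule msub_id[OF _ fc inv]) auto
    finally have "msub \<Psi> f \<in> in_coordinates N H M"
      using f mcarr_msub[OF _ \<Psi>z fc \<Psi>c] by (simp add: in_coordinates_def mfps_carrier_eq msubst_eq_msub \<Phi>_def[abs_def])
    then have 0: "msub (pgam N \<gamma>') (msub \<Psi> f) = 0" by (rule segre_variety_kills[OF \<rho>' \<gamma>'])
    have zp: "zconst {..<2 * N} (pgam N \<gamma>')" using s'.\<gamma>_const by (auto simp: zconst_def pgam_def)
    have pc: "pgam N \<gamma>' i \<in> mcarr {..<N + ?n}" if "i \<in> {..<2 * N}" for i
      using that s'.\<gamma>_carr by (auto simp: pgam_def intro!: mcarr_mvar)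
    have "msub (pgam N \<gamma>') (msub \<Psi> f) = msub (\<lambda>i. msub (pgam N \<gamma>') (\<Psi> i)) f"
      by (rule msub_msub[OF _ fc _ \<Psi>z \<Psi>c zp]) auto
    then have "msub \<kappa> (msub (\<lambda>i. msub (pgam N \<gamma>') (\<Psi> i)) f) = 0" using 0 msub_0[OF finite.emptyI z\<kappa>] by simp
    also have "msub \<kappa> (msub (\<lambda>i. msub (pgam N \<gamma>') (\<Psi> i)) f) = msub (\<lambda>i. msub \<kappa> (msub (pgam N \<gamma>') (\<Psi> i))) f"
    proof (rule msub_msub[OF _ fc _ _ _ z\<kappa>])
      show "zconst {..<2 * N} (\<lambda>i. msub (pgam N \<gamma>') (\<Psi> i))"
        using \<Psi>z mconst_msub[OF _ zp \<Psi>c] by (simp add: zconst_def)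
      show "msub (pgam N \<gamma>') (\<Psi> i) \<in> mcarr {..<N + ?n}" if "i \<in> {..<2 * N}" for i
        by (rule mcarr_msub[OF _ zp \<Psi>c[OF that] pc]) auto
    qed simp_all
    also have "\<dots> = msub (pgam N \<gamma>'') f"
    proof (rule msub_cong[OF _ fc])
      show *: "msub \<kappa> (msub (pgam N \<gamma>') (\<Psi> i)) = pgam N \<gamma>'' i" if i: "i \<in> {..<2 * N}" for i
      proof (cases "i < N")
        case True
        have "msub (pgam N \<gamma>') (G i) = msub (($) \<gamma>') (G i)"
          by (rule msub_cong[OF _ G(1)[OF True], symmetric]) (use zg in \<open>auto simp: pgam_def\<close>)
        then show ?thesis using True by (simp add: \<Psi>_def pgam_def g'')
      next
        case False
        then have m: "i - N < N" using i by simp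
        note Gm = mcarr_mcnj[OF G(1)[OF m]]
        have "msub (pgam N \<gamma>') (\<Psi> i) = msub (\<lambda>k. msub (pgam N \<gamma>') (mvar (N + k))) (mcnj (G (i - N)))"
          using False by (simp add: \<Psi>_def) (rule msub_msub[OF _ Gm _ zs _ zp]; auto intro: mcarr_mvar)
        also have "\<dots> = mcnj (G (i - N))"
          by (rule msub_id[OF _ Gm]) (auto simp: msub_mvar[OF _ zp] pgam_def)
        finally have "msub \<kappa> (msub (pgam N \<gamma>') (\<Psi> i)) = msub \<kappa> (mcnj (G (i - N)))" by simp
        also have "msub \<kappa> (mcnj (G (i - N))) = msub (\<lambda>k. mcnj (H $ k)) (mcnj (G (i - N)))"
          by (rule msub_cong[OF _ Gm z\<kappa>]) (auto simp: \<kappa>_def)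
        also have "\<dots> = mvar (i - N)" using mcnj_msub[OF _ G(1)[OF m] zH] G(4)[OF m] by simp
        finally show ?thesis using False by (simp add: pgam_def)
      qed
      show "zconst {..<2 * N} (\<lambda>i. msub \<kappa> (msub (pgam N \<gamma>') (\<Psi> i)))"
      proof -
        have "mconst (\<gamma>'' $ i) = 0" if "i < N" for i
          using that mconst_msub[OF _ z\<kappa> gG(1)] gG(2) by (simp add: g'')
        then show ?thesis using * by (auto simp: zconst_def pgam_def)
      qed
    qed simp
    finally show "msub (pgam N \<gamma>'') f = 0" .
  next
    have d: "mconst (mderiv (N + l) (\<gamma>'' $ i)) = (\<Sum>k<N. mconst (jcol N G k i) * mconst (jcol N (($) \<gamma>') (N + l) k))"
      if i: "i < N" and l: "l < ?n" for i l
    proof -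
      have dk: "mconst (mderiv (N + l) (msub \<kappa> (\<gamma>' $ k))) = mconst (mderiv (N + l) (\<gamma>' $ k))" if k: "k < N" for k
      proof -
        have "mderiv (N + l) (\<kappa> m) = (if m = N + l then 1 else 0)" if "m < N + ?n" for m
          using mderiv_notin[OF mcarr_mcnj[OF Hc[of m]], of "N + l"] by (auto simp: \<kappa>_def mderiv_mvar)
        then have "mderiv (N + l) (msub \<kappa> (\<gamma>' $ k)) = (\<Sum>m<N + ?n. if m = N + l then msub \<kappa> (mderiv m (\<gamma>' $ k)) else 0)"
          unfolding mderiv_msub[OF finite_lessThan z\<kappa> s'.\<gamma>_carr[OF k]] by (intro sum.cong refl) simp
        then show ?thesis using l mconst_msub[OF _ z\<kappa> mcarr_mderiv[OF s'.\<gamma>_carr[OF k]]] by (simp del: mderiv.rep_eq)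
      qed
      have z: "zconst {..<N} (\<lambda>k. msub \<kappa> (\<gamma>' $ k))"
        using mconst_msub[OF _ z\<kappa> s'.\<gamma>_carr] s'.\<gamma>_const by (simp add: zconst_def)
      have "\<gamma>'' $ i = msub (\<lambda>k. msub \<kappa> (\<gamma>' $ k)) (G i)"
        unfolding g''[OF i]
        by (rule msub_msub[OF _ G(1)[OF i] finite_lessThan[of "N + ?n"] zg _ z\<kappa>]) (use s'.\<gamma>_carr in auto)
      then have "mderiv (N + l) (\<gamma>'' $ i) = (\<Sum>k<N. msub (\<lambda>k. msub \<kappa> (\<gamma>' $ k)) (mderiv k (G i)) * mderiv (N + l) (msub \<kappa> (\<gamma>' $ k)))"
        using mderiv_msub[OF _ z G(1)[OF i]] by simp
      then show ?thesis
        using i G(1)[OF i] dk by (simp add: jcol_def mconst_msub[OF _ z] del: mderiv.rep_eq)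
    qed
    show "indep {..<?n} (\<lambda>l i. mconst (jcol N (($) \<gamma>'') (N + l) i))"
      unfolding indep_def
    proof (intro allI impI)
      fix c assume 0: "\<forall>i. (\<Sum>l<?n. c l * mconst (jcol N (($) \<gamma>'') (N + l) i)) = 0"
      define u where "u k = (\<Sum>l<?n. c l * mconst (jcol N (($) \<gamma>') (N + l) k))" for k
      have "(\<Sum>k<N. u k * mconst (jcol N G k i)) = 0" for i
      proof (cases "i < N")
        case True
        have "(\<Sum>l<?n. c l * mconst (jcol N (($) \<gamma>'') (N + l) i))
            = (\<Sum>l<?n. \<Sum>k<N. mconst (jcol N G k i) * (c l * mconst (jcol N (($) \<gamma>') (N + l) k)))"
          using True d[OF True]
          by (intro sum.cong refl) (simp add: jcol_def[of N "($) \<gamma>''"] sum_distrib_left mult.left_commute del: mderiv.rep_eq)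
        also have "\<dots> = (\<Sum>k<N. u k * mconst (jcol N G k i))"
          by (subst sum.swap) (simp add: u_def sum_distrib_left mult.commute)
        finally show ?thesis using 0 by simp
      qed (simp add: jcol_def)
      then have "\<forall>i. (\<Sum>k<N. u k * mconst (jcol N G k i)) = 0" by blast
      then have "\<forall>k\<in>{..<N}. u k = 0" using spec[OF G(5)[unfolded indep_def], of u] by (rule rev_mp)
      then have "u k = 0" for k by (cases "k < N") (simp_all add: u_def jcol_def)
      then have "\<forall>k. (\<Sum>l<?n. c l * mconst (jcol N (($) \<gamma>') (N + l) k)) = 0" by (simp add: u_def)
      then show "\<forall>l\<in>{..<?n}. c l = 0"
        using spec[OF segre_variety_t[OF \<gamma>', unfolded indep_def], of c] by (rule rev_mp)
    qed
  qed simp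
  have z': "zconst {..<N} (($) (s'.v j))" for j using s'.v_props by (simp add: zconst_def)
  have v'': "s''.v j $ i = msub (($) (s'.v j)) (G i)" if i: "i < N" for i j
    using i
  proof (induction j arbitrary: i)
    case 0
    then show ?case using msub_eq_0[OF _ G(1)[OF 0] G(2)[OF 0], of "($) (0\<^sub>v N)"] by simp
  next
    case (Suc j)
    have z'': "zconst {..<N} (($) (s''.v j))" using s''.v_props by (simp add: zconst_def)
    \<comment> \<open>By induction the iterate of \<gamma>'' is G composed with that of \<gamma>',
      so H recovers the latter; conjugated, this cancels the H contained in \<kappa>.\<close>
    have vH: "msub (($) (s''.v j)) (H $ k) = s'.v j $ k" if k: "k < N" for k
    proof -
      have "s'.v j $ k = msub (($) (s'.v j)) (msub G (H $ k))" using G(3)[OF k] k msub_mvar[OF _ z', of k j] by simp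
      also have "\<dots> = msub (\<lambda>m. msub (($) (s'.v j)) (G m)) (H $ k)"
        by (rule msub_msub[OF _ Hc[OF k] _ zG _ z']) (use G(1) in auto)
      also have "\<dots> = msub (($) (s''.v j)) (H $ k)"
        by (rule msub_cong[OF _ Hc[OF k] z'', symmetric]) (use Suc.IH in auto)
      finally show ?thesis by simp
    qed
    have t: "msub (s''.tau j) (\<kappa> k) = s'.tau j k" if k: "k \<in> {..<N + ?n}" for k
    proof (cases "k < N")
      case True
      have "msub (s''.tau j) (mcnj (H $ k)) = msub (\<lambda>m. mcnj (s''.v j $ m)) (mcnj (H $ k))"
        using s''.v_props by (intro msub_cong[OF _ mcarr_mcnj[OF Hc[OF True]]]) (auto simp: zconst_def s''.tau_def)
      also have "\<dots> = mcnj (msub (($) (s''.v j)) (H $ k))" by (rule mcnj_msub[OF _ Hc[OF True] z'', symmetric]) simp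
      finally show ?thesis using True by (simp add: \<kappa>_def vH s'.tau_def)
    next
      case False
      then show ?thesis using k msub_mvar[OF _ s''.tau_z, of k j] by (simp add: \<kappa>_def s'.tau_def s''.tau_def)
    qed
    have "s''.v (Suc j) $ i = msub (s''.tau j) (msub \<kappa> (msub (($) \<gamma>') (G i)))"
      using s''.v_Suc[OF Suc.prems] g''[OF Suc.prems] by simp
    also have "\<dots> = msub (\<lambda>k. msub (s''.tau j) (\<kappa> k)) (msub (($) \<gamma>') (G i))"
      by (rule msub_msub[OF _ gG(1)[OF Suc.prems] _ z\<kappa> _ s''.tau_z]) (use \<kappa>c in auto)
    also have "\<dots> = msub (s'.tau j) (msub (($) \<gamma>') (G i))"
      by (rule msub_cong[OF _ gG(1)[OF Suc.prems] s'.tau_z, symmetric]) (simp_all add: t)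
    also have "\<dots> = msub (\<lambda>k. msub (s'.tau j) (\<gamma>' $ k)) (G i)"
      by (rule msub_msub[OF _ G(1)[OF Suc.prems] _ zg _ s'.tau_z]) (use s'.\<gamma>_carr in auto)
    also have "\<dots> = msub (($) (s'.v (Suc j))) (G i)"
      by (rule msub_cong[OF _ G(1)[OF Suc.prems] z', symmetric]) (simp_all add: s'.v_Suc)
    finally show ?case .
  qed
  have v': "s'.v j $ k = msub (($) (s''.v j)) (H $ k)" if k: "k < N" for k
  proof -
    have z'': "zconst {..<N} (($) (s''.v j))" using s''.v_props by (simp add: zconst_def)
    have "s'.v j $ k = msub (($) (s'.v j)) (msub G (H $ k))" using G(3)[OF k] k msub_mvar[OF _ z', of k j] by simp
    also have "\<dots> = msub (\<lambda>m. msub (($) (s'.v j)) (G m)) (H $ k)"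
      by (rule msub_msub[OF _ Hc[OF k] _ zG _ z']) (use G(1) in auto)
    also have "\<dots> = msub (($) (s''.v j)) (H $ k)"
      by (rule msub_cong[OF _ Hc[OF k] z'', symmetric]) (use v'' in auto)
    finally show ?thesis .
  qed
  have "Rk (j * ?n) (s'.v j) = s''.R j"
  proof (rule antisym)
    show "Rk (j * ?n) (s'.v j) \<le> s''.R j"
      by (rule Rk_left_le[where G = "($) H" and N = N]) (use s''.v_carrier s''.v_props Hc s'.v_carrier v' in blast)+
    show "s''.R j \<le> Rk (j * ?n) (s'.v j)"
      by (rule Rk_left_le[where G = G and N = N]) (use s''.v_carrier s'.v_props G(1) s'.v_carrier v'' in blast)+
  qed
  also have "\<dots> = s.R j"
    by (rule antisym[OF s.Rk_reparametrization_le[OF s''.segre_axioms] s''.Rk_reparametrization_le[OF s]])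
  finally show ?thesis .
qed

text \<open>Changes of coordinates, generators and Segre variety mapping are treated simultaneously,
  with \<rho>' and \<gamma>' referring to the ideal in the new coordinates. The dimension formulas
  are stated in the integers to avoid truncated subtraction.\<close>

theorem theorem2p3:
  fixes N d n g :: nat and M :: "complex mfps set" and \<rho> \<gamma> :: "complex mfps vec"
    and v :: "nat \<Rightarrow> complex mfps vec"
  assumes "generic_manifold N d M"
    and "generators (2 * N) d M \<rho>"
    and "segre_variety_mapping N d \<rho> \<gamma>"
    and "n = N - d"
    and "v = segre_mapping N n \<gamma>"
    and "g = lie_algebra_dim N M"
  shows "(\<forall>j\<ge>1. Rk (j * n) (v j) \<le> Rk ((j + 1) * n) (v (j + 1)))
    \<and> (\<forall>H \<rho>' \<gamma>'. coordinate_change N H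
          \<and> generators (2 * N) d (in_coordinates N H M) \<rho>'
          \<and> segre_variety_mapping N d \<rho>' \<gamma>'
        \<longrightarrow> (\<forall>j\<ge>1. Rk (j * n) (segre_mapping N n \<gamma>' j) = Rk (j * n) (v j)))
    \<and> (\<exists>k\<^sub>0. 1 \<le> k\<^sub>0 \<and> k\<^sub>0 \<le> d + 1
        \<and> (\<forall>j\<ge>k\<^sub>0. Rk (j * n) (v j) = Rk ((j + 1) * n) (v (j + 1)))
        \<and> (k\<^sub>0 > 1 \<longrightarrow>
            (\<forall>j. 1 \<le> j \<and> j \<le> k\<^sub>0 - 1 \<longrightarrow> Rk (j * n) (v j) < Rk ((j + 1) * n) (v (j + 1))))
        \<and> (let is_orbit = (\<lambda>Or. CR_manifold_of_dim N g Or \<and> M \<subseteq> Or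
                \<and> (\<forall>X. CR_vector_field N M X \<longrightarrow> tangent X Or))
           in (\<exists>!Or. is_orbit Or)
            \<and> (\<forall>Or. is_orbit Or \<longrightarrow>
                (\<exists>e. int e = 2 * int N - int d - int g
                  \<and> (let orbit_eqs = (\<lambda>f. f \<in> carrier_vec e \<and> set\<^sub>v f \<subseteq> mfps_carrier N
                           \<and> generators (2 * N) (e + d) Or (f @\<^sub>v \<rho>))
                     in (\<exists>f. orbit_eqs f)
                      \<and> (\<forall>f. orbit_eqs f \<longrightarrow>
                          (let W = genideal (mfps_ring N) (set\<^sub>v f)
                           in manifold_ideal N e W
                            \<and> (\<forall>j\<ge>1. maps_into (v j) W)
                            \<and> int (Rk (k\<^sub>0 * n) (v k\<^sub>0)) = int g + int d - int N
                            \<and> manifold_of_dim N (Rk (k\<^sub>0 * n) (v k\<^sub>0)) W)))))))"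
proof -
  obtain B r where "generic_normal N d M B r" using generic_normal_exists[OF assms(1)] .
  then interpret gn: generic_normal N d M B r .
  interpret s: segre N d M B r n \<gamma>
    unfolding assms(4) by (rule gn.segre_if_segre_variety_mapping[OF assms(2,3)])
  obtain BJ h J A C X F where fo: "formal_orbit N d M B r BJ h J (lie_algebra_dim N M) A C X F"
    by (rule gn.formal_orbit_exists)
  interpret fo: formal_orbit N d M B r BJ h J g A C X F
    using fo by (simp only: assms(6))
  interpret so: segre_orbit N d M B r n \<gamma> BJ h J g A C X F ..
  obtain k\<^sub>0 where k: "1 \<le> k\<^sub>0" "k\<^sub>0 \<le> d + 1" "\<And>j. j \<ge> k\<^sub>0 \<Longrightarrow> s.R j = s.R (Suc j)"
    "\<And>j. 1 \<le> j \<Longrightarrow> j < k\<^sub>0 \<Longrightarrow> s.R j < s.R (Suc j)" "s.R k\<^sub>0 + N = g + d"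
    by (rule so.stabilization) (rule that)
  have cardC: "card C + d + g = 2 * N" using fo.C(2) fo.card_BJ by simp
  have mono: "\<forall>j\<ge>1. Rk (j * n) (v j) \<le> Rk ((j + 1) * n) (v (j + 1))"
    unfolding assms(5) Suc_eq_plus1[symmetric] using s.R_mono by blast
  have coord: "\<forall>H \<rho>' \<gamma>'. coordinate_change N H
          \<and> generators (2 * N) d (in_coordinates N H M) \<rho>'
          \<and> segre_variety_mapping N d \<rho>' \<gamma>'
        \<longrightarrow> (\<forall>j\<ge>1. Rk (j * n) (segre_mapping N n \<gamma>' j) = Rk (j * n) (v j))"
    unfolding assms(4,5) using Rk_coordinates[OF s.segre_axioms[unfolded assms(4)]] by blast
  have const: "\<forall>j\<ge>k\<^sub>0. Rk (j * n) (v j) = Rk ((j + 1) * n) (v (j + 1))"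
    unfolding assms(5) Suc_eq_plus1[symmetric] using k(3) by blast
  have less: "\<forall>j. 1 \<le> j \<and> j \<le> k\<^sub>0 - 1 \<longrightarrow> Rk (j * n) (v j) < Rk ((j + 1) * n) (v (j + 1))"
  proof (intro allI impI)
    fix j assume "1 \<le> j \<and> j \<le> k\<^sub>0 - 1"
    then have "1 \<le> j" "j < k\<^sub>0" using k(1) by auto
    then show "Rk (j * n) (v j) < Rk ((j + 1) * n) (v (j + 1))"
      unfolding assms(5) Suc_eq_plus1[symmetric] by (rule k(4))
  qed
  define is_orbit where "is_orbit Or \<longleftrightarrow> CR_manifold_of_dim N g Or \<and> M \<subseteq> Or
                \<and> (\<forall>X. CR_vector_field N M X \<longrightarrow> tangent X Or)" for Or
  \<comment> \<open>Only \<open>J\<close> is an orbit, so what is claimed for an arbitrary orbit is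
    proved for \<open>J\<close>.\<close>
  have orbit_iff: "is_orbit Or \<longleftrightarrow> Or = J" for Or
    using fo.orbit_unique fo.CR_J fo.M_J fo.CR_field_J unfolding is_orbit_def by blast
  define orbit_eqs where "orbit_eqs f \<longleftrightarrow> f \<in> carrier_vec (card C) \<and> set\<^sub>v f \<subseteq> mfps_carrier N
                           \<and> generators (2 * N) (card C + d) J (f @\<^sub>v \<rho>)" for f
  have ex: "\<exists>f. orbit_eqs f"
    unfolding orbit_eqs_def by (rule fo.orbit_equations_exist[OF assms(2)]) blast
  have eqs: "manifold_ideal N (card C) (genideal (mfps_ring N) (set\<^sub>v f))
      \<and> (\<forall>j\<ge>1. maps_into (v j) (genideal (mfps_ring N) (set\<^sub>v f)))
      \<and> int (Rk (k\<^sub>0 * n) (v k\<^sub>0)) = int g + int d - int N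
      \<and> manifold_of_dim N (Rk (k\<^sub>0 * n) (v k\<^sub>0)) (genideal (mfps_ring N) (set\<^sub>v f))" if "orbit_eqs f" for f
  proof (intro conjI allI impI)
    have f: "f \<in> carrier_vec (card C)" "set\<^sub>v f \<subseteq> mfps_carrier N" "generators (2 * N) (card C + d) J (f @\<^sub>v \<rho>)"
      using that by (auto simp: orbit_eqs_def)
    note W = fo.orbit_equations[OF f fo.C(2)]
    show mi: "manifold_ideal N (card C) (genideal (mfps_ring N) (set\<^sub>v f))" by (rule W(3))
    show "int (Rk (k\<^sub>0 * n) (v k\<^sub>0)) = int g + int d - int N" using k(5) by (simp add: assms(5))
    have "card C + Rk (k\<^sub>0 * n) (v k\<^sub>0) = N" using k(5) cardC by (simp add: assms(5))
    then show "manifold_of_dim N (Rk (k\<^sub>0 * n) (v k\<^sub>0)) (genideal (mfps_ring N) (set\<^sub>v f))"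
      using mi by (auto simp: manifold_of_dim_def)
    fix j :: nat
    show "maps_into (v j) (genideal (mfps_ring N) (set\<^sub>v f))"
      unfolding maps_into_def W(1) assms(5)
    proof
      fix x assume "x \<in> lideal N {..<card C} (($) f)"
      then obtain a where a: "\<And>i. i \<in> {..<card C} \<Longrightarrow> a i \<in> mcarr {..<N}" "x = (\<Sum>i<card C. a i * f $ i)"
        by (rule lidealE) (rule that)
      have "msub (($) (s.v j)) x = (\<Sum>i<card C. msub (($) (s.v j)) (a i) * msub (($) (s.v j)) (f $ i))"
        unfolding a(2) using a(1) W(2) by (subst msub_sum[OF _ so.v_z]) (simp_all add: msub_mult[OF _ so.v_z])
      also have "\<dots> = 0" using W(2) so.msub_v_J by simp
      finally show "msubst x (s.v j) = 0" by (simp add: msubst_eq_msub)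
    qed
  qed
  have e: "int (card C) = 2 * int N - int d - int g" using cardC by simp
  have orbit: "\<exists>e. int e = 2 * int N - int d - int g
      \<and> (let orbit_eqs = (\<lambda>f. f \<in> carrier_vec e \<and> set\<^sub>v f \<subseteq> mfps_carrier N
              \<and> generators (2 * N) (e + d) Or (f @\<^sub>v \<rho>))
         in (\<exists>f. orbit_eqs f)
          \<and> (\<forall>f. orbit_eqs f \<longrightarrow>
              (let W = genideal (mfps_ring N) (set\<^sub>v f)
               in manifold_ideal N e W
                \<and> (\<forall>j\<ge>1. maps_into (v j) W)
                \<and> int (Rk (k\<^sub>0 * n) (v k\<^sub>0)) = int g + int d - int N
                \<and> manifold_of_dim N (Rk (k\<^sub>0 * n) (v k\<^sub>0)) W)))" if "is_orbit Or" for Or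
    using that e ex eqs unfolding orbit_iff Let_def orbit_eqs_def by (intro exI[of _ "card C"]) simp
  have "\<exists>!Or. is_orbit Or" unfolding orbit_iff by simp
  then have "let is_orbit = (\<lambda>Or. CR_manifold_of_dim N g Or \<and> M \<subseteq> Or
                \<and> (\<forall>X. CR_vector_field N M X \<longrightarrow> tangent X Or))
           in (\<exists>!Or. is_orbit Or)
            \<and> (\<forall>Or. is_orbit Or \<longrightarrow>
                (\<exists>e. int e = 2 * int N - int d - int g
                  \<and> (let orbit_eqs = (\<lambda>f. f \<in> carrier_vec e \<and> set\<^sub>v f \<subseteq> mfps_carrier N
                           \<and> generators (2 * N) (e + d) Or (f @\<^sub>v \<rho>))
                     in (\<exists>f. orbit_eqs f)
                      \<and> (\<forall>f. orbit_eqs f \<longrightarrow>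
                          (let W = genideal (mfps_ring N) (set\<^sub>v f)
                           in manifold_ideal N e W
                            \<and> (\<forall>j\<ge>1. maps_into (v j) W)
                            \<and> int (Rk (k\<^sub>0 * n) (v k\<^sub>0)) = int g + int d - int N
                            \<and> manifold_of_dim N (Rk (k\<^sub>0 * n) (v k\<^sub>0)) W)))))"
    using orbit unfolding is_orbit_def Let_def by blast
  then show ?thesis using mono coord const less k(1,2) by blast
qed

end
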